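(* Let $T>0$ and $c\in\left(-\frac14,\frac34\right)$. Let $\omega$ be a nonempty open subset of $(-1,1)$. Then approximate controllability holds for $$\begin{cases}\partial_tf-\partial^2_{xx}f+\frac{c}{x^2}f=u(t,x)\chi_\omega(x), & (t,x)\in(0,T)\times(-1,1),\\ f(t,-1)=f(t,1)=0, & t\in(0,T),\\ f(0,x)=f^0(x), & x\in(-1,1);\end{cases}$$ that is, for any $(f^0,f^T)\in L^2(-1,1)^2$ and any $\varepsilon>0$, there exists $u\in L^2((0,T)\times\omega)$ such that the solution $f$ of this problem (in the sense given in the context) satisfies $\|f(T)-f^T\|_{L^2(-1,1)}\le\varepsilon$.
   Context: All functions are real-valued; $\chi_\omega$ is the indicator function of $\omega$. Write $c=c_\nu:=\nu^2-\frac14$ with $\nu\in(0,1)$. Let $\tilde H^2_0(-1,1):=\{f\in H^2(-1,1): f(0)=f'(0)=0\}$ and let $\mathcal{F}_s$ be the set of $f\in L^2(-1,1)$ such that $f=c_1^+|x|^{\nu+\frac12}+c_2^+|x|^{-\nu+\frac12}$ on $(0,1)$ and $f=c_1^-|x|^{\nu+\frac12}+c_2^-|x|^{-\nu+\frac12}$ on $(-1,0)$ for some constants $c_1^\pm,c_2^\pm\in\mathbb{R}$. Let $D(A)$ be the set of functions $f=f_r+f_s$ with $f_r\in\tilde H^2_0(-1,1)$, $f_s\in\mathcal{F}_s$ (this decomposition is unique), such that $f(-1)=f(1)=0$, $$c_1^-+c_2^-+c_1^++c_2^+=0,\qquad \left(\nu+\tfrac12\right)c_1^-+\left(-\nu+\tfrac12\right)c_2^-=\left(\nu+\tfrac12\right)c_1^++\left(-\nu+\tfrac12\right)c_2^+,$$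 where $c_1^\pm,c_2^\pm$ are the coefficients of $f_s$. Let $A_0$ be the operator on $L^2(-1,1)$ with domain $D(A)$ given by $A_0f=-\partial^2_{xx}f+\frac{c_\nu}{x^2}f$, derivatives being taken on $(-1,0)\cup(0,1)$. It is self-adjoint and nonnegative; $e^{-A_0t}$ denotes the semigroup generated by $-A_0$ on $L^2(-1,1)$. The solution of the controlled problem is the mild solution $f(t)=e^{-A_0t}f^0+\int_0^te^{-A_0(t-\tau)}v(\tau)\,d\tau$, $t\in[0,T]$, where $v(t)(x)=u(t,x)\chi_\omega(x)$ ($u$ extended by $0$ outside $\omega$). *)

theory Defs
  imports "HOL-Analysis.Analysis"
begin

section \<open>The real Hilbert space $L^2(-1,1)$\<close>

definition square_integrable :: "'a measure \<Rightarrow> ('a \<Rightarrow> real) \<Rightarrow> bool" where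
  "square_integrable M f \<longleftrightarrow> f \<in> borel_measurable M \<and> integrable M (\<lambda>x. (f x)\<^sup>2)"

text \<open>Borel measurable representatives suffice: every Lebesgue measurable function agrees
  almost everywhere with a Borel measurable one.\<close>
definition I11 :: "real measure" where
  "I11 = restrict_space lborel {-1<..<1}"

lemma square_integrable_mult:
  assumes "square_integrable M f" "square_integrable M g"
  shows "integrable M (\<lambda>x. f x * g x)"
proof (rule Bochner_Integration.integrable_bound)
  show "integrable M (\<lambda>x. (f x)\<^sup>2 + (g x)\<^sup>2)"
    using assms by (auto simp: square_integrable_def)
  show "(\<lambda>x. f x * g x) \<in> borel_measurable M"
    using assms by (auto simp: square_integrable_def)
  have "norm (a * b) \<le> norm (a\<^sup>2 + b\<^sup>2)" for a b :: real
  proof -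
    have "0 \<le> (\<bar>a\<bar> - \<bar>b\<bar>)\<^sup>2" by simp
    then have "2 * (\<bar>a\<bar> * \<bar>b\<bar>) \<le> a\<^sup>2 + b\<^sup>2"
      by (simp add: power2_eq_square algebra_simps)
    moreover have "0 \<le> \<bar>a\<bar> * \<bar>b\<bar>" by simp
    ultimately have "\<bar>a\<bar> * \<bar>b\<bar> \<le> a\<^sup>2 + b\<^sup>2" by linarith
    then show ?thesis by (simp add: abs_mult)
  qed
  then show "AE x in M. norm (f x * g x) \<le> norm ((f x)\<^sup>2 + (g x)\<^sup>2)" by simp
qed

lemma square_integrable_add:
  assumes "square_integrable M f" "square_integrable M g"
  shows "square_integrable M (\<lambda>x. f x + g x)"
proof -
  have "integrable M (\<lambda>x. (f x)\<^sup>2 + (g x)\<^sup>2 + 2 * (f x * g x))"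
    using assms square_integrable_mult[OF assms] by (auto simp: square_integrable_def)
  then show ?thesis
    using assms by (auto simp: square_integrable_def power2_sum mult.assoc)
qed

lemma square_integrable_scale:
  assumes "square_integrable M f"
  shows "square_integrable M (\<lambda>x. c * f x)"
  using assms by (auto simp: square_integrable_def power_mult_distrib)

lemma square_integrable_uminus:
  assumes "square_integrable M f"
  shows "square_integrable M (\<lambda>x. - f x)"
  using square_integrable_scale[OF assms, of "-1"] by simp

lemma square_integrable_diff:
  assumes "square_integrable M f" "square_integrable M g"
  shows "square_integrable M (\<lambda>x. f x - g x)"
  using square_integrable_add[OF assms(1) square_integrable_uminus[OF assms(2)]] by simp

lemma square_integrable_zero: "square_integrable M (\<lambda>x. 0)"
  by (simp add: square_integrable_def)

quotient_type L2 = "real \<Rightarrow> real" / partial: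
  "\<lambda>f g. square_integrable I11 f \<and> square_integrable I11 g \<and> (AE x in I11. f x = g x)"
proof (rule part_equivpI)
  show "\<exists>f. square_integrable I11 f \<and> square_integrable I11 f \<and> (AE x in I11. f x = f x)"
    using square_integrable_zero by auto
  show "symp (\<lambda>f g. square_integrable I11 f \<and> square_integrable I11 g \<and> (AE x in I11. f x = g x))"
    by (auto intro!: sympI elim: AE_mp)
  show "transp (\<lambda>f g. square_integrable I11 f \<and> square_integrable I11 g \<and> (AE x in I11. f x = g x))"
    by (rule transpI) (auto elim: AE_mp)
qed

text \<open>The class of \<open>f\<close> if \<open>f\<close> is square integrable on $(-1,1)$, and \<open>0\<close> otherwise;
  \<open>rep_L2\<close> chooses a representative.\<close>
definition L2_of :: "(real \<Rightarrow> real) \<Rightarrow> L2" where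
  "L2_of f = abs_L2 (if square_integrable I11 f then f else (\<lambda>x. 0))"

instantiation L2 :: real_vector
begin

lift_definition zero_L2 :: L2 is "\<lambda>x. 0"
  by (simp add: square_integrable_zero)

lift_definition plus_L2 :: "L2 \<Rightarrow> L2 \<Rightarrow> L2" is "\<lambda>f g x. f x + g x"
  by (auto intro: square_integrable_add)

lift_definition minus_L2 :: "L2 \<Rightarrow> L2 \<Rightarrow> L2" is "\<lambda>f g x. f x - g x"
  by (auto intro: square_integrable_diff)

lift_definition uminus_L2 :: "L2 \<Rightarrow> L2" is "\<lambda>f x. - f x"
  by (auto intro: square_integrable_uminus)

lift_definition scaleR_L2 :: "real \<Rightarrow> L2 \<Rightarrow> L2" is "\<lambda>c f x. c * f x"
  by (auto intro: square_integrable_scale)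

instance
  by standard
    (transfer; auto simp: algebra_simps
      intro!: square_integrable_add square_integrable_scale square_integrable_diff
        square_integrable_uminus square_integrable_zero)+

end

instantiation L2 :: real_inner
begin

lift_definition inner_L2 :: "L2 \<Rightarrow> L2 \<Rightarrow> real" is "\<lambda>f g. \<integral>x. f x * g x \<partial>I11"
  by (rule integral_cong_AE) (auto simp: square_integrable_def)

definition norm_L2 :: "L2 \<Rightarrow> real" where "norm_L2 f = sqrt (inner f f)"
definition sgn_L2 :: "L2 \<Rightarrow> L2" where "sgn_L2 f = f /\<^sub>R norm f"
definition dist_L2 :: "L2 \<Rightarrow> L2 \<Rightarrow> real" where "dist_L2 f g = norm (f - g)"
definition uniformity_L2 :: "(L2 \<times> L2) filter" where
  "uniformity_L2 = (INF e\<in>{0<..}. principal {(f, g). dist f g < e})"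
definition open_L2 :: "L2 set \<Rightarrow> bool" where
  "open_L2 U = (\<forall>f\<in>U. \<forall>\<^sub>F (f', g) in uniformity. f' = f \<longrightarrow> g \<in> U)"

instance
proof
  fix f g h :: L2 and r :: real and U :: "L2 set"
  show "dist f g = norm (f - g)" by (rule dist_L2_def)
  show "sgn f = f /\<^sub>R norm f" by (rule sgn_L2_def)
  show "uniformity = (INF e\<in>{0<..}. principal {(f :: L2, g). dist f g < e})"
    by (rule uniformity_L2_def)
  show "open U = (\<forall>f\<in>U. \<forall>\<^sub>F (f', g) in uniformity. f' = f \<longrightarrow> g \<in> U)" by (rule open_L2_def)
  show "norm f = sqrt (inner f f)" by (rule norm_L2_def)
  show "inner f g = inner g f" by transfer (simp add: mult.commute)
  show "inner (f + g) h = inner f h + inner g h"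
    by transfer (simp add: distrib_right square_integrable_mult)
  show "inner (r *\<^sub>R f) g = r * inner f g"
    by transfer (simp add: mult.assoc)
  show "0 \<le> inner f f" by transfer simp
  show "inner f f = 0 \<longleftrightarrow> f = 0"
  proof transfer
    fix f assume f: "square_integrable I11 f \<and> square_integrable I11 f \<and> (AE x in I11. f x = f x)"
    then have "integrable I11 (\<lambda>x. f x * f x)" by (simp add: square_integrable_mult)
    then have "(\<integral>x. f x * f x \<partial>I11) = 0 \<longleftrightarrow> (AE x in I11. f x * f x = 0)"
      by (rule integral_nonneg_eq_0_iff_AE) simp
    with f show "((\<integral>x. f x * f x \<partial>I11) = 0) \<longleftrightarrow>
      (square_integrable I11 f \<and> square_integrable I11 (\<lambda>x. 0) \<and> (AE x in I11. f x = 0))"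
      by (simp add: square_integrable_zero)
  qed
qed

end

lemma square_integrable_rep_L2: "square_integrable I11 (rep_L2 f)"
  using Quotient_rep_reflp[OF Quotient_L2] by simp

lemma L2_of_rep_L2: "L2_of (rep_L2 f) = f"
  unfolding L2_of_def using Quotient_abs_rep[OF Quotient_L2] square_integrable_rep_L2 by simp

lemma rep_L2_of:
  assumes "square_integrable I11 f"
  shows "AE x in I11. rep_L2 (L2_of f) x = f x"
  unfolding L2_of_def using Quotient_rep_abs[OF Quotient_L2, of f] assms by simp

lemma L2_of_eqI:
  assumes "square_integrable I11 f" "square_integrable I11 g" "AE x in I11. f x = g x"
  shows "L2_of f = L2_of g"
  unfolding L2_of_def using Quotient_rel[OF Quotient_L2, of f g] assms by simp

lemma L2_of_add:
  assumes "square_integrable I11 f" "square_integrable I11 g"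
  shows "L2_of f + L2_of g = L2_of (\<lambda>x. f x + g x)"
  using assms by (simp add: L2_of_def square_integrable_add plus_L2.abs_eq)

lemma L2_of_diff:
  assumes "square_integrable I11 f" "square_integrable I11 g"
  shows "L2_of f - L2_of g = L2_of (\<lambda>x. f x - g x)"
  using assms by (simp add: L2_of_def square_integrable_diff minus_L2.abs_eq)

lemma L2_of_scaleR:
  assumes "square_integrable I11 f"
  shows "c *\<^sub>R L2_of f = L2_of (\<lambda>x. c * f x)"
  using assms by (simp add: L2_of_def square_integrable_scale scaleR_L2.abs_eq)

lemma norm_L2_of:
  assumes "square_integrable I11 f"
  shows "(norm (L2_of f))\<^sup>2 = (\<integral>x. (f x)\<^sup>2 \<partial>I11)"
proof -
  have "(norm (L2_of f))\<^sup>2 = (\<integral>x. f x * f x \<partial>I11)"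
    using assms by (simp add: power2_norm_eq_inner L2_of_def inner_L2.abs_eq)
  then show ?thesis by (simp only: power2_eq_square)
qed

lemma norm_L2_nn:
  assumes "square_integrable I11 f"
  shows "(\<integral>\<^sup>+x. ennreal ((f x)\<^sup>2) \<partial>I11) = ennreal ((norm (L2_of f))\<^sup>2)"
  using assms unfolding norm_L2_of[OF assms]
  by (intro nn_integral_eq_integral) (auto simp: square_integrable_def)

lemma emeasure_I11: "emeasure I11 (space I11) = 2"
  by (simp add: I11_def emeasure_restrict_space space_restrict_space)

lemma sets_I11: "A \<in> sets I11 \<longleftrightarrow> A \<in> sets borel \<and> A \<subseteq> {-1<..<1}"
  by (auto simp: I11_def sets_restrict_space_iff)

lemma finite_measure_I11: "finite_measure I11"
  by (rule finite_measureI) (simp add: emeasure_I11)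

instance L2 :: complete_space
proof
  fix X :: "nat \<Rightarrow> L2" assume "Cauchy X"
  have "\<exists>r. strict_mono r \<and> (\<forall>k. \<forall>m\<ge>r k. \<forall>n\<ge>r k. dist (X m) (X n) < (1/2)^k)"
  proof -
    have "\<exists>N. \<forall>m\<ge>N. \<forall>n\<ge>N. dist (X m) (X n) < (1/2)^k" for k
      using metric_CauchyD[OF \<open>Cauchy X\<close>, of "(1/2)^k"] by simp
    then obtain N where N: "\<And>k m n. m \<ge> N k \<Longrightarrow> n \<ge> N k \<Longrightarrow> dist (X m) (X n) < (1/2)^k"
      by metis
    define r where "r k = (\<Sum>i\<le>k. Suc (N i))" for k
    have "strict_mono r" by (rule strict_monoI_Suc) (simp add: r_def)
    moreover have "N k \<le> r k" for k
    proof -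
      have "Suc (N k) \<le> r k" unfolding r_def by (rule member_le_sum) auto
      then show ?thesis by simp
    qed
    ultimately show ?thesis using N by (meson le_trans)
  qed
  then obtain r where r: "strict_mono r"
    and rd: "\<And>k m n. m \<ge> r k \<Longrightarrow> n \<ge> r k \<Longrightarrow> dist (X m) (X n) < (1/2)^k" by blast
  define F where "F k = rep_L2 (X (r k))" for k
  have F: "square_integrable I11 (F k)" for k
    unfolding F_def by (rule square_integrable_rep_L2)
  have [measurable]: "F k \<in> borel_measurable I11" for k
    using F by (simp add: square_integrable_def)
  have LF: "L2_of (F k) = X (r k)" for k by (simp add: F_def L2_of_rep_L2)
  have FF: "(\<integral>\<^sup>+x. ennreal ((F j x - F k x)\<^sup>2) \<partial>I11) \<le> ennreal (((1/2)^m)\<^sup>2)"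
    if "j \<ge> m" "k \<ge> m" for j k m
  proof -
    have "(\<integral>\<^sup>+x. ennreal ((F j x - F k x)\<^sup>2) \<partial>I11) = ennreal ((dist (X (r j)) (X (r k)))\<^sup>2)"
      unfolding norm_L2_nn[OF square_integrable_diff[OF F F]] L2_of_diff[OF F F, symmetric] LF
        dist_norm ..
    moreover have "dist (X (r j)) (X (r k)) < (1/2)^m"
      using that r by (intro rd) (auto simp: strict_mono_less_eq)
    ultimately show ?thesis by (simp add: power_mono)
  qed
  define d where "d k x = F (Suc k) x - F k x" for k x
  have [measurable]: "d k \<in> borel_measurable I11" for k unfolding d_def by measurable
  have dk: "(\<integral>\<^sup>+x. ennreal \<bar>d k x\<bar> \<partial>I11) \<le> ennreal (3 * (1/2)^k)" for k
  proof -
    have "\<bar>a\<bar> \<le> 2^k * a\<^sup>2 + (1/2)^k" for a :: real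
    proof -
      have "0 \<le> 2^k * (\<bar>a\<bar> - (1/2)^k)\<^sup>2" by simp
      also have "\<dots> = 2^k * a\<^sup>2 - 2 * \<bar>a\<bar> + (1/2)^k"
        by (simp add: power2_eq_square algebra_simps power_one_over)
      finally have "2 * \<bar>a\<bar> \<le> 2^k * a\<^sup>2 + (1/2)^k" by simp
      then show ?thesis using abs_ge_zero[of a] by linarith
    qed
    then have "(\<integral>\<^sup>+x. ennreal \<bar>d k x\<bar> \<partial>I11)
        \<le> (\<integral>\<^sup>+x. ennreal (2^k) * ennreal ((d k x)\<^sup>2) + ennreal ((1/2)^k) \<partial>I11)"
      by (intro nn_integral_mono)
        (simp flip: ennreal_mult ennreal_plus)
    also have "\<dots> = ennreal (2^k) * (\<integral>\<^sup>+x. ennreal ((d k x)\<^sup>2) \<partial>I11) + ennreal ((1/2)^k) * 2"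
      by (simp add: nn_integral_add nn_integral_cmult emeasure_I11)
    also have "\<dots> \<le> ennreal (2^k) * ennreal (((1/2)^k)\<^sup>2) + ennreal ((1/2)^k) * ennreal 2"
      unfolding d_def using FF[of k "Suc k" k]
      by (intro add_mono mult_left_mono) auto
    also have "\<dots> = ennreal (3 * (1/2)^k)"
      by (simp flip: ennreal_mult ennreal_plus del: ennreal_numeral
          add: power2_eq_square power_one_over)
    finally show ?thesis .
  qed
  have "(\<integral>\<^sup>+x. (\<Sum>k. ennreal \<bar>d k x\<bar>) \<partial>I11) = (\<Sum>k. \<integral>\<^sup>+x. ennreal \<bar>d k x\<bar> \<partial>I11)"
    by (rule nn_integral_suminf) simp
  also have "\<dots> \<le> (\<Sum>k. ennreal (3 * (1/2)^k))"
    by (intro suminf_le dk) auto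
  also have "\<dots> < \<infinity>"
    by (subst suminf_ennreal2) (auto intro!: summable_mult summable_geometric)
  finally have "AE x in I11. (\<Sum>k. ennreal \<bar>d k x\<bar>) \<noteq> \<infinity>"
    by (intro nn_integral_PInf_AE) auto
  then have conv: "AE x in I11. convergent (\<lambda>k. F k x)"
  proof eventually_elim
    fix x assume "(\<Sum>k. ennreal \<bar>d k x\<bar>) \<noteq> \<infinity>"
    then have "summable (\<lambda>k. \<bar>d k x\<bar>)"
      by (intro summable_suminf_not_top) auto
    then have "summable (\<lambda>k. d k x)" by (rule summable_rabs_cancel)
    then have "convergent (\<lambda>n. \<Sum>k<n. d k x)" by (simp add: summable_iff_convergent)
    then obtain l where "(\<lambda>n. \<Sum>k<n. d k x) \<longlonglongrightarrow> l" by (auto simp: convergent_def)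
    moreover have "(\<Sum>k<n. d k x) = F n x - F 0 x" for n
      unfolding d_def by (rule sum_lessThan_telescope)
    ultimately have "(\<lambda>n. F n x - F 0 x + F 0 x) \<longlonglongrightarrow> l + F 0 x" by (intro tendsto_add) auto
    then show "convergent (\<lambda>k. F k x)" by (auto simp: convergent_def)
  qed
  define G where "G x = lim (\<lambda>k. F k x)" for x
  have [measurable]: "G \<in> borel_measurable I11" unfolding G_def by measurable
  have lim: "AE x in I11. (\<lambda>k. F k x) \<longlonglongrightarrow> G x"
    using conv unfolding G_def by (simp add: convergent_LIMSEQ_iff)
  have GF: "(\<integral>\<^sup>+x. ennreal ((G x - F k x)\<^sup>2) \<partial>I11) \<le> ennreal (((1/2)^k)\<^sup>2)" for k
  proof -
    have "(\<integral>\<^sup>+x. ennreal ((G x - F k x)\<^sup>2) \<partial>I11)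
        = (\<integral>\<^sup>+x. liminf (\<lambda>j. ennreal ((F j x - F k x)\<^sup>2)) \<partial>I11)"
    proof (rule nn_integral_cong_AE)
      show "AE x in I11. ennreal ((G x - F k x)\<^sup>2) = liminf (\<lambda>j. ennreal ((F j x - F k x)\<^sup>2))"
        using lim
      proof eventually_elim
        fix x assume "(\<lambda>k. F k x) \<longlonglongrightarrow> G x"
        then have "(\<lambda>j. ennreal ((F j x - F k x)\<^sup>2)) \<longlonglongrightarrow> ennreal ((G x - F k x)\<^sup>2)"
          by (intro tendsto_ennrealI tendsto_intros)
        then show "ennreal ((G x - F k x)\<^sup>2) = liminf (\<lambda>j. ennreal ((F j x - F k x)\<^sup>2))"
          by (rule lim_imp_Liminf[OF sequentially_bot, symmetric])
      qed
    qed
    also have "\<dots> \<le> liminf (\<lambda>j. \<integral>\<^sup>+x. ennreal ((F j x - F k x)\<^sup>2) \<partial>I11)"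
      by (rule nn_integral_liminf) simp
    also have "\<dots> \<le> ennreal (((1/2)^k)\<^sup>2)"
    proof (rule order_trans[OF Liminf_le_Limsup[OF sequentially_bot]], rule Limsup_bounded)
      show "\<forall>\<^sub>F j in sequentially.
          (\<integral>\<^sup>+x. ennreal ((F j x - F k x)\<^sup>2) \<partial>I11) \<le> ennreal (((1/2)^k)\<^sup>2)"
        using eventually_ge_at_top[of k] by eventually_elim (simp add: FF)
    qed
    finally show ?thesis .
  qed
  have GFs: "square_integrable I11 (\<lambda>x. G x - F k x)" for k
  proof -
    have "(\<integral>\<^sup>+x. ennreal ((G x - F k x)\<^sup>2) \<partial>I11) < \<infinity>"
      using GF[of k] by (rule le_less_trans) simp
    then show ?thesis
      unfolding square_integrable_def by (auto intro!: integrableI_nonneg)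
  qed
  have G: "square_integrable I11 G"
    using square_integrable_add[OF GFs[of 0] F[of 0]] by simp
  have near: "dist (L2_of G) (X (r k)) \<le> (1/2)^k" for k
  proof -
    have "ennreal ((dist (L2_of G) (X (r k)))\<^sup>2) \<le> ennreal (((1/2)^k)\<^sup>2)"
      using GF[of k]
      unfolding norm_L2_nn[OF GFs] L2_of_diff[OF G F, symmetric] LF dist_norm .
    then have "(dist (L2_of G) (X (r k)))\<^sup>2 \<le> ((1/2)^k)\<^sup>2" by simp
    then show ?thesis by (rule power2_le_imp_le) simp
  qed
  have "(\<lambda>k. X (r k)) \<longlonglongrightarrow> L2_of G"
  proof (rule metric_tendsto_imp_tendsto)
    show "(\<lambda>k. (1/2)^k :: real) \<longlonglongrightarrow> 0" by (rule LIMSEQ_power_zero) simp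
    show "\<forall>\<^sub>F k in sequentially. dist (X (r k)) (L2_of G) \<le> dist ((1/2)^k :: real) 0"
      using near by (simp add: dist_commute)
  qed
  then have "X \<longlonglongrightarrow> L2_of G"
    using Cauchy_converges_subseq[OF \<open>Cauchy X\<close> r] by (simp add: o_def)
  then show "convergent X" by (auto simp: convergent_def)
qed

instance L2 :: banach ..

lemma second_countable_if_dense:
  fixes D :: "'a::metric_space set"
  assumes "countable D" "closure D = UNIV"
  shows "\<exists>B::'a set set. countable B \<and> open = generate_topology B"
proof (intro exI conjI)
  let ?B = "(\<lambda>(d, n). ball d (1 / real (Suc n))) ` (D \<times> (UNIV :: nat set))"
  show "countable ?B" using assms(1) by (intro countable_image countable_SIGMA) auto
  have "topological_basis ?B"
  proof (rule topological_basisI)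
    fix U :: "'a set" and x assume "open U" "x \<in> U"
    then obtain e where e: "e > 0" "ball x e \<subseteq> U" by (meson openE)
    obtain n where n: "1 / real (Suc n) < e / 2"
      using nat_approx_posE[of "e/2"] e by auto
    have "x \<in> closure D" using assms(2) by simp
    then obtain d where d: "d \<in> D" "dist d x < 1 / real (Suc n)"
      unfolding closure_approachable by (metis of_nat_0_less_iff zero_less_Suc zero_less_divide_1_iff)
    have "ball d (1 / real (Suc n)) \<subseteq> U"
    proof
      fix y assume "y \<in> ball d (1 / real (Suc n))"
      then have "dist x y < e"
        using dist_triangle[of x y d] d n by (simp add: dist_commute)
      then show "y \<in> U" using e by auto
    qed
    moreover have "x \<in> ball d (1 / real (Suc n))" using d by simp
    ultimately show "\<exists>V\<in>?B. x \<in> V \<and> V \<subseteq> U" using d(1) by blast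
  qed auto
  then show "open = generate_topology ?B" by (rule topological_basis_imp_subbasis)
qed

lemma countable_closure_subspace:
  fixes E :: "'a::real_normed_vector set"
  assumes "countable E"
  obtains D where "countable D" "E \<subseteq> D" "subspace (closure D)"
proof -
  define D where "D = (\<lambda>xs. \<Sum>(q, e)\<leftarrow>xs. q *\<^sub>R e) ` lists ((\<rat> :: real set) \<times> E)"
  have "countable D" unfolding D_def
    by (intro countable_image countable_lists countable_SIGMA assms countable_rat)
  moreover have "E \<subseteq> D"
  proof
    fix e assume "e \<in> E"
    then show "e \<in> D" unfolding D_def by (intro image_eqI[of _ _ "[(1, e)]"]) auto
  qed
  moreover have "subspace (closure D)"
  proof (rule subspaceI)
    have "0 \<in> D" unfolding D_def by (intro image_eqI[of _ _ "[]"]) auto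
    then show "0 \<in> closure D" using closure_subset by blast
  next
    have D_add: "x + y \<in> D" if "x \<in> D" "y \<in> D" for x y
    proof -
      from that obtain xs ys where xs: "xs \<in> lists (\<rat> \<times> E)" "x = (\<Sum>(q, e)\<leftarrow>xs. q *\<^sub>R e)"
        and ys: "ys \<in> lists (\<rat> \<times> E)" "y = (\<Sum>(q, e)\<leftarrow>ys. q *\<^sub>R e)"
        unfolding D_def by blast
      then show ?thesis unfolding D_def by (intro image_eqI[of _ _ "xs @ ys"]) auto
    qed
    fix x y assume "x \<in> closure D" "y \<in> closure D"
    then obtain f g where "\<And>n. f n \<in> D" "f \<longlonglongrightarrow> x" "\<And>n. g n \<in> D" "g \<longlonglongrightarrow> y"
      unfolding closure_sequential by blast
    then show "x + y \<in> closure D"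
      unfolding closure_sequential using D_add by (intro exI[of _ "\<lambda>n. f n + g n"]) (auto intro: tendsto_add)
  next
    have D_scale: "q *\<^sub>R x \<in> D" if "q \<in> \<rat>" "x \<in> D" for q :: real and x
    proof -
      from that obtain xs where xs: "xs \<in> lists (\<rat> \<times> E)" "x = (\<Sum>(q, e)\<leftarrow>xs. q *\<^sub>R e)"
        unfolding D_def by blast
      have "q *\<^sub>R (\<Sum>(p, e)\<leftarrow>ys. p *\<^sub>R e) = (\<Sum>(p, e)\<leftarrow>map (\<lambda>(p, e). (q * p, e)) ys. p *\<^sub>R e)"
        for ys :: "(real \<times> 'a) list"
        by (induction ys) (auto simp: scaleR_add_right)
      moreover have "p \<in> \<rat> \<and> e \<in> E" if "(p, e) \<in> set xs" for p e
        using xs(1) that by (auto dest: bspec)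
      ultimately show ?thesis unfolding D_def using xs(2) that(1)
        by (intro image_eqI[of _ _ "map (\<lambda>(p, e). (q * p, e)) xs"]) (auto intro: Rats_mult)
    qed
    fix c :: real and x assume "x \<in> closure D"
    moreover have "c \<in> closure \<rat>" by (simp add: Rats_closure_real)
    ultimately obtain f q where "\<And>n. f n \<in> D" "f \<longlonglongrightarrow> x" "\<And>n. q n \<in> \<rat>" "q \<longlonglongrightarrow> c"
      unfolding closure_sequential by blast
    then show "c *\<^sub>R x \<in> closure D"
      unfolding closure_sequential using D_scale
      by (intro exI[of _ "\<lambda>n. q n *\<^sub>R f n"]) (auto intro: tendsto_scaleR)
  qed
  ultimately show thesis by (rule that)
qed

lemma L2_of_dominated_convergence:
  assumes f: "square_integrable I11 f"
    and s[measurable]: "\<And>n. s n \<in> borel_measurable I11"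
    and lim: "\<And>x. x \<in> space I11 \<Longrightarrow> (\<lambda>n. s n x) \<longlonglongrightarrow> f x"
    and bound: "\<And>n x. x \<in> space I11 \<Longrightarrow> \<bar>s n x\<bar> \<le> 2 * \<bar>f x\<bar>"
  shows "square_integrable I11 (s n)" and "(\<lambda>n. L2_of (s n)) \<longlonglongrightarrow> L2_of f"
proof -
  have [measurable]: "f \<in> borel_measurable I11" using f by (simp add: square_integrable_def)
  have f2: "integrable I11 (\<lambda>x. (f x)\<^sup>2)" using f by (simp add: square_integrable_def)
  have sn: "square_integrable I11 (s n)" for n
    unfolding square_integrable_def
  proof
    show "integrable I11 (\<lambda>x. (s n x)\<^sup>2)"
    proof (rule Bochner_Integration.integrable_bound)
      show "integrable I11 (\<lambda>x. 4 * (f x)\<^sup>2)" using f2 by simp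
      show "AE x in I11. norm ((s n x)\<^sup>2) \<le> norm (4 * (f x)\<^sup>2)"
      proof (rule AE_I2)
        fix x assume "x \<in> space I11"
        from power_mono[OF bound[OF this], of n 2]
        show "norm ((s n x)\<^sup>2) \<le> norm (4 * (f x)\<^sup>2)" by (simp add: power_mult_distrib)
      qed
    qed simp
  qed simp
  then show "square_integrable I11 (s n)" .
  have "(\<lambda>n. \<integral>x. (s n x - f x)\<^sup>2 \<partial>I11) \<longlonglongrightarrow> (\<integral>x. 0 \<partial>I11)"
  proof (rule integral_dominated_convergence[where w = "\<lambda>x. 9 * (f x)\<^sup>2"])
    show "integrable I11 (\<lambda>x. 9 * (f x)\<^sup>2)" using f2 by simp
    show "AE x in I11. (\<lambda>n. (s n x - f x)\<^sup>2) \<longlonglongrightarrow> 0"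
    proof (rule AE_I2)
      fix x assume "x \<in> space I11"
      from tendsto_power[OF tendsto_diff[OF lim[OF this] tendsto_const[of "f x"]], of 2]
      show "(\<lambda>n. (s n x - f x)\<^sup>2) \<longlonglongrightarrow> 0" by simp
    qed
    show "AE x in I11. norm ((s n x - f x)\<^sup>2) \<le> 9 * (f x)\<^sup>2" for n
    proof (rule AE_I2)
      fix x assume "x \<in> space I11"
      from bound[OF this, of n] have "\<bar>s n x - f x\<bar> \<le> 3 * \<bar>f x\<bar>" by linarith
      from power_mono[OF this, of 2]
      show "norm ((s n x - f x)\<^sup>2) \<le> 9 * (f x)\<^sup>2" by (simp add: power_mult_distrib)
    qed
  qed simp_all
  then have "(\<lambda>n. (dist (L2_of (s n)) (L2_of f))\<^sup>2) \<longlonglongrightarrow> 0"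
    by (simp add: dist_norm L2_of_diff[OF sn f] norm_L2_of[OF square_integrable_diff[OF sn f]])
  then have "(\<lambda>n. sqrt ((dist (L2_of (s n)) (L2_of f))\<^sup>2)) \<longlonglongrightarrow> sqrt 0"
    by (rule tendsto_real_sqrt)
  then show "(\<lambda>n. L2_of (s n)) \<longlonglongrightarrow> L2_of f"
    by (simp add: tendsto_dist_iff[of _ "L2_of f"])
qed

lemma borel_measurable_I11: "f \<in> borel_measurable borel \<Longrightarrow> f \<in> borel_measurable I11"
  unfolding I11_def by (rule measurable_restrict_space1) simp

lemma square_integrable_indicator:
  assumes "A \<in> sets borel"
  shows "square_integrable I11 (indicat_real A)"
proof -
  have m: "indicat_real A \<in> borel_measurable I11"
    using assms by (intro borel_measurable_I11) simp
  moreover have "(\<lambda>x. (indicat_real A x)\<^sup>2) = indicat_real A" by (auto simp: indicator_def)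
  moreover have "integrable I11 (indicat_real A)"
    by (rule finite_measure.integrable_const_bound[OF finite_measure_I11, of _ 1])
      (use m in \<open>auto simp: indicator_def\<close>)
  ultimately show ?thesis by (simp add: square_integrable_def)
qed

lemma L2_of_zero: "L2_of (\<lambda>x. 0) = 0"
  by (simp add: L2_of_def zero_L2_def)

lemma L2_of_sum:
  assumes "finite I" "\<And>i. i \<in> I \<Longrightarrow> square_integrable I11 (f i)"
  shows "square_integrable I11 (\<lambda>x. \<Sum>i\<in>I. f i x) \<and> L2_of (\<lambda>x. \<Sum>i\<in>I. f i x) = (\<Sum>i\<in>I. L2_of (f i))"
  using assms
proof (induction I rule: finite_induct)
  case empty
  then show ?case by (simp add: square_integrable_zero L2_of_zero)
next
  case (insert i I)
  then have "square_integrable I11 (f i)" and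
    "square_integrable I11 (\<lambda>x. \<Sum>i\<in>I. f i x)"
    "L2_of (\<lambda>x. \<Sum>i\<in>I. f i x) = (\<Sum>i\<in>I. L2_of (f i))" by auto
  with insert(1,2) show ?case
    by (simp add: square_integrable_add L2_of_add[symmetric])
qed

instance L2 :: second_countable_topology
proof
  obtain B :: "real set set" where B: "countable B" "topological_basis B"
    using ex_countable_basis by blast
  define G where "G = Inter ` {b. finite b \<and> b \<subseteq> B}"
  have "countable G"
    unfolding G_def by (intro countable_image countable_Collect_finite_subset B)
  then have "countable ((\<lambda>A. L2_of (indicat_real A)) ` G)" by simp
  then obtain D where D: "countable D" "(\<lambda>A. L2_of (indicat_real A)) ` G \<subseteq> D" "subspace (closure D)"
    by (rule countable_closure_subspace)
  define C where "C = closure D"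
  have C: "subspace C" "closed C" using D by (auto simp: C_def)
  have G_C: "L2_of (indicat_real A) \<in> C" if "A \<in> G" for A
    using D(2) that closure_subset unfolding C_def by blast
  have "sets borel \<subseteq> sigma_sets UNIV G"
  proof -
    have "B \<subseteq> G"
    proof
      fix b assume "b \<in> B"
      then show "b \<in> G" unfolding G_def by (intro image_eqI[of _ _ "{b}"]) auto
    qed
    then show ?thesis
      by (simp add: borel_eq_countable_basis[OF B] sigma_sets_mono')
  qed
  moreover have GB: "sigma_sets UNIV G \<subseteq> sets borel"
  proof -
    have "G \<subseteq> sets borel"
    proof
      fix A assume "A \<in> G"
      then obtain b where b: "finite b" "b \<subseteq> B" "A = \<Inter>b" by (auto simp: G_def)
      have "open (\<Inter>b)"
        using b topological_basis_open[OF B(2)] by (intro open_Inter) auto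
      then show "A \<in> sets borel" using b by simp
    qed
    from sets.sigma_sets_subset[OF this] show ?thesis by simp
  qed
  ultimately have borel: "sets borel = sigma_sets UNIV G" by blast
  have "Int_stable G"
  proof (rule Int_stableI)
    fix a b assume "a \<in> G" "b \<in> G"
    then obtain a' b' where "finite a'" "a' \<subseteq> B" "a = \<Inter>a'" "finite b'" "b' \<subseteq> B" "b = \<Inter>b'"
      by (auto simp: G_def)
    then show "a \<inter> b \<in> G" unfolding G_def by (intro image_eqI[of _ _ "a' \<union> b'"]) auto
  qed
  then have ind_C: "L2_of (indicat_real A) \<in> C" if "A \<in> sigma_sets UNIV G" for A
    using subset_UNIV[of G, folded Pow_UNIV] that
  proof (induction rule: sigma_sets_induct_disjoint)
    case (basic A)
    then show ?case by (intro G_C)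
  next
    case empty
    have "indicat_real {} = (\<lambda>x. 0)" by auto
    then show ?case using C by (simp add: L2_of_zero subspace_0)
  next
    case (compl A)
    have "UNIV \<in> G" unfolding G_def by (intro image_eqI[of _ _ "{}"]) auto
    then have "L2_of (indicat_real UNIV) - L2_of (indicat_real A) \<in> C"
      using compl(2) by (intro subspace_diff[OF C(1) G_C])
    moreover have "A \<in> sets borel" using compl borel by simp
    then have "L2_of (indicat_real UNIV) - L2_of (indicat_real A) = L2_of (indicat_real (UNIV - A))"
      by (subst L2_of_diff[OF square_integrable_indicator square_integrable_indicator])
        (auto intro!: arg_cong[of _ _ L2_of] simp: fun_eq_iff indicator_def)
    ultimately show ?case by simp
  next
    case (union A)
    have A: "A i \<in> sets borel" for i using union(2) borel by auto
    define s where "s n x = (\<Sum>i<n. indicat_real (A i) x)" for n :: nat and x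
    have s: "s n x = indicat_real (\<Union>i<n. A i) x" for n x
      unfolding s_def using union(1)
      by (subst indicator_UN_disjoint) (auto simp: disjoint_family_on_def)
    have UA: "(\<Union>i. A i) \<in> sets borel" using A by blast
    have "(\<lambda>n. L2_of (s n)) \<longlonglongrightarrow> L2_of (indicat_real (\<Union>i. A i))"
    proof (rule L2_of_dominated_convergence)
      show "square_integrable I11 (indicat_real (\<Union>i. A i))"
        using UA by (rule square_integrable_indicator)
      show "s n \<in> borel_measurable I11" for n
        unfolding s_def using A by (intro borel_measurable_I11) simp
      show "(\<lambda>n. s n x) \<longlonglongrightarrow> indicat_real (\<Union>i. A i) x" for x
        unfolding s by (rule LIMSEQ_indicator_UN)
      show "\<bar>s n x\<bar> \<le> 2 * \<bar>indicat_real (\<Union>i. A i) x\<bar>" for n x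
        unfolding s by (auto simp: indicator_def)
    qed
    moreover have "L2_of (s n) \<in> C" for n
    proof -
      have "L2_of (s n) = (\<Sum>i<n. L2_of (indicat_real (A i)))"
        unfolding s_def using L2_of_sum[of "{..<n}" "\<lambda>i. indicat_real (A i)"]
        by (simp add: square_integrable_indicator A)
      then show ?thesis using C union(3) by (auto intro: subspace_sum)
    qed
    ultimately show ?case by (rule closed_sequentially[OF C(2), rotated])
  qed
  have "C = UNIV"
  proof (intro set_eqI iffI UNIV_I)
    fix g :: L2
    define f where "f = rep_L2 g"
    have f: "square_integrable I11 f" "L2_of f = g"
      by (simp_all add: f_def square_integrable_rep_L2 L2_of_rep_L2)
    then have "f \<in> borel_measurable I11" by (simp add: square_integrable_def)
    from borel_measurable_implies_sequence_metric[OF this, of 0] obtain s where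
      s: "\<And>i. simple_function I11 (s i)" "\<And>x. x \<in> space I11 \<Longrightarrow> (\<lambda>i. s i x) \<longlonglongrightarrow> f x"
      "\<And>i x. x \<in> space I11 \<Longrightarrow> \<bar>s i x\<bar> \<le> 2 * \<bar>f x\<bar>"
      by simp metis
    have lim: "(\<lambda>n. L2_of (s n)) \<longlonglongrightarrow> L2_of f" and sn: "\<And>n. square_integrable I11 (s n)"
      using L2_of_dominated_convergence[OF f(1) borel_measurable_simple_function[OF s(1)] s(2,3)]
      by auto
    have "L2_of (s n) \<in> C" for n
    proof -
      define A where "A y = s n -` {y} \<inter> space I11" for y
      have fin: "finite (s n ` space I11)" using s(1) by (simp add: simple_function_def)
      have A: "A y \<in> sets borel" for y
        using simple_functionD(2)[OF s(1), of n "{y}"] unfolding A_def sets_I11 by blast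
      have sum: "square_integrable I11 (\<lambda>x. \<Sum>y\<in>s n ` space I11. y * indicat_real (A y) x) \<and>
          L2_of (\<lambda>x. \<Sum>y\<in>s n ` space I11. y * indicat_real (A y) x) =
          (\<Sum>y\<in>s n ` space I11. L2_of (\<lambda>x. y * indicat_real (A y) x))"
        by (rule L2_of_sum[OF fin]) (intro square_integrable_scale square_integrable_indicator A)
      have "L2_of (s n) = L2_of (\<lambda>x. \<Sum>y\<in>s n ` space I11. y * indicat_real (A y) x)"
      proof (rule L2_of_eqI[OF sn])
        show "AE x in I11. s n x = (\<Sum>y\<in>s n ` space I11. y * indicat_real (A y) x)"
        proof (rule AE_I2)
          fix x assume x: "x \<in> space I11"
          have "(\<Sum>y\<in>s n ` space I11. y * indicat_real (A y) x)
              = (\<Sum>y\<in>s n ` space I11. if y = s n x then y else 0)"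
            using x by (intro sum.cong) (auto simp: A_def indicator_def)
          then show "s n x = (\<Sum>y\<in>s n ` space I11. y * indicat_real (A y) x)"
            using x fin by simp
        qed
      qed (use sum in blast)
      also have "\<dots> = (\<Sum>y\<in>s n ` space I11. y *\<^sub>R L2_of (indicat_real (A y)))"
        using sum by (simp add: L2_of_scaleR square_integrable_indicator A)
      also have "\<dots> \<in> C"
        using C A borel ind_C by (intro subspace_sum subspace_scale) auto
      finally show ?thesis .
    qed
    then have "L2_of f \<in> C" by (rule closed_sequentially[OF C(2) _ lim])
    then show "g \<in> C" using f(2) by simp
  qed
  then show "\<exists>B::L2 set set. countable B \<and> open = generate_topology B"
    using second_countable_if_dense[OF D(1)] by (simp add: C_def)
qed


section \<open>The operator $A_0$\<close>

text \<open>Weak derivatives in one dimension, tested against compactly supported $C^1$ functions.\<close>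

definition test_function :: "real set \<Rightarrow> (real \<Rightarrow> real) \<Rightarrow> bool" where
  "test_function \<Omega> \<phi> \<longleftrightarrow> \<phi> C1_differentiable_on UNIV \<and>
     compact (closure {x. \<phi> x \<noteq> 0}) \<and> closure {x. \<phi> x \<noteq> 0} \<subseteq> \<Omega>"

definition locally_integrable :: "real set \<Rightarrow> (real \<Rightarrow> real) \<Rightarrow> bool" where
  "locally_integrable \<Omega> f \<longleftrightarrow> (\<forall>K. compact K \<and> K \<subseteq> \<Omega> \<longrightarrow> set_integrable lborel K f)"

definition weak_derivative :: "real set \<Rightarrow> (real \<Rightarrow> real) \<Rightarrow> (real \<Rightarrow> real) \<Rightarrow> bool" where
  "weak_derivative \<Omega> f g \<longleftrightarrow> locally_integrable \<Omega> f \<and> locally_integrable \<Omega> g \<and>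
     (\<forall>\<phi>. test_function \<Omega> \<phi> \<longrightarrow>
        (LINT x:\<Omega>|lborel. f x * deriv \<phi> x) = - (LINT x:\<Omega>|lborel. g x * \<phi> x))"

text \<open>The value \<open>y\<close> at \<open>a\<close> of (the class of) \<open>f\<close>: some representative tends to \<open>y\<close> at \<open>a\<close>.
  If \<open>f\<close> has a representative that is continuous near \<open>a\<close> on $[-1,1]$, this is its value
  at \<open>a\<close>; for $a = \pm 1$ it is the trace. Such a \<open>y\<close> is unique, because $(-1,1)$ has
  positive measure near \<open>a\<close>.\<close>

definition has_value :: "L2 \<Rightarrow> real \<Rightarrow> real \<Rightarrow> bool" where
  "has_value f a y \<longleftrightarrow>
     (\<exists>F. (AE x in I11. F x = rep_L2 f x) \<and> (F \<longlongrightarrow> y) (at a within {-1<..<1}))"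

text \<open>$H^2(-1,1)$, and its subspace $\tilde H^2_0(-1,1)$ of functions with $f(0) = f'(0) = 0$.\<close>

definition H2 :: "L2 set" where
  "H2 = {f. \<exists>f' f'' :: L2. weak_derivative {-1<..<1} (rep_L2 f) (rep_L2 f') \<and>
     weak_derivative {-1<..<1} (rep_L2 f') (rep_L2 f'')}"

definition H2_0 :: "L2 set" where
  "H2_0 = {f \<in> H2. has_value f 0 0 \<and>
     (\<exists>f' :: L2. weak_derivative {-1<..<1} (rep_L2 f) (rep_L2 f') \<and> has_value f' 0 0)}"

text \<open>The elements of $\mathcal{F}_s$; \<open>c1m\<close>, \<open>c2m\<close> stand for $c_1^-, c_2^-$ and \<open>c1p\<close>, \<open>c2p\<close>
  for $c_1^+, c_2^+$.\<close>

definition singular_fun :: "real \<Rightarrow> real \<Rightarrow> real \<Rightarrow> real \<Rightarrow> real \<Rightarrow> real \<Rightarrow> real" where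
  "singular_fun \<nu> c1m c2m c1p c2p x =
     (if x > 0 then c1p * \<bar>x\<bar> powr (\<nu> + 1/2) + c2p * \<bar>x\<bar> powr (- \<nu> + 1/2)
      else c1m * \<bar>x\<bar> powr (\<nu> + 1/2) + c2m * \<bar>x\<bar> powr (- \<nu> + 1/2))"

definition dom_A0 :: "real \<Rightarrow> L2 set" where
  "dom_A0 \<nu> = {f. \<exists>f\<^sub>r\<in>H2_0. \<exists>c1m c2m c1p c2p.
     f = f\<^sub>r + L2_of (singular_fun \<nu> c1m c2m c1p c2p) \<and>
     has_value f (-1) 0 \<and> has_value f 1 0 \<and>
     c1m + c2m + c1p + c2p = 0 \<and>
     (\<nu> + 1/2) * c1m + (- \<nu> + 1/2) * c2m = (\<nu> + 1/2) * c1p + (- \<nu> + 1/2) * c2p}"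

text \<open>The derivatives are those on $(-1,0) \cup (0,1)$. Only the restriction of \<open>A0 \<nu>\<close> to
  \<open>dom_A0 \<nu>\<close> is meaningful: there the description has a unique solution in $L^2(-1,1)$.\<close>

definition A0 :: "real \<Rightarrow> L2 \<Rightarrow> L2" where
  "A0 \<nu> f = (THE g. \<exists>f' f''.
     weak_derivative ({-1<..<1} - {0}) (rep_L2 f) f' \<and>
     weak_derivative ({-1<..<1} - {0}) f' f'' \<and>
     (AE x in I11. rep_L2 g x = - f'' x + (\<nu>\<^sup>2 - 1/4) / x\<^sup>2 * rep_L2 f x))"


section \<open>Semigroups and mild solutions\<close>

definition C0_semigroup :: "(real \<Rightarrow> 'a \<Rightarrow> 'a::real_normed_vector) \<Rightarrow> bool" where
  "C0_semigroup S \<longleftrightarrow>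
     (\<forall>t\<ge>0. bounded_linear (S t)) \<and>
     (\<forall>f. S 0 f = f) \<and>
     (\<forall>s\<ge>0. \<forall>t\<ge>0. \<forall>f. S (s + t) f = S s (S t f)) \<and>
     (\<forall>f. ((\<lambda>t. S t f) \<longlongrightarrow> f) (at_right 0))"

text \<open>\<open>B\<close> with domain \<open>D\<close> is the infinitesimal generator of \<open>S\<close>.\<close>

definition generates ::
    "'a set \<Rightarrow> ('a \<Rightarrow> 'a) \<Rightarrow> (real \<Rightarrow> 'a \<Rightarrow> 'a::real_normed_vector) \<Rightarrow> bool" where
  "generates D B S \<longleftrightarrow> C0_semigroup S \<and>
     (\<forall>f g. ((\<lambda>h. (S h f - f) /\<^sub>R h) \<longlongrightarrow> g) (at_right 0) \<longleftrightarrow> f \<in> D \<and> g = B f)"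

text \<open>A \<open>C\<^sub>0\<close>-semigroup on a Banach space is determined by its generator for times \<open>t \<ge> 0\<close>, so
  the choice is immaterial there.\<close>

definition generated_semigroup ::
    "'a set \<Rightarrow> ('a \<Rightarrow> 'a) \<Rightarrow> real \<Rightarrow> 'a \<Rightarrow> 'a::real_normed_vector" where
  "generated_semigroup D B = (SOME S. generates D B S)"

definition exp_A0 :: "real \<Rightarrow> real \<Rightarrow> L2 \<Rightarrow> L2" where
  "exp_A0 \<nu> = generated_semigroup (dom_A0 \<nu>) (\<lambda>f. - A0 \<nu> f)"

definition mild_solution :: "real \<Rightarrow> L2 \<Rightarrow> (real \<Rightarrow> L2) \<Rightarrow> real \<Rightarrow> L2" where
  "mild_solution \<nu> f0 v t =
     exp_A0 \<nu> t f0 + (LINT \<tau>:{0..t}|lborel. exp_A0 \<nu> (t - \<tau>) (v \<tau>))"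

end

theory Submission
  imports Defs "HOL-Library.Diagonal_Subsequence"
begin

text \<open>
  By duality the states reached from \<open>0\<close> are dense if an element \<open>z\<close> with
  \<open>\<langle>exp (- A t) w, z\<rangle> = 0\<close> for all \<open>t \<in> (0, T)\<close> and all \<open>w\<close> supported in \<open>\<omega>\<close> must vanish
  (\<open>approximate_controllability\<close>). If \<open>A\<close> is diagonal with nonnegative eigenvalues, this function of
  \<open>t\<close> is analytic, so it vanishes for all \<open>t > 0\<close>. It is a superposition of exponentials
  \<open>exp (- \<mu> t)\<close>, and the part that belongs to each eigenvalue \<open>\<mu>\<close> vanishes separately: the projection
  of \<open>z\<close> to the eigenspace is orthogonal to all \<open>w\<close>, that is, an eigenfunction that vanishes on
  \<open>\<omega>\<close> (\<open>heat_unique_continuation\<close>). It remains to diagonalise \<open>A\<close> and to prove that such an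
  eigenfunction is zero.

  Everything that concerns \<open>A\<close> rests on variation of parameters. The equation
  \<open>- f'' + c / x\<^sup>2 f = g\<close> has the homogeneous solutions \<open>x\<^sup>\<alpha>\<close>, \<open>x\<^sup>\<beta>\<close> with \<open>\<alpha> = 1/2 + \<nu>\<close>,
  \<open>\<beta> = 1/2 - \<nu>\<close>, and an integral operator \<open>V\<close> gives the solution with vanishing data at the
  singularity. The domain of \<open>A\<close> consists exactly of the functions that are
  \<open>c\<^sub>1 x\<^sup>\<alpha> + c\<^sub>2 x\<^sup>\<beta> + V g\<close> on either side, with coefficients subject to the transmission and
  boundary conditions, and \<open>A\<close> sends such a function to \<open>g\<close> (\<open>dom_A0_iff\<close>). Hardy's inequality
  makes the singular term \<open>V g / x\<^sup>2\<close> square integrable, and uniqueness comes from Wronskians.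

  The explicit form shows that \<open>A\<close> is symmetric, that its kernel is spanned by \<open>x\<^sup>\<beta> - x\<^sup>\<alpha>\<close>, and
  that its inverse on the orthogonal complement of the kernel is compact. The spectral theorem for
  compact symmetric operators then yields an orthonormal basis of eigenvectors that determines the
  graph of \<open>A\<close> (\<open>diagonalisation\<close>).

  An eigenfunction solves on each side a Volterra equation with a nonnegative kernel. For a negative
  eigenvalue this forces the even and the odd part to keep their sign up to the end point, against the
  Dirichlet condition; so the eigenvalues are nonnegative (\<open>eigenvalue_nonneg\<close>). If an eigenfunction
  vanishes on \<open>\<omega>\<close>, it vanishes on one side of the singularity by uniqueness for a regular equation.
  There \<open>c\<^sub>1 = c\<^sub>2 = 0\<close>, and the two transmission conditions, which are independent because
  \<open>\<alpha> \<noteq> \<beta>\<close>, carry this across the singularity; uniqueness for the Volterra equation finishes the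
  proof (\<open>eigenfunction_unique_continuation\<close>).

  The semigroup is given as any one generated by \<open>- A\<close>, so it also has to be identified with
  \<open>exp (- A t)\<close>: by uniform boundedness any such semigroup is locally bounded, and on eigenvectors it
  is determined (\<open>generated_semigroup_eq_heat\<close>).
\<close>

section \<open>Orthogonal complements in a Hilbert space\<close>

text \<open>A minimising sequence for the distance is Cauchy by the parallelogram law.\<close>
lemma nearest_point_exists:
  fixes M :: "'a::{real_inner,complete_space} set"
  assumes M: "subspace M" "closed M"
  shows "\<exists>m\<in>M. \<forall>y\<in>M. norm (x - m) \<le> norm (x - y)"
proof -
  define S where "S = (\<lambda>y. (norm (x - y))\<^sup>2) ` M"
  define \<delta> where "\<delta> = Inf S"
  have S0: "S \<noteq> {}" using subspace_0[OF M(1)] by (auto simp: S_def)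
  have bdd: "bdd_below S" by (rule bdd_belowI[of _ 0]) (auto simp: S_def)
  have low: "\<delta> \<le> (norm (x - y))\<^sup>2" if "y \<in> M" for y
    unfolding \<delta>_def using that bdd by (intro cInf_lower) (auto simp: S_def)
  have "\<exists>y\<in>M. (norm (x - y))\<^sup>2 < \<delta> + 1 / real (Suc n)" for n
  proof -
    have "\<delta> < \<delta> + 1 / real (Suc n)" by simp
    then obtain s where "s \<in> S" "s < \<delta> + 1 / real (Suc n)"
      unfolding \<delta>_def using cInf_lessD[OF S0] by blast
    then show ?thesis by (auto simp: S_def)
  qed
  then obtain y where y: "\<And>n. y n \<in> M" "\<And>n. (norm (x - y n))\<^sup>2 < \<delta> + 1 / real (Suc n)" by metis
  have par: "(norm (y n - y k))\<^sup>2 \<le> 2 * (1 / real (Suc n)) + 2 * (1 / real (Suc k))" for n k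
  proof -
    have "(1/2) *\<^sub>R (y n + y k) \<in> M" using y(1) M(1) by (simp add: subspace_add subspace_scale)
    from low[OF this] have "\<delta> \<le> (norm (x - (1/2) *\<^sub>R (y n + y k)))\<^sup>2" .
    moreover have "(norm (y n - y k))\<^sup>2 = 2 * (norm (x - y n))\<^sup>2 + 2 * (norm (x - y k))\<^sup>2
        - 4 * (norm (x - (1/2) *\<^sub>R (y n + y k)))\<^sup>2"
      by (simp add: power2_norm_eq_inner inner_diff_left inner_diff_right inner_add_left
          inner_add_right inner_commute algebra_simps)
    ultimately show ?thesis using y(2)[of n] y(2)[of k] by linarith
  qed
  have "Cauchy y"
  proof (rule metric_CauchyI)
    fix e :: real assume e: "0 < e"
    obtain N where N: "1 / real (Suc N) < e\<^sup>2 / 4"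
      using nat_approx_posE[of "e\<^sup>2/4"] e by auto
    have "dist (y m) (y n) < e" if "m \<ge> N" "n \<ge> N" for m n
    proof -
      have "1 / real (Suc m) \<le> 1 / real (Suc N)" "1 / real (Suc n) \<le> 1 / real (Suc N)"
        using that by (auto simp: field_simps)
      then have "(norm (y m - y n))\<^sup>2 < e\<^sup>2" using par[of m n] N by linarith
      then show ?thesis using e by (simp add: dist_norm power_less_imp_less_base)
    qed
    then show "\<exists>N. \<forall>m\<ge>N. \<forall>n\<ge>N. dist (y m) (y n) < e" by blast
  qed
  then obtain m where m: "y \<longlonglongrightarrow> m" using Cauchy_convergent convergent_def by blast
  have "m \<in> M" by (rule closed_sequentially[OF M(2) y(1) m])
  moreover have "norm (x - m) \<le> norm (x - z)" if "z \<in> M" for z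
  proof -
    have "(norm (x - m))\<^sup>2 \<le> \<delta>"
    proof (rule LIMSEQ_le)
      show "(\<lambda>n. (norm (x - y n))\<^sup>2) \<longlonglongrightarrow> (norm (x - m))\<^sup>2" by (intro tendsto_intros m)
      show "(\<lambda>n. \<delta> + 1 / real (Suc n)) \<longlonglongrightarrow> \<delta>"
        using tendsto_add[OF tendsto_const[of \<delta>] LIMSEQ_inverse_real_of_nat]
        by (simp add: inverse_eq_divide)
      show "\<exists>N. \<forall>n\<ge>N. (norm (x - y n))\<^sup>2 \<le> \<delta> + 1 / real (Suc n)" using y(2) less_imp_le by blast
    qed
    then have "(norm (x - m))\<^sup>2 \<le> (norm (x - z))\<^sup>2" using low[OF that] by linarith
    then show ?thesis by (rule power2_le_imp_le) simp
  qed
  ultimately show ?thesis by blast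
qed

lemma closed_subspace_eq_UNIV:
  fixes M :: "'a::{real_inner,complete_space} set"
  assumes M: "subspace M" "closed M" and triv: "\<And>z. (\<And>y. y \<in> M \<Longrightarrow> inner z y = 0) \<Longrightarrow> z = 0"
  shows "M = UNIV"
proof (intro set_eqI iffI UNIV_I)
  fix x :: 'a
  obtain m where m: "m \<in> M" "\<And>y. y \<in> M \<Longrightarrow> norm (x - m) \<le> norm (x - y)"
    using nearest_point_exists[OF M] by blast
  have "x - m = 0"
  proof (rule triv)
    fix y assume y: "y \<in> M"
    show "inner (x - m) y = 0"
    proof (cases "y = 0")
      case False
      define t where "t = inner (x - m) y / inner y y"
      have pos: "inner y y > 0" using False by simp
      have "m + t *\<^sub>R y \<in> M" using m(1) y M(1) by (simp add: subspace_add subspace_scale)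
      from m(2)[OF this] have "(norm (x - m))\<^sup>2 \<le> (norm (x - (m + t *\<^sub>R y)))\<^sup>2" by simp
      also have "\<dots> = (norm (x - m))\<^sup>2 - 2 * t * inner (x - m) y + t\<^sup>2 * inner y y"
        by (simp add: power2_norm_eq_inner inner_diff_left inner_diff_right inner_add_left
            inner_add_right inner_commute algebra_simps power2_eq_square[of t])
      also have "\<dots> = (norm (x - m))\<^sup>2 - (inner (x - m) y)\<^sup>2 / inner y y"
        using pos by (simp add: t_def power2_eq_square field_simps)
      finally have "(inner (x - m) y)\<^sup>2 / inner y y \<le> 0" by simp
      then have "(inner (x - m) y)\<^sup>2 \<le> 0" using pos by (simp add: divide_le_0_iff)
      then show ?thesis by simp
    qed simp
  qed
  then show "x \<in> M" using m(1) by simp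
qed

lemma subspace_closure:
  fixes S :: "'a::real_normed_vector set"
  assumes "subspace S"
  shows "subspace (closure S)"
proof (rule subspaceI)
  show "0 \<in> closure S" using subspace_0[OF assms] closure_subset by blast
next
  fix x y assume "x \<in> closure S" "y \<in> closure S"
  then obtain f g where "\<And>n. f n \<in> S" "f \<longlonglongrightarrow> x" "\<And>n. g n \<in> S" "g \<longlonglongrightarrow> y"
    unfolding closure_sequential by blast
  then show "x + y \<in> closure S"
    unfolding closure_sequential using subspace_add[OF assms]
    by (intro exI[of _ "\<lambda>n. f n + g n"]) (auto intro: tendsto_add)
next
  fix c :: real and x assume "x \<in> closure S"
  then obtain f where "\<And>n. f n \<in> S" "f \<longlonglongrightarrow> x" unfolding closure_sequential by blast
  then show "c *\<^sub>R x \<in> closure S"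
    unfolding closure_sequential using subspace_scale[OF assms]
    by (intro exI[of _ "\<lambda>n. c *\<^sub>R f n"]) (auto intro: tendsto_scaleR)
qed

lemma closure_span_eq_UNIV:
  fixes Y :: "'a::{real_inner,complete_space} set"
  assumes "\<And>z. (\<And>y. y \<in> Y \<Longrightarrow> inner z y = 0) \<Longrightarrow> z = 0"
  shows "closure (span Y) = UNIV"
proof (rule closed_subspace_eq_UNIV)
  show "subspace (closure (span Y))" by (intro subspace_closure subspace_span)
  fix z :: 'a assume "\<And>y. y \<in> closure (span Y) \<Longrightarrow> inner z y = 0"
  then show "z = 0" using assms by (meson closure_subset span_base subsetD)
qed simp


section \<open>The spectral theorem for compact symmetric operators\<close>

definition weakly_Cauchy :: "(nat \<Rightarrow> 'a::real_inner) \<Rightarrow> bool" where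
  "weakly_Cauchy x \<longleftrightarrow> bounded (range x) \<and> (\<forall>y. convergent (\<lambda>n. inner (x n) y))"

text \<open>On a Hilbert space this is compactness of a linear operator. The sequential form suits
  integral operators: their values converge pointwise along a weakly Cauchy sequence.\<close>
definition completely_continuous :: "('a::real_inner \<Rightarrow> 'b::real_normed_vector) \<Rightarrow> bool" where
  "completely_continuous R \<longleftrightarrow> (\<forall>x. weakly_Cauchy x \<longrightarrow> convergent (\<lambda>n. R (x n)))"

text \<open>A diagonal argument over a countable dense set; boundedness of the sequence carries
  convergence from the dense set to all test vectors.\<close>
lemma weakly_Cauchy_subsequence:
  fixes x :: "nat \<Rightarrow> 'a::{real_inner,second_countable_topology}"
  assumes bdd: "bounded (range x)"
  shows "\<exists>r. strict_mono r \<and> weakly_Cauchy (x \<circ> r)"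
proof -
  obtain D :: "'a set" where D: "countable D" "\<And>X. open X \<Longrightarrow> X \<noteq> {} \<Longrightarrow> \<exists>d\<in>D. d \<in> X"
    using countable_dense_exists by blast
  have "D \<noteq> {}" using D(2)[of UNIV] by auto
  define d where "d = from_nat_into D"
  have d: "range d = D" using D(1) \<open>D \<noteq> {}\<close> by (simp add: d_def range_from_nat_into)
  obtain B where B: "\<And>n. norm (x n) \<le> B" using bdd by (auto simp: bounded_iff)
  have B0: "B \<ge> 0" using norm_ge_zero[of "x 0"] B[of 0] by linarith
  have bound: "\<bar>inner (x n) y\<bar> \<le> B * norm y" for n y
    using Cauchy_Schwarz_ineq2[of "x n" y] B[of n] by (meson mult_right_mono norm_ge_zero order_trans)
  interpret subseqs "\<lambda>k s. convergent (\<lambda>n. inner (x (s n)) (d k))"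
  proof
    fix k and s :: "nat \<Rightarrow> nat"
    have "bounded (range (\<lambda>n. inner (x (s n)) (d k)))"
      using bound by (auto simp: bounded_iff)
    then obtain l r where "strict_mono r" "((\<lambda>n. inner (x (s n)) (d k)) \<circ> r) \<longlonglongrightarrow> l"
      using bounded_imp_convergent_subsequence by blast
    then show "\<exists>r'. strict_mono r' \<and> convergent (\<lambda>n. inner (x ((s \<circ> r') n)) (d k))"
      by (auto simp: convergent_def o_def)
  qed
  have conv_d: "convergent (\<lambda>n. inner (x (diagseq n)) (d k))" for k
  proof -
    have "convergent (\<lambda>n. inner (x ((diagseq \<circ> (+) (Suc k)) n)) (d k))"
    proof (rule diagseq_holds)
      fix r s :: "nat \<Rightarrow> nat" and n
      assume r: "strict_mono r" and "convergent (\<lambda>i. inner (x (s i)) (d n))"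
      from convergent_subseq_convergent[OF this(2) r]
      show "convergent (\<lambda>i. inner (x ((s \<circ> r) i)) (d n))" by (simp add: o_def)
    qed
    then have "convergent (\<lambda>n. inner (x (diagseq (n + Suc k))) (d k))" by (simp add: add.commute)
    then show ?thesis by (rule convergent_ignore_initial_segment[THEN iffD1])
  qed
  have "convergent (\<lambda>n. inner (x (diagseq n)) y)" for y
  proof (rule Cauchy_convergent, rule metric_CauchyI)
    fix e :: real assume e: "0 < e"
    define h where "h = e / (3 * (B + 1))"
    have h: "h > 0" "B * h < e / 3" using e B0 by (auto simp: h_def field_simps)
    obtain z where z: "z \<in> D" "dist y z < h" using D(2)[of "ball y h"] h by auto
    then obtain k where k: "z = d k" using d by blast
    have "Cauchy (\<lambda>n. inner (x (diagseq n)) z)" using conv_d k convergent_Cauchy by blast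
    then obtain N where N: "\<And>m n. m \<ge> N \<Longrightarrow> n \<ge> N \<Longrightarrow>
        dist (inner (x (diagseq m)) z) (inner (x (diagseq n)) z) < e / 3"
      using metric_CauchyD[of _ "e/3"] e by (metis (no_types, lifting) divide_pos_pos zero_less_numeral)
    have near: "\<bar>inner (x (diagseq n)) y - inner (x (diagseq n)) z\<bar> < e / 3" for n
    proof -
      have "\<bar>inner (x (diagseq n)) (y - z)\<bar> \<le> B * norm (y - z)" by (rule bound)
      also have "\<dots> \<le> B * h" using z(2) B0 by (intro mult_left_mono) (auto simp: dist_norm)
      finally show ?thesis using h by (simp add: inner_diff_right)
    qed
    have "dist (inner (x (diagseq m)) y) (inner (x (diagseq n)) y) < e" if "m \<ge> N" "n \<ge> N" for m n
      using N[OF that] near[of m] near[of n] unfolding dist_real_def by linarith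
    then show "\<exists>N. \<forall>m\<ge>N. \<forall>n\<ge>N. dist (inner (x (diagseq m)) y) (inner (x (diagseq n)) y) < e"
      by blast
  qed
  moreover have "bounded (range (x \<circ> diagseq))"
    using bdd by (rule bounded_subset) auto
  ultimately have "weakly_Cauchy (x \<circ> diagseq)" by (simp add: weakly_Cauchy_def)
  then show ?thesis using subseq_diagseq by blast
qed

lemma completely_continuous_bounded:
  fixes R :: "'a::{real_inner,second_countable_topology} \<Rightarrow> 'b::real_normed_vector"
  assumes lin: "linear R" and cc: "completely_continuous R"
  shows "bounded_linear R"
proof (rule ccontr)
  assume "\<not> bounded_linear R"
  then have "\<nexists>K. \<forall>x. norm (R x) \<le> norm x * K"
    using lin by (simp add: bounded_linear_def bounded_linear_axioms_def)
  then have "\<forall>n::nat. \<exists>y. norm (R y) > norm y * real n" by (meson not_le)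
  then obtain y where y: "\<And>n::nat. norm (R (y n)) > norm (y n) * real n" by metis
  have y0: "y n \<noteq> 0" for n
  proof
    assume "y n = 0"
    then show False using y[of n] linear_0[OF lin] by simp
  qed
  define x where "x n = y n /\<^sub>R norm (y n)" for n
  have x1: "norm (x n) = 1" for n using y0 by (simp add: x_def)
  have xn: "norm (R (x n)) > real n" for n
    using y[of n] y0[of n] lin by (simp add: x_def linear_cmul field_simps)
  obtain r where r: "strict_mono r" "weakly_Cauchy (x \<circ> r)"
    using weakly_Cauchy_subsequence[of x] x1 by (auto simp: bounded_iff)
  then have "convergent (\<lambda>n. R ((x \<circ> r) n))" using cc by (auto simp: completely_continuous_def)
  then have "Bseq (\<lambda>n. R ((x \<circ> r) n))" by (rule convergent_imp_Bseq)
  then obtain K where K: "\<And>n. norm (R (x (r n))) \<le> K" by (auto simp: Bseq_def)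
  obtain n :: nat where "K < real n" using reals_Archimedean2 by blast
  also have "real n \<le> real (r n)" using seq_suble[OF r(1)] by simp
  finally show False using xn[of "r n"] K[of n] by linarith
qed

text \<open>Along a maximising sequence of unit vectors \<open>x n\<close> for \<open>norm (R x)\<close>, with supremum
  \<open>m\<close>, the vectors \<open>R (R (x n)) - m\<^sup>2 x n\<close> tend to zero. By compactness \<open>x n\<close> then converges,
  to an eigenvector of \<open>R\<^sup>2\<close>, which splits into eigenvectors of \<open>R\<close> for \<open>m\<close> and \<open>- m\<close>.\<close>
lemma eigenvector_exists:
  fixes R :: "'a::{real_inner,complete_space,second_countable_topology} \<Rightarrow> 'a"
  assumes lin: "linear R" and cc: "completely_continuous R"
    and sym: "\<And>x y. inner (R x) y = inner x (R y)" and inj: "\<And>x. R x = 0 \<Longrightarrow> x = 0"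
    and M: "subspace M" "closed M" "M \<noteq> {0}" and RM: "\<And>x. x \<in> M \<Longrightarrow> R x \<in> M"
  shows "\<exists>e\<in>M. norm e = 1 \<and> (\<exists>\<rho>. R e = \<rho> *\<^sub>R e)"
proof -
  interpret R: bounded_linear R using completely_continuous_bounded[OF lin cc] .
  obtain y where y: "y \<in> M" "y \<noteq> 0" using M subspace_0 by blast
  define S where "S = (\<lambda>x. norm (R x)) ` {x \<in> M. norm x = 1}"
  define m where "m = Sup S"
  obtain K where K: "\<And>x. norm (R x) \<le> norm x * K" using R.bounded by blast
  have bdd: "bdd_above S" 
  proof (rule bdd_aboveI)
    fix s assume "s \<in> S"
    then obtain x where "norm x = 1" "s = norm (R x)" by (auto simp: S_def)
    then show "s \<le> K" using K[of x] by simp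
  qed
  have unit: "x /\<^sub>R norm x \<in> M" "norm (x /\<^sub>R norm x) = 1" if "x \<in> M" "x \<noteq> 0" for x
    using that M(1) by (auto simp: subspace_scale)
  have S0: "S \<noteq> {}" using unit[OF y] by (auto simp: S_def)
  have Rm: "norm (R x) \<le> m * norm x" if x: "x \<in> M" for x
  proof (cases "x = 0")
    case False
    have "norm (R (x /\<^sub>R norm x)) \<le> m"
      unfolding m_def using unit[OF x False] bdd by (intro cSup_upper) (auto simp: S_def)
    then show ?thesis using False by (simp add: R.scaleR field_simps)
  qed (simp add: R.zero)
  have "0 < norm (R y)" using inj y by auto
  then have "0 < m * norm y" using Rm[OF y(1)] by linarith
  then have m0: "m > 0" using y(2) by (simp add: zero_less_mult_iff)
  have "\<exists>x\<in>M. norm x = 1 \<and> norm (R x) > m - 1 / real (Suc n)" for n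
  proof -
    have "m - 1 / real (Suc n) < m" by simp
    then obtain s where "s \<in> S" "m - 1 / real (Suc n) < s"
      unfolding m_def using less_cSupD[OF S0] by blast
    then show ?thesis by (auto simp: S_def)
  qed
  then obtain x' where x': "\<And>n. x' n \<in> M" "\<And>n. norm (x' n) = 1"
    "\<And>n. norm (R (x' n)) > m - 1 / real (Suc n)" by metis
  obtain r where r: "strict_mono r" "weakly_Cauchy (x' \<circ> r)"
    using weakly_Cauchy_subsequence[of x'] x'(2) by (auto simp: bounded_iff)
  define x where "x = x' \<circ> r"
  have x: "\<And>n. x n \<in> M" "\<And>n. norm (x n) = 1" using x' by (auto simp: x_def)
  have "(\<lambda>n. norm (R (x' n))) \<longlonglongrightarrow> m"
  proof (rule tendsto_sandwich)
    show "\<forall>\<^sub>F n in sequentially. m - 1 / real (Suc n) \<le> norm (R (x' n))"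
      using x'(3) by (intro always_eventually) (auto intro: less_imp_le)
    show "\<forall>\<^sub>F n in sequentially. norm (R (x' n)) \<le> m"
      using Rm[OF x'(1)] x'(2) by (intro always_eventually) auto
    show "(\<lambda>n. m - 1 / real (Suc n)) \<longlonglongrightarrow> m"
      using tendsto_diff[OF tendsto_const[of m] LIMSEQ_inverse_real_of_nat]
      by (simp add: inverse_eq_divide)
  qed simp
  then have nRx: "(\<lambda>n. norm (R (x n))) \<longlonglongrightarrow> m"
    using LIMSEQ_subseq_LIMSEQ[OF _ r(1)] by (simp add: x_def o_def)
  obtain w where w: "(\<lambda>n. R (x n)) \<longlonglongrightarrow> w"
    using cc r(2) unfolding completely_continuous_def convergent_def x_def by blast
  have RRw: "(\<lambda>n. R (R (x n))) \<longlonglongrightarrow> R w" by (rule R.tendsto[OF w])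
  have "(\<lambda>n. R (R (x n)) - m\<^sup>2 *\<^sub>R x n) \<longlonglongrightarrow> 0"
  proof (rule tendsto_norm_zero_cancel, rule tendsto_sandwich[where f = "\<lambda>_. 0"])
    show "(\<lambda>n. sqrt (m\<^sup>2 * (m\<^sup>2 - (norm (R (x n)))\<^sup>2))) \<longlonglongrightarrow> 0"
    proof -
      have "(\<lambda>n. sqrt (m\<^sup>2 * (m\<^sup>2 - (norm (R (x n)))\<^sup>2))) \<longlonglongrightarrow> sqrt (m\<^sup>2 * (m\<^sup>2 - m\<^sup>2))"
        by (intro tendsto_intros nRx)
      then show ?thesis by simp
    qed
    show "\<forall>\<^sub>F n in sequentially. norm (R (R (x n)) - m\<^sup>2 *\<^sub>R x n)
        \<le> sqrt (m\<^sup>2 * (m\<^sup>2 - (norm (R (x n)))\<^sup>2))"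
    proof (intro always_eventually allI real_le_rsqrt)
      fix n
      have "(norm (R (R (x n)) - m\<^sup>2 *\<^sub>R x n))\<^sup>2
          = (norm (R (R (x n))))\<^sup>2 - 2 * m\<^sup>2 * inner (R (R (x n))) (x n) + m^4 * (norm (x n))\<^sup>2"
        by (simp add: power2_norm_eq_inner inner_diff_left inner_diff_right inner_commute
            algebra_simps power2_eq_square[of m] power4_eq_xxxx)
      also have "inner (R (R (x n))) (x n) = (norm (R (x n)))\<^sup>2"
        by (simp add: sym power2_norm_eq_inner)
      also have "(norm (R (R (x n))))\<^sup>2 \<le> (m * norm (R (x n)))\<^sup>2"
        using Rm[OF RM[OF x(1)]] by (intro power_mono) auto
      finally show "(norm (R (R (x n)) - m\<^sup>2 *\<^sub>R x n))\<^sup>2 \<le> m\<^sup>2 * (m\<^sup>2 - (norm (R (x n)))\<^sup>2)"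
        using x(2)[of n] by (simp add: algebra_simps power2_eq_square power4_eq_xxxx)
    qed
  qed simp_all
  from tendsto_diff[OF RRw this] have "(\<lambda>n. m\<^sup>2 *\<^sub>R x n) \<longlonglongrightarrow> R w" by simp
  from tendsto_scaleR[OF tendsto_const[of "inverse (m\<^sup>2)"] this]
  have xl: "x \<longlonglongrightarrow> inverse (m\<^sup>2) *\<^sub>R R w" using m0 by simp
  define e where "e = inverse (m\<^sup>2) *\<^sub>R R w"
  have eM: "e \<in> M" unfolding e_def by (rule closed_sequentially[OF M(2) x(1) xl])
  have "(\<lambda>n. norm (x n)) \<longlonglongrightarrow> norm e" using xl unfolding e_def by (rule tendsto_norm)
  then have e1: "norm e = 1" using x(2) by (simp add: LIMSEQ_const_iff)
  have "R e = w" using R.tendsto[OF xl] w LIMSEQ_unique unfolding e_def by blast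
  then have RRe: "R (R e) = m\<^sup>2 *\<^sub>R e" using m0 by (simp add: e_def)
  show ?thesis
  proof (cases "R e + m *\<^sub>R e = 0")
    case True
    then have "R e = (- m) *\<^sub>R e" by (simp add: eq_neg_iff_add_eq_0)
    then show ?thesis using eM e1 by blast
  next
    case False
    define v where "v = R e + m *\<^sub>R e"
    have vM: "v \<in> M" using eM RM M(1) by (simp add: v_def subspace_add subspace_scale)
    have "R v = m *\<^sub>R v" by (simp add: v_def R.add R.scaleR RRe power2_eq_square algebra_simps)
    then have "R (v /\<^sub>R norm v) = m *\<^sub>R (v /\<^sub>R norm v)" by (simp add: R.scaleR)
    then show ?thesis using unit[OF vM] False unfolding v_def[symmetric] by blast
  qed
qed

definition orthonormal :: "'a::real_inner set \<Rightarrow> bool" where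
  "orthonormal E \<longleftrightarrow> pairwise orthogonal E \<and> (\<forall>e\<in>E. norm e = 1)"

text \<open>A maximal orthonormal set of eigenvectors is total: the orthogonal complement is
  invariant, so if it were nonzero it would contain another eigenvector.\<close>
theorem total_orthonormal_eigenvectors:
  fixes R :: "'a::{real_inner,complete_space,second_countable_topology} \<Rightarrow> 'a"
  assumes lin: "linear R" and cc: "completely_continuous R"
    and sym: "\<And>x y. inner (R x) y = inner x (R y)" and inj: "\<And>x. R x = 0 \<Longrightarrow> x = 0"
    and E0: "orthonormal E0" "\<And>e. e \<in> E0 \<Longrightarrow> \<exists>\<rho>. R e = \<rho> *\<^sub>R e"
  shows "\<exists>E. E0 \<subseteq> E \<and> orthonormal E \<and> (\<forall>e\<in>E. \<exists>\<rho>. R e = \<rho> *\<^sub>R e) \<and>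
    (\<forall>z. (\<forall>e\<in>E. inner z e = 0) \<longrightarrow> z = 0)"
proof -
  define \<A> where "\<A> = {E. E0 \<subseteq> E \<and> orthonormal E \<and> (\<forall>e\<in>E. \<exists>\<rho>. R e = \<rho> *\<^sub>R e)}"
  have "\<exists>E\<in>\<A>. \<forall>X\<in>\<A>. E \<subseteq> X \<longrightarrow> X = E"
  proof (rule subset_Zorn_nonempty)
    show "\<A> \<noteq> {}" using E0 by (auto simp: \<A>_def)
    fix \<C> assume C: "\<C> \<noteq> {}" "subset.chain \<A> \<C>"
    then have CA: "\<C> \<subseteq> \<A>" and ch: "\<And>X Y. X \<in> \<C> \<Longrightarrow> Y \<in> \<C> \<Longrightarrow> X \<subseteq> Y \<or> Y \<subseteq> X"
      by (auto simp: subset_chain_def)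
    have "pairwise orthogonal (\<Union>\<C>)"
    proof (rule pairwiseI)
      fix a b assume "a \<in> \<Union>\<C>" "b \<in> \<Union>\<C>" and ab: "a \<noteq> b"
      then obtain X where "X \<in> \<C>" "a \<in> X" "b \<in> X" by (meson UnionE ch subsetD)
      then show "orthogonal a b" using CA ab by (auto simp: \<A>_def orthonormal_def pairwise_def)
    qed
    moreover have "E0 \<subseteq> \<Union>\<C>" using C(1) CA by (auto simp: \<A>_def)
    moreover have "norm e = 1 \<and> (\<exists>\<rho>. R e = \<rho> *\<^sub>R e)" if "e \<in> \<Union>\<C>" for e
      using that CA by (auto simp: \<A>_def orthonormal_def)
    ultimately show "\<Union>\<C> \<in> \<A>" by (simp add: \<A>_def orthonormal_def)
  qed
  then obtain E where E: "E \<in> \<A>" and max: "\<And>X. X \<in> \<A> \<Longrightarrow> E \<subseteq> X \<Longrightarrow> X = E" by blast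
  define M where "M = {z. \<forall>e\<in>E. inner z e = 0}"
  have "M = {0}"
  proof (rule ccontr)
    assume "M \<noteq> {0}"
    have sub: "subspace M" by (auto simp: M_def subspace_def inner_add_left)
    have "closed M"
    proof -
      have "M = (\<Inter>e\<in>E. {z. inner z e = 0})" by (auto simp: M_def)
      moreover have "closed {z. inner z e = 0}" for e :: 'a
        by (intro closed_Collect_eq continuous_intros)
      ultimately show ?thesis by auto
    qed
    moreover have "R x \<in> M" if "x \<in> M" for x
    proof -
      have "inner (R x) e = 0" if e: "e \<in> E" for e
      proof -
        obtain \<rho> where "R e = \<rho> *\<^sub>R e" using E e by (auto simp: \<A>_def)
        then show ?thesis using \<open>x \<in> M\<close> e by (simp add: sym M_def)
      qed
      then show ?thesis by (simp add: M_def)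
    qed
    ultimately obtain e where e: "e \<in> M" "norm e = 1" "\<exists>\<rho>. R e = \<rho> *\<^sub>R e"
      using eigenvector_exists[OF lin cc sym inj sub _ \<open>M \<noteq> {0}\<close>] by blast
    have orth: "inner x e = 0" "inner e x = 0" if "x \<in> E" for x
      using e(1) that by (auto simp: M_def inner_commute)
    have "insert e E \<in> \<A>"
      using E e orth by (auto simp: \<A>_def orthonormal_def pairwise_insert orthogonal_def)
    then have "e \<in> E" using max by blast
    then have "inner e e = 0" using orth by blast
    then show False using e(2) by simp
  qed
  then show ?thesis using E unfolding \<A>_def M_def by blast
qed

section \<open>Diagonal operators\<close>

locale total_orthonormal =
  fixes E :: "'a::{real_inner,banach} set"
  assumes orthonormal: "orthonormal E"
    and total: "\<And>z. (\<And>e. e \<in> E \<Longrightarrow> inner z e = 0) \<Longrightarrow> z = 0"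
begin

lemma inner_basis: "e \<in> E \<Longrightarrow> e' \<in> E \<Longrightarrow> inner e e' = (if e = e' then 1 else 0)"
  using orthonormal by (auto simp: orthonormal_def pairwise_def orthogonal_def norm_eq_1)

lemma coord_eqI: "(\<And>e. e \<in> E \<Longrightarrow> inner f e = inner g e) \<Longrightarrow> f = g"
  using total[of "f - g"] by (simp add: inner_diff_left)

lemma inner_sum_basis:
  assumes "finite F" "F \<subseteq> E" "e \<in> E"
  shows "inner (\<Sum>e\<in>F. c e *\<^sub>R e) e = (if e \<in> F then c e else 0)"
proof -
  have "inner (\<Sum>e\<in>F. c e *\<^sub>R e) e = (\<Sum>e'\<in>F. if e' = e then c e' else 0)"
    unfolding inner_sum_left using assms by (intro sum.cong) (auto simp: inner_basis)
  then show ?thesis using assms(1) by simp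
qed

lemma norm_sum_basis:
  assumes "finite F" "F \<subseteq> E"
  shows "(norm (\<Sum>e\<in>F. c e *\<^sub>R e))\<^sup>2 = (\<Sum>e\<in>F. (c e)\<^sup>2)"
proof -
  have "(norm (\<Sum>e\<in>F. c e *\<^sub>R e))\<^sup>2 = (\<Sum>e\<in>F. c e * inner (\<Sum>e\<in>F. c e *\<^sub>R e) e)"
    unfolding power2_norm_eq_inner inner_sum_right[of "\<Sum>e\<in>F. c e *\<^sub>R e"] by simp
  also have "\<dots> = (\<Sum>e\<in>F. (c e)\<^sup>2)"
    using inner_sum_basis[OF assms subsetD[OF assms(2)]]
    by (intro sum.cong) (auto simp: power2_eq_square)
  finally show ?thesis .
qed

definition proj :: "'a set \<Rightarrow> 'a \<Rightarrow> 'a" where "proj F f = (\<Sum>e\<in>F. inner f e *\<^sub>R e)"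

lemma norm_proj:
  assumes "finite F" "F \<subseteq> E"
  shows "(norm (proj F f))\<^sup>2 = (\<Sum>e\<in>F. (inner f e)\<^sup>2)"
  unfolding proj_def by (rule norm_sum_basis[OF assms])

lemma pythagoras:
  assumes "finite F" "F \<subseteq> E"
  shows "(norm (f - (\<Sum>e\<in>F. c e *\<^sub>R e)))\<^sup>2 = (norm f)\<^sup>2 - (norm (proj F f))\<^sup>2 + (\<Sum>e\<in>F. (inner f e - c e)\<^sup>2)"
proof -
  have "inner f (\<Sum>e\<in>F. c e *\<^sub>R e) = (\<Sum>e\<in>F. c e * inner f e)" by (simp add: inner_sum_right)
  then have "(norm (f - (\<Sum>e\<in>F. c e *\<^sub>R e)))\<^sup>2
      = (norm f)\<^sup>2 - 2 * (\<Sum>e\<in>F. c e * inner f e) + (norm (\<Sum>e\<in>F. c e *\<^sub>R e))\<^sup>2"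
    by (simp add: power2_norm_eq_inner inner_diff_left inner_diff_right inner_commute)
  then show ?thesis
    unfolding norm_sum_basis[OF assms] norm_proj[OF assms]
    by (simp add: power2_diff sum.distrib sum_subtractf sum_distrib_left algebra_simps)
qed

lemma bessel:
  assumes "finite F" "F \<subseteq> E"
  shows "norm (proj F f) \<le> norm f"
proof -
  have "0 \<le> (norm (f - (\<Sum>e\<in>F. inner f e *\<^sub>R e)))\<^sup>2" by simp
  then have "(norm (proj F f))\<^sup>2 \<le> (norm f)\<^sup>2" unfolding pythagoras[OF assms] by simp
  then show ?thesis by (rule power2_le_imp_le) simp
qed

lemma closure_span_basis: "closure (span E) = UNIV"
  by (rule closure_span_eq_UNIV) (use total in blast)

lemma proj_approx:
  assumes "\<epsilon> > 0"
  shows "\<exists>F. finite F \<and> F \<subseteq> E \<and> norm (f - proj F f) < \<epsilon>"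
proof -
  have "f \<in> closure (span E)" using closure_span_basis by simp
  then obtain y where y: "y \<in> span E" "dist y f < \<epsilon>"
    unfolding closure_approachable using assms by blast
  then obtain F c where F: "finite F" "F \<subseteq> E" "y = (\<Sum>e\<in>F. c e *\<^sub>R e)"
    unfolding span_explicit by blast
  have "(norm (f - proj F f))\<^sup>2 \<le> (norm (f - y))\<^sup>2"
    unfolding F(3) pythagoras[OF F(1,2)] unfolding proj_def pythagoras[OF F(1,2)]
    by (simp add: sum_nonneg)
  then have "norm (f - proj F f) \<le> norm (f - y)" by (rule power2_le_imp_le) simp
  then show ?thesis using F y(2) by (auto simp: dist_norm norm_minus_commute)
qed

lemma norm_le_coord:
  assumes le: "\<And>e. e \<in> E \<Longrightarrow> \<bar>inner g e\<bar> \<le> C * \<bar>inner f e\<bar>" and "C \<ge> 0"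
  shows "norm g \<le> C * norm f"
proof (rule field_le_epsilon)
  fix \<epsilon> :: real assume "\<epsilon> > 0"
  then obtain F where F: "finite F" "F \<subseteq> E" "norm (g - proj F g) < \<epsilon>" using proj_approx by blast
  have "(norm (proj F g))\<^sup>2 \<le> (\<Sum>e\<in>F. (C * inner f e)\<^sup>2)"
    unfolding norm_proj[OF F(1,2)]
  proof (rule sum_mono)
    fix e assume "e \<in> F"
    then have "\<bar>inner g e\<bar> \<le> \<bar>C * inner f e\<bar>" using le F(2) assms(2) by (auto simp: abs_mult)
    then show "(inner g e)\<^sup>2 \<le> (C * inner f e)\<^sup>2" by (simp add: abs_le_square_iff)
  qed
  also have "\<dots> = (C * norm (proj F f))\<^sup>2"
    by (simp add: power_mult_distrib norm_proj[OF F(1,2)] sum_distrib_left)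
  finally have "norm (proj F g) \<le> C * norm (proj F f)"
    by (rule power2_le_imp_le) (simp add: assms(2))
  also have "\<dots> \<le> C * norm f" using bessel[OF F(1,2)] assms(2) by (intro mult_left_mono)
  finally show "norm g \<le> C * norm f + \<epsilon>"
    using F(3) norm_triangle_ineq[of "proj F g" "g - proj F g"] by simp
qed

definition bounded_mult :: "('a \<Rightarrow> real) \<Rightarrow> bool" where
  "bounded_mult m \<longleftrightarrow> (\<exists>C. \<forall>e\<in>E. \<bar>m e\<bar> \<le> C)"

text \<open>The operator acting as multiplication by \<open>m\<close> on the coordinates. Specifying it by its
  coordinates makes the algebraic rules immediate.\<close>
definition Mult :: "('a \<Rightarrow> real) \<Rightarrow> 'a \<Rightarrow> 'a" where
  "Mult m f = (THE g. \<forall>e\<in>E. inner g e = m e * inner f e)"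

lemma Mult_eqI: "(\<And>e. e \<in> E \<Longrightarrow> inner g e = m e * inner f e) \<Longrightarrow> Mult m f = g"
  unfolding Mult_def by (rule the_equality) (auto intro: coord_eqI)

lemma bounded_multI: "(\<And>e. e \<in> E \<Longrightarrow> \<bar>m e\<bar> \<le> C) \<Longrightarrow> bounded_mult m"
  unfolding bounded_mult_def by blast

lemma inner_Mult:
  assumes m: "bounded_mult m" and e: "e \<in> E"
  shows "inner (Mult m f) e = m e * inner f e"
proof -
  obtain C where C: "\<And>e. e \<in> E \<Longrightarrow> \<bar>m e\<bar> \<le> C" using m by (auto simp: bounded_mult_def)
  have C0: "C \<ge> 0" using C[OF e] by linarith
  have "\<exists>F. finite F \<and> F \<subseteq> E \<and> norm (f - proj F f) < 1 / real (Suc n)" for n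
    by (rule proj_approx) simp
  then obtain F where F: "\<And>n. finite (F n)" "\<And>n. F n \<subseteq> E"
    "\<And>n. norm (f - proj (F n) f) < 1 / real (Suc n)" by metis
  have lim: "(\<lambda>n. proj (F n) f) \<longlonglongrightarrow> f"
  proof (rule metric_tendsto_imp_tendsto)
    show "(\<lambda>n. 1 / real (Suc n)) \<longlonglongrightarrow> 0"
      using LIMSEQ_inverse_real_of_nat by (simp add: inverse_eq_divide)
    show "\<forall>\<^sub>F n in sequentially. dist (proj (F n) f) f \<le> dist (1 / real (Suc n)) 0"
      using F(3) by (intro always_eventually) (auto simp: dist_norm norm_minus_commute intro: less_imp_le)
  qed
  define g where "g n = (\<Sum>e\<in>F n. (m e * inner f e) *\<^sub>R e)" for n
  have g: "inner (g n) e = m e * inner (proj (F n) f) e" if "e \<in> E" for n e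
    unfolding g_def proj_def using F(1,2) that by (simp add: inner_sum_basis)
  have gd: "dist (g n) (g k) \<le> C * dist (proj (F n) f) (proj (F k) f)" for n k
    unfolding dist_norm
  proof (rule norm_le_coord[OF _ C0])
    fix e assume "e \<in> E"
    then show "\<bar>inner (g n - g k) e\<bar> \<le> C * \<bar>inner (proj (F n) f - proj (F k) f) e\<bar>"
      using C by (simp add: g inner_diff_left abs_mult mult_right_mono flip: right_diff_distrib)
  qed
  have "Cauchy g"
  proof (rule metric_CauchyI)
    fix \<epsilon> :: real assume "0 < \<epsilon>"
    then have "\<epsilon> / (C + 1) > 0" using C0 by simp
    then obtain N where N: "\<And>m n. m \<ge> N \<Longrightarrow> n \<ge> N \<Longrightarrow>
        dist (proj (F m) f) (proj (F n) f) < \<epsilon> / (C + 1)"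
      using metric_CauchyD[OF LIMSEQ_imp_Cauchy[OF lim]] by blast
    have "dist (g m) (g n) < \<epsilon>" if "m \<ge> N" "n \<ge> N" for m n
    proof -
      have "C * dist (proj (F m) f) (proj (F n) f) \<le> C * (\<epsilon> / (C + 1))"
        using N[OF that] C0 by (intro mult_left_mono) auto
      also have "\<dots> < \<epsilon>" using C0 \<open>0 < \<epsilon>\<close> by (simp add: field_simps)
      finally show ?thesis using gd[of m n] by linarith
    qed
    then show "\<exists>N. \<forall>m\<ge>N. \<forall>n\<ge>N. dist (g m) (g n) < \<epsilon>" by blast
  qed
  then obtain h where h: "g \<longlonglongrightarrow> h" using Cauchy_convergent convergent_def by blast
  have he: "inner h e = m e * inner f e" if "e \<in> E" for e
  proof (rule LIMSEQ_unique)
    show "(\<lambda>n. inner (g n) e) \<longlonglongrightarrow> inner h e" by (intro tendsto_intros h)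
    show "(\<lambda>n. inner (g n) e) \<longlonglongrightarrow> m e * inner f e"
      unfolding g[OF that] by (intro tendsto_intros lim)
  qed
  then have "Mult m f = h" by (intro Mult_eqI)
  then show ?thesis using he e by simp
qed

lemma norm_Mult_le:
  assumes "\<And>e. e \<in> E \<Longrightarrow> \<bar>m e\<bar> \<le> C" "C \<ge> 0"
  shows "norm (Mult m f) \<le> C * norm f"
proof (rule norm_le_coord[OF _ assms(2)])
  fix e assume "e \<in> E"
  then show "\<bar>inner (Mult m f) e\<bar> \<le> C * \<bar>inner f e\<bar>"
    using inner_Mult[OF bounded_multI[OF assms(1)]] assms(1) by (simp add: abs_mult mult_right_mono)
qed

lemma bounded_linear_Mult:
  assumes "bounded_mult m"
  shows "bounded_linear (Mult m)"
proof -
  obtain C where C: "\<And>e. e \<in> E \<Longrightarrow> \<bar>m e\<bar> \<le> C" using assms by (auto simp: bounded_mult_def)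
  have C': "\<bar>m e\<bar> \<le> \<bar>C\<bar>" if "e \<in> E" for e using C[OF that] by linarith
  show ?thesis
  proof (rule bounded_linear_intro[where K = "\<bar>C\<bar>"])
    show "Mult m (f + g) = Mult m f + Mult m g" for f g
      by (rule Mult_eqI) (simp add: inner_Mult[OF assms] inner_add_left distrib_left)
    show "Mult m (r *\<^sub>R f) = r *\<^sub>R Mult m f" for r f
      by (rule Mult_eqI) (simp add: inner_Mult[OF assms])
    show "norm (Mult m f) \<le> norm f * \<bar>C\<bar>" for f
      using norm_Mult_le[of m "\<bar>C\<bar>" f] C' by (simp add: mult.commute)
  qed
qed

lemma bounded_mult_add: "bounded_mult m \<Longrightarrow> bounded_mult m' \<Longrightarrow> bounded_mult (\<lambda>e. m e + m' e)"
  unfolding bounded_mult_def by (metis abs_triangle_ineq add_mono order_trans)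

lemma bounded_mult_scale: "bounded_mult m \<Longrightarrow> bounded_mult (\<lambda>e. c * m e)"
  unfolding bounded_mult_def by (metis abs_ge_zero abs_mult mult_left_mono)

lemma Mult_add:
  "bounded_mult m \<Longrightarrow> bounded_mult m' \<Longrightarrow> Mult (\<lambda>e. m e + m' e) f = Mult m f + Mult m' f"
  by (rule Mult_eqI) (simp add: inner_Mult inner_add_left distrib_right)

lemma Mult_scale: "bounded_mult m \<Longrightarrow> Mult (\<lambda>e. c * m e) f = c *\<^sub>R Mult m f"
  by (rule Mult_eqI) (simp add: inner_Mult)

lemma Mult_basis: "bounded_mult m \<Longrightarrow> e \<in> E \<Longrightarrow> Mult m e = m e *\<^sub>R e"
  by (rule Mult_eqI) (simp add: inner_basis)

lemma Mult_symmetric: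
  assumes "bounded_mult m"
  shows "inner (Mult m f) g = inner f (Mult m g)"
proof -
  interpret M: bounded_linear "Mult m" by (rule bounded_linear_Mult[OF assms])
  have "{g. inner (Mult m f) g = inner f (Mult m g)} = UNIV" (is "?S = _")
  proof -
    have "subspace ?S" by (auto simp: subspace_def M.add M.scaleR M.zero inner_add_right)
    moreover have "E \<subseteq> ?S" using assms by (auto simp: inner_Mult Mult_basis)
    ultimately have "span E \<subseteq> ?S" by (simp add: span_minimal)
    moreover have "closed ?S"
      by (intro closed_Collect_eq continuous_intros M.continuous_on)
    ultimately show ?thesis using closure_span_basis closure_minimal by blast
  qed
  then show ?thesis by blast
qed

text \<open>Bounded pointwise convergence of multipliers is strong convergence of the operators:
  uniformly bounded operators need to converge only on a total set.\<close>
lemma Mult_tendsto: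
  assumes bdd: "\<forall>\<^sub>F n in F. \<forall>e\<in>E. \<bar>m n e\<bar> \<le> C" and bdd': "\<And>e. e \<in> E \<Longrightarrow> \<bar>\<mu> e\<bar> \<le> C"
    and C0: "C \<ge> 0" and lim: "\<And>e. e \<in> E \<Longrightarrow> ((\<lambda>n. m n e) \<longlongrightarrow> \<mu> e) F"
  shows "((\<lambda>n. Mult (m n) f) \<longlongrightarrow> Mult \<mu> f) F"
proof (rule tendstoI)
  fix \<epsilon> :: real assume \<epsilon>: "0 < \<epsilon>"
  define \<delta> where "\<delta> = \<epsilon> / (4 * (C + 1))"
  have \<delta>: "\<delta> > 0" "C * \<delta> < \<epsilon> / 4" using \<epsilon> C0 by (auto simp: \<delta>_def field_simps)
  obtain G where G: "finite G" "G \<subseteq> E" "norm (f - proj G f) < \<delta>" using proj_approx \<delta>(1) by blast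
  have \<mu>: "bounded_mult \<mu>" by (rule bounded_multI[OF bdd'])
  have MP: "Mult \<nu> (proj G f) = (\<Sum>e\<in>G. (\<nu> e * inner f e) *\<^sub>R e)" if "bounded_mult \<nu>" for \<nu>
  proof -
    interpret M: bounded_linear "Mult \<nu>" by (rule bounded_linear_Mult[OF that])
    have "e \<in> G \<Longrightarrow> Mult \<nu> e = \<nu> e *\<^sub>R e" for e using G(2) Mult_basis[OF that] by blast
    then show ?thesis unfolding proj_def M.sum by (intro sum.cong) (auto simp: M.scaleR mult.commute)
  qed
  have "((\<lambda>n. \<Sum>e\<in>G. (m n e * inner f e) *\<^sub>R e) \<longlongrightarrow> (\<Sum>e\<in>G. (\<mu> e * inner f e) *\<^sub>R e)) F"
    using G(2) lim by (intro tendsto_intros) auto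
  then have "\<forall>\<^sub>F n in F. dist (\<Sum>e\<in>G. (m n e * inner f e) *\<^sub>R e) (\<Sum>e\<in>G. (\<mu> e * inner f e) *\<^sub>R e) < \<epsilon> / 2"
    using \<epsilon> by (intro tendstoD) auto
  with bdd show "\<forall>\<^sub>F n in F. dist (Mult (m n) f) (Mult \<mu> f) < \<epsilon>"
  proof eventually_elim
    fix n assume b: "\<forall>e\<in>E. \<bar>m n e\<bar> \<le> C"
      and d: "dist (\<Sum>e\<in>G. (m n e * inner f e) *\<^sub>R e) (\<Sum>e\<in>G. (\<mu> e * inner f e) *\<^sub>R e) < \<epsilon> / 2"
    have mn: "bounded_mult (m n)" using b by (intro bounded_multI) blast
    have small: "dist (Mult \<nu> f) (Mult \<nu> (proj G f)) < \<epsilon> / 4"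
      if "\<And>e. e \<in> E \<Longrightarrow> \<bar>\<nu> e\<bar> \<le> C" for \<nu>
    proof -
      interpret M: bounded_linear "Mult \<nu>" by (rule bounded_linear_Mult[OF bounded_multI[OF that]])
      have "norm (Mult \<nu> (f - proj G f)) \<le> C * norm (f - proj G f)" by (rule norm_Mult_le[OF that C0])
      also have "\<dots> \<le> C * \<delta>" using G(3) C0 by (intro mult_left_mono) auto
      finally show ?thesis using \<delta>(2) by (simp add: dist_norm M.diff)
    qed
    have "dist (Mult (m n) (proj G f)) (Mult \<mu> (proj G f)) < \<epsilon> / 2"
      using d by (simp add: MP mn \<mu>)
    moreover have "dist (Mult (m n) f) (Mult (m n) (proj G f)) < \<epsilon> / 4" using b by (intro small) blast
    moreover have "dist (Mult \<mu> (proj G f)) (Mult \<mu> f) < \<epsilon> / 4"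
      using small[OF bdd'] by (simp add: dist_commute)
    ultimately show "dist (Mult (m n) f) (Mult \<mu> f) < \<epsilon>"
      using dist_triangle[of "Mult (m n) f" "Mult \<mu> f" "Mult (m n) (proj G f)"]
        dist_triangle[of "Mult (m n) (proj G f)" "Mult \<mu> f" "Mult \<mu> (proj G f)"] by linarith
  qed
qed

end

section \<open>The semigroup of a nonnegative diagonal operator\<close>

text \<open>The gliding hump argument: each step of size \<open>3\<^sup>-\<^sup>n\<close> can be directed so that \<open>U (n)\<close>
  stays large, and later steps are too small to undo this.\<close>
lemma uniform_boundedness:
  fixes U :: "nat \<Rightarrow> 'a::banach \<Rightarrow> 'b::real_normed_vector"
  assumes bl: "\<And>n. bounded_linear (U n)" and pb: "\<And>x. bounded (range (\<lambda>n. U n x))"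
  shows "\<exists>M. \<forall>n x. norm (U n x) \<le> M * norm x"
proof (rule ccontr)
  assume neg: "\<not> ?thesis"
  have "\<exists>k x. norm x = 1 \<and> norm (U k x) \<ge> 3/4 * onorm (U k) \<and> onorm (U k) > 4 ^ n" for n :: nat
  proof -
    obtain k x where "norm (U k x) > 4 ^ n * norm x" using neg by (meson not_le)
    moreover have "norm (U k x) \<le> onorm (U k) * norm x" by (rule onorm[OF bl])
    ultimately have "4 ^ n * norm x < onorm (U k) * norm x" by linarith
    then have k: "onorm (U k) > 4 ^ n" by (simp add: mult_less_cancel_right)
    interpret U: bounded_linear "U k" by (rule bl)
    have "(0::real) < 4 ^ n" by simp
    then have pos: "onorm (U k) > 0" using k by linarith
    have "\<exists>z. norm (U k z) > 3/4 * onorm (U k) * norm z"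
    proof (rule ccontr)
      assume "\<not> ?thesis"
      then have "onorm (U k) \<le> 3/4 * onorm (U k)"
        using pos by (intro onorm_bound) (auto simp: not_less)
      then show False using pos by simp
    qed
    then obtain z where z: "norm (U k z) > 3/4 * onorm (U k) * norm z" by blast
    have "z \<noteq> 0" using z by (auto simp: U.zero)
    then have "norm (z /\<^sub>R norm z) = 1" "norm (U k (z /\<^sub>R norm z)) \<ge> 3/4 * onorm (U k)"
      using z by (auto simp: U.scaleR field_simps)
    then show ?thesis using k by blast
  qed
  then obtain k v where v: "\<And>n. norm (v n) = 1" "\<And>n. norm (U (k n) (v n)) \<ge> 3/4 * onorm (U (k n))"
    "\<And>n::nat. onorm (U (k n)) > 4 ^ n" by metis
  define c :: "nat \<Rightarrow> real" where "c n = (1/3) ^ n" for n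
  define step where "step n x = (if norm (U (k n) (x + c n *\<^sub>R v n)) \<ge> c n * norm (U (k n) (v n))
      then x + c n *\<^sub>R v n else x - c n *\<^sub>R v n)" for n x
  have step_big: "norm (U (k n) (step n x)) \<ge> c n * norm (U (k n) (v n))" for n x
  proof -
    interpret U: bounded_linear "U (k n)" by (rule bl)
    have c0: "c n \<ge> 0" by (simp add: c_def)
    have "2 * (c n * norm (U (k n) (v n))) = norm (U (k n) (x + c n *\<^sub>R v n) - U (k n) (x - c n *\<^sub>R v n))"
      using c0 by (simp add: U.add U.diff U.scaleR flip: scaleR_2)
    also have "\<dots> \<le> norm (U (k n) (x + c n *\<^sub>R v n)) + norm (U (k n) (x - c n *\<^sub>R v n))"
      by (rule norm_triangle_ineq4)
    finally show ?thesis by (auto simp: step_def)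
  qed
  have step_dist: "norm (step n x - x) = c n" for n x
    using v(1)[of n] by (auto simp: step_def c_def)
  define x where "x = rec_nat 0 (\<lambda>n y. step n y)"
  have xS: "x (Suc n) = step n (x n)" for n by (simp add: x_def)
  have dn: "norm (x (Suc n) - x n) = c n" for n by (simp add: xS step_dist)
  have tail: "norm (x (n + j) - x (Suc n)) \<le> c n / 2" if "j \<ge> 1" for n j
  proof -
    have "norm (x (n + Suc i) - x (Suc n)) \<le> c n / 2 - c (n + i) / 2" for i
    proof (induction i)
      case (Suc i)
      have "norm (x (n + Suc (Suc i)) - x (Suc n))
          \<le> norm (x (Suc (n + Suc i)) - x (n + Suc i)) + norm (x (n + Suc i) - x (Suc n))"
        using norm_triangle_ineq[of "x (Suc (n + Suc i)) - x (n + Suc i)" "x (n + Suc i) - x (Suc n)"]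
        by simp
      also have "\<dots> \<le> c (n + Suc i) + (c n / 2 - c (n + i) / 2)" using Suc dn[of "n + Suc i"] by simp
      also have "\<dots> = c n / 2 - c (n + Suc i) / 2" by (simp add: c_def)
      finally show ?case .
    qed simp
    from this[of "j - 1"] that show ?thesis
      using zero_le_power[of "1/3::real" "n + (j - 1)"] unfolding c_def by (simp del: zero_le_power)
  qed
  have "Cauchy x"
  proof (rule metric_CauchyI)
    fix \<epsilon> :: real assume "0 < \<epsilon>"
    then obtain N where N: "c N < \<epsilon>"
      using real_arch_pow_inv[of \<epsilon> "1/3"] by (auto simp: c_def)
    have "dist (x m) (x n) < \<epsilon>" if "m \<ge> Suc N" "n \<ge> Suc N" for m n
    proof -
      have "norm (x m - x (Suc N)) \<le> c N / 2" "norm (x n - x (Suc N)) \<le> c N / 2"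
        using tail[of "m - N" N] tail[of "n - N" N] that by auto
      then show ?thesis
        using norm_triangle_ineq4[of "x m - x (Suc N)" "x n - x (Suc N)"] N by (simp add: dist_norm)
    qed
    then show "\<exists>M. \<forall>m\<ge>M. \<forall>n\<ge>M. dist (x m) (x n) < \<epsilon>" by blast
  qed
  then obtain y where y: "x \<longlonglongrightarrow> y" using Cauchy_convergent convergent_def by blast
  have near: "norm (y - x (Suc n)) \<le> c n / 2" for n
  proof (rule LIMSEQ_le_const2)
    show "(\<lambda>j. norm (x (j + n) - x (Suc n))) \<longlonglongrightarrow> norm (y - x (Suc n))"
      by (intro tendsto_intros LIMSEQ_ignore_initial_segment y)
    show "\<exists>N. \<forall>j\<ge>N. norm (x (j + n) - x (Suc n)) \<le> c n / 2"
      using tail[of _ n] by (intro exI[of _ 1]) (simp add: add.commute)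
  qed
  obtain M where M: "\<And>n. norm (U n y) \<le> M" using pb[of y] by (auto simp: bounded_iff)
  have "(4/3) ^ n / 4 \<le> M" for n :: nat
  proof -
    interpret U: bounded_linear "U (k n)" by (rule bl)
    have c0: "c n > 0" by (simp add: c_def)
    have "norm (U (k n) (y - x (Suc n))) \<le> onorm (U (k n)) * norm (y - x (Suc n))"
      by (rule onorm[OF bl])
    also have "\<dots> \<le> onorm (U (k n)) * (c n / 2)"
      using near by (intro mult_left_mono onorm_pos_le bl)
    finally have "norm (U (k n) (y - x (Suc n))) \<le> c n * onorm (U (k n)) / 2" by (simp add: mult.commute)
    moreover have "norm (U (k n) (x (Suc n))) \<ge> c n * (3/4 * onorm (U (k n)))"
      unfolding xS using step_big[of n "x n"] mult_left_mono[OF v(2)[of n] less_imp_le[OF c0]] by linarith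
    moreover have "norm (U (k n) (x (Suc n))) \<le> norm (U (k n) y) + norm (U (k n) (y - x (Suc n)))"
      using norm_triangle_ineq4[of "U (k n) y" "U (k n) (y - x (Suc n))"] by (simp add: U.diff)
    ultimately have "c n * onorm (U (k n)) / 4 \<le> M" using M[of "k n"] by (simp add: algebra_simps)
    moreover have "c n * 4 ^ n \<le> c n * onorm (U (k n))"
      using v(3)[of n] c0 by (intro mult_left_mono) auto
    moreover have "c n * 4 ^ n = (4/3) ^ n" by (simp add: c_def power_divide)
    ultimately show ?thesis by simp
  qed
  moreover obtain n :: nat where "4 * M < (4/3) ^ n" using real_arch_pow[of "4/3" "4 * M"] by auto
  ultimately have "(4/3) ^ n / 4 \<le> M" "4 * M < (4/3) ^ n" by blast+
  then show False by linarith
qed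

text \<open>Otherwise there are times \<open>t n\<close> tending to \<open>0\<close> with \<open>S (t n)\<close> of unbounded norm, although these
  operators converge pointwise.\<close>
lemma C0_semigroup_locally_bounded:
  fixes S :: "real \<Rightarrow> 'a::banach \<Rightarrow> 'a"
  assumes S: "C0_semigroup S"
  shows "\<exists>\<delta>>0. \<exists>M\<ge>0. \<forall>t\<in>{0..\<delta>}. \<forall>f. norm (S t f) \<le> M * norm f"
proof (rule ccontr)
  assume neg: "\<not> ?thesis"
  have "\<exists>t\<in>{0..1 / real (Suc n)}. \<exists>f. norm (S t f) > real n * norm f" for n
    using neg by (meson not_le of_nat_0_le_iff of_nat_0_less_iff zero_less_Suc zero_less_divide_1_iff)
  then obtain t f where t: "\<And>n. t n \<in> {0..1 / real (Suc n)}" "\<And>n. norm (S (t n) (f n)) > real n * norm (f n)"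
    by metis
  have bl: "bounded_linear (S (t n))" for n using S t(1)[of n] by (auto simp: C0_semigroup_def)
  have S0: "S 0 g = g" for g using S by (simp add: C0_semigroup_def)
  have t0: "t \<longlonglongrightarrow> 0"
  proof (rule tendsto_sandwich[of "\<lambda>_. 0" _ _ "\<lambda>n. 1 / real (Suc n)"])
    show "(\<lambda>n. 1 / real (Suc n)) \<longlonglongrightarrow> 0"
      using LIMSEQ_inverse_real_of_nat by (simp add: inverse_eq_divide)
  qed (use t(1) in auto)
  have "bounded (range (\<lambda>n. S (t n) g))" for g
  proof -
    have "((\<lambda>h. S h g) \<longlongrightarrow> g) (at_right 0)" using S by (simp add: C0_semigroup_def)
    moreover have "at 0 within {0..} = at_right (0::real)"
      unfolding at_within_def by (rule arg_cong[where f = "\<lambda>A. inf (nhds 0) (principal A)"]) auto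
    ultimately have "continuous (at 0 within {0..}) (\<lambda>h. S h g)"
      by (simp only: continuous_within S0)
    then have "(\<lambda>n. S (t n) g) \<longlonglongrightarrow> S 0 g"
      using t(1) t0 by (intro continuous_within_tendsto_compose[where f = "\<lambda>h. S h g"]) auto
    then show ?thesis by (rule convergent_imp_bounded)
  qed
  from uniform_boundedness[OF bl this] obtain M where M: "\<And>n g. norm (S (t n) g) \<le> M * norm g" by blast
  obtain n :: nat where n: "M < real n" using reals_Archimedean2 by blast
  then have "M * norm (f n) \<le> real n * norm (f n)" by (intro mult_right_mono) auto
  then show False using M[of n "f n"] t(2)[of n] by linarith
qed

lemma C0_semigroup_power:
  assumes "C0_semigroup S" "h \<ge> 0" "S h e = r *\<^sub>R e"
  shows "S (real n * h) e = r ^ n *\<^sub>R e"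
proof (induction n)
  case 0
  then show ?case using assms(1) by (simp add: C0_semigroup_def)
next
  case (Suc n)
  have nh: "real n * h \<ge> 0" using assms(2) by simp
  interpret S: bounded_linear "S (real n * h)" using assms(1) nh by (auto simp: C0_semigroup_def)
  have "real (Suc n) * h = real n * h + h" by (simp add: distrib_right)
  moreover have "S (real n * h + h) e = S (real n * h) (S h e)"
    using assms(1,2) nh unfolding C0_semigroup_def by blast
  ultimately have "S (real (Suc n) * h) e = r *\<^sub>R S (real n * h) e"
    by (simp only: assms(3) S.scaleR)
  then show ?case using Suc by simp
qed

text \<open>The error of \<open>S t e\<close> against \<open>exp (\<mu> t) e\<close> is a telescoping sum of \<open>n\<close> errors over time
  \<open>t / n\<close>, each of which is \<open>o(1 / n)\<close> because \<open>e\<close> is an eigenvector of the generator.\<close>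
lemma C0_semigroup_eigenvector:
  fixes S :: "real \<Rightarrow> 'a::banach \<Rightarrow> 'a"
  assumes S: "C0_semigroup S" and d: "((\<lambda>h. (S h e - e) /\<^sub>R h) \<longlongrightarrow> \<mu> *\<^sub>R e) (at_right 0)" and "t \<ge> 0"
  shows "S t e = exp (\<mu> * t) *\<^sub>R e"
proof -
  obtain \<delta> M where \<delta>: "\<delta> > 0" and M: "M \<ge> 0" "\<And>t f. t \<in> {0..\<delta>} \<Longrightarrow> norm (S t f) \<le> M * norm f"
    using C0_semigroup_locally_bounded[OF S] by blast
  have add: "S (s + t) f = S s (S t f)" if "s \<ge> 0" "t \<ge> 0" for s t f
    using S that by (simp add: C0_semigroup_def)
  have bl: "bounded_linear (S t)" if "t \<ge> 0" for t using S that by (simp add: C0_semigroup_def)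
  have S0: "S 0 f = f" for f using S by (simp add: C0_semigroup_def)
  have short: "S t e = exp (\<mu> * t) *\<^sub>R e" if t: "0 < t" "t \<le> \<delta>" for t
  proof -
    define V where "V s f = exp (- \<mu> * s) *\<^sub>R S s f" for s f
    define K where "K = exp (\<bar>\<mu>\<bar> * t) * M"
    have K: "norm (V s f) \<le> K * norm f" if "0 \<le> s" "s \<le> t" for s f
    proof -
      have "- \<mu> * s \<le> \<bar>\<mu>\<bar> * t"
        using that mult_right_mono[of "- \<mu>" "\<bar>\<mu>\<bar>" s] mult_left_mono[of s t "\<bar>\<mu>\<bar>"] by linarith
      then have "exp (- \<mu> * s) * norm (S s f) \<le> exp (\<bar>\<mu>\<bar> * t) * (M * norm f)"
        using that t M(2)[of s f] by (intro mult_mono) auto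
      then show ?thesis by (simp add: V_def K_def)
    qed
    have dV: "((\<lambda>h. (V h e - e) /\<^sub>R h) \<longlongrightarrow> 0) (at_right 0)"
    proof -
      have ex: "((\<lambda>h. (exp (- \<mu> * h) - 1) / h) \<longlongrightarrow> - \<mu>) (at_right 0)"
      proof -
        have "((\<lambda>h. exp (- \<mu> * h)) has_real_derivative - \<mu>) (at 0)"
          by (auto intro!: derivative_eq_intros)
        then show ?thesis unfolding DERIV_def by (auto intro: filterlim_mono at_le)
      qed
      have e1: "((\<lambda>h. exp (- \<mu> * h)) \<longlongrightarrow> 1) (at_right 0)"
        by (auto intro!: tendsto_eq_intros)
      have "((\<lambda>h. exp (- \<mu> * h) *\<^sub>R ((S h e - e) /\<^sub>R h) + ((exp (- \<mu> * h) - 1) / h) *\<^sub>R e)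
          \<longlongrightarrow> 1 *\<^sub>R (\<mu> *\<^sub>R e) + (- \<mu>) *\<^sub>R e) (at_right 0)"
        by (intro tendsto_intros ex e1 d)
      moreover have "(V h e - e) /\<^sub>R h = exp (- \<mu> * h) *\<^sub>R ((S h e - e) /\<^sub>R h) + ((exp (- \<mu> * h) - 1) / h) *\<^sub>R e" for h
        by (simp add: V_def scaleR_diff_right scaleR_diff_left divide_inverse algebra_simps)
      ultimately show ?thesis by simp
    qed
    have tele: "norm (V (real n * h) e - e) \<le> real n * (K * norm (V h e - e))"
      if h: "h \<ge> 0" and "real n * h \<le> t" for n h
      using that(2)
    proof (induction n)
      case 0
      then show ?case by (simp add: V_def S0)
    next
      case (Suc n)
      have nh: "real n * h \<ge> 0" "real n * h \<le> t" using h Suc.prems by (auto simp: distrib_right)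
      interpret S: bounded_linear "S (real n * h)" using bl nh by blast
      have "real (Suc n) * h = real n * h + h" by (simp add: distrib_right)
      moreover have "exp (- \<mu> * (real n * h + h)) = exp (- \<mu> * (real n * h)) * exp (- \<mu> * h)"
        by (simp add: distrib_left flip: exp_add)
      ultimately have "V (real (Suc n) * h) e = V (real n * h) (V h e)"
        using add[OF nh(1) h] by (simp add: V_def S.scaleR)
      then have "V (real (Suc n) * h) e - e = V (real n * h) (V h e - e) + (V (real n * h) e - e)"
        by (simp add: V_def S.diff scaleR_diff_right)
      then have "norm (V (real (Suc n) * h) e - e)
          \<le> norm (V (real n * h) (V h e - e)) + norm (V (real n * h) e - e)"
        by (metis norm_triangle_ineq)
      also have "\<dots> \<le> K * norm (V h e - e) + real n * (K * norm (V h e - e))"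
        using K[OF nh] Suc.IH[OF nh(2)] by (intro add_mono)
      finally show ?case by (simp add: distrib_right)
    qed
    have "norm (V t e - e) \<le> 0"
    proof (rule LIMSEQ_le_const)
      have "(\<lambda>n. t / real (Suc n)) \<longlonglongrightarrow> 0"
        using tendsto_mult[OF tendsto_const[of t] LIMSEQ_inverse_real_of_nat] by (simp add: divide_inverse)
      then have "filterlim (\<lambda>n. t / real (Suc n)) (at_right 0) sequentially"
        using t(1) by (intro filterlim_at_withinI) auto
      from filterlim_compose[OF tendsto_norm_zero[OF dV] this]
      have "(\<lambda>n. norm ((V (t / real (Suc n)) e - e) /\<^sub>R (t / real (Suc n)))) \<longlonglongrightarrow> 0" .
      from tendsto_mult[OF tendsto_const[of "t * K"] this]
      show "(\<lambda>n. t * K * norm ((V (t / real (Suc n)) e - e) /\<^sub>R (t / real (Suc n)))) \<longlonglongrightarrow> 0" by simp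
      have "norm (V t e - e) \<le> t * K * norm ((V (t / real (Suc n)) e - e) /\<^sub>R (t / real (Suc n)))" for n
      proof -
        have "real (Suc n) * (t / real (Suc n)) = t" by simp
        then have "norm (V t e - e) \<le> real (Suc n) * (K * norm (V (t / real (Suc n)) e - e))"
          using tele[of "t / real (Suc n)" "Suc n"] t(1) by simp
        also have "\<dots> = t * K * norm ((V (t / real (Suc n)) e - e) /\<^sub>R (t / real (Suc n)))"
          using t(1) by (simp add: divide_inverse del: of_nat_Suc)
        finally show ?thesis .
      qed
      then show "\<exists>N. \<forall>n\<ge>N. norm (V t e - e)
          \<le> t * K * norm ((V (t / real (Suc n)) e - e) /\<^sub>R (t / real (Suc n)))" by blast
    qed
    then have "V t e = e" by simp
    then have "exp (\<mu> * t) *\<^sub>R V t e = exp (\<mu> * t) *\<^sub>R e" by simp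
    then show ?thesis by (simp add: V_def flip: exp_add)
  qed
  show ?thesis
  proof (cases "t = 0")
    case False
    obtain n :: nat where n: "t / \<delta> < real n" using reals_Archimedean2 by blast
    have tp: "t > 0" using False \<open>t \<ge> 0\<close> by simp
    then have n0: "n > 0" using n \<delta> by (cases n) (auto simp: field_simps)
    have h: "0 < t / real n" "t / real n \<le> \<delta>" using tp n0 n \<delta> by (auto simp: field_simps)
    have "S (real n * (t / real n)) e = exp (\<mu> * (t / real n)) ^ n *\<^sub>R e"
      using h by (intro C0_semigroup_power[OF S _ short]) auto
    then show ?thesis using n0 by (simp flip: exp_of_nat_mult)
  qed (simp add: S0)
qed

locale diagonal_operator = total_orthonormal +
  fixes ev :: "'a \<Rightarrow> real" and D :: "'a set" and A :: "'a \<Rightarrow> 'a"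
  assumes nonneg: "\<And>e. e \<in> E \<Longrightarrow> ev e \<ge> 0"
    and diagonal: "\<And>f g. f \<in> D \<and> A f = g \<longleftrightarrow> (\<forall>e\<in>E. inner g e = ev e * inner f e)"
begin

definition heat :: "real \<Rightarrow> 'a \<Rightarrow> 'a" where "heat t = Mult (\<lambda>e. exp (- ev e * t))"

lemma exp_le_1: "e \<in> E \<Longrightarrow> t \<ge> 0 \<Longrightarrow> \<bar>exp (- ev e * t)\<bar> \<le> 1"
  using nonneg by simp

lemma bounded_exp: "t \<ge> 0 \<Longrightarrow> bounded_mult (\<lambda>e. exp (- ev e * t))"
  by (rule bounded_multI[OF exp_le_1])

lemma Mult_one: "Mult (\<lambda>e. 1) f = f"
  by (rule Mult_eqI) simp

lemma inner_heat: "t \<ge> 0 \<Longrightarrow> e \<in> E \<Longrightarrow> inner (heat t f) e = exp (- ev e * t) * inner f e"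
  unfolding heat_def by (rule inner_Mult[OF bounded_exp])

lemma heat_tendsto:
  assumes "t \<ge> 0"
  shows "((\<lambda>s. heat s f) \<longlongrightarrow> heat t f) (at t within {0..})"
  unfolding heat_def
proof (rule Mult_tendsto[where C = 1])
  show "\<forall>\<^sub>F s in at t within {0..}. \<forall>e\<in>E. \<bar>exp (- ev e * s)\<bar> \<le> 1"
    using exp_le_1 by (auto simp: eventually_at_filter)
qed (use assms exp_le_1 in \<open>auto intro!: tendsto_intros\<close>)

lemma C0_semigroup_heat: "C0_semigroup heat"
  unfolding C0_semigroup_def
proof (intro conjI allI impI)
  fix s t :: real and f
  show "heat 0 f = f" using Mult_one by (simp add: heat_def)
  show "bounded_linear (heat t)" if "t \<ge> 0"
    unfolding heat_def by (rule bounded_linear_Mult[OF bounded_exp[OF that]])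
  show "heat (s + t) f = heat s (heat t f)" if "s \<ge> 0" "t \<ge> 0"
    using that by (intro coord_eqI) (simp add: inner_heat distrib_left exp_diff exp_minus divide_inverse)
  have "((\<lambda>s. heat s f) \<longlongrightarrow> heat 0 f) (at_right 0)"
    using heat_tendsto[of 0 f] by (rule filterlim_mono) (auto intro: at_le)
  then show "((\<lambda>t. heat t f) \<longlongrightarrow> f) (at_right 0)" using \<open>heat 0 f = f\<close> by simp
qed

lemma heat_generates: "generates D (\<lambda>f. - A f) heat"
  unfolding generates_def
proof (intro conjI C0_semigroup_heat allI)
  fix f g
  show "((\<lambda>h. (heat h f - f) /\<^sub>R h) \<longlongrightarrow> g) (at_right 0) \<longleftrightarrow> f \<in> D \<and> g = - A f"
  proof
    assume L: "((\<lambda>h. (heat h f - f) /\<^sub>R h) \<longlongrightarrow> g) (at_right 0)"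
    have "inner (- g) e = ev e * inner f e" if e: "e \<in> E" for e
    proof -
      have "((\<lambda>h. inner ((heat h f - f) /\<^sub>R h) e) \<longlongrightarrow> inner g e) (at_right 0)"
        by (intro tendsto_intros L)
      moreover have "\<forall>\<^sub>F h in at_right 0. inner ((heat h f - f) /\<^sub>R h) e
          = (exp (- ev e * h) - 1) / h * inner f e"
        by (rule eventually_at_right_less[THEN eventually_mono])
          (simp add: inner_diff_left inner_heat e field_simps)
      ultimately have "((\<lambda>h. (exp (- ev e * h) - 1) / h * inner f e) \<longlongrightarrow> inner g e) (at_right 0)"
        by (rule Lim_transform_eventually)
      moreover have "((\<lambda>h. (exp (- ev e * h) - 1) / h) \<longlongrightarrow> - ev e) (at_right 0)"
      proof -
        have "((\<lambda>h. exp (- ev e * h)) has_real_derivative - ev e) (at 0)"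
          by (auto intro!: derivative_eq_intros)
        then show ?thesis unfolding DERIV_def by (auto intro: filterlim_mono at_le)
      qed
      then have "((\<lambda>h. (exp (- ev e * h) - 1) / h * inner f e) \<longlongrightarrow> - ev e * inner f e) (at_right 0)"
        by (intro tendsto_intros)
      ultimately have "inner g e = - ev e * inner f e"
        by (rule tendsto_unique[rotated]) simp
      then show ?thesis by simp
    qed
    then show "f \<in> D \<and> g = - A f" using diagonal[of f "- g"] by auto
  next
    assume fg: "f \<in> D \<and> g = - A f"
    then have ge: "inner g e = - ev e * inner f e" if "e \<in> E" for e
      using diagonal[of f "A f"] that by auto
    \<comment> \<open>On the coordinates of \<open>g\<close> the difference quotient acts as a multiplier with values in
      \<open>[0, 1]\<close>, so no bound on the eigenvalues enters.\<close>
    define m where "m h e = (if ev e = 0 then 1 else (1 - exp (- ev e * h)) / (ev e * h))" for h e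
    have m1: "\<bar>m h e\<bar> \<le> 1" if "e \<in> E" "h > 0" for h e
    proof (cases "ev e = 0")
      case False
      then have "ev e * h > 0" using nonneg[OF that(1)] that(2) by simp
      moreover have "1 - ev e * h \<le> exp (- ev e * h)" using exp_ge_add_one_self[of "- ev e * h"] by simp
      ultimately show ?thesis using False by (simp add: m_def abs_le_iff divide_le_eq)
    qed (simp add: m_def)
    have "((\<lambda>h. Mult (m h) g) \<longlongrightarrow> Mult (\<lambda>e. 1) g) (at_right 0)"
    proof (rule Mult_tendsto[where C = 1])
      show "\<forall>\<^sub>F h in at_right 0. \<forall>e\<in>E. \<bar>m h e\<bar> \<le> 1"
        by (rule eventually_at_right_less[THEN eventually_mono]) (use m1 in auto)
      fix e assume e: "e \<in> E"
      show "((\<lambda>h. m h e) \<longlongrightarrow> 1) (at_right 0)"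
      proof (cases "ev e = 0")
        case False
        have "((\<lambda>h. exp (- ev e * h)) has_real_derivative - ev e) (at 0)"
          by (auto intro!: derivative_eq_intros)
        then have "((\<lambda>h. (exp (- ev e * h) - 1) / h) \<longlongrightarrow> - ev e) (at_right 0)"
          unfolding DERIV_def by (auto intro: filterlim_mono at_le)
        then have "((\<lambda>h. - (1 / ev e) * ((exp (- ev e * h) - 1) / h)) \<longlongrightarrow> - (1 / ev e) * (- ev e)) (at_right 0)"
          by (intro tendsto_intros)
        moreover have "- (1 / ev e) * ((exp (- ev e * h) - 1) / h) = m h e" for h
          using False by (simp add: m_def divide_inverse algebra_simps)
        ultimately show ?thesis using False by simp
      qed (simp add: m_def)
    qed simp_all
    moreover have "\<forall>\<^sub>F h in at_right 0. Mult (m h) g = (heat h f - f) /\<^sub>R h"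
    proof (rule eventually_at_right_less[THEN eventually_mono], rule Mult_eqI)
      fix h :: real and e assume h: "0 < h" and e: "e \<in> E"
      show "inner ((heat h f - f) /\<^sub>R h) e = m h e * inner g e"
        using h by (simp add: inner_diff_left inner_heat e ge[OF e] m_def field_simps)
    qed
    ultimately show "((\<lambda>h. (heat h f - f) /\<^sub>R h) \<longlongrightarrow> g) (at_right 0)"
      unfolding Mult_one by (rule Lim_transform_eventually)
  qed
qed

text \<open>Both semigroups multiply each eigenvector by the same exponential, and eigenvectors span a dense
  subspace.\<close>
lemma generated_semigroup_eq_heat:
  assumes "t \<ge> 0"
  shows "generated_semigroup D (\<lambda>f. - A f) t f = heat t f"
proof -
  define S where "S = generated_semigroup D (\<lambda>f. - A f)"
  have gen: "generates D (\<lambda>f. - A f) S"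
    unfolding S_def generated_semigroup_def by (rule someI[of "generates D (\<lambda>f. - A f)", OF heat_generates])
  then have S: "C0_semigroup S" by (simp add: generates_def)
  interpret St: bounded_linear "S t" using S assms by (simp add: C0_semigroup_def)
  interpret Ht: bounded_linear "heat t" using C0_semigroup_heat assms by (simp add: C0_semigroup_def)
  have "S t e = heat t e" if e: "e \<in> E" for e
  proof -
    have "e \<in> D \<and> A e = ev e *\<^sub>R e" unfolding diagonal using e by (auto simp: inner_basis)
    then have "((\<lambda>h. (S h e - e) /\<^sub>R h) \<longlongrightarrow> (- ev e) *\<^sub>R e) (at_right 0)"
      using gen unfolding scaleR_minus_left generates_def by auto
    from C0_semigroup_eigenvector[where \<mu> = "- ev e", OF S this assms]
    have "S t e = exp (- ev e * t) *\<^sub>R e" .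
    then show ?thesis by (simp only: heat_def Mult_basis[OF bounded_exp[OF assms] e])
  qed
  then have "E \<subseteq> {f. S t f = heat t f}" (is "_ \<subseteq> ?U") by blast
  moreover have "subspace ?U" by (auto simp: subspace_def St.add Ht.add St.scaleR Ht.scaleR St.zero Ht.zero)
  moreover have "closed ?U" by (intro closed_Collect_eq St.continuous_on Ht.continuous_on continuous_intros)
  ultimately have "closure (span E) \<subseteq> ?U" by (intro closure_minimal span_minimal)
  then show ?thesis using closure_span_basis by (auto simp: S_def)
qed

lemma power_exp_bound:
  assumes "e \<in> E" "t > 0"
  shows "\<bar>ev e ^ j * exp (- ev e * t)\<bar> \<le> fact j / t ^ j"
proof -
  define y where "y = ev e * t"
  have y: "y \<ge> 0" using nonneg assms by (simp add: y_def)
  have "(\<Sum>i\<in>{j}. y ^ i /\<^sub>R fact i) \<le> (\<Sum>i. y ^ i /\<^sub>R fact i)"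
    by (intro sum_le_suminf summable_exp_generic) (use y in auto)
  then have "y ^ j / fact j \<le> exp y" by (simp add: exp_def divide_inverse mult.commute)
  then have "ev e ^ j * t ^ j \<le> fact j * exp (ev e * t)"
    by (simp add: y_def field_simps power_mult_distrib)
  then have "ev e ^ j * exp (- ev e * t) \<le> fact j / t ^ j"
    using assms(2) by (simp add: exp_minus field_simps)
  then show ?thesis using nonneg[OF assms(1)] by simp
qed

text \<open>The functions \<open>t \<mapsto> \<langle>A\<^sup>j exp (- A t) w, z\<rangle>\<close> are successive derivatives, so they all vanish
  on the interval.\<close>
lemma heat_derivatives_vanish:
  assumes zero: "\<And>t. 0 < t \<Longrightarrow> t < T \<Longrightarrow> inner (heat t w) z = 0"
  shows "0 < t \<Longrightarrow> t < T \<Longrightarrow> inner (Mult (\<lambda>e. ev e ^ j * exp (- ev e * t)) w) z = 0"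
proof (induction j arbitrary: t)
  case 0
  then show ?case using zero by (simp add: heat_def)
next
  case (Suc j)
  have bdd: "bounded_mult (\<lambda>e. ev e ^ i * exp (- ev e * s))" if "s > 0" for i s
    using power_exp_bound[OF _ that] by (rule bounded_multI)
  define m where "m s e = ev e ^ j * exp (- ev e * t) * ((exp (- ev e * s) - 1) / s)" for s e
  have mb: "\<bar>m s e\<bar> \<le> \<bar>ev e ^ Suc j * exp (- ev e * t)\<bar>" if e: "e \<in> E" and s: "s > 0" for s e
  proof -
    have "1 - ev e * s \<le> exp (- ev e * s)" using exp_ge_add_one_self[of "- ev e * s"] by simp
    moreover have "exp (- ev e * s) \<le> 1" using nonneg[OF e] s by simp
    ultimately have "\<bar>(exp (- ev e * s) - 1) / s\<bar> \<le> ev e" using s by (simp add: divide_le_eq)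
    then have "\<bar>m s e\<bar> \<le> \<bar>ev e ^ j * exp (- ev e * t)\<bar> * ev e"
      unfolding m_def abs_mult[of _ "(exp (- ev e * s) - 1) / s"] by (intro mult_left_mono) auto
    then show ?thesis using nonneg[OF e] by (simp add: abs_mult mult_ac)
  qed
  have "((\<lambda>s. Mult (m s) w) \<longlongrightarrow> Mult (\<lambda>e. - (ev e ^ Suc j * exp (- ev e * t))) w) (at_right 0)"
  proof (rule Mult_tendsto[where C = "fact (Suc j) / t ^ Suc j"])
    show "\<forall>\<^sub>F s in at_right 0. \<forall>e\<in>E. \<bar>m s e\<bar> \<le> fact (Suc j) / t ^ Suc j"
      by (rule eventually_at_right_less[THEN eventually_mono])
        (meson Suc.prems(1) mb order_trans power_exp_bound)
    show "\<bar>- (ev e ^ Suc j * exp (- ev e * t))\<bar> \<le> fact (Suc j) / t ^ Suc j" if "e \<in> E" for e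
      using power_exp_bound[OF that Suc.prems(1), of "Suc j"] by (simp only: abs_minus_cancel)
    fix e assume "e \<in> E"
    have "((\<lambda>h. exp (- ev e * h)) has_real_derivative - ev e) (at 0)"
      by (auto intro!: derivative_eq_intros)
    then have "((\<lambda>h. (exp (- ev e * h) - 1) / h) \<longlongrightarrow> - ev e) (at_right 0)"
      unfolding DERIV_def by (auto intro: filterlim_mono at_le)
    then have "((\<lambda>s. m s e) \<longlongrightarrow> ev e ^ j * exp (- ev e * t) * (- ev e)) (at_right 0)"
      unfolding m_def by (intro tendsto_intros)
    then show "((\<lambda>s. m s e) \<longlongrightarrow> - (ev e ^ Suc j * exp (- ev e * t))) (at_right 0)"
      by (simp add: mult_ac)
  qed (use Suc.prems in auto)
  then have "((\<lambda>s. inner (Mult (m s) w) z)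
      \<longlongrightarrow> inner (Mult (\<lambda>e. - (ev e ^ Suc j * exp (- ev e * t))) w) z) (at_right 0)"
    by (intro tendsto_intros)
  moreover have "((\<lambda>s. inner (Mult (m s) w) z) \<longlongrightarrow> 0) (at_right 0)"
  proof (rule tendsto_eventually)
    have "\<forall>\<^sub>F s in at_right 0. s \<in> {0<..<T - t}"
      using Suc.prems by (intro eventually_at_right_real) auto
    then show "\<forall>\<^sub>F s in at_right 0. inner (Mult (m s) w) z = 0"
    proof eventually_elim
      fix s assume s: "s \<in> {0<..<T - t}"
      have "Mult (m s) w = (1 / s) *\<^sub>R (Mult (\<lambda>e. ev e ^ j * exp (- ev e * (t + s))) w
          - Mult (\<lambda>e. ev e ^ j * exp (- ev e * t)) w)"
      proof (rule Mult_eqI)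
        fix e assume e: "e \<in> E"
        have "exp (- ev e * (t + s)) = exp (- ev e * t) * exp (- ev e * s)"
          by (simp add: distrib_left flip: exp_add)
        then show "inner ((1 / s) *\<^sub>R (Mult (\<lambda>e. ev e ^ j * exp (- ev e * (t + s))) w
            - Mult (\<lambda>e. ev e ^ j * exp (- ev e * t)) w)) e = m s e * inner w e"
          using s Suc.prems
          by (simp only: inner_scaleR_left inner_diff_left inner_Mult[OF bdd e] m_def add_pos_pos
              greaterThanLessThan_iff) (simp add: field_simps)
      qed
      then show "inner (Mult (m s) w) z = 0"
        using Suc.IH[of t] Suc.IH[of "t + s"] Suc.prems s by (simp add: inner_diff_left)
    qed
  qed
  ultimately have "inner (Mult (\<lambda>e. - (ev e ^ Suc j * exp (- ev e * t))) w) z = 0"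
    using tendsto_unique trivial_limit_at_right_real by blast
  then have "inner (Mult (\<lambda>e. (- 1) * (ev e ^ Suc j * exp (- ev e * t))) w) z = 0"
    by simp
  then show ?case unfolding Mult_scale[OF bdd[OF Suc.prems(1)]] by simp
qed

text \<open>The Taylor series of the heat multipliers at \<open>t\<close> converges boundedly for steps up to \<open>t\<close>, so
  each use of it doubles the interval.\<close>
lemma heat_vanishing_extends:
  assumes zero: "\<And>t. 0 < t \<Longrightarrow> t < T \<Longrightarrow> inner (heat t w) z = 0" and "0 < t" "t < 2 * T"
  shows "inner (heat t w) z = 0"
proof -
  define s where "s = t / 2"
  have s: "0 < s" "s < T" "t = s + s" using assms by (auto simp: s_def)
  have bdd: "bounded_mult (\<lambda>e. ev e ^ i * exp (- ev e * s))" for i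
    using power_exp_bound[OF _ s(1)] by (rule bounded_multI)
  define p where "p n e = (\<Sum>j<n. ((- s) ^ j / fact j) * (ev e ^ j * exp (- ev e * s)))" for n e
  have p: "bounded_mult (p n) \<and> inner (Mult (p n) w) z = 0" for n
  proof (induction n)
    case 0
    have "Mult (p 0) w = 0" by (rule Mult_eqI) (simp add: p_def)
    moreover have "bounded_mult (p 0)" by (auto simp: p_def bounded_mult_def)
    ultimately show ?case by simp
  next
    case (Suc n)
    have "p (Suc n) = (\<lambda>e. p n e + ((- s) ^ n / fact n) * (ev e ^ n * exp (- ev e * s)))"
      by (simp add: p_def fun_eq_iff)
    then show ?case
      using Suc bdd[of n] heat_derivatives_vanish[OF zero s(1,2), of n]
      by (simp only: bounded_mult_add bounded_mult_scale Mult_add Mult_scale inner_add_left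
          inner_scaleR_left) simp
  qed
  have "(\<lambda>n. Mult (p n) w) \<longlonglongrightarrow> Mult (\<lambda>e. exp (- ev e * t)) w"
  proof (rule Mult_tendsto[where C = 1])
    have sums: "(\<lambda>j. y ^ j / fact j) sums exp y" for y :: real
      using exp_converges[of y] by (simp add: divide_inverse mult.commute)
    have pe: "p n e = exp (- ev e * s) * (\<Sum>j<n. (- (ev e * s)) ^ j / fact j)" for n e
      unfolding p_def sum_distrib_left
      by (intro sum.cong) (auto simp: power_minus[of s] power_minus[of "ev e * s"] power_mult_distrib)
    have "\<bar>p n e\<bar> \<le> 1" if e: "e \<in> E" for n e
    proof -
      have y: "ev e * s \<ge> 0" using nonneg[OF e] s(1) by simp
      have "\<bar>\<Sum>j<n. (- (ev e * s)) ^ j / fact j\<bar> \<le> (\<Sum>j<n. \<bar>(- (ev e * s)) ^ j / fact j\<bar>)"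
        by (rule sum_abs)
      also have "\<dots> = (\<Sum>j<n. (ev e * s) ^ j / fact j)"
        using y by (intro sum.cong) (auto simp: power_abs)
      also have "\<dots> \<le> exp (ev e * s)"
        using y sums[of "ev e * s"] by (intro sum_le_suminf[THEN order_trans]) (auto simp: sums_iff)
      finally have "\<bar>p n e\<bar> \<le> exp (- ev e * s) * exp (ev e * s)"
        unfolding pe abs_mult by (simp add: mult_left_mono)
      then show ?thesis by (simp flip: exp_add)
    qed
    then show "\<forall>\<^sub>F n in sequentially. \<forall>e\<in>E. \<bar>p n e\<bar> \<le> 1" by simp
    show "\<bar>exp (- ev e * t)\<bar> \<le> 1" if "e \<in> E" for e using exp_le_1[OF that] assms(2) by simp
    fix e assume "e \<in> E"
    have "(\<lambda>n. \<Sum>j<n. (- (ev e * s)) ^ j / fact j) \<longlonglongrightarrow> exp (- (ev e * s))"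
      using sums[of "- (ev e * s)"] by (simp add: sums_def)
    then have "(\<lambda>n. p n e) \<longlonglongrightarrow> exp (- ev e * s) * exp (- (ev e * s))"
      unfolding pe by (intro tendsto_intros)
    moreover have "exp (- ev e * s) * exp (- (ev e * s)) = exp (- ev e * t)"
      unfolding exp_add[symmetric] s(3) by (simp add: algebra_simps)
    ultimately show "(\<lambda>n. p n e) \<longlonglongrightarrow> exp (- ev e * t)" by simp
  qed simp
  then have "(\<lambda>n. inner (Mult (p n) w) z) \<longlonglongrightarrow> inner (heat t w) z"
    unfolding heat_def by (intro tendsto_intros)
  then show ?thesis using p by (simp add: LIMSEQ_const_iff)
qed

lemma heat_vanishing_all_times:
  assumes "T > 0" and zero: "\<And>t. 0 < t \<Longrightarrow> t < T \<Longrightarrow> inner (heat t w) z = 0" and "t > 0"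
  shows "inner (heat t w) z = 0"
proof -
  have ext: "0 < s \<Longrightarrow> s < 2 ^ n * T \<Longrightarrow> inner (heat s w) z = 0" for n :: nat and s
  proof (induction n arbitrary: s)
    case 0
    then show ?case using zero by simp
  next
    case (Suc n)
    then show ?case using heat_vanishing_extends[of "2 ^ n * T" w z s] by (simp add: mult_ac)
  qed
  obtain n :: nat where "t / T < 2 ^ n" using real_arch_pow[of 2 "t / T"] by auto
  then show ?thesis using ext[of t n] assms(1,3) by (simp add: field_simps)
qed

text \<open>The polynomials \<open>r (1 - (r - r0)\<^sup>2)\<^sup>k\<close> in \<open>r = exp (- A)\<close> converge boundedly to \<open>r0\<close> times the
  indicator of \<open>r0\<close>; they have no constant term, so only the positive times \<open>1, 2, \<dots>\<close> enter.\<close>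
lemma eigenprojection_orthogonal:
  assumes "T > 0" and zero: "\<And>t. 0 < t \<Longrightarrow> t < T \<Longrightarrow> inner (heat t w) z = 0"
  shows "inner (Mult (\<lambda>e. if ev e = \<mu> then 1 else 0) w) z = 0"
proof (cases "\<mu> \<ge> 0")
  case False
  then have "Mult (\<lambda>e. if ev e = \<mu> then 1 else 0) w = 0" using nonneg by (intro Mult_eqI) auto
  then show ?thesis by simp
next
  case True
  define r where "r e = exp (- ev e)" for e
  define r0 where "r0 = exp (- \<mu>)"
  have r: "0 < r e" "r e \<le> 1" if "e \<in> E" for e using nonneg[OF that] by (auto simp: r_def)
  have r0: "0 < r0" "r0 \<le> 1" using True by (auto simp: r0_def)
  have sq: "0 \<le> 1 - (r e - r0)\<^sup>2" "1 - (r e - r0)\<^sup>2 \<le> 1" if "e \<in> E" for e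
    using r[OF that] r0 by (auto simp: abs_square_le_1)
  define q where "q n k e = r e ^ n * (1 - (r e - r0)\<^sup>2) ^ k" for n k e
  have q1: "\<bar>q n k e\<bar> \<le> 1" if "e \<in> E" for n k e
    unfolding q_def abs_mult using r[OF that] sq[OF that]
    by (intro mult_le_one) (auto simp: power_le_one)
  have qb: "bounded_mult (q n k)" for n k by (rule bounded_multI[OF q1])
  have "inner (Mult (q n k) w) z = 0" if "n > 0" for n k
    using that
  proof (induction k arbitrary: n)
    case 0
    have "q n 0 = (\<lambda>e. exp (- ev e * real n))"
      by (simp add: q_def r_def fun_eq_iff mult.commute flip: exp_of_nat_mult)
    then show ?case
      using heat_vanishing_all_times[OF assms, of "real n"] 0 by (simp add: heat_def)
  next
    case (Suc k)
    have "q n (Suc k) = (\<lambda>e. (1 - r0\<^sup>2) * q n k e + (2 * r0 * q (Suc n) k e + (- 1) * q (Suc (Suc n)) k e))"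
      by (simp add: q_def fun_eq_iff power2_eq_square algebra_simps)
    then show ?case
      using Suc by (simp only: Mult_add Mult_scale bounded_mult_add bounded_mult_scale qb
          inner_add_left inner_scaleR_left)
  qed
  moreover have "(\<lambda>k. Mult (q 1 k) w) \<longlonglongrightarrow> Mult (\<lambda>e. r0 * (if ev e = \<mu> then 1 else 0)) w"
  proof (rule Mult_tendsto[where C = 1])
    show "\<forall>\<^sub>F k in sequentially. \<forall>e\<in>E. \<bar>q 1 k e\<bar> \<le> 1" using q1 by simp
    show "\<bar>r0 * (if ev e = \<mu> then 1 else 0)\<bar> \<le> 1" for e using r0 by simp
    fix e assume e: "e \<in> E"
    show "(\<lambda>k. q 1 k e) \<longlonglongrightarrow> r0 * (if ev e = \<mu> then 1 else 0)"
    proof (cases "ev e = \<mu>")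
      case True
      then have "r e = r0" by (simp add: r_def r0_def)
      then show ?thesis using True by (simp add: q_def)
    next
      case False
      then have "(r e - r0)\<^sup>2 > 0" by (simp add: r_def r0_def)
      then have "(\<lambda>k. (1 - (r e - r0)\<^sup>2) ^ k) \<longlonglongrightarrow> 0" using sq[OF e] by (intro LIMSEQ_power_zero) simp
      from tendsto_mult[OF tendsto_const[of "r e"] this]
      show ?thesis using False by (simp add: q_def)
    qed
  qed simp
  then have "(\<lambda>k. inner (Mult (q 1 k) w) z) \<longlonglongrightarrow> inner (Mult (\<lambda>e. r0 * (if ev e = \<mu> then 1 else 0)) w) z"
    by (intro tendsto_intros)
  ultimately have "inner (Mult (\<lambda>e. r0 * (if ev e = \<mu> then 1 else 0)) w) z = 0"
    by (simp add: LIMSEQ_const_iff)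
  moreover have "bounded_mult (\<lambda>e. if ev e = \<mu> then 1 else 0)"
    by (rule bounded_multI[of _ 1]) simp
  ultimately show ?thesis using r0 by (simp add: Mult_scale)
qed

text \<open>The projection of \<open>z\<close> to each eigenspace is orthogonal to \<open>W\<close>, hence zero.\<close>
theorem heat_unique_continuation:
  assumes "T > 0" and zero: "\<And>t w. 0 < t \<Longrightarrow> t < T \<Longrightarrow> w \<in> W \<Longrightarrow> inner (heat t w) z = 0"
    and eigen: "\<And>p \<mu>. p \<in> D \<Longrightarrow> A p = \<mu> *\<^sub>R p \<Longrightarrow> (\<And>w. w \<in> W \<Longrightarrow> inner w p = 0) \<Longrightarrow> p = 0"
  shows "z = 0"
proof (rule total)
  fix e assume e: "e \<in> E"
  define m where "m e' = (if ev e' = ev e then 1 else 0 :: real)" for e'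
  have m: "bounded_mult m" by (rule bounded_multI[of _ 1]) (simp add: m_def)
  have "Mult m z \<in> D \<and> A (Mult m z) = ev e *\<^sub>R Mult m z"
    unfolding diagonal by (simp add: inner_Mult[OF m]) (simp add: m_def)
  moreover have "inner w (Mult m z) = 0" if "w \<in> W" for w
    using eigenprojection_orthogonal[OF assms(1) zero[OF _ _ that], of "ev e"]
    by (simp add: Mult_symmetric[OF m] flip: m_def)
  ultimately have "Mult m z = 0" using eigen by blast
  then have "0 = m e * inner z e" using inner_Mult[OF m e, of z] by simp
  then show "inner z e = 0" by (simp add: m_def)
qed

end

section \<open>Primitives and weak derivatives on the line\<close>

text \<open>\<open>F\<close> is a locally absolutely continuous function with almost everywhere derivative \<open>G\<close>.\<close>
definition primitive_on :: "real set \<Rightarrow> (real \<Rightarrow> real) \<Rightarrow> (real \<Rightarrow> real) \<Rightarrow> bool" where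
  "primitive_on J F G \<longleftrightarrow> (\<forall>a b. a \<le> b \<and> {a..b} \<subseteq> J \<longrightarrow>
     set_integrable lborel {a..b} G \<and> integral {a..b} G = F b - F a)"

lemma primitive_onD:
  assumes "primitive_on J F G" "a \<le> b" "{a..b} \<subseteq> J"
  shows "set_integrable lborel {a..b} G" "integral {a..b} G = F b - F a"
  using assms by (auto simp: primitive_on_def)

lemma primitive_on_subset: "primitive_on J F G \<Longrightarrow> J' \<subseteq> J \<Longrightarrow> primitive_on J' F G"
  unfolding primitive_on_def by blast

lemma primitive_on_cong:
  assumes "\<And>x. x \<in> J \<Longrightarrow> F x = F' x" "\<And>x. x \<in> J \<Longrightarrow> G x = G' x"
  shows "primitive_on J F G \<longleftrightarrow> primitive_on J F' G'"
proof -
  have "(set_integrable lborel {a..b} G \<longleftrightarrow> set_integrable lborel {a..b} G') \<and>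
      integral {a..b} G = integral {a..b} G' \<and> F b - F a = F' b - F' a" if "a \<le> b" "{a..b} \<subseteq> J" for a b
  proof (intro conjI)
    show "set_integrable lborel {a..b} G \<longleftrightarrow> set_integrable lborel {a..b} G'"
      by (rule set_integrable_cong) (use assms that in auto)
    show "integral {a..b} G = integral {a..b} G'"
      by (rule integral_cong) (use assms that in auto)
  qed (use assms that in \<open>auto simp: subset_iff\<close>)
  then show ?thesis unfolding primitive_on_def by metis
qed

lemma primitive_on_integrable_on:
  assumes "primitive_on J F G" "a \<le> b" "{a..b} \<subseteq> J"
  shows "G integrable_on {a..b}"
  using set_borel_integral_eq_integral(1)[OF primitive_onD(1)[OF assms]] .

lemma primitive_on_has_integral:
  assumes "primitive_on J F G" "a \<le> b" "{a..b} \<subseteq> J"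
  shows "(G has_integral (F b - F a)) {a..b}"
  using integrable_integral[OF primitive_on_integrable_on[OF assms]] primitive_onD(2)[OF assms] by simp

lemma primitive_on_scale:
  assumes "primitive_on J F G"
  shows "primitive_on J (\<lambda>x. c * F x) (\<lambda>x. c * G x)"
  using assms unfolding primitive_on_def by (simp add: right_diff_distrib)

lemma primitive_on_add:
  assumes "primitive_on J F G" "primitive_on J P Q"
  shows "primitive_on J (\<lambda>x. F x + P x) (\<lambda>x. G x + Q x)"
  unfolding primitive_on_def
proof (intro allI impI conjI)
  fix a b assume ab: "a \<le> b \<and> {a..b} \<subseteq> J"
  show "set_integrable lborel {a..b} (\<lambda>x. G x + Q x)"
    using assms ab by (intro set_integral_add) (auto simp: primitive_on_def)
  show "integral {a..b} (\<lambda>x. G x + Q x) = F b + P b - (F a + P a)"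
    using ab primitive_onD(2)[OF assms(1)] primitive_onD(2)[OF assms(2)]
      primitive_on_integrable_on[OF assms(1)] primitive_on_integrable_on[OF assms(2)]
    by (subst integral_add) auto
qed

lemma primitive_on_diff:
  assumes "primitive_on J F G" "primitive_on J P Q"
  shows "primitive_on J (\<lambda>x. F x - P x) (\<lambda>x. G x - Q x)"
  using primitive_on_add[OF assms(1) primitive_on_scale[OF assms(2), of "-1"]] by simp

lemma set_integrable_lborel_continuous:
  fixes f :: "real \<Rightarrow> real"
  shows "continuous_on {a..b} f \<Longrightarrow> set_integrable lborel {a..b} f"
  by (rule borel_integrable_atLeastAtMost')

lemma primitive_on_C1:
  assumes F: "\<And>x. x \<in> J \<Longrightarrow> (F has_real_derivative G x) (at x within J)" and G: "continuous_on J G"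
  shows "primitive_on J F G"
  unfolding primitive_on_def
proof (intro allI impI conjI)
  fix a b assume ab: "a \<le> b \<and> {a..b} \<subseteq> J"
  show "set_integrable lborel {a..b} G"
    using ab G by (intro set_integrable_lborel_continuous) (auto intro: continuous_on_subset)
  have "(F has_vector_derivative G x) (at x within {a..b})" if "x \<in> {a..b}" for x
  proof -
    have "x \<in> J" using that ab by blast
    from F[OF this] show ?thesis
      unfolding has_real_derivative_iff_has_vector_derivative
      using ab by (auto intro: has_vector_derivative_within_subset)
  qed
  then have "(G has_integral F b - F a) {a..b}" using ab by (intro fundamental_theorem_of_calculus) auto
  then show "integral {a..b} G = F b - F a" by (rule integral_unique)
qed

lemma primitive_on_indefinite:
  assumes "set_integrable lborel {c..d} G"
  shows "primitive_on {c..d} (\<lambda>x. integral {c..x} G) G"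
  unfolding primitive_on_def
proof (intro allI impI conjI)
  fix a b assume ab: "a \<le> b \<and> {a..b} \<subseteq> {c..d}"
  then have cd: "c \<le> a" "b \<le> d" by auto
  show "set_integrable lborel {a..b} G"
    by (rule set_integrable_subset[OF assms]) (use ab in auto)
  have "G integrable_on {c..b}"
    by (rule integrable_on_subinterval[OF set_borel_integral_eq_integral(1)[OF assms]]) (use cd in auto)
  from Henstock_Kurzweil_Integration.integral_combine[OF cd(1) _ this] ab
  show "integral {a..b} G = integral {c..b} G - integral {c..a} G" by simp
qed

lemma primitive_on_continuous:
  assumes "primitive_on J F G" "{a..b} \<subseteq> J"
  shows "continuous_on {a..b} F"
proof (cases "a \<le> b")
  case True
  have "G integrable_on {a..b}" by (rule primitive_on_integrable_on[OF assms(1) True assms(2)])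
  then have "continuous_on {a..b} (\<lambda>x. F a + integral {a..x} G)"
    by (intro continuous_intros indefinite_integral_continuous_1)
  moreover have "F a + integral {a..x} G = F x" if "x \<in> {a..b}" for x
  proof -
    have "{a..x} \<subseteq> J" using that assms(2) by (auto simp: subset_iff)
    then show ?thesis using primitive_onD(2)[OF assms(1), of a x] that by simp
  qed
  ultimately show ?thesis by (rule continuous_on_eq)
qed simp

text \<open>Cutting \<open>[a, b]\<close> into \<open>n\<close> pieces on which \<open>\<Gamma>\<close> grows equally leaves a total change of order
  \<open>1 / n\<close>.\<close>
lemma constant_of_quadratic_increments:
  fixes H \<Gamma> :: "real \<Rightarrow> real"
  assumes "a \<le> b" and \<Gamma>: "continuous_on {a..b} \<Gamma>" "\<Gamma> a \<le> \<Gamma> b"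
    and H: "\<And>x y. a \<le> x \<Longrightarrow> x \<le> y \<Longrightarrow> y \<le> b \<Longrightarrow> \<bar>H y - H x\<bar> \<le> (\<Gamma> y - \<Gamma> x)\<^sup>2"
  shows "H b = H a"
proof -
  have H': "\<bar>H y - H x\<bar> \<le> (\<Gamma> y - \<Gamma> x)\<^sup>2" if "x \<in> {a..b}" "y \<in> {a..b}" for x y
  proof (cases "x \<le> y")
    case False
    then show ?thesis using H[of y x] that by (simp add: abs_minus_commute power2_commute)
  qed (use H that in auto)
  define L where "L = \<Gamma> b - \<Gamma> a"
  have bound: "\<bar>H b - H a\<bar> \<le> L\<^sup>2 * (1 / real (Suc n))" for n
  proof -
    define N where "N = real (Suc n)"
    have N: "N > 0" by (simp add: N_def)
    have "\<exists>x\<in>{a..b}. \<Gamma> x = \<Gamma> a + real i * L / N" if "i \<le> Suc n" for i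
    proof -
      have "0 \<le> real i * L / N" using \<Gamma>(2) N by (simp add: L_def)
      moreover have "real i * L / N \<le> L"
      proof -
        have "real i * L \<le> N * L" using that \<Gamma>(2) by (intro mult_right_mono) (auto simp: N_def L_def)
        then show ?thesis using N by (simp add: field_simps)
      qed
      ultimately show ?thesis
        using IVT'[of \<Gamma> a "\<Gamma> a + real i * L / N" b] assms(1) \<Gamma>(1) by (auto simp: L_def)
    qed
    then obtain x where x: "\<And>i. i \<le> Suc n \<Longrightarrow> x i \<in> {a..b}"
      "\<And>i. i \<le> Suc n \<Longrightarrow> \<Gamma> (x i) = \<Gamma> a + real i * L / N" by metis
    have "\<bar>H (x k) - H (x 0)\<bar> \<le> real k * (L / N)\<^sup>2" if "k \<le> Suc n" for k
      using that
    proof (induction k)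
      case (Suc k)
      have "\<Gamma> (x (Suc k)) - \<Gamma> (x k) = L / N"
        using x(2)[of k] x(2)[of "Suc k"] Suc.prems N by (simp add: field_simps)
      then have "\<bar>H (x (Suc k)) - H (x k)\<bar> \<le> (L / N)\<^sup>2"
        using H'[of "x k" "x (Suc k)"] x(1)[of k] x(1)[of "Suc k"] Suc.prems by simp
      then show ?case using Suc.IH Suc.prems by (simp add: distrib_right)
    qed simp
    from this[of "Suc n"] have "\<bar>H (x (Suc n)) - H (x 0)\<bar> \<le> N * (L / N)\<^sup>2" by (simp add: N_def)
    moreover have "H (x 0) = H a" using H'[of "x 0" a] x(1)[of 0] x(2)[of 0] assms(1) by simp
    moreover have "H (x (Suc n)) = H b"
    proof -
      have "\<Gamma> (x (Suc n)) = \<Gamma> b" using x(2)[of "Suc n"] N by (simp add: L_def N_def)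
      then show ?thesis using H'[of "x (Suc n)" b] x(1)[of "Suc n"] assms(1) by simp
    qed
    ultimately have "\<bar>H b - H a\<bar> \<le> N * (L / N)\<^sup>2" by simp
    also have "\<dots> = L\<^sup>2 * (1 / N)" using N by (simp add: power2_eq_square)
    finally show ?thesis by (simp add: N_def)
  qed
  have "\<bar>H b - H a\<bar> \<le> L\<^sup>2 * 0"
  proof (rule LIMSEQ_le_const)
    show "(\<lambda>n. L\<^sup>2 * (1 / real (Suc n))) \<longlonglongrightarrow> L\<^sup>2 * 0"
      using LIMSEQ_inverse_real_of_nat by (intro tendsto_intros) (simp add: inverse_eq_divide)
  qed (use bound in blast)
  then show ?thesis by simp
qed

lemma set_integrable_mult_continuous:
  fixes G P :: "real \<Rightarrow> real"
  assumes G: "set_integrable lborel {a..b} G" and P: "continuous_on {a..b} P"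
  shows "set_integrable lborel {a..b} (\<lambda>x. G x * P x)"
proof -
  have "compact (P ` {a..b})" using P by (intro compact_continuous_image) auto
  then obtain B where B: "\<And>x. x \<in> {a..b} \<Longrightarrow> \<bar>P x\<bar> \<le> B"
    using compact_imp_bounded[of "P ` {a..b}"] unfolding bounded_iff by force
  have m: "(\<lambda>x. indicator {a..b} x *\<^sub>R P x) \<in> borel_measurable borel"
    using P by (intro borel_measurable_continuous_on_indicator) auto
  have "integrable lborel (\<lambda>x. (indicator {a..b} x *\<^sub>R G x) * (indicator {a..b} x *\<^sub>R P x))"
  proof (rule Bochner_Integration.integrable_bound)
    show "integrable lborel (\<lambda>x. B * (indicator {a..b} x *\<^sub>R G x))"
      using G unfolding set_integrable_def by (intro integrable_mult_right)
    show "(\<lambda>x. (indicator {a..b} x *\<^sub>R G x) * (indicator {a..b} x *\<^sub>R P x)) \<in> borel_measurable lborel"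
      using G m unfolding set_integrable_def by (intro borel_measurable_times) auto
    show "AE x in lborel. norm ((indicator {a..b} x *\<^sub>R G x) * (indicator {a..b} x *\<^sub>R P x))
        \<le> norm (B * (indicator {a..b} x *\<^sub>R G x))"
    proof (rule AE_I2)
      fix x
      show "norm ((indicator {a..b} x *\<^sub>R G x) * (indicator {a..b} x *\<^sub>R P x))
        \<le> norm (B * (indicator {a..b} x *\<^sub>R G x))"
      proof (cases "x \<in> {a..b}")
        case True
        have "\<bar>G x\<bar> * \<bar>P x\<bar> \<le> \<bar>G x\<bar> * \<bar>B\<bar>" using B[OF True] by (intro mult_left_mono) auto
        then show ?thesis using True by (simp add: abs_mult mult.commute)
      qed simp
    qed
  qed
  moreover have "(\<lambda>x. (indicator {a..b} x *\<^sub>R G x) * (indicator {a..b} x *\<^sub>R P x))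
      = (\<lambda>x. indicator {a..b} x *\<^sub>R (G x * P x))"
    by (auto simp: fun_eq_iff indicator_def)
  ultimately show ?thesis by (simp add: set_integrable_def)
qed

lemma has_integral_abs_bound:
  fixes f g :: "real \<Rightarrow> real"
  assumes "(f has_integral i) S" "(g has_integral j) S" "\<And>x. x \<in> S \<Longrightarrow> \<bar>f x\<bar> \<le> g x"
  shows "\<bar>i\<bar> \<le> j"
proof -
  have "i \<le> j" using assms(3) by (intro has_integral_le[OF assms(1,2)]) (auto simp: abs_le_iff)
  moreover have "- i \<le> j"
    using assms(3) by (intro has_integral_le[OF has_integral_neg[OF assms(1)] assms(2)]) (auto simp: abs_le_iff)
  ultimately show ?thesis by simp
qed

text \<open>With \<open>\<Gamma>\<close> a primitive of \<open>\<bar>G\<bar> + \<bar>Q\<bar>\<close>, the function \<open>F P - \<integral> (G P + F Q)\<close> has increments of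
  order \<open>(\<Delta> \<Gamma>)\<^sup>2\<close>, hence is constant.\<close>
theorem primitive_on_mult:
  assumes FG: "primitive_on J F G" and PQ: "primitive_on J P Q"
  shows "primitive_on J (\<lambda>x. F x * P x) (\<lambda>x. G x * P x + F x * Q x)"
  unfolding primitive_on_def
proof (intro allI impI)
  fix a b assume "a \<le> b \<and> {a..b} \<subseteq> J"
  then have ab: "a \<le> b" and J: "{a..b} \<subseteq> J" by auto
  have cF: "continuous_on {a..b} F" and cP: "continuous_on {a..b} P"
    using primitive_on_continuous FG PQ J by blast+
  define R where "R x = G x * P x + F x * Q x" for x
  have R: "set_integrable lborel {a..b} R"
    unfolding R_def using set_integrable_mult_continuous[OF primitive_onD(1)[OF FG ab J] cP]
      set_integrable_mult_continuous[OF primitive_onD(1)[OF PQ ab J] cF]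
    by (intro set_integral_add) (auto simp: mult.commute)
  have aG: "set_integrable lborel {a..b} (\<lambda>x. \<bar>G x\<bar>)" and aQ: "set_integrable lborel {a..b} (\<lambda>x. \<bar>Q x\<bar>)"
    using primitive_onD(1)[OF FG ab J] primitive_onD(1)[OF PQ ab J] by (auto intro: set_integrable_abs)
  define A where "A x = integral {a..x} (\<lambda>x. \<bar>G x\<bar>)" for x
  define B where "B x = integral {a..x} (\<lambda>x. \<bar>Q x\<bar>)" for x
  have pA: "primitive_on {a..b} A (\<lambda>x. \<bar>G x\<bar>)" and pB: "primitive_on {a..b} B (\<lambda>x. \<bar>Q x\<bar>)"
    unfolding A_def B_def by (rule primitive_on_indefinite[OF aG] primitive_on_indefinite[OF aQ])+
  have pR: "primitive_on {a..b} (\<lambda>x. integral {a..x} R) R" by (rule primitive_on_indefinite[OF R])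
  define \<Gamma> where "\<Gamma> x = A x + B x" for x
  define H where "H x = F x * P x - integral {a..x} R" for x
  have "H b = H a"
  proof (rule constant_of_quadratic_increments[OF ab, of \<Gamma>])
    show "continuous_on {a..b} \<Gamma>"
      unfolding \<Gamma>_def using primitive_on_continuous[OF pA] primitive_on_continuous[OF pB]
      by (intro continuous_intros) auto
    have inc: "\<bar>F y - F x\<bar> \<le> A y - A x" "\<bar>P y - P x\<bar> \<le> B y - B x" if "a \<le> x" "x \<le> y" "y \<le> b" for x y
    proof -
      have s: "{x..y} \<subseteq> {a..b}" "{x..y} \<subseteq> J" using that J by auto
      have hF: "(G has_integral F y - F x) {x..y}" and hP: "(Q has_integral P y - P x) {x..y}"
        and hA: "((\<lambda>x. \<bar>G x\<bar>) has_integral A y - A x) {x..y}"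
        and hB: "((\<lambda>x. \<bar>Q x\<bar>) has_integral B y - B x) {x..y}"
        using primitive_on_has_integral FG PQ pA pB that(2) s by blast+
      show "\<bar>F y - F x\<bar> \<le> A y - A x" by (rule has_integral_abs_bound[OF hF hA]) simp
      show "\<bar>P y - P x\<bar> \<le> B y - B x" by (rule has_integral_abs_bound[OF hP hB]) simp
    qed
    show "\<Gamma> a \<le> \<Gamma> b" using inc[of a b] ab by (auto simp: \<Gamma>_def)
    fix x y assume xy: "a \<le> x" "x \<le> y" "y \<le> b"
    have s: "{x..y} \<subseteq> {a..b}" "{x..y} \<subseteq> J" using xy J by auto
    have hF: "(G has_integral F y - F x) {x..y}" and hP: "(Q has_integral P y - P x) {x..y}"
      and hR: "(R has_integral (integral {a..y} R - integral {a..x} R)) {x..y}"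
      and hA: "((\<lambda>x. \<bar>G x\<bar>) has_integral A y - A x) {x..y}" and hB: "((\<lambda>x. \<bar>Q x\<bar>) has_integral B y - B x) {x..y}"
      using primitive_on_has_integral FG PQ pA pB pR xy(2) s by blast+
    have "((\<lambda>s. G s * P y + F x * Q s - R s) has_integral
        ((F y - F x) * P y + F x * (P y - P x) - (integral {a..y} R - integral {a..x} R))) {x..y}"
      by (intro has_integral_diff has_integral_add has_integral_mult_left has_integral_mult_right hF hP hR)
    then have h1: "((\<lambda>s. G s * P y + F x * Q s - R s) has_integral (H y - H x)) {x..y}"
      by (simp add: H_def algebra_simps)
    have h2: "((\<lambda>s. (B y - B x) * \<bar>G s\<bar> + (A y - A x) * \<bar>Q s\<bar>) has_integral
        (B y - B x) * (A y - A x) + (A y - A x) * (B y - B x)) {x..y}"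
      by (intro has_integral_add has_integral_mult_right hA hB)
    have "\<bar>H y - H x\<bar> \<le> (B y - B x) * (A y - A x) + (A y - A x) * (B y - B x)"
    proof (rule has_integral_abs_bound[OF h1 h2])
      fix s assume s: "s \<in> {x..y}"
      have "\<bar>P y - P s\<bar> \<le> B y - B x" "\<bar>F s - F x\<bar> \<le> A y - A x"
        using inc[of s y] inc[of x s] s xy by auto
      then have "\<bar>P y - P s\<bar> * \<bar>G s\<bar> \<le> (B y - B x) * \<bar>G s\<bar>" "\<bar>F s - F x\<bar> * \<bar>Q s\<bar> \<le> (A y - A x) * \<bar>Q s\<bar>"
        by (auto intro: mult_right_mono)
      moreover have "\<bar>G s * P y + F x * Q s - R s\<bar> \<le> \<bar>P y - P s\<bar> * \<bar>G s\<bar> + \<bar>F s - F x\<bar> * \<bar>Q s\<bar>"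
        unfolding R_def abs_mult[symmetric]
        using abs_triangle_ineq4[of "(P y - P s) * G s" "(F s - F x) * Q s"] by (simp add: algebra_simps)
      ultimately show "\<bar>G s * P y + F x * Q s - R s\<bar> \<le> (B y - B x) * \<bar>G s\<bar> + (A y - A x) * \<bar>Q s\<bar>"
        by linarith
    qed
    also have "\<dots> \<le> (\<Gamma> y - \<Gamma> x)\<^sup>2"
    proof -
      have "0 \<le> (A y - A x)\<^sup>2 + (B y - B x)\<^sup>2" by simp
      then show ?thesis by (simp add: \<Gamma>_def power2_eq_square algebra_simps)
    qed
    finally show "\<bar>H y - H x\<bar> \<le> (\<Gamma> y - \<Gamma> x)\<^sup>2" by simp
  qed
  then have "integral {a..b} R = F b * P b - F a * P a" by (simp add: H_def)
  then show "set_integrable lborel {a..b} (\<lambda>x. G x * P x + F x * Q x) \<and>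
      integral {a..b} (\<lambda>x. G x * P x + F x * Q x) = F b * P b - F a * P a"
    using R unfolding R_def by blast
qed


lemma AE_zero_of_interval_integrals:
  fixes h :: "real \<Rightarrow> real"
  assumes h: "integrable lborel h" and z: "\<And>x. (LINT y:{x<..}|lborel. h y) = 0"
  shows "AE x in lborel. h x = 0"
proof -
  have [measurable]: "h \<in> borel_measurable borel" using h by auto
  define p n where "p x = max 0 (h x)" and "n x = max 0 (- h x)" for x
  have [measurable]: "p \<in> borel_measurable borel" "n \<in> borel_measurable borel"
    unfolding p_def n_def by measurable
  have pi: "integrable lborel p" and ni: "integrable lborel n"
    by (rule Bochner_Integration.integrable_bound[OF h]; auto simp: p_def n_def)+
  have em: "emeasure (density lborel f) {x<..} = ennreal (LINT y:{x<..}|lborel. f y)"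
    if f: "integrable lborel f" "\<And>y. f y \<ge> 0" for f :: "real \<Rightarrow> real" and x
  proof -
    have "emeasure (density lborel f) {x<..} = (\<integral>\<^sup>+y. ennreal (indicator {x<..} y *\<^sub>R f y) \<partial>lborel)"
      using f(1) by (subst emeasure_density) (auto intro!: nn_integral_cong simp: indicator_def)
    also have "\<dots> = ennreal (\<integral>y. indicator {x<..} y *\<^sub>R f y \<partial>lborel)"
      using f integrable_mult_indicator[OF _ f(1), of "{x<..}"] by (intro nn_integral_eq_integral) auto
    finally show ?thesis by (simp add: set_lebesgue_integral_def)
  qed
  have "density lborel p = density lborel n"
  proof (rule measure_eqI_lessThan)
    fix x
    have "(LINT y:{x<..}|lborel. p y) - (LINT y:{x<..}|lborel. n y) = (LINT y:{x<..}|lborel. p y - n y)"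
      using integrable_mult_indicator[OF _ pi, of "{x<..}"] integrable_mult_indicator[OF _ ni, of "{x<..}"]
      by (intro set_integral_diff(2)[symmetric]) (simp_all add: set_integrable_def)
    also have "(\<lambda>y. p y - n y) = h" by (auto simp: p_def n_def fun_eq_iff)
    finally have "(LINT y:{x<..}|lborel. p y) = (LINT y:{x<..}|lborel. n y)" using z[of x] by simp
    then show "emeasure (density lborel p) {x<..} = emeasure (density lborel n) {x<..}"
      using em[OF pi] em[OF ni] by (simp add: p_def n_def)
    show "emeasure (density lborel p) {x<..} < \<infinity>" using em[OF pi] by (simp add: p_def)
  qed simp_all
  then have "AE x in lborel. ennreal (p x) = ennreal (n x)"
    by (subst (asm) sigma_finite_measure.density_unique_iff[OF sigma_finite_lborel]) auto
  then show ?thesis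
  proof eventually_elim
    case (elim x)
    then have "p x = n x" by (subst (asm) ennreal_inj) (auto simp: p_def n_def)
    then show ?case by (auto simp: p_def n_def max_def split: if_splits)
  qed
qed

lemma AE_zero_of_subinterval_integrals:
  fixes h :: "real \<Rightarrow> real"
  assumes h: "set_integrable lborel {p..q} h"
    and z: "\<And>s t. p \<le> s \<Longrightarrow> s < t \<Longrightarrow> t \<le> q \<Longrightarrow> (LINT y:{s<..<t}|lborel. h y) = 0"
  shows "AE x in lborel. x \<in> {p..q} \<longrightarrow> h x = 0"
proof -
  have "AE x in lborel. indicator {p..q} x *\<^sub>R h x = 0"
  proof (rule AE_zero_of_interval_integrals)
    show hi: "integrable lborel (\<lambda>x. indicator {p..q} x *\<^sub>R h x)" using h by (simp add: set_integrable_def)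
    fix x
    define s where "s = max p x"
    have "(LINT y:{x<..}|lborel. indicator {p..q} y *\<^sub>R h y) = (LINT y:{s<..<q}|lborel. h y)"
      unfolding set_lebesgue_integral_def
    proof (rule integral_cong_AE)
      have "AE y in lborel. y \<noteq> p \<and> y \<noteq> q" using AE_lborel_singleton[of p] AE_lborel_singleton[of q] by eventually_elim simp
      then show "AE y in lborel. indicator {x<..} y *\<^sub>R (indicator {p..q} y *\<^sub>R h y) = indicator {s<..<q} y *\<^sub>R h y"
        by eventually_elim (auto simp: indicator_def s_def)
      have m: "(\<lambda>y. indicator {p..q} y *\<^sub>R h y) \<in> borel_measurable borel" using hi by auto
      then show "(\<lambda>y. indicator {x<..} y *\<^sub>R (indicator {p..q} y *\<^sub>R h y)) \<in> borel_measurable lborel"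
        by measurable
      have "(\<lambda>y. indicator {s<..<q} y *\<^sub>R h y) = (\<lambda>y. indicator {s<..<q} y *\<^sub>R (indicator {p..q} y *\<^sub>R h y))"
        by (auto simp: fun_eq_iff indicator_def s_def)
      then show "(\<lambda>y. indicator {s<..<q} y *\<^sub>R h y) \<in> borel_measurable lborel" using m by simp
    qed
    also have "\<dots> = 0"
    proof (cases "s < q")
      case True
      then show ?thesis using z[of s q] by (simp add: s_def)
    next
      case False
      then have "{s<..<q} = {}" by auto
      then show ?thesis by (simp add: set_lebesgue_integral_def)
    qed
    finally show "(LINT y:{x<..}|lborel. indicator {p..q} y *\<^sub>R h y) = 0" .
  qed
  then show ?thesis by eventually_elim auto
qed

lemma DERIV_max0_square: "((\<lambda>x::real. (max 0 x)\<^sup>2) has_real_derivative 2 * max 0 x) (at x)"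
proof -
  consider "x > 0" | "x < 0" | "x = 0" by linarith
  then show ?thesis
  proof cases
    case 1
    have "((\<lambda>x. x\<^sup>2) has_real_derivative 2 * max 0 x) (at x)"
      using 1 by (auto intro!: derivative_eq_intros)
    moreover have "\<forall>\<^sub>F y in nhds x. y\<^sup>2 = (max 0 y)\<^sup>2"
      using eventually_nhds_in_open[of "{0<..}" x] 1 by (auto elim!: eventually_mono)
    ultimately show ?thesis by (subst DERIV_cong_ev[OF refl _ refl, symmetric])
  next
    case 2
    have "((\<lambda>x. 0) has_real_derivative 2 * max 0 x) (at x)" using 2 by simp
    moreover have "\<forall>\<^sub>F y in nhds x. 0 = (max 0 y)\<^sup>2"
      using eventually_nhds_in_open[of "{..<0}" x] 2 by (auto elim!: eventually_mono)
    ultimately show ?thesis by (subst DERIV_cong_ev[OF refl _ refl, symmetric])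
  next
    case 3
    have "((\<lambda>h. ((max 0 (0 + h))\<^sup>2 - (max 0 0)\<^sup>2) / h) \<longlongrightarrow> (0::real)) (at 0)"
    proof (rule Lim_null_comparison)
      show "\<forall>\<^sub>F h in at 0. norm (((max 0 (0 + h))\<^sup>2 - (max 0 0)\<^sup>2) / h) \<le> \<bar>h\<bar>" for h :: real
        by (intro always_eventually) (auto simp: max_def power2_eq_square)
      show "((\<lambda>h. \<bar>h\<bar>) \<longlongrightarrow> 0) (at (0::real))" by (auto intro!: tendsto_eq_intros)
    qed
    then show ?thesis using 3 by (simp add: DERIV_def)
  qed
qed

text \<open>\<open>C\<^sup>1\<close> functions with support \<open>[s, t]\<close> that increase to the indicator of \<open>(s, t)\<close>.\<close>
definition bump :: "real \<Rightarrow> real \<Rightarrow> nat \<Rightarrow> real \<Rightarrow> real" where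
  "bump s t n x = (let q = real n * ((max 0 (x - s))\<^sup>2 * (max 0 (t - x))\<^sup>2) in q / (1 + q))"

lemma bump_bounds: "0 \<le> bump s t n x" "bump s t n x \<le> 1"
proof -
  have "0 \<le> q \<Longrightarrow> 0 \<le> q / (1 + q) \<and> q / (1 + q) \<le> 1" for q :: real by (simp add: field_simps)
  from this[of "real n * ((max 0 (x - s))\<^sup>2 * (max 0 (t - x))\<^sup>2)"]
  show "0 \<le> bump s t n x" "bump s t n x \<le> 1" unfolding bump_def Let_def by auto
qed

lemma bump_eq_0: "x \<notin> {s<..<t} \<Longrightarrow> bump s t n x = 0"
  by (auto simp: bump_def max_def)

lemma bump_tendsto: "(\<lambda>n. bump s t n x) \<longlonglongrightarrow> indicator {s<..<t} x"
proof (cases "x \<in> {s<..<t}")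
  case True
  define c where "c = (max 0 (x - s))\<^sup>2 * (max 0 (t - x))\<^sup>2"
  have c: "c > 0" using True by (simp add: c_def)
  have "(\<lambda>n. 1 - 1 / (1 + real n * c)) \<longlonglongrightarrow> 1 - 0"
  proof (rule tendsto_diff[OF tendsto_const], rule tendsto_divide_0[OF tendsto_const])
    show "filterlim (\<lambda>n. 1 + real n * c) at_infinity sequentially"
      using c by (intro filterlim_at_top_imp_at_infinity filterlim_tendsto_add_at_top[OF tendsto_const]
          filterlim_at_top_mult_tendsto_pos[OF tendsto_const] filterlim_real_sequentially)
  qed
  moreover have "bump s t n x = 1 - 1 / (1 + real n * c)" for n
  proof -
    have "1 + real n * c > 0" using c by (simp add: add_pos_nonneg)
    then show ?thesis unfolding bump_def Let_def c_def[symmetric] by (simp add: field_simps)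
  qed
  ultimately show ?thesis using True by simp
qed (simp add: bump_eq_0)

lemma bump_C1: "\<exists>D. (\<forall>x. (bump s t n has_real_derivative D x) (at x)) \<and> continuous_on UNIV D"
proof -
  define q where "q x = real n * ((max 0 (x - s))\<^sup>2 * (max 0 (t - x))\<^sup>2)" for x
  define q' where "q' x = real n * (2 * max 0 (x - s) * (max 0 (t - x))\<^sup>2 - (max 0 (x - s))\<^sup>2 * (2 * max 0 (t - x)))" for x
  have q: "(q has_real_derivative q' x) (at x)" for x
  proof -
    have 1: "((\<lambda>x. (max 0 (x - s))\<^sup>2) has_real_derivative 2 * max 0 (x - s) * 1) (at x)"
      by (rule DERIV_chain2[where f = "\<lambda>x. (max 0 x)\<^sup>2", OF DERIV_max0_square]) (auto intro!: derivative_eq_intros)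
    have 2: "((\<lambda>x. (max 0 (t - x))\<^sup>2) has_real_derivative 2 * max 0 (t - x) * (- 1)) (at x)"
      by (rule DERIV_chain2[where f = "\<lambda>x. (max 0 x)\<^sup>2", OF DERIV_max0_square]) (auto intro!: derivative_eq_intros)
    show ?thesis unfolding q_def
      by (rule derivative_eq_intros 1 2 refl)+ (simp add: q'_def algebra_simps)
  qed
  have pos: "1 + q x > 0" for x by (simp add: q_def add_pos_nonneg)
  have b: "bump s t n = (\<lambda>x. q x / (1 + q x))" by (simp add: bump_def q_def Let_def fun_eq_iff)
  have cq: "continuous_on UNIV q" using q by (meson DERIV_continuous continuous_at_imp_continuous_on)
  show ?thesis
  proof (intro exI conjI allI)
    show "(bump s t n has_real_derivative q' x / (1 + q x)\<^sup>2) (at x)" for x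
      unfolding b using pos[of x]
      by (auto intro!: derivative_eq_intros q simp: power2_eq_square field_simps)
    have "1 + q x \<noteq> 0" for x using pos[of x] by simp
    then show "continuous_on UNIV (\<lambda>x. q' x / (1 + q x)\<^sup>2)"
      unfolding q'_def by (auto intro!: continuous_intros cq)
  qed
qed

lemma test_functionI:
  assumes "\<And>x. (\<phi> has_real_derivative D x) (at x)" "continuous_on UNIV D"
    and "\<And>x. x \<notin> {s..t} \<Longrightarrow> \<phi> x = 0" "{s..t} \<subseteq> \<Omega>"
  shows "test_function \<Omega> \<phi>"
  unfolding test_function_def
proof (intro conjI)
  show "\<phi> C1_differentiable_on UNIV"
    unfolding C1_differentiable_on_def
    using assms(1,2) by (auto simp: has_real_derivative_iff_has_vector_derivative)
  have sub: "closure {x. \<phi> x \<noteq> 0} \<subseteq> {s..t}" using assms(3) by (intro closure_minimal) force+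
  then show "closure {x. \<phi> x \<noteq> 0} \<subseteq> \<Omega>" using assms(4) by blast
  show "compact (closure {x. \<phi> x \<noteq> 0})"
    using sub by (simp add: compact_eq_bounded_closed bounded_subset[OF bounded_closed_interval])
qed

lemma bump_test_function: "{s..t} \<subseteq> \<Omega> \<Longrightarrow> test_function \<Omega> (bump s t n)"
  using bump_C1[of s t n] by (auto intro!: test_functionI simp: bump_eq_0)

text \<open>The fundamental lemma of the calculus of variations.\<close>
lemma AE_zero_of_test_functions:
  fixes h :: "real \<Rightarrow> real"
  assumes "open \<Omega>" and h: "locally_integrable \<Omega> h"
    and z: "\<And>s t n. s < t \<Longrightarrow> {s..t} \<subseteq> \<Omega> \<Longrightarrow> (LINT x:\<Omega>|lborel. h x * bump s t n x) = 0"
  shows "AE x in lborel. x \<in> \<Omega> \<longrightarrow> h x = 0"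
proof -
  have "AE x in lborel. x \<in> {p..q} \<longrightarrow> h x = 0" if pq: "{p..q} \<subseteq> \<Omega>" for p q
  proof (rule AE_zero_of_subinterval_integrals)
    show hi: "set_integrable lborel {p..q} h" using h pq by (auto simp: locally_integrable_def)
    fix s t assume st: "p \<le> s" "s < t" "t \<le> q"
    have st': "{s..t} \<subseteq> \<Omega>" using st pq by auto
    have hst: "set_integrable lborel {s..t} h" using h st' by (auto simp: locally_integrable_def)
    have hst': "set_integrable lborel {s<..<t} h" by (rule set_integrable_subset[OF hst]) auto
    have m: "(\<lambda>x. indicator {s<..<t} x *\<^sub>R h x) \<in> borel_measurable borel"
      using hst' by (auto simp: set_integrable_def)
    have [measurable]: "bump s t n \<in> borel_measurable borel" for n
      using bump_C1[of s t n] by (intro borel_measurable_continuous_onI)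
        (meson DERIV_continuous continuous_at_imp_continuous_on)
    have eq: "indicator {s<..<t} x *\<^sub>R h x * bump s t n x = indicator \<Omega> x *\<^sub>R (h x * bump s t n x)" for x n
      using st' bump_eq_0[of x s t n] by (auto simp: indicator_def subset_iff)
    have "(\<lambda>n. LINT x|lborel. indicator {s<..<t} x *\<^sub>R h x * bump s t n x) \<longlonglongrightarrow>
        (LINT x|lborel. indicator {s<..<t} x *\<^sub>R h x)"
    proof (rule integral_dominated_convergence[where w = "\<lambda>x. \<bar>indicator {s<..<t} x *\<^sub>R h x\<bar>"])
      show "AE x in lborel. (\<lambda>n. indicator {s<..<t} x *\<^sub>R h x * bump s t n x) \<longlonglongrightarrow> indicator {s<..<t} x *\<^sub>R h x"
      proof (rule AE_I2)
        fix x
        have "(\<lambda>n. indicator {s<..<t} x *\<^sub>R h x * bump s t n x) \<longlonglongrightarrow> indicator {s<..<t} x *\<^sub>R h x * indicator {s<..<t} x"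
          by (intro tendsto_intros bump_tendsto)
        then show "(\<lambda>n. indicator {s<..<t} x *\<^sub>R h x * bump s t n x) \<longlonglongrightarrow> indicator {s<..<t} x *\<^sub>R h x"
          by (auto simp: indicator_def split: if_splits)
      qed
      show "AE x in lborel. norm (indicator {s<..<t} x *\<^sub>R h x * bump s t n x) \<le> \<bar>indicator {s<..<t} x *\<^sub>R h x\<bar>" for n
      proof (rule AE_I2)
        fix x
        show "norm (indicator {s<..<t} x *\<^sub>R h x * bump s t n x) \<le> \<bar>indicator {s<..<t} x *\<^sub>R h x\<bar>"
          using mult_left_mono[OF bump_bounds(2)[of s t n x], of "\<bar>h x\<bar>"] bump_bounds(1)[of s t n x]
          by (auto simp: indicator_def abs_mult)
      qed
      show "(\<lambda>x. indicator {s<..<t} x *\<^sub>R h x * bump s t n x) \<in> borel_measurable lborel" for n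
        using m by measurable
    qed (use m hst' in \<open>auto simp: set_integrable_def\<close>)
    moreover have "(LINT x|lborel. indicator {s<..<t} x *\<^sub>R h x * bump s t n x) = 0" for n
      using z[OF st(2) st', of n] unfolding eq by (simp add: set_lebesgue_integral_def)
    ultimately show "(LINT y:{s<..<t}|lborel. h y) = 0"
      by (simp add: LIMSEQ_const_iff set_lebesgue_integral_def)
  qed
  then have "AE x in lborel. \<forall>pq \<in> {pq \<in> \<rat> \<times> \<rat>. {fst pq..snd pq} \<subseteq> \<Omega>}. x \<in> {fst pq..snd pq} \<longrightarrow> h x = 0"
    by (subst AE_ball_countable) (auto intro: countable_subset[OF _ countable_SIGMA[OF countable_rat countable_rat]])
  then show ?thesis
  proof eventually_elim
    case (elim x)
    show ?case
    proof
      assume "x \<in> \<Omega>"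
      then obtain e where e: "e > 0" "ball x e \<subseteq> \<Omega>" using assms(1) openE by blast
      obtain p q where pq: "p \<in> \<rat>" "x - e < p" "p < x" "q \<in> \<rat>" "x < q" "q < x + e"
        using Rats_dense_in_real[of "x - e" x] Rats_dense_in_real[of x "x + e"] e(1) by auto
      have "{p..q} \<subseteq> \<Omega>" using pq e(2) by (auto simp: subset_iff dist_real_def abs_less_iff)
      then show "h x = 0" using elim pq by force
    qed
  qed
qed

lemma locally_integrable_mult_continuous:
  assumes g: "locally_integrable \<Omega> g" and st: "{s..t} \<subseteq> \<Omega>"
    and P: "continuous_on UNIV P" "\<And>x. x \<notin> {s..t} \<Longrightarrow> P x = 0"
  shows "set_integrable lborel {s..t} (\<lambda>x. g x * P x)"
    "indicator \<Omega> x *\<^sub>R (g x * P x) = indicator {s..t} x *\<^sub>R (g x * P x)"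
proof -
  show "set_integrable lborel {s..t} (\<lambda>x. g x * P x)"
    using g st continuous_on_subset[OF P(1)]
    by (intro set_integrable_mult_continuous) (auto simp: locally_integrable_def)
  show "indicator \<Omega> x *\<^sub>R (g x * P x) = indicator {s..t} x *\<^sub>R (g x * P x)"
    using subsetD[OF st, of x] P(2)[of x] by (cases "x \<in> {s..t}") (auto simp: indicator_def)
qed

lemma bump_continuous: "continuous_on A (bump s t n)"
proof -
  obtain D where "\<And>x. (bump s t n has_real_derivative D x) (at x)" using bump_C1 by blast
  then show ?thesis by (intro continuous_at_imp_continuous_on ballI) (rule DERIV_isCont)
qed

lemma locally_integrable_mult_bump:
  assumes g: "locally_integrable \<Omega> g" and st: "{s..t} \<subseteq> \<Omega>"
  shows "set_integrable lborel \<Omega> (\<lambda>x. g x * bump s t n x)"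
proof -
  have b0: "bump s t n x = 0" if "x \<notin> {s..t}" for x using that by (intro bump_eq_0) auto
  have i: "set_integrable lborel {s..t} (\<lambda>x. g x * bump s t n x)"
    by (rule locally_integrable_mult_continuous(1)[OF g st bump_continuous]) (rule b0)
  have eq: "indicator \<Omega> x *\<^sub>R (g x * bump s t n x) = indicator {s..t} x *\<^sub>R (g x * bump s t n x)" for x
    by (rule locally_integrable_mult_continuous(2)[OF g st bump_continuous]) (rule b0)
  show ?thesis using i unfolding set_integrable_def eq .
qed

lemma locally_integrable_diff:
  "locally_integrable \<Omega> f \<Longrightarrow> locally_integrable \<Omega> g \<Longrightarrow> locally_integrable \<Omega> (\<lambda>x. f x - g x)"
  by (auto simp: locally_integrable_def)

lemma vanishing_derivative_outside:
  assumes "\<And>x. (\<phi> has_real_derivative D x) (at x)" "closed K" "\<And>x. x \<notin> K \<Longrightarrow> \<phi> x = 0" "x \<notin> K"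
  shows "D x = (0::real)"
proof -
  have "\<forall>\<^sub>F y in nhds x. y \<in> - K" using assms(2,4) by (intro eventually_nhds_in_open) auto
  then have "\<forall>\<^sub>F y in nhds x. 0 = \<phi> y" by eventually_elim (simp add: assms(3))
  moreover have "((\<lambda>x. 0) has_real_derivative 0) (at x)" by simp
  ultimately have "(\<phi> has_real_derivative 0) (at x)" by (subst DERIV_cong_ev[OF refl _ refl, symmetric])
  then show ?thesis using assms(1) DERIV_unique by blast
qed

lemma weak_derivative_unique:
  assumes "open \<Omega>" and wd: "weak_derivative \<Omega> f g" "weak_derivative \<Omega> f' g'"
    and ae: "AE x in lborel. x \<in> \<Omega> \<longrightarrow> f x = f' x"
  shows "AE x in lborel. x \<in> \<Omega> \<longrightarrow> g x = g' x"
proof -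
  have l: "locally_integrable \<Omega> g" "locally_integrable \<Omega> g'" "locally_integrable \<Omega> f" "locally_integrable \<Omega> f'"
    using wd by (auto simp: weak_derivative_def)
  have "AE x in lborel. x \<in> \<Omega> \<longrightarrow> g x - g' x = 0"
  proof (rule AE_zero_of_test_functions[OF assms(1) locally_integrable_diff[OF l(1,2)]])
    fix s t :: real and n assume st: "s < t" "{s..t} \<subseteq> \<Omega>"
    obtain D where D: "\<And>x. (bump s t n has_real_derivative D x) (at x)" "continuous_on UNIV D"
      using bump_C1 by blast
    have dD: "deriv (bump s t n) = D" using D(1) DERIV_imp_deriv by blast
    have D0: "D x = 0" if "x \<notin> {s..t}" for x
      by (rule vanishing_derivative_outside[OF D(1) _ _ that]) (auto intro!: bump_eq_0)
    have i: "set_integrable lborel {s..t} (\<lambda>x. f x * D x)" "set_integrable lborel {s..t} (\<lambda>x. f' x * D x)"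
      by (rule locally_integrable_mult_continuous(1)[OF l(3) st(2) D(2)], erule D0,
        rule locally_integrable_mult_continuous(1)[OF l(4) st(2) D(2)], erule D0)
    have eq: "indicator \<Omega> x *\<^sub>R (f x * D x) = indicator {s..t} x *\<^sub>R (f x * D x)"
      "indicator \<Omega> x *\<^sub>R (f' x * D x) = indicator {s..t} x *\<^sub>R (f' x * D x)" for x
      by (rule locally_integrable_mult_continuous(2)[OF l(3) st(2) D(2)], erule D0,
        rule locally_integrable_mult_continuous(2)[OF l(4) st(2) D(2)], erule D0)
    have "(LINT x:\<Omega>|lborel. f x * D x) = (LINT x:\<Omega>|lborel. f' x * D x)"
      unfolding set_lebesgue_integral_def eq
    proof (rule integral_cong_AE)
      show "AE x in lborel. indicator {s..t} x *\<^sub>R (f x * D x) = indicator {s..t} x *\<^sub>R (f' x * D x)"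
        using ae by eventually_elim (use st(2) in \<open>auto simp: indicator_def\<close>)
    qed (use i in \<open>auto simp: set_integrable_def\<close>)
    moreover have "(LINT x:\<Omega>|lborel. f x * D x) = - (LINT x:\<Omega>|lborel. g x * bump s t n x)"
      "(LINT x:\<Omega>|lborel. f' x * D x) = - (LINT x:\<Omega>|lborel. g' x * bump s t n x)"
      using wd bump_test_function[OF st(2), of n] unfolding weak_derivative_def dD[symmetric] by blast+
    ultimately have "(LINT x:\<Omega>|lborel. g x * bump s t n x) = (LINT x:\<Omega>|lborel. g' x * bump s t n x)"
      by linarith
    then show "(LINT x:\<Omega>|lborel. (g x - g' x) * bump s t n x) = 0"
      using set_integral_diff(2)[OF locally_integrable_mult_bump[OF l(1) st(2), of n]
          locally_integrable_mult_bump[OF l(2) st(2), of n]] by (simp add: left_diff_distrib)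
  qed
  then show ?thesis by eventually_elim auto
qed

text \<open>Integration by parts on one component of the domain; the support condition \<open>l, r \<notin> K\<close> makes
  the boundary terms vanish.\<close>
lemma primitive_test_integral:
  assumes FG: "primitive_on {l<..<r} F G"
    and \<phi>: "\<And>x. (\<phi> has_real_derivative D x) (at x)" "continuous_on UNIV D"
    and K: "compact K" "\<And>x. x \<notin> K \<Longrightarrow> \<phi> x = 0" "l \<notin> K" "r \<notin> K" and "l < r"
  shows "set_integrable lborel {l<..<r} (\<lambda>x. F x * D x)" "set_integrable lborel {l<..<r} (\<lambda>x. G x * \<phi> x)"
    "(LINT x:{l<..<r}|lborel. F x * D x) = - (LINT x:{l<..<r}|lborel. G x * \<phi> x)"
proof -
  have D0: "D x = 0" if "x \<notin> K" for x
    by (rule vanishing_derivative_outside[OF \<phi>(1) compact_imp_closed[OF K(1)] K(2) that])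
  have cK: "compact (K \<inter> {l..r})" using K(1) by (intro compact_Int) auto
  have "\<exists>a b. l < a \<and> a \<le> b \<and> b < r \<and> K \<inter> {l..r} \<subseteq> {a<..<b}"
  proof (cases "K \<inter> {l..r} = {}")
    case True
    then show ?thesis using \<open>l < r\<close> by (intro exI[of _ "(l + r) / 2"]) auto
  next
    case False
    obtain p where p: "p \<in> K \<inter> {l..r}" "\<And>x. x \<in> K \<inter> {l..r} \<Longrightarrow> p \<le> x"
      using compact_attains_inf[OF cK False] by blast
    obtain q where q: "q \<in> K \<inter> {l..r}" "\<And>x. x \<in> K \<inter> {l..r} \<Longrightarrow> x \<le> q"
      using compact_attains_sup[OF cK False] by blast
    have "p \<noteq> l" "q \<noteq> r" using p(1) q(1) K(3,4) by auto
    then have pq: "l < p" "q < r" "p \<le> q" using p q by auto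
    have "K \<inter> {l..r} \<subseteq> {(l + p) / 2<..<(q + r) / 2}"
    proof
      fix x assume "x \<in> K \<inter> {l..r}"
      then have "p \<le> x" "x \<le> q" using p(2) q(2) by auto
      then show "x \<in> {(l + p) / 2<..<(q + r) / 2}" using pq by (auto simp: field_simps)
    qed
    moreover have "l < (l + p) / 2" "(l + p) / 2 \<le> (q + r) / 2" "(q + r) / 2 < r"
      using pq by auto
    ultimately show ?thesis by blast
  qed
  then obtain a b where ab: "l < a" "a \<le> b" "b < r" "K \<inter> {l..r} \<subseteq> {a<..<b}" by blast
  have s: "{a..b} \<subseteq> {l<..<r}" using ab by auto
  have nK: "x \<notin> K" if "x \<in> {l<..<r}" "x \<notin> {a<..<b}" for x using that ab(4) by force
  have cF: "continuous_on {a..b} F" by (rule primitive_on_continuous[OF FG s])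
  have c\<phi>: "continuous_on {a..b} \<phi>"
    by (intro continuous_at_imp_continuous_on ballI) (rule DERIV_isCont[OF \<phi>(1)])
  have cD: "continuous_on {a..b} D" using \<phi>(2) continuous_on_subset by blast
  have i1: "set_integrable lborel {a..b} (\<lambda>x. F x * D x)"
    by (intro set_integrable_lborel_continuous continuous_intros cF cD)
  have i2: "set_integrable lborel {a..b} (\<lambda>x. G x * \<phi> x)"
    by (rule set_integrable_mult_continuous[OF primitive_onD(1)[OF FG ab(2) s] c\<phi>])
  have e1: "indicator {l<..<r} x *\<^sub>R (F x * D x) = indicator {a..b} x *\<^sub>R (F x * D x)" for x
    using subsetD[OF s, of x] nK[of x] D0[of x] by (cases "x \<in> {a<..<b}") (auto simp: indicator_def)
  have e2: "indicator {l<..<r} x *\<^sub>R (G x * \<phi> x) = indicator {a..b} x *\<^sub>R (G x * \<phi> x)" for x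
    using subsetD[OF s, of x] nK[of x] K(2)[of x] by (cases "x \<in> {a<..<b}") (auto simp: indicator_def)
  show "set_integrable lborel {l<..<r} (\<lambda>x. F x * D x)" "set_integrable lborel {l<..<r} (\<lambda>x. G x * \<phi> x)"
    using i1 i2 unfolding set_integrable_def e1 e2 by auto
  have "primitive_on {a..b} \<phi> D"
    using \<phi>(1) by (intro primitive_on_C1 cD) (rule has_field_derivative_at_within)
  from primitive_on_mult[OF primitive_on_subset[OF FG s] this]
  have "primitive_on {a..b} (\<lambda>x. F x * \<phi> x) (\<lambda>x. G x * \<phi> x + F x * D x)" .
  from primitive_onD(2)[OF this ab(2)]
  have "integral {a..b} (\<lambda>x. G x * \<phi> x + F x * D x) = 0"
    using K(2)[OF nK[of a]] K(2)[OF nK[of b]] ab by simp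
  moreover have "integral {a..b} (\<lambda>x. G x * \<phi> x + F x * D x)
      = (LINT x:{a..b}|lborel. G x * \<phi> x) + (LINT x:{a..b}|lborel. F x * D x)"
    using set_integral_add[OF i2 i1] set_borel_integral_eq_integral(2) by metis
  ultimately show "(LINT x:{l<..<r}|lborel. F x * D x) = - (LINT x:{l<..<r}|lborel. G x * \<phi> x)"
    unfolding set_lebesgue_integral_def e1 e2 by simp
qed

lemma primitive_on_locally_integrable:
  assumes FG: "primitive_on {l<..<r} F G" and K: "compact K" "K \<subseteq> {l<..<r}"
  shows "set_integrable lborel K F" "set_integrable lborel K G"
proof -
  have "set_integrable lborel K F \<and> set_integrable lborel K G"
  proof (cases "K = {}")
    case True
    then show ?thesis by (simp add: set_integrable_def)
  next
    case False
    obtain p where p: "p \<in> K" "\<And>x. x \<in> K \<Longrightarrow> p \<le> x" using compact_attains_inf[OF K(1) False] by blast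
    obtain q where q: "q \<in> K" "\<And>x. x \<in> K \<Longrightarrow> x \<le> q" using compact_attains_sup[OF K(1) False] by blast
    have "p \<in> {l<..<r}" "q \<in> {l<..<r}" using p(1) q(1) K(2) by auto
    then have pq: "p \<le> q" "{p..q} \<subseteq> {l<..<r}" "K \<subseteq> {p..q}" using p q by auto
    have "K \<in> sets lborel" using K(1) by (simp add: compact_imp_closed)
    then show ?thesis
      using set_integrable_subset[OF set_integrable_lborel_continuous[OF primitive_on_continuous[OF FG pq(2)]]]
        set_integrable_subset[OF primitive_onD(1)[OF FG pq(1,2)]] pq(3) by blast
  qed
  then show "set_integrable lborel K F" "set_integrable lborel K G" by auto
qed

lemma test_functionE:
  assumes "test_function \<Omega> \<phi>"
  obtains D K where "\<And>x. (\<phi> has_real_derivative D x) (at x)" "continuous_on UNIV D" "deriv \<phi> = D"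
    "compact K" "K \<subseteq> \<Omega>" "\<And>x. x \<notin> K \<Longrightarrow> \<phi> x = 0"
proof -
  obtain D where D: "\<And>x. (\<phi> has_real_derivative D x) (at x)" "continuous_on UNIV D"
    using assms by (auto simp: test_function_def C1_differentiable_on_def has_real_derivative_iff_has_vector_derivative)
  moreover have "deriv \<phi> = D" using D(1) DERIV_imp_deriv by blast
  moreover have "compact (closure {x. \<phi> x \<noteq> 0})" "closure {x. \<phi> x \<noteq> 0} \<subseteq> \<Omega>"
    using assms by (auto simp: test_function_def)
  moreover have "\<phi> x = 0" if "x \<notin> closure {x. \<phi> x \<noteq> 0}" for x
    using that closure_subset[of "{x. \<phi> x \<noteq> 0}"] by blast
  ultimately show thesis by (rule that)
qed

lemma weak_derivative_of_primitive:
  assumes FG: "primitive_on {l<..<r} F G" and "l < r"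
  shows "weak_derivative {l<..<r} F G"
  unfolding weak_derivative_def
proof (intro conjI allI impI)
  show "locally_integrable {l<..<r} F" "locally_integrable {l<..<r} G"
    using primitive_on_locally_integrable[OF FG] by (auto simp: locally_integrable_def)
  fix \<phi> assume "test_function {l<..<r} \<phi>"
  then obtain D K where D: "\<And>x. (\<phi> has_real_derivative D x) (at x)" "continuous_on UNIV D" "deriv \<phi> = D"
    "compact K" "K \<subseteq> {l<..<r}" "\<And>x. x \<notin> K \<Longrightarrow> \<phi> x = 0" by (rule test_functionE) blast
  then show "(LINT x:{l<..<r}|lborel. F x * deriv \<phi> x) = - (LINT x:{l<..<r}|lborel. G x * \<phi> x)"
    using primitive_test_integral(3)[OF FG D(1,2,4,6) _ _ \<open>l < r\<close>] by fastforce
qed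

lemma weak_derivative_of_primitive_punctured:
  assumes F1: "primitive_on {l<..<m} F G" and F2: "primitive_on {m<..<r} F G" and "l < m" "m < r"
  shows "weak_derivative ({l<..<r} - {m}) F G"
proof -
  have U: "{l<..<r} - {m} = {l<..<m} \<union> {m<..<r}" using assms(3,4) by auto
  show ?thesis
    unfolding weak_derivative_def U
  proof (intro conjI allI impI)
    have "set_integrable lborel K F \<and> set_integrable lborel K G"
      if K: "compact K" "K \<subseteq> {l<..<m} \<union> {m<..<r}" for K
    proof -
      have "m \<notin> K" using K(2) by auto
      have "K \<inter> {..<m} = K \<inter> {..m}" "K \<inter> {m<..} = K \<inter> {m..}"
        using \<open>m \<notin> K\<close> by (auto simp: less_le)
      then have c: "compact (K \<inter> {..<m})" "compact (K \<inter> {m<..})"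
        using compact_Int_closed[OF K(1) closed_atMost] compact_Int_closed[OF K(1) closed_atLeast] by auto
      have s: "K \<inter> {..<m} \<subseteq> {l<..<m}" "K \<inter> {m<..} \<subseteq> {m<..<r}" using K(2) by auto
      have eq: "K = (K \<inter> {..<m}) \<union> (K \<inter> {m<..})" using \<open>m \<notin> K\<close> by (auto simp: less_le)
      have "K \<inter> {..<m} \<in> sets lborel" "K \<inter> {m<..} \<in> sets lborel"
        using c by (simp_all add: compact_imp_closed)
      then show ?thesis
        using primitive_on_locally_integrable[OF F1 c(1) s(1)]
          primitive_on_locally_integrable[OF F2 c(2) s(2)]
        by (subst (1 2) eq) (auto intro: set_integrable_Un)
    qed
    then show "locally_integrable ({l<..<m} \<union> {m<..<r}) F" "locally_integrable ({l<..<m} \<union> {m<..<r}) G"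
      by (auto simp: locally_integrable_def)
    fix \<phi> assume "test_function ({l<..<m} \<union> {m<..<r}) \<phi>"
    then obtain D K where D: "\<And>x. (\<phi> has_real_derivative D x) (at x)" "continuous_on UNIV D" "deriv \<phi> = D"
      "compact K" "K \<subseteq> {l<..<m} \<union> {m<..<r}" "\<And>x. x \<notin> K \<Longrightarrow> \<phi> x = 0" by (rule test_functionE) blast
    have "l \<notin> K" "m \<notin> K" "r \<notin> K" using D(5) assms(3,4) by auto
    then have 1: "set_integrable lborel {l<..<m} (\<lambda>x. F x * D x)" "set_integrable lborel {l<..<m} (\<lambda>x. G x * \<phi> x)"
      "(LINT x:{l<..<m}|lborel. F x * D x) = - (LINT x:{l<..<m}|lborel. G x * \<phi> x)"
      and 2: "set_integrable lborel {m<..<r} (\<lambda>x. F x * D x)" "set_integrable lborel {m<..<r} (\<lambda>x. G x * \<phi> x)"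
      "(LINT x:{m<..<r}|lborel. F x * D x) = - (LINT x:{m<..<r}|lborel. G x * \<phi> x)"
      using primitive_test_integral[OF F1 D(1,2,4,6) _ _ \<open>l < m\<close>]
        primitive_test_integral[OF F2 D(1,2,4,6) _ _ \<open>m < r\<close>] by auto
    have "{l<..<m} \<inter> {m<..<r} = {}" by auto
    then show "(LINT x:{l<..<m} \<union> {m<..<r}|lborel. F x * deriv \<phi> x)
        = - (LINT x:{l<..<m} \<union> {m<..<r}|lborel. G x * \<phi> x)"
      using set_integral_Un[OF _ 1(1) 2(1)] set_integral_Un[OF _ 1(2) 2(2)] 1(3) 2(3) D(3) by simp
  qed
qed

text \<open>Du Bois-Reymond: a test function \<open>\<psi>\<close> is a derivative of a test function up to a multiple of
  a fixed \<open>\<eta>\<close>, so testing \<open>f\<close> minus a primitive of \<open>g\<close> against \<open>\<psi>\<close> only sees the integral of \<open>\<psi>\<close>.\<close>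
lemma primitive_of_weak_derivative:
  assumes wd: "weak_derivative {-1<..<1} f g" and g: "set_integrable lborel {-1..1} g"
  shows "\<exists>c. AE x in lborel. x \<in> {-1<..<1} \<longrightarrow> f x = c + integral {-1..x} g"
proof -
  define I :: "real set" where "I = {-1<..<1}"
  define F where "F x = integral {-1..x} g" for x
  have pF: "primitive_on {-1..1} F g" unfolding F_def by (rule primitive_on_indefinite[OF g])
  have wF: "weak_derivative I F g"
    unfolding I_def by (rule weak_derivative_of_primitive[OF primitive_on_subset[OF pF]]) auto
  have lf: "locally_integrable I f" and lF: "locally_integrable I F"
    using wd wF by (auto simp: weak_derivative_def I_def)
  define \<eta> where "\<eta> = bump (-1/2) (1/2) 1"
  have one: "locally_integrable I (\<lambda>x. 1)"
    unfolding locally_integrable_def using borel_integrable_compact[of _ "\<lambda>x. 1 :: real"]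
    by (auto simp: set_integrable_def)
  have bi: "set_integrable lborel I (bump s t n)" if "{s..t} \<subseteq> I" for s t n
    using locally_integrable_mult_bump[OF one that, of n] by simp
  have sub\<eta>: "{-1/2..1/2} \<subseteq> I" by (auto simp: I_def)
  define m where "m = (LINT x:I|lborel. \<eta> x)"
  have "m \<noteq> 0"
  proof
    assume "m = 0"
    then have "AE x in lborel. indicator I x *\<^sub>R \<eta> x = 0"
      using bi[OF sub\<eta>, of 1] unfolding m_def set_lebesgue_integral_def set_integrable_def \<eta>_def
      by (subst (asm) integral_nonneg_eq_0_iff_AE) (auto simp: bump_bounds)
    moreover have "indicator I x *\<^sub>R \<eta> x \<noteq> 0" if "x \<in> {-1/2<..<1/2}" for x
    proof -
      define q where "q = real 1 * ((max 0 (x - (-1/2)))\<^sup>2 * (max 0 (1/2 - x))\<^sup>2)"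
      have "q > 0" using that by (simp add: q_def)
      then have "q / (1 + q) > 0" by simp
      moreover have "\<eta> x = q / (1 + q)" by (simp only: \<eta>_def bump_def Let_def q_def of_nat_1)
      moreover have "x \<in> I" using that by (auto simp: I_def)
      ultimately show ?thesis using \<open>q > 0\<close> by simp
    qed
    ultimately have "AE x in lborel. x \<notin> {-1/2<..<1/2::real}" by (elim AE_mp) auto
    then have "emeasure lborel {-1/2<..<1/2::real} = 0"
      by (subst (asm) AE_iff_measurable[OF _ refl]) (auto simp: greaterThanLessThan_def lessThan_def greaterThan_def Collect_conj_eq Int_commute)
    then show False by simp
  qed
  define C where "C = ((LINT x:I|lborel. f x * \<eta> x) - (LINT x:I|lborel. F x * \<eta> x)) / m"
  have "AE x in lborel. x \<in> I \<longrightarrow> f x - F x - C = 0"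
  proof (rule AE_zero_of_test_functions)
    show "open I" by (simp add: I_def)
    show "locally_integrable I (\<lambda>x. f x - F x - C)"
      using locally_integrable_diff[OF locally_integrable_diff[OF lf lF], of "\<lambda>x. C"] one
      by (simp add: locally_integrable_def set_integrable_def)
    fix s t :: real and n assume st: "s < t" "{s..t} \<subseteq> I"
    define \<psi> where "\<psi> = bump s t n"
    define k where "k = (LINT x:I|lborel. \<psi> x) / m"
    define \<kappa> where "\<kappa> x = \<psi> x - k * \<eta> x" for x
    define a b where "a = min s (-1/2)" and "b = max t (1/2)"
    have st': "-1 < s" "t < 1" using st by (auto simp: I_def subset_iff)
    then have ab: "-1 < a" "b < 1" "a \<le> b" using st(1) by (auto simp: a_def b_def)
    have \<kappa>0: "\<kappa> x = 0" if "x \<notin> {a..b}" for x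
    proof -
      have "x \<notin> {s<..<t}" "x \<notin> {-1/2<..<1/2}" using that by (auto simp: a_def b_def)
      then show ?thesis unfolding \<kappa>_def \<psi>_def \<eta>_def by (subst (1 2) bump_eq_0) auto
    qed
    have c\<kappa>: "continuous_on A \<kappa>" for A
      unfolding \<kappa>_def \<psi>_def \<eta>_def by (intro continuous_intros bump_continuous)
    have \<kappa>I: "(LINT x:I|lborel. \<kappa> x) = 0"
    proof -
      have "(LINT x:I|lborel. \<kappa> x) = (LINT x:I|lborel. \<psi> x) - k * m"
        unfolding \<kappa>_def m_def using bi[OF st(2), of n] bi[OF sub\<eta>, of 1]
        by (simp add: \<psi>_def \<eta>_def)
      then show ?thesis using \<open>m \<noteq> 0\<close> by (simp add: k_def)
    qed
    define \<phi> where "\<phi> x = integral {-2..x} \<kappa>" for x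
    have \<phi>0: "\<phi> x = 0" if "x \<notin> {a..b}" for x
    proof (cases "x < a")
      case True
      have "integral {-2..x} \<kappa> = integral {-2..x} (\<lambda>x. 0)"
        by (rule integral_cong) (use True \<kappa>0 in auto)
      then show ?thesis by (simp add: \<phi>_def)
    next
      case False
      then have xb: "x > b" using that by auto
      have ind: "indicator {-2..x} y *\<^sub>R \<kappa> y = indicator I y *\<^sub>R \<kappa> y" for y
        using \<kappa>0[of y] ab xb by (auto simp: indicator_def I_def)
      have "(LINT y:{-2..x}|lborel. \<kappa> y) = 0" using \<kappa>I unfolding set_lebesgue_integral_def ind .
      then show ?thesis
        using set_borel_integral_eq_integral(2)[OF set_integrable_lborel_continuous[OF c\<kappa>], of "-2" x]
        by (simp add: \<phi>_def)
    qed
    have d\<phi>: "(\<phi> has_real_derivative \<kappa> x) (at x)" for x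
    proof (cases "x < -1")
      case True
      have "\<forall>\<^sub>F y in nhds x. y \<in> {..<-1}" using True by (intro eventually_nhds_in_open) auto
      then have "\<forall>\<^sub>F y in nhds x. 0 = \<phi> y" by eventually_elim (use \<phi>0 ab in auto)
      moreover have "((\<lambda>x. 0) has_real_derivative \<kappa> x) (at x)" using \<kappa>0[of x] True ab by simp
      ultimately show ?thesis by (subst DERIV_cong_ev[OF refl _ refl, symmetric])
    next
      case False
      have "(\<phi> has_real_derivative \<kappa> x) (at x within {-2..x+1})"
        unfolding \<phi>_def using False by (intro integral_has_real_derivative c\<kappa>) auto
      then show ?thesis using False by (simp add: at_within_Icc_at)
    qed
    have test: "test_function I \<phi>"
      by (rule test_functionI[OF d\<phi> c\<kappa> \<phi>0]) (use ab in \<open>auto simp: I_def\<close>)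
    have der: "deriv \<phi> = \<kappa>" using d\<phi> DERIV_imp_deriv by blast
    have split: "(LINT x:I|lborel. p x * \<kappa> x) = (LINT x:I|lborel. p x * \<psi> x) - k * (LINT x:I|lborel. p x * \<eta> x)"
      if p: "locally_integrable I p" for p
    proof -
      have i: "set_integrable lborel I (\<lambda>x. p x * \<psi> x)" "set_integrable lborel I (\<lambda>x. p x * \<eta> x)"
        unfolding \<psi>_def \<eta>_def by (rule locally_integrable_mult_bump[OF p] st(2) sub\<eta>)+
      have "(LINT x:I|lborel. p x * \<kappa> x) = (LINT x:I|lborel. p x * \<psi> x - k * (p x * \<eta> x))"
        by (simp add: \<kappa>_def algebra_simps)
      also have "\<dots> = (LINT x:I|lborel. p x * \<psi> x) - (LINT x:I|lborel. k * (p x * \<eta> x))"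
        using i by (intro set_integral_diff(2)) auto
      finally show ?thesis by simp
    qed
    have "(LINT x:I|lborel. f x * \<kappa> x) = (LINT x:I|lborel. F x * \<kappa> x)"
      using wd wF test der unfolding weak_derivative_def I_def by metis
    then have "(LINT x:I|lborel. f x * \<psi> x) - (LINT x:I|lborel. F x * \<psi> x) = k * (C * m)"
      using split[OF lf] split[OF lF] \<open>m \<noteq> 0\<close> by (simp add: C_def right_diff_distrib)
    also have "k * (C * m) = C * (LINT x:I|lborel. \<psi> x)" using \<open>m \<noteq> 0\<close> by (simp add: k_def)
    finally have eq: "(LINT x:I|lborel. f x * \<psi> x) - (LINT x:I|lborel. F x * \<psi> x) = C * (LINT x:I|lborel. \<psi> x)" .
    have i: "set_integrable lborel I (\<lambda>x. f x * \<psi> x)" "set_integrable lborel I (\<lambda>x. F x * \<psi> x)"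
      "set_integrable lborel I (\<lambda>x. C * \<psi> x)"
      unfolding \<psi>_def by (rule locally_integrable_mult_bump lf lF st(2) bi set_integrable_mult_right impI)+
    have "(LINT x:I|lborel. (f x - F x - C) * \<psi> x)
        = (LINT x:I|lborel. f x * \<psi> x - F x * \<psi> x - C * \<psi> x)" by (simp add: algebra_simps)
    also have "\<dots> = (LINT x:I|lborel. f x * \<psi> x) - (LINT x:I|lborel. F x * \<psi> x) - (LINT x:I|lborel. C * \<psi> x)"
      using set_integral_diff[OF set_integral_diff(1)[OF i(1,2)] i(3)] set_integral_diff(2)[OF i(1,2)] by simp
    finally show "(LINT x:I|lborel. (f x - F x - C) * bump s t n x) = 0" using eq by (simp add: \<psi>_def)
  qed
  then show ?thesis unfolding I_def F_def by (intro exI[of _ C]) (elim AE_mp, auto)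
qed


section \<open>Half-line representatives and moments\<close>

lemma AE_I11: "(AE x in I11. P x) \<longleftrightarrow> (AE x in lborel. x \<in> {-1<..<1} \<longrightarrow> P x)"
  unfolding I11_def by (rule AE_restrict_space_iff) simp

lemma integrable_I11: "integrable I11 (f :: real \<Rightarrow> real) \<longleftrightarrow> set_integrable lborel {-1<..<1} f"
  unfolding I11_def set_integrable_def by (rule integrable_restrict_space) simp

lemma integral_I11: "(\<integral>x. (f :: real \<Rightarrow> real) x \<partial>I11) = (LINT x:{-1<..<1}|lborel. f x)"
  unfolding I11_def set_lebesgue_integral_def by (rule integral_restrict_space) simp

lemma measurable_I11: "(f :: real \<Rightarrow> real) \<in> borel_measurable I11 \<longleftrightarrow> (\<lambda>x. indicator {-1<..<1} x * f x) \<in> borel_measurable borel"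
  unfolding I11_def by (subst borel_measurable_restrict_space_iff) auto

text \<open>A Borel representative on the whole line, vanishing outside the interval.\<close>
definition rep0 :: "L2 \<Rightarrow> real \<Rightarrow> real" where "rep0 g x = indicator {-1<..<1} x * rep_L2 g x"

lemma rep0_measurable [measurable]: "rep0 g \<in> borel_measurable borel"
  using square_integrable_rep_L2[of g] unfolding square_integrable_def measurable_I11 rep0_def by simp

lemma rep0_mult_integrable: "integrable lborel (\<lambda>x. rep0 g x * rep0 h x)"
proof -
  have "integrable I11 (\<lambda>x. rep_L2 g x * rep_L2 h x)"
    by (rule square_integrable_mult[OF square_integrable_rep_L2 square_integrable_rep_L2])
  moreover have "(\<lambda>x. indicator {-1<..<1} x *\<^sub>R (rep_L2 g x * rep_L2 h x)) = (\<lambda>x. rep0 g x * rep0 h x)"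
    by (auto simp: rep0_def indicator_def fun_eq_iff)
  ultimately show ?thesis by (simp add: integrable_I11 set_integrable_def)
qed

lemma square_integrable_rep0: "square_integrable I11 (rep0 g)"
  using rep0_mult_integrable[of g g] integrable_mult_indicator[OF _ rep0_mult_integrable[of g g], of "{-1<..<1}"]
  by (simp add: square_integrable_def borel_measurable_I11 integrable_I11 set_integrable_def power2_eq_square)

lemma AE_rep0: "AE x in I11. rep0 g x = rep_L2 g x"
  unfolding AE_I11 by (auto simp: rep0_def)

lemma L2_of_rep0: "L2_of (rep0 g) = g"
  using L2_of_eqI[OF square_integrable_rep0 square_integrable_rep_L2 AE_rep0] by (simp add: L2_of_rep_L2)

lemma inner_L2_of:
  assumes "square_integrable I11 f" "square_integrable I11 g"
  shows "inner (L2_of f) (L2_of g) = (\<integral>x. f x * g x \<partial>I11)"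
  using assms by (simp add: L2_of_def inner_L2.abs_eq)

lemma inner_rep0: "inner g (L2_of F) = (\<integral>x. rep0 g x * F x \<partial>I11)" if "square_integrable I11 F"
  using inner_L2_of[OF square_integrable_rep0 that, of g] by (simp add: L2_of_rep0)

lemma L2_eqI: "(AE x in lborel. x \<in> {-1<..<1} \<longrightarrow> rep0 f x = rep0 g x) \<Longrightarrow> f = g"
  using L2_of_eqI[OF square_integrable_rep0 square_integrable_rep0, of f g] by (simp add: AE_I11 L2_of_rep0)

lemma rep0_L2_of:
  assumes "square_integrable I11 F"
  shows "AE x in lborel. x \<in> {-1<..<1} \<longrightarrow> rep0 (L2_of F) x = F x"
  using rep_L2_of[OF assms] unfolding AE_I11 by eventually_elim (simp add: rep0_def)

lemma integral_I11_split:
  fixes f :: "real \<Rightarrow> real"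
  assumes f: "integrable I11 f"
  shows "set_integrable lborel {0<..<1} f" "set_integrable lborel {0<..<1} (\<lambda>x. f (- x))"
    "(\<integral>x. f x \<partial>I11) = (LINT x:{0<..<1}|lborel. f x) + (LINT x:{0<..<1}|lborel. f (- x))"
proof -
  have f': "set_integrable lborel {-1<..<1} f" using f by (simp add: integrable_I11)
  show p: "set_integrable lborel {0<..<1} f" by (rule set_integrable_subset[OF f']) auto
  have n: "set_integrable lborel {-1<..<0} f" by (rule set_integrable_subset[OF f']) auto
  have r: "indicator {-1<..<0} (- x) * f (- x) = indicator {0<..<1} x * f (- x)" for x :: real
    by (auto simp: indicator_def)
  show "set_integrable lborel {0<..<1} (\<lambda>x. f (- x))"
    using lborel_integrable_real_affine[of "\<lambda>x. indicator {-1<..<0} x *\<^sub>R f x" "-1" 0] n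
    by (simp add: set_integrable_def flip: r)
  have rn: "(LINT x:{-1<..<0}|lborel. f x) = (LINT x:{0<..<1}|lborel. f (- x))"
    using lborel_integral_real_affine[of "-1" "\<lambda>x. indicator {-1<..<0} x *\<^sub>R f x" 0]
    by (simp add: set_lebesgue_integral_def flip: r)
  have "(LINT x:{-1<..<1}|lborel. f x) = (LINT x:{-1<..<0} \<union> {0<..<1}|lborel. f x)"
    unfolding set_lebesgue_integral_def
  proof (rule integral_cong_AE)
    show "AE x in lborel. indicator {-1<..<1} x *\<^sub>R f x = indicator ({-1<..<0} \<union> {0<..<1}) x *\<^sub>R f x"
      using AE_lborel_singleton[of 0] by eventually_elim (auto simp: indicator_def)
    show "(\<lambda>x. indicator {-1<..<1} x *\<^sub>R f x) \<in> borel_measurable lborel"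
      using f' by (auto simp: set_integrable_def)
    show "(\<lambda>x. indicator ({-1<..<0} \<union> {0<..<1}) x *\<^sub>R f x) \<in> borel_measurable lborel"
      using set_integrable_Un[OF n p] by (auto simp: set_integrable_def)
  qed
  also have "\<dots> = (LINT x:{-1<..<0}|lborel. f x) + (LINT x:{0<..<1}|lborel. f x)"
    by (rule set_integral_Un[OF _ n p]) auto
  finally show "(\<integral>x. f x \<partial>I11) = (LINT x:{0<..<1}|lborel. f x) + (LINT x:{0<..<1}|lborel. f (- x))"
    by (simp add: integral_I11 rn)
qed

lemma powr_set_integrable:
  fixes a c :: real
  assumes "a > -1" "c \<ge> 0"
  shows "set_integrable lborel {0..c} (\<lambda>x. x powr a)" "(LINT x:{0..c}|lborel. x powr a) = c powr (a + 1) / (a + 1)"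
proof -
  have h: "((\<lambda>x. x powr a) has_integral c powr (a + 1) / (a + 1)) {0..c}"
    by (rule has_integral_powr_from_0[OF assms])
  then have "(\<lambda>x. x powr a) absolutely_integrable_on {0..c}"
    by (intro nonnegative_absolutely_integrable_1) (auto simp: has_integral_integrable)
  then have "integrable lborel (\<lambda>x. indicator {0..c} x *\<^sub>R x powr a)"
    unfolding set_integrable_def by (subst (asm) integrable_completion) auto
  then show i: "set_integrable lborel {0..c} (\<lambda>x. x powr a)" by (simp add: set_integrable_def)
  show "(LINT x:{0..c}|lborel. x powr a) = c powr (a + 1) / (a + 1)"
    using set_borel_integral_eq_integral(2)[OF i] h by (simp add: integral_unique)
qed

lemma integral_unit_scale:
  fixes f :: "real \<Rightarrow> real"
  assumes "\<sigma> \<in> {1, -1 :: real}"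
  shows "(LINT z|lborel. f (\<sigma> * z)) = (LINT z|lborel. f z)"
    "integrable lborel (\<lambda>z. f (\<sigma> * z)) \<longleftrightarrow> integrable lborel f"
  using assms lborel_integral_real_affine[of \<sigma> f 0] lborel_integrable_real_affine_iff[of \<sigma> f 0] by auto

text \<open>The power \<open>y\<^sup>p\<close> on \<open>(0, x)\<close>, placed on the side \<open>\<sigma>\<close> of the singularity.\<close>
definition side_power :: "real \<Rightarrow> real \<Rightarrow> real \<Rightarrow> real \<Rightarrow> real" where
  "side_power p \<sigma> x z = indicator {0<..<x} (\<sigma> * z) * (\<sigma> * z) powr p"

lemma side_power_measurable [measurable]: "side_power p \<sigma> x \<in> borel_measurable borel"
  unfolding side_power_def by measurable

lemma side_power_support: "x \<le> 1 \<Longrightarrow> \<sigma> \<in> {1, -1} \<Longrightarrow> z \<notin> {-1<..<1} \<Longrightarrow> side_power p \<sigma> x z = 0"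
  by (auto simp: side_power_def indicator_def)

lemma LINT_open_closed:
  fixes f :: "real \<Rightarrow> real"
  assumes "set_integrable lborel {a..b} f"
  shows "(LINT y|lborel. indicator {a<..<b} y * f y) = (LINT y:{a..b}|lborel. f y)"
    "integrable lborel (\<lambda>y. indicator {a<..<b} y * f y)"
proof -
  have i: "set_integrable lborel {a<..<b} f" by (rule set_integrable_subset[OF assms]) auto
  then show "integrable lborel (\<lambda>y. indicator {a<..<b} y * f y)" by (simp add: set_integrable_def)
  show "(LINT y|lborel. indicator {a<..<b} y * f y) = (LINT y:{a..b}|lborel. f y)"
    unfolding set_lebesgue_integral_def
  proof (rule integral_cong_AE)
    show "AE y in lborel. indicator {a<..<b} y * f y = indicator {a..b} y *\<^sub>R f y"
      using AE_lborel_singleton[of a] AE_lborel_singleton[of b] by eventually_elim (auto simp: indicator_def)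
  qed (use i assms in \<open>auto simp: set_integrable_def\<close>)
qed

lemma side_power_L2:
  assumes "p > -1/2" "0 \<le> x" "x \<le> 1" "\<sigma> \<in> {1, -1}"
  shows "square_integrable I11 (side_power p \<sigma> x)"
    "(norm (L2_of (side_power p \<sigma> x)))\<^sup>2 = x powr (2 * p + 1) / (2 * p + 1)"
proof -
  define f where "f = (\<lambda>z::real. indicator {0<..<x} z * z powr (2 * p))"
  have sq: "(side_power p \<sigma> x z)\<^sup>2 = f (\<sigma> * z)" for z
    by (auto simp: side_power_def f_def indicator_def power2_eq_square simp flip: powr_add)
  have ind: "indicator {-1<..<1} z *\<^sub>R (side_power p \<sigma> x z)\<^sup>2 = f (\<sigma> * z)" for z
    using side_power_support[OF assms(3,4), of z p] unfolding sq[symmetric] by (auto simp: indicator_def)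
  have pw: "set_integrable lborel {0..x} (\<lambda>z. z powr (2 * p))"
    "(LINT z:{0..x}|lborel. z powr (2 * p)) = x powr (2 * p + 1) / (2 * p + 1)"
    using powr_set_integrable[of "2 * p" x] assms by auto
  have "integrable lborel f" "(LINT z|lborel. f z) = x powr (2 * p + 1) / (2 * p + 1)"
    using LINT_open_closed[OF pw(1)] pw(2) by (simp_all add: f_def)
  then have i: "integrable lborel (\<lambda>z. f (\<sigma> * z))" "(LINT z|lborel. f (\<sigma> * z)) = x powr (2 * p + 1) / (2 * p + 1)"
    using integral_unit_scale[OF assms(4), of f] by auto
  then show s: "square_integrable I11 (side_power p \<sigma> x)"
    by (simp add: square_integrable_def borel_measurable_I11 integrable_I11 set_integrable_def ind[simplified])
  show "(norm (L2_of (side_power p \<sigma> x)))\<^sup>2 = x powr (2 * p + 1) / (2 * p + 1)"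
    using i(2) by (simp add: norm_L2_of[OF s] integral_I11 set_lebesgue_integral_def ind[simplified])
qed

text \<open>For \<open>p \<in> {1/2 + \<nu>, 1/2 - \<nu>}\<close> these are the integrals against homogeneous solutions in the variation of
  parameters; \<open>p = 0\<close> and \<open>p = 1\<close> occur in double primitives.\<close>
definition moment :: "real \<Rightarrow> real \<Rightarrow> L2 \<Rightarrow> real \<Rightarrow> real" where
  "moment p \<sigma> g x = integral {0..x} (\<lambda>y. y powr p * rep0 g (\<sigma> * y))"

lemma side_product_integrable:
  assumes "p > -1/2" "\<sigma> \<in> {1, -1}"
  shows "set_integrable lborel {0..1} (\<lambda>y. y powr p * rep0 g (\<sigma> * y))"
proof -
  have "integrable I11 (\<lambda>z. side_power p \<sigma> 1 z * rep0 g z)"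
    using assms by (intro square_integrable_mult side_power_L2(1) square_integrable_rep0) auto
  moreover have eq: "indicator {-1<..<1} z *\<^sub>R (side_power p \<sigma> 1 z * rep0 g z) = side_power p \<sigma> 1 z * rep0 g z" for z
    by (auto simp: rep0_def indicator_def)
  ultimately have i: "integrable lborel (\<lambda>z. side_power p \<sigma> 1 z * rep0 g z)"
    unfolding integrable_I11 set_integrable_def eq by blast
  have "integrable lborel (\<lambda>y. indicator {0<..<1} y * y powr p * rep0 g (\<sigma> * y))"
  proof (subst integral_unit_scale(2)[OF assms(2), symmetric])
    have s: "\<sigma> * (\<sigma> * z) = z" for z using assms(2) by auto
    show "integrable lborel (\<lambda>z. indicator {0<..<1} (\<sigma> * z) * (\<sigma> * z) powr p * rep0 g (\<sigma> * (\<sigma> * z)))"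
      unfolding s using i by (simp only: side_power_def)
  qed
  moreover have "indicator {0<..<1} y * y powr p * rep0 g (\<sigma> * y) = indicator {0..1} y *\<^sub>R (y powr p * rep0 g (\<sigma> * y))" for y
    using assms(2) by (auto simp: indicator_def rep0_def)
  ultimately show ?thesis by (simp add: set_integrable_def)
qed

lemma moment_primitive:
  assumes "p > -1/2" "\<sigma> \<in> {1, -1}"
  shows "primitive_on {0..1} (moment p \<sigma> g) (\<lambda>y. y powr p * rep0 g (\<sigma> * y))"
  unfolding moment_def by (rule primitive_on_indefinite[OF side_product_integrable[OF assms]])

lemma LINT_side:
  fixes F :: "real \<Rightarrow> real"
  assumes "0 \<le> x" "x \<le> 1" "\<sigma> \<in> {1, -1}"
    and i: "set_integrable lborel {0..x} (\<lambda>y. F (\<sigma> * y))"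
  shows "(LINT y:{0..x}|lborel. F (\<sigma> * y)) = (\<integral>z. indicator {0<..<x} (\<sigma> * z) * F z \<partial>I11)"
    "integrable I11 (\<lambda>z. indicator {0<..<x} (\<sigma> * z) * F z)"
proof -
  have s: "\<sigma> * (\<sigma> * z) = z" for z using assms(3) by auto
  have ind: "indicator {-1<..<1} z * (indicator {0<..<x} (\<sigma> * z) * F z) = indicator {0<..<x} (\<sigma> * z) * F z" for z
    using assms(2,3) by (auto simp: indicator_def)
  have "(LINT y:{0..x}|lborel. F (\<sigma> * y)) = (LINT y|lborel. indicator {0<..<x} y * F (\<sigma> * y))"
    using LINT_open_closed(1)[OF i] by simp
  also have "\<dots> = (LINT z|lborel. indicator {0<..<x} (\<sigma> * z) * F (\<sigma> * (\<sigma> * z)))"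
    by (rule integral_unit_scale(1)[OF assms(3), symmetric])
  finally show "(LINT y:{0..x}|lborel. F (\<sigma> * y)) = (\<integral>z. indicator {0<..<x} (\<sigma> * z) * F z \<partial>I11)"
    by (simp add: s integral_I11 set_lebesgue_integral_def ind)
  have "integrable lborel (\<lambda>z. indicator {0<..<x} (\<sigma> * z) * F (\<sigma> * (\<sigma> * z)))"
    using LINT_open_closed(2)[OF i] integral_unit_scale(2)[OF assms(3), of "\<lambda>y. indicator {0<..<x} y * F (\<sigma> * y)"] by blast
  then show "integrable I11 (\<lambda>z. indicator {0<..<x} (\<sigma> * z) * F z)"
    by (simp add: s integrable_I11 set_integrable_def ind)
qed

lemma moment_eq_inner:
  assumes "p > -1/2" "0 \<le> x" "x \<le> 1" "\<sigma> \<in> {1, -1}"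
  shows "moment p \<sigma> g x = inner g (L2_of (side_power p \<sigma> x))"
proof -
  have s: "\<sigma> * (\<sigma> * z) = z" for z using assms(4) by auto
  have i: "set_integrable lborel {0..x} (\<lambda>y. y powr p * rep0 g (\<sigma> * y))"
    by (rule set_integrable_subset[OF side_product_integrable[OF assms(1,4)]]) (use assms in auto)
  have "moment p \<sigma> g x = (LINT y:{0..x}|lborel. y powr p * rep0 g (\<sigma> * y))"
    unfolding moment_def by (rule set_borel_integral_eq_integral(2)[OF i, symmetric])
  also have "\<dots> = (\<integral>z. indicator {0<..<x} (\<sigma> * z) * ((\<sigma> * z) powr p * rep0 g z) \<partial>I11)"
    using LINT_side(1)[OF assms(2-4), of "\<lambda>z. (\<sigma> * z) powr p * rep0 g z"] i by (simp add: s)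
  also have "\<dots> = inner g (L2_of (side_power p \<sigma> x))"
    unfolding inner_rep0[OF side_power_L2(1)[OF assms]] by (simp add: side_power_def mult_ac)
  finally show ?thesis .
qed

lemma moment_bound:
  assumes "p > -1/2" "0 \<le> x" "x \<le> 1" "\<sigma> \<in> {1, -1}"
  shows "\<bar>moment p \<sigma> g x\<bar> \<le> norm g * (x powr (p + 1/2) / sqrt (2 * p + 1))"
proof -
  have "norm (L2_of (side_power p \<sigma> x)) = sqrt (x powr (2 * p + 1) / (2 * p + 1))"
    using side_power_L2(2)[OF assms] by (metis norm_ge_zero real_sqrt_unique)
  also have "\<dots> = x powr (p + 1/2) / sqrt (2 * p + 1)"
  proof -
    have "sqrt (x powr (2 * p + 1)) = x powr (p + 1/2)"
      by (rule real_sqrt_unique) (simp_all add: power2_eq_square flip: powr_add)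
    then show ?thesis by (simp add: real_sqrt_divide)
  qed
  finally show ?thesis unfolding moment_eq_inner[OF assms] by (metis Cauchy_Schwarz_ineq2)
qed

text \<open>Hardy's inequality. Splitting \<open>y\<^sup>p = y\<^bsup>p/2-1/4\<^esup> y\<^bsup>p/2+1/4\<^esup>\<close> in the Cauchy-Schwarz inequality leaves a
  double integral that Tonelli's theorem evaluates.\<close>
lemma hardy:
  assumes p: "p > -1/2" and \<sigma>: "\<sigma> \<in> {1, -1}"
  shows "set_integrable lborel {0<..<1} (\<lambda>x. (x powr (- p - 1) * moment p \<sigma> g x)\<^sup>2)"
proof -
  define s where "s = p / 2 + 1 / 4"
  define q where "q = p / 2 - 1 / 4"
  define d where "d = p + 1 / 2"
  have sq: "s > 0" "q > -1/2" "q + s = p" "2 * s = d" "2 * q + 1 = d" "d > 0" using p by (auto simp: s_def q_def d_def)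
  define k where "k x z = indicator {0<..<x} (\<sigma> * z) * ((\<sigma> * z) powr s * rep0 g z)" for x z
  have [measurable]: "k x \<in> borel_measurable borel" for x unfolding k_def by measurable
  have kL: "square_integrable I11 (k x)" if "0 < x" "x < 1" for x
    unfolding square_integrable_def
  proof (intro conjI borel_measurable_I11)
    show "integrable I11 (\<lambda>z. (k x z)\<^sup>2)"
    proof (rule Bochner_Integration.integrable_bound)
      show "integrable I11 (\<lambda>z. (rep0 g z)\<^sup>2)" using square_integrable_rep0 by (simp add: square_integrable_def)
      show "AE z in I11. norm ((k x z)\<^sup>2) \<le> norm ((rep0 g z)\<^sup>2)"
      proof (rule AE_I2)
        fix z
        show "norm ((k x z)\<^sup>2) \<le> norm ((rep0 g z)\<^sup>2)"
        proof (cases "\<sigma> * z \<in> {0<..<x}")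
          case True
          then have "(\<sigma> * z) powr s \<le> 1 powr s" using sq that by (intro powr_mono2) auto
          then have "((\<sigma> * z) powr s)\<^sup>2 \<le> 1" by (simp add: power_le_one)
          then have "((\<sigma> * z) powr s)\<^sup>2 * (rep0 g z)\<^sup>2 \<le> 1 * (rep0 g z)\<^sup>2" by (intro mult_right_mono) auto
          then show ?thesis using True by (simp add: k_def power_mult_distrib)
        qed (simp add: k_def)
      qed
    qed (intro borel_measurable_I11, measurable)
  qed simp
  define G where "G y = y powr d * (rep0 g (\<sigma> * y))\<^sup>2" for y
  have [measurable]: "G \<in> borel_measurable borel" unfolding G_def by measurable
  have pt: "ennreal ((x powr (- p - 1) * moment p \<sigma> g x)\<^sup>2) \<le>
      ennreal (x powr (- d - 1) / d) * (\<integral>\<^sup>+y. indicator {0<..<x} y * ennreal (G y) \<partial>lborel)"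
    if x: "0 < x" "x < 1" for x
  proof -
    have x1: "0 \<le> x" "x \<le> 1" using x by auto
    have "moment p \<sigma> g x = inner g (L2_of (side_power p \<sigma> x))" by (rule moment_eq_inner[OF p x1 \<sigma>])
    also have "\<dots> = (\<integral>z. side_power q \<sigma> x z * k x z \<partial>I11)"
      unfolding inner_rep0[OF side_power_L2(1)[OF p x1 \<sigma>]]
      by (intro Bochner_Integration.integral_cong) (auto simp: side_power_def k_def indicator_def powr_add[symmetric] sq)
    also have "\<dots> = inner (L2_of (side_power q \<sigma> x)) (L2_of (k x))"
      by (rule inner_L2_of[OF side_power_L2(1)[OF sq(2) x1 \<sigma>] kL[OF x], symmetric])
    finally have "(moment p \<sigma> g x)\<^sup>2 \<le> (norm (L2_of (side_power q \<sigma> x)))\<^sup>2 * (norm (L2_of (k x)))\<^sup>2"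
      using Cauchy_Schwarz_ineq[of "L2_of (side_power q \<sigma> x)" "L2_of (k x)"] by (simp add: power2_norm_eq_inner)
    then have "(moment p \<sigma> g x)\<^sup>2 \<le> x powr d / d * (norm (L2_of (k x)))\<^sup>2"
      unfolding side_power_L2(2)[OF sq(2) x1 \<sigma>] sq(5) .
    then have "(x powr (- p - 1))\<^sup>2 * (moment p \<sigma> g x)\<^sup>2 \<le> (x powr (- p - 1))\<^sup>2 * (x powr d / d * (norm (L2_of (k x)))\<^sup>2)"
      by (rule mult_left_mono) simp
    also have "\<dots> = x powr (- d - 1) / d * (norm (L2_of (k x)))\<^sup>2"
    proof -
      have "- p - 1 + (- p - 1) + d = - d - 1" by (simp add: d_def)
      then have "x powr (- p - 1) * x powr (- p - 1) * x powr d = x powr (- d - 1)"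
        by (simp only: powr_add[symmetric])
      then show ?thesis by (simp add: power2_eq_square)
    qed
    finally have "ennreal ((x powr (- p - 1) * moment p \<sigma> g x)\<^sup>2) \<le> ennreal (x powr (- d - 1) / d * (norm (L2_of (k x)))\<^sup>2)"
      by (intro ennreal_leI) (simp add: power_mult_distrib)
    also have "\<dots> = ennreal (x powr (- d - 1) / d) * (\<integral>\<^sup>+z. ennreal ((k x z)\<^sup>2) \<partial>I11)"
      unfolding norm_L2_nn[OF kL[OF x]] using sq by (subst ennreal_mult) auto
    also have "(\<integral>\<^sup>+z. ennreal ((k x z)\<^sup>2) \<partial>I11) = (\<integral>\<^sup>+z. indicator {0<..<x} (\<sigma> * z) * ennreal (G (\<sigma> * z)) \<partial>lborel)"
      unfolding I11_def
      by (subst nn_integral_restrict_space)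
        (use \<sigma> x in \<open>auto intro!: nn_integral_cong simp: k_def G_def indicator_def power2_eq_square sq(4)[symmetric] simp flip: powr_add\<close>)
    also have "\<dots> = (\<integral>\<^sup>+y. indicator {0<..<x} y * ennreal (G y) \<partial>lborel)"
      using \<sigma> nn_integral_real_affine[of "\<lambda>y. indicator {0<..<x} y * ennreal (G y)" \<sigma> 0] by auto
    finally show ?thesis .
  qed
  have "(\<integral>\<^sup>+x. indicator {0<..<1} x * ennreal ((x powr (- p - 1) * moment p \<sigma> g x)\<^sup>2) \<partial>lborel)
      \<le> (\<integral>\<^sup>+x. (\<integral>\<^sup>+y. indicator {0<..<1} x * ennreal (x powr (- d - 1) / d) * (indicator {0<..<x} y * ennreal (G y)) \<partial>lborel) \<partial>lborel)"
  proof (rule nn_integral_mono)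
    fix x :: real
    show "indicator {0<..<1} x * ennreal ((x powr (- p - 1) * moment p \<sigma> g x)\<^sup>2)
        \<le> (\<integral>\<^sup>+y. indicator {0<..<1} x * ennreal (x powr (- d - 1) / d) * (indicator {0<..<x} y * ennreal (G y)) \<partial>lborel)"
      by (subst nn_integral_cmult) (use pt in \<open>auto simp: indicator_def\<close>)
  qed
  also have "\<dots> = (\<integral>\<^sup>+y. (\<integral>\<^sup>+x. indicator {0<..<1} x * ennreal (x powr (- d - 1) / d) * (indicator {0<..<x} y * ennreal (G y)) \<partial>lborel) \<partial>lborel)"
  proof (rule lborel_pair.Fubini')
    have ind: "indicator {0<..<x} y = (if 0 < y \<and> y < x then 1 else 0 :: ennreal)" for x y :: real
      by (auto simp: indicator_def)
    show "(\<lambda>(y, x). indicator {0<..<1} x * ennreal (x powr (- d - 1) / d) * (indicator {0<..<x} y * ennreal (G y)))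
        \<in> borel_measurable (lborel \<Otimes>\<^sub>M lborel)"
      unfolding ind by measurable
  qed
  also have "\<dots> \<le> (\<integral>\<^sup>+y. ennreal (1 / d\<^sup>2) * ennreal ((rep0 g (\<sigma> * y))\<^sup>2) \<partial>lborel)"
  proof (rule nn_integral_mono)
    fix y :: real
    show "(\<integral>\<^sup>+x. indicator {0<..<1} x * ennreal (x powr (- d - 1) / d) * (indicator {0<..<x} y * ennreal (G y)) \<partial>lborel)
        \<le> ennreal (1 / d\<^sup>2) * ennreal ((rep0 g (\<sigma> * y))\<^sup>2)"
    proof (cases "y > 0")
      case False
      then have "indicator {0<..<x} y = (0 :: ennreal)" for x by (auto simp: indicator_def)
      then show ?thesis by simp
    next
      case True
      have h: "((\<lambda>x. x powr (- d - 1)) has_integral - (y powr (- d - 1 + 1)) / (- d - 1 + 1)) {y..}"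
        using sq True by (intro has_integral_powr_to_inf) auto
      have "(\<integral>\<^sup>+x. indicator {0<..<1} x * ennreal (x powr (- d - 1) / d) * (indicator {0<..<x} y * ennreal (G y)) \<partial>lborel)
          \<le> (\<integral>\<^sup>+x. ennreal (G y / d) * (ennreal (x powr (- d - 1)) * indicator {y..} x) \<partial>lborel)"
        using True sq by (intro nn_integral_mono)
          (auto simp: indicator_def G_def mult_ac simp flip: ennreal_mult)
      also have "\<dots> = ennreal (G y / d) * (\<integral>\<^sup>+x. ennreal (x powr (- d - 1)) * indicator {y..} x \<partial>lborel)"
        by (rule nn_integral_cmult) auto
      also have "(\<integral>\<^sup>+x. ennreal (x powr (- d - 1)) * indicator {y..} x \<partial>lborel) = ennreal (y powr (- d) / d)"
      proof -
        have "(\<integral>\<^sup>+x. ennreal (x powr (- d - 1)) * indicator {y..} x \<partial>lborel)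
            = (\<integral>\<^sup>+x. ennreal (indicator {y..} x * x powr (- d - 1)) \<partial>lborel)"
          by (intro nn_integral_cong) (auto simp: indicator_def)
        then show ?thesis using nn_integral_has_integral_lebesgue[OF _ h] by simp
      qed
      also have "ennreal (G y / d) * ennreal (y powr (- d) / d) = ennreal (1 / d\<^sup>2) * ennreal ((rep0 g (\<sigma> * y))\<^sup>2)"
        using sq True by (simp add: G_def power2_eq_square powr_minus field_simps flip: ennreal_mult)
      finally show ?thesis .
    qed
  qed
  also have "\<dots> = ennreal (1 / d\<^sup>2) * (\<integral>\<^sup>+y. ennreal ((rep0 g (\<sigma> * y))\<^sup>2) \<partial>lborel)"
    by (rule nn_integral_cmult) auto
  also have "\<dots> < \<infinity>"
  proof -
    have "integrable lborel (\<lambda>y. (rep0 g (\<sigma> * y))\<^sup>2)"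
      using integral_unit_scale(2)[OF \<sigma>, of "\<lambda>y. (rep0 g y)\<^sup>2"] rep0_mult_integrable[of g g] by (simp add: power2_eq_square)
    then have "(\<integral>\<^sup>+y. ennreal ((rep0 g (\<sigma> * y))\<^sup>2) \<partial>lborel) < \<infinity>"
      by (simp add: nn_integral_eq_integral)
    then show ?thesis by (simp add: ennreal_mult_less_top)
  qed
  finally have fin: "(\<integral>\<^sup>+x. indicator {0<..<1} x * ennreal ((x powr (- p - 1) * moment p \<sigma> g x)\<^sup>2) \<partial>lborel) < \<infinity>" .
  have m: "(\<lambda>x. indicator {0<..<1} x * moment p \<sigma> g x) \<in> borel_measurable borel"
  proof -
    have "continuous_on {0<..<1} (moment p \<sigma> g)"
      by (rule continuous_on_subset[OF primitive_on_continuous[OF moment_primitive[OF p \<sigma>] order_refl]]) auto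
    from borel_measurable_continuous_on_indicator[OF _ this] show ?thesis by simp
  qed
  have eq: "indicator {0<..<1} x *\<^sub>R (x powr (- p - 1) * moment p \<sigma> g x)\<^sup>2
      = (x powr (- p - 1) * (indicator {0<..<1} x * moment p \<sigma> g x))\<^sup>2" for x
    by (auto simp: indicator_def)
  show ?thesis
    unfolding set_integrable_def
  proof (rule integrableI_nonneg)
    show "(\<lambda>x. indicator {0<..<1} x *\<^sub>R (x powr (- p - 1) * moment p \<sigma> g x)\<^sup>2) \<in> borel_measurable lborel"
      unfolding eq using m by measurable
    have "(\<integral>\<^sup>+x. ennreal (indicator {0<..<1} x *\<^sub>R (x powr (- p - 1) * moment p \<sigma> g x)\<^sup>2) \<partial>lborel)
        = (\<integral>\<^sup>+x. indicator {0<..<1} x * ennreal ((x powr (- p - 1) * moment p \<sigma> g x)\<^sup>2) \<partial>lborel)"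
      by (intro nn_integral_cong) (auto simp: indicator_def)
    then show "(\<integral>\<^sup>+x. ennreal (indicator {0<..<1} x *\<^sub>R (x powr (- p - 1) * moment p \<sigma> g x)\<^sup>2) \<partial>lborel) < \<infinity>"
      using fin by simp
  qed simp
qed

section \<open>Variation of parameters\<close>

lemma primitive_on_cong_AE:
  assumes FG: "primitive_on J F G" and m: "(\<lambda>x. indicator J x * G' x) \<in> borel_measurable borel"
    and ae: "AE x in lborel. x \<in> J \<longrightarrow> G x = G' x"
  shows "primitive_on J F G'"
  unfolding primitive_on_def
proof (intro allI impI)
  fix a b assume "a \<le> b \<and> {a..b} \<subseteq> J"
  then have ab: "a \<le> b" "{a..b} \<subseteq> J" by auto
  have i: "set_integrable lborel {a..b} G" by (rule primitive_onD(1)[OF FG ab])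
  have ae': "AE x in lborel. indicator {a..b} x *\<^sub>R G x = indicator {a..b} x *\<^sub>R G' x"
    using ae by eventually_elim (use ab(2) in \<open>auto simp: indicator_def\<close>)
  have eq: "indicator {a..b} x *\<^sub>R G' x = indicator {a..b} x * (indicator J x * G' x)" for x
    using ab(2) by (auto simp: indicator_def)
  have m': "(\<lambda>x. indicator {a..b} x *\<^sub>R G' x) \<in> borel_measurable lborel" unfolding eq using m by measurable
  have i': "set_integrable lborel {a..b} G'"
    using i ae' m' unfolding set_integrable_def by (subst integrable_cong_AE[symmetric]) auto
  have "(LINT x:{a..b}|lborel. G x) = (LINT x:{a..b}|lborel. G' x)"
    unfolding set_lebesgue_integral_def
    by (rule integral_cong_AE) (use i ae' m' in \<open>auto simp: set_integrable_def\<close>)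
  then have "integral {a..b} G' = integral {a..b} G"
    using set_borel_integral_eq_integral(2)[OF i] set_borel_integral_eq_integral(2)[OF i'] by simp
  then show "set_integrable lborel {a..b} G' \<and> integral {a..b} G' = F b - F a"
    using i' primitive_onD(2)[OF FG ab] by simp
qed

lemma primitive_on_powr: "primitive_on {0<..} (\<lambda>x. x powr a) (\<lambda>x. a * x powr (a - 1))"
proof (rule primitive_on_C1)
  show "continuous_on {0<..} (\<lambda>x. a * x powr (a - 1))" by (intro continuous_intros) auto
  fix x :: real assume "x \<in> {0<..}"
  then have "((\<lambda>x. x powr a) has_real_derivative a * x powr (a - 1)) (at x)"
    by (intro has_real_derivative_powr) simp
  then show "((\<lambda>x. x powr a) has_real_derivative a * x powr (a - 1)) (at x within {0<..})"
    by (rule has_field_derivative_at_within)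
qed

text \<open>Functions on \<open>[-1, 1]\<close> are glued from their two halves: the difference to an honest
  primitive is constant on each half and continuous at \<open>0\<close>.\<close>
lemma primitive_on_glue:
  assumes p: "primitive_on {0<..1} F G" and n: "primitive_on {0<..1} (\<lambda>x. F (- x)) (\<lambda>x. - G (- x))"
    and c: "isCont F 0" and G: "set_integrable lborel {-1..1} G"
  shows "primitive_on {-1..1} F G"
proof -
  define \<Phi> where "\<Phi> x = integral {-1..x} G" for x
  have \<Phi>: "primitive_on {-1..1} \<Phi> G" unfolding \<Phi>_def by (rule primitive_on_indefinite[OF G])
  define H where "H x = F x - \<Phi> x" for x
  have "continuous_on {-1..1} \<Phi>" by (rule primitive_on_continuous[OF \<Phi> order_refl])
  then have c\<Phi>: "isCont \<Phi> 0" by (rule continuous_on_interior) auto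
  have cH: "isCont H 0" unfolding H_def by (intro continuous_intros c c\<Phi>)
  have Hp: "H x = H 1" if "0 < x" "x \<le> 1" for x
  proof -
    have "{x..1} \<subseteq> {0<..1}" "{x..1} \<subseteq> {-1..1}" using that by auto
    then have "integral {x..1} G = F 1 - F x" "integral {x..1} G = \<Phi> 1 - \<Phi> x"
      using primitive_onD(2)[OF p, of x 1] primitive_onD(2)[OF \<Phi>, of x 1] that by auto
    then show ?thesis by (simp add: H_def)
  qed
  have Hn: "H (- x) = H (- 1)" if "0 < x" "x \<le> 1" for x
  proof -
    have "{x..1} \<subseteq> {0<..1}" "{-1..-x} \<subseteq> {-1..1}" using that by auto
    then have "integral {x..1} (\<lambda>x. - G (- x)) = F (- 1) - F (- x)" "integral {-1..-x} G = \<Phi> (- x) - \<Phi> (- 1)"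
      using primitive_onD(2)[OF n, of x 1] primitive_onD(2)[OF \<Phi>, of "-1" "-x"] that by auto
    moreover have "integral {x..1} (\<lambda>x. - G (- x)) = - integral {-1..-x} G"
      using Henstock_Kurzweil_Integration.integral_reflect_real[of "-x" "-1" G] by simp
    ultimately show ?thesis by (simp add: H_def)
  qed
  have lp: "(H \<longlongrightarrow> H 1) (at_right 0)"
  proof (rule tendsto_eventually)
    have "\<forall>\<^sub>F x in at_right 0. x \<in> {0<..<1::real}" by (rule eventually_at_right_real) simp
    then show "\<forall>\<^sub>F x in at_right 0. H x = H 1"
    proof eventually_elim
      case (elim x)
      then show ?case using Hp[of x] by simp
    qed
  qed
  have ln: "(H \<longlongrightarrow> H (- 1)) (at_left 0)"
  proof (rule tendsto_eventually)
    have "\<forall>\<^sub>F x in at_left 0. x \<in> {-1<..<0::real}" by (rule eventually_at_left_real) simp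
    then show "\<forall>\<^sub>F x in at_left 0. H x = H (- 1)"
    proof eventually_elim
      case (elim x)
      then show ?case using Hn[of "- x"] by simp
    qed
  qed
  have t0: "(H \<longlongrightarrow> H 0) (at_right 0)" "(H \<longlongrightarrow> H 0) (at_left 0)"
    using cH tendsto_within_subset[OF _ subset_UNIV] unfolding isCont_def by blast+
  have H0: "H 1 = H 0" "H (- 1) = H 0"
    using tendsto_unique[OF trivial_limit_at_right_real lp t0(1)]
      tendsto_unique[OF trivial_limit_at_left_real ln t0(2)] by auto
  have const: "F x = \<Phi> x + H 0" if "x \<in> {-1..1}" for x
  proof -
    consider "x > 0" | "x = 0" | "x < 0" by linarith
    then have "H x = H 0" using Hp[of x] Hn[of "- x"] H0 that by cases auto
    then show ?thesis by (simp add: H_def)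
  qed
  show ?thesis
    using \<Phi> const unfolding primitive_on_def by (auto simp: subset_iff)
qed

locale inverse_square =
  fixes \<nu> :: real
  assumes \<nu>: "0 < \<nu>" "\<nu> < 1"
begin

text \<open>The exponents of the two solutions \<open>x\<^sup>\<alpha>\<close>, \<open>x\<^sup>\<beta>\<close> of \<open>u'' = c / x\<^sup>2 u\<close>, and \<open>c\<close> itself.\<close>
definition "\<alpha> = 1/2 + \<nu>"
definition "\<beta> = 1/2 - \<nu>"
definition "pot = \<nu>\<^sup>2 - 1/4"

lemma exponents: "\<alpha> > -1/2" "\<beta> > -1/2" "\<alpha> + \<beta> = 1" "\<beta> - \<alpha> = - 2 * \<nu>" "\<alpha> * (\<alpha> - 1) = pot" "\<beta> * (\<beta> - 1) = pot"
  using \<nu> by (auto simp: \<alpha>_def \<beta>_def pot_def power2_eq_square algebra_simps)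

lemma powr_cross:
  assumes "x > 0"
  shows "x powr \<alpha> * x powr (\<beta> - 1) = 1" "x powr \<beta> * x powr (\<alpha> - 1) = 1"
proof -
  have "\<alpha> + (\<beta> - 1) = 0" "\<beta> + (\<alpha> - 1) = 0" using exponents(3) by auto
  then show "x powr \<alpha> * x powr (\<beta> - 1) = 1" "x powr \<beta> * x powr (\<alpha> - 1) = 1"
    using assms by (simp_all only: powr_add[symmetric]) simp_all
qed

text \<open>The solution of \<open>- w'' + c / x\<^sup>2 w = g\<close> on the side \<open>\<sigma>\<close> with vanishing data at the singularity,
  and its derivative.\<close>
definition V :: "real \<Rightarrow> L2 \<Rightarrow> real \<Rightarrow> real" where
  "V \<sigma> g x = (x powr \<beta> * moment \<alpha> \<sigma> g x - x powr \<alpha> * moment \<beta> \<sigma> g x) / (2 * \<nu>)"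

definition V' :: "real \<Rightarrow> L2 \<Rightarrow> real \<Rightarrow> real" where
  "V' \<sigma> g x = (\<beta> * x powr (\<beta> - 1) * moment \<alpha> \<sigma> g x - \<alpha> * x powr (\<alpha> - 1) * moment \<beta> \<sigma> g x) / (2 * \<nu>)"

lemma moment_powr_primitive:
  assumes "p > -1/2" "\<sigma> \<in> {1, -1}"
  shows "primitive_on {0<..1} (\<lambda>x. moment p \<sigma> g x * x powr a)
    (\<lambda>x. x powr p * rep0 g (\<sigma> * x) * x powr a + moment p \<sigma> g x * (a * x powr (a - 1)))"
  by (rule primitive_on_mult[OF primitive_on_subset[OF moment_primitive[OF assms]]
      primitive_on_subset[OF primitive_on_powr]]) auto

lemma V_primitive:
  assumes "\<sigma> \<in> {1, -1}"
  shows "primitive_on {0<..1} (V \<sigma> g) (V' \<sigma> g)"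
proof -
  have "primitive_on {0<..1}
      (\<lambda>x. 1 / (2 * \<nu>) * (moment \<alpha> \<sigma> g x * x powr \<beta> - moment \<beta> \<sigma> g x * x powr \<alpha>))
      (\<lambda>x. 1 / (2 * \<nu>) * (x powr \<alpha> * rep0 g (\<sigma> * x) * x powr \<beta> + moment \<alpha> \<sigma> g x * (\<beta> * x powr (\<beta> - 1))
        - (x powr \<beta> * rep0 g (\<sigma> * x) * x powr \<alpha> + moment \<beta> \<sigma> g x * (\<alpha> * x powr (\<alpha> - 1)))))"
    by (intro primitive_on_scale primitive_on_diff moment_powr_primitive assms exponents)
  then show ?thesis
    by (rule primitive_on_cong[THEN iffD1, rotated 2]) (auto simp: V_def V'_def field_simps)
qed

lemma V'_primitive:
  assumes "\<sigma> \<in> {1, -1}"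
  shows "primitive_on {0<..1} (V' \<sigma> g) (\<lambda>x. pot / x\<^sup>2 * V \<sigma> g x - rep0 g (\<sigma> * x))"
proof -
  have P: "primitive_on {0<..1}
      (\<lambda>x. 1 / (2 * \<nu>) * (\<beta> * (moment \<alpha> \<sigma> g x * x powr (\<beta> - 1)) - \<alpha> * (moment \<beta> \<sigma> g x * x powr (\<alpha> - 1))))
      (\<lambda>x. 1 / (2 * \<nu>) * (\<beta> * (x powr \<alpha> * rep0 g (\<sigma> * x) * x powr (\<beta> - 1) + moment \<alpha> \<sigma> g x * ((\<beta> - 1) * x powr (\<beta> - 1 - 1)))
        - \<alpha> * (x powr \<beta> * rep0 g (\<sigma> * x) * x powr (\<alpha> - 1) + moment \<beta> \<sigma> g x * ((\<alpha> - 1) * x powr (\<alpha> - 1 - 1)))))"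
    by (intro primitive_on_scale primitive_on_diff moment_powr_primitive assms exponents)
  show ?thesis
  proof (rule primitive_on_cong[THEN iffD1, OF _ _ P])
    fix x :: real assume "x \<in> {0<..1}"
    then have x: "x > 0" by simp
    show "1 / (2 * \<nu>) * (\<beta> * (moment \<alpha> \<sigma> g x * x powr (\<beta> - 1)) - \<alpha> * (moment \<beta> \<sigma> g x * x powr (\<alpha> - 1))) = V' \<sigma> g x"
      by (simp add: V'_def field_simps)
    have e: "x powr \<alpha> * x powr (\<beta> - 1) = 1" "x powr \<beta> * x powr (\<alpha> - 1) = 1"
      by (rule powr_cross[OF x])+
    have f: "x powr (\<beta> - 1 - 1) = x powr \<beta> / x\<^sup>2" "x powr (\<alpha> - 1 - 1) = x powr \<alpha> / x\<^sup>2"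
      using x by (simp_all add: powr_diff power2_eq_square)
    have "1 / (2 * \<nu>) * (\<beta> * (x powr \<alpha> * rep0 g (\<sigma> * x) * x powr (\<beta> - 1) + moment \<alpha> \<sigma> g x * ((\<beta> - 1) * x powr (\<beta> - 1 - 1)))
        - \<alpha> * (x powr \<beta> * rep0 g (\<sigma> * x) * x powr (\<alpha> - 1) + moment \<beta> \<sigma> g x * ((\<alpha> - 1) * x powr (\<alpha> - 1 - 1))))
      = 1 / (2 * \<nu>) * (\<beta> * (x powr \<alpha> * x powr (\<beta> - 1)) * rep0 g (\<sigma> * x) - \<alpha> * (x powr \<beta> * x powr (\<alpha> - 1)) * rep0 g (\<sigma> * x)
        + (\<beta> * (\<beta> - 1)) * moment \<alpha> \<sigma> g x * x powr (\<beta> - 1 - 1) - (\<alpha> * (\<alpha> - 1)) * moment \<beta> \<sigma> g x * x powr (\<alpha> - 1 - 1))"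
      by (simp add: algebra_simps)
    also have "\<dots> = 1 / (2 * \<nu>) * ((\<beta> - \<alpha>) * rep0 g (\<sigma> * x)
        + pot / x\<^sup>2 * (x powr \<beta> * moment \<alpha> \<sigma> g x - x powr \<alpha> * moment \<beta> \<sigma> g x))"
      unfolding e f exponents(5,6) by (simp add: algebra_simps)
    also have "\<dots> = pot / x\<^sup>2 * V \<sigma> g x - rep0 g (\<sigma> * x)"
      unfolding exponents(4) V_def using \<nu> by (simp add: field_simps)
    finally show "1 / (2 * \<nu>) * (\<beta> * (x powr \<alpha> * rep0 g (\<sigma> * x) * x powr (\<beta> - 1) + moment \<alpha> \<sigma> g x * ((\<beta> - 1) * x powr (\<beta> - 1 - 1)))
        - \<alpha> * (x powr \<beta> * rep0 g (\<sigma> * x) * x powr (\<alpha> - 1) + moment \<beta> \<sigma> g x * ((\<alpha> - 1) * x powr (\<alpha> - 1 - 1))))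
      = pot / x\<^sup>2 * V \<sigma> g x - rep0 g (\<sigma> * x)" .
  qed
qed

lemma moment_tendsto_0:
  assumes "p > -1/2" "\<sigma> \<in> {1, -1}"
  shows "(moment p \<sigma> g \<longlongrightarrow> 0) (at_right 0)"
proof (rule Lim_null_comparison)
  show "\<forall>\<^sub>F x in at_right 0. norm (moment p \<sigma> g x) \<le> norm g * (x powr (p + 1/2) / sqrt (2 * p + 1))"
  proof (rule eventually_mono)
    show "\<forall>\<^sub>F x in at_right 0. x \<in> {0<..<1::real}" by (rule eventually_at_right_real) simp
    fix x :: real assume "x \<in> {0<..<1}"
    then show "norm (moment p \<sigma> g x) \<le> norm g * (x powr (p + 1/2) / sqrt (2 * p + 1))"
      using moment_bound[OF assms(1) _ _ assms(2), of x g] by simp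
  qed
  have "((\<lambda>x. x powr (p + 1/2)) \<longlongrightarrow> 0) (at_right 0)"
    by (intro tendsto_zero_powrI) (use assms in \<open>auto intro!: tendsto_eq_intros simp: eventually_at_filter\<close>)
  then show "((\<lambda>x. norm g * (x powr (p + 1/2) / sqrt (2 * p + 1))) \<longlongrightarrow> 0) (at_right 0)"
    by (intro tendsto_mult_right_zero tendsto_divide_zero)
qed

lemma V_bounds:
  assumes "\<sigma> \<in> {1, -1}"
  shows "\<exists>C\<ge>0. \<forall>x\<in>{0<..1}. \<bar>V \<sigma> g x\<bar> \<le> C * x powr (3/2) \<and> \<bar>V' \<sigma> g x\<bar> \<le> C * x powr (1/2)"
proof -
  define a where "a = norm g / sqrt (2 * \<alpha> + 1)"
  define b where "b = norm g / sqrt (2 * \<beta> + 1)"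
  define C where "C = (1 + \<bar>\<alpha>\<bar> + \<bar>\<beta>\<bar>) * (a + b) / (2 * \<nu>)"
  have ab: "a \<ge> 0" "b \<ge> 0" using exponents(1,2) by (auto simp: a_def b_def)
  have "\<bar>V \<sigma> g x\<bar> \<le> C * x powr (3/2) \<and> \<bar>V' \<sigma> g x\<bar> \<le> C * x powr (1/2)" if x: "x \<in> {0<..1}" for x
  proof -
    have x': "0 \<le> x" "x \<le> 1" using x by auto
    have m: "\<bar>moment \<alpha> \<sigma> g x\<bar> \<le> a * x powr (\<alpha> + 1/2)" "\<bar>moment \<beta> \<sigma> g x\<bar> \<le> b * x powr (\<beta> + 1/2)"
      using moment_bound[OF exponents(1) x' assms, of g] moment_bound[OF exponents(2) x' assms, of g] by (auto simp: a_def b_def)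
    have e: "x powr \<beta> * x powr (\<alpha> + 1/2) = x powr (3/2)" "x powr \<alpha> * x powr (\<beta> + 1/2) = x powr (3/2)"
      "x powr (\<beta> - 1) * x powr (\<alpha> + 1/2) = x powr (1/2)" "x powr (\<alpha> - 1) * x powr (\<beta> + 1/2) = x powr (1/2)"
      by (simp_all add: \<alpha>_def \<beta>_def flip: powr_add)
    have t: "\<bar>(k * p * m - l * q * n) / (2 * \<nu>)\<bar> \<le> C * r"
      if "\<bar>m\<bar> \<le> a * m'" "\<bar>n\<bar> \<le> b * n'" "p * m' = r" "q * n' = r" "\<bar>k\<bar> \<le> 1 + \<bar>\<alpha>\<bar> + \<bar>\<beta>\<bar>" "\<bar>l\<bar> \<le> 1 + \<bar>\<alpha>\<bar> + \<bar>\<beta>\<bar>"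
        "p \<ge> 0" "q \<ge> 0" "r \<ge> 0" for k l m n m' n' p q r
    proof -
      define K where "K = 1 + \<bar>\<alpha>\<bar> + \<bar>\<beta>\<bar>"
      have "\<bar>k * p * m\<bar> \<le> K * p * (a * m')"
        unfolding abs_mult using that by (intro mult_mono) (auto simp: K_def)
      moreover have "\<bar>l * q * n\<bar> \<le> K * q * (b * n')"
        unfolding abs_mult using that by (intro mult_mono) (auto simp: K_def)
      ultimately have "\<bar>k * p * m - l * q * n\<bar> \<le> K * a * (p * m') + K * b * (q * n')"
        using abs_triangle_ineq4[of "k * p * m" "l * q * n"] by (simp add: mult_ac)
      also have "\<dots> = K * (a + b) * r" unfolding that by (simp add: algebra_simps)
      finally have "\<bar>k * p * m - l * q * n\<bar> / (2 * \<nu>) \<le> K * (a + b) * r / (2 * \<nu>)"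
        using \<nu> by (intro divide_right_mono) auto
      then show ?thesis using \<nu> by (simp add: C_def K_def)
    qed
    show ?thesis
      using t[OF m e(1,2), of 1 1] t[OF m e(3,4), of \<beta> \<alpha>] by (simp add: V_def V'_def)
  qed
  moreover have "C \<ge> 0" using ab \<nu> by (simp add: C_def)
  ultimately show ?thesis by blast
qed

text \<open>For \<open>u = x\<^sup>p\<close> with \<open>p \<in> {\<alpha>, \<beta>}\<close> the Wronskian \<open>u w' - u' w\<close> has derivative \<open>- u g\<close> and tends to
  zero at the singularity, so it is \<open>- moment p\<close>. The two Wronskians determine \<open>w\<close>.\<close>
lemma V_unique:
  assumes \<sigma>: "\<sigma> \<in> {1, -1}" and w: "primitive_on {0<..1} w w'"
    and w': "primitive_on {0<..1} w' (\<lambda>x. pot / x\<^sup>2 * w x - rep0 g (\<sigma> * x))"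
    and b: "\<And>x. x \<in> {0<..1} \<Longrightarrow> \<bar>w x\<bar> \<le> C * x powr (3/2)" "\<And>x. x \<in> {0<..1} \<Longrightarrow> \<bar>w' x\<bar> \<le> C * x powr (1/2)"
    and x: "x \<in> {0<..1}"
  shows "w x = V \<sigma> g x"
proof -
  have wr: "x powr p * w' x - p * x powr (p - 1) * w x = - moment p \<sigma> g x"
    if p: "p > -1/2" "p * (p - 1) = pot" for p
  proof -
    define h where "h x = x powr p * w' x - p * x powr (p - 1) * w x" for x
    have u: "primitive_on {0<..1} (\<lambda>x. x powr p) (\<lambda>x. p * x powr (p - 1))"
      "primitive_on {0<..1} (\<lambda>x. x powr (p - 1)) (\<lambda>x. (p - 1) * x powr (p - 1 - 1))"
    proof -
      have J: "{0<..1} \<subseteq> {0::real<..}" by auto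
      show "primitive_on {0<..1} (\<lambda>x. x powr p) (\<lambda>x. p * x powr (p - 1))"
        "primitive_on {0<..1} (\<lambda>x. x powr (p - 1)) (\<lambda>x. (p - 1) * x powr (p - 1 - 1))"
        by (rule primitive_on_subset[OF primitive_on_powr J])+
    qed
    have "primitive_on {0<..1} (\<lambda>x. x powr p * w' x - p * (x powr (p - 1) * w x) + moment p \<sigma> g x)
      (\<lambda>x. (p * x powr (p - 1) * w' x + x powr p * (pot / x\<^sup>2 * w x - rep0 g (\<sigma> * x)))
        - p * ((p - 1) * x powr (p - 1 - 1) * w x + x powr (p - 1) * w' x) + x powr p * rep0 g (\<sigma> * x))"
      by (intro primitive_on_add primitive_on_diff primitive_on_scale primitive_on_mult u w w'
          primitive_on_subset[OF moment_primitive[OF p(1) \<sigma>]]) auto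
    then have "primitive_on {0<..1} (\<lambda>x. h x + moment p \<sigma> g x) (\<lambda>x. 0)"
    proof (rule primitive_on_cong[THEN iffD1, rotated 2])
      fix x :: real assume "x \<in> {0<..1}"
      then have x: "x > 0" by simp
      have f: "x powr (p - 1 - 1) = x powr p / x\<^sup>2" using x by (simp add: powr_diff power2_eq_square)
      show "(p * x powr (p - 1) * w' x + x powr p * (pot / x\<^sup>2 * w x - rep0 g (\<sigma> * x)))
        - p * ((p - 1) * x powr (p - 1 - 1) * w x + x powr (p - 1) * w' x) + x powr p * rep0 g (\<sigma> * x) = 0"
        unfolding f p(2)[symmetric] by (simp add: algebra_simps)
    qed (simp add: h_def mult_ac)
    then have const: "h y + moment p \<sigma> g y = h x + moment p \<sigma> g x" if "y \<in> {0<..<x}" for y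
      using primitive_onD(2)[of "{0<..1}" "\<lambda>x. h x + moment p \<sigma> g x" "\<lambda>x. 0" y x] that x by (auto simp: subset_iff)
    have "(h \<longlongrightarrow> 0) (at_right 0)"
    proof (rule Lim_null_comparison)
      have "\<forall>\<^sub>F y in at_right 0. y \<in> {0<..<1::real}" by (rule eventually_at_right_real) simp
      then show "\<forall>\<^sub>F y in at_right 0. norm (h y) \<le> C * (1 + \<bar>p\<bar>) * y powr (p + 1/2)"
      proof eventually_elim
        case (elim y)
        then have y: "y \<in> {0<..1}" by auto
        have "\<bar>y powr p * w' y\<bar> \<le> y powr p * (C * y powr (1/2))"
          unfolding abs_mult using b(2)[OF y] by (intro mult_mono) auto
        moreover have "\<bar>p * y powr (p - 1) * w y\<bar> \<le> \<bar>p\<bar> * y powr (p - 1) * (C * y powr (3/2))"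
          unfolding abs_mult using b(1)[OF y] by (intro mult_mono) auto
        moreover have "y powr p * y powr (1/2) = y powr (p + 1/2)" "y powr (p - 1) * y powr (3/2) = y powr (p + 1/2)"
          by (simp_all add: add.commute flip: powr_add)
        ultimately show ?case
          using abs_triangle_ineq4[of "y powr p * w' y" "p * y powr (p - 1) * w y"]
          by (simp add: h_def algebra_simps)
      qed
      have "((\<lambda>x. x powr (p + 1/2)) \<longlongrightarrow> 0) (at_right 0)"
        by (intro tendsto_zero_powrI) (use p in \<open>auto intro!: tendsto_eq_intros simp: eventually_at_filter\<close>)
      then show "((\<lambda>y. C * (1 + \<bar>p\<bar>) * y powr (p + 1/2)) \<longlongrightarrow> 0) (at_right 0)"
        by (intro tendsto_mult_right_zero)
    qed
    then have "((\<lambda>y. h y + moment p \<sigma> g y) \<longlongrightarrow> 0 + 0) (at_right 0)"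
      by (intro tendsto_add moment_tendsto_0 p \<sigma>)
    moreover have "((\<lambda>y. h y + moment p \<sigma> g y) \<longlongrightarrow> h x + moment p \<sigma> g x) (at_right 0)"
    proof (rule tendsto_eventually)
      have "\<forall>\<^sub>F y in at_right 0. y \<in> {0<..<x}" using x by (intro eventually_at_right_real) simp
      then show "\<forall>\<^sub>F y in at_right 0. h y + moment p \<sigma> g y = h x + moment p \<sigma> g x"
        by eventually_elim (rule const)
    qed
    ultimately have "h x + moment p \<sigma> g x = 0 + 0"
      by (rule tendsto_unique[OF trivial_limit_at_right_real, rotated])
    then show ?thesis by (simp add: h_def)
  qed
  have x0: "x > 0" using x by simp
  have e: "x powr \<alpha> * x powr (\<beta> - 1) = 1" "x powr \<beta> * x powr (\<alpha> - 1) = 1"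
    by (rule powr_cross[OF x0])+
  have "x powr \<beta> * moment \<alpha> \<sigma> g x - x powr \<alpha> * moment \<beta> \<sigma> g x
      = x powr \<alpha> * (x powr \<beta> * w' x - \<beta> * x powr (\<beta> - 1) * w x) - x powr \<beta> * (x powr \<alpha> * w' x - \<alpha> * x powr (\<alpha> - 1) * w x)"
    unfolding wr[OF exponents(1,5)] wr[OF exponents(2,6)] by (simp add: algebra_simps)
  also have "\<dots> = (\<alpha> * (x powr \<beta> * x powr (\<alpha> - 1)) - \<beta> * (x powr \<alpha> * x powr (\<beta> - 1))) * w x"
    by (simp add: algebra_simps)
  also have "\<dots> = 2 * \<nu> * w x" unfolding e using exponents(4) by simp
  finally show ?thesis using \<nu> by (simp add: V_def)
qed

end

section \<open>The domain of the operator\<close>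

lemma square_integrable_imp_integrable:
  assumes "square_integrable I11 f"
  shows "integrable I11 f"
proof -
  have "integrable I11 (\<lambda>x. (1::real)\<^sup>2)"
    using finite_measure.integrable_const[OF finite_measure_I11, of "1::real"] by simp
  then have "square_integrable I11 (\<lambda>x. 1)" by (simp add: square_integrable_def)
  from square_integrable_mult[OF assms this] show ?thesis by simp
qed

lemma set_integrable_rep_L2: "set_integrable lborel {-1<..<1} (rep_L2 g)"
  using square_integrable_imp_integrable[OF square_integrable_rep_L2] by (simp add: integrable_I11)

lemma set_integrable_rep0: "set_integrable lborel {-1..1} (rep0 g)"
proof -
  have "integrable lborel (\<lambda>x. indicator {-1<..<1} x *\<^sub>R rep_L2 g x)"
    using set_integrable_rep_L2 by (simp add: set_integrable_def)
  moreover have "indicator {-1<..<1} x *\<^sub>R rep_L2 g x = indicator {-1..1} x *\<^sub>R rep0 g x" for x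
    by (auto simp: rep0_def indicator_def)
  ultimately show ?thesis by (simp add: set_integrable_def)
qed

lemma locally_integrable_rep_L2: "\<Omega> \<subseteq> {-1<..<1} \<Longrightarrow> locally_integrable \<Omega> (rep_L2 g)"
  unfolding locally_integrable_def
  using set_integrable_subset[OF set_integrable_rep_L2] by (auto simp: compact_imp_closed)

lemma weak_derivative_rep_left:
  assumes \<Omega>: "\<Omega> \<subseteq> {-1<..<1}" and sq: "square_integrable I11 F" and wd: "weak_derivative \<Omega> F G" and o: "open \<Omega>"
  shows "weak_derivative \<Omega> (rep_L2 (L2_of F)) G"
  unfolding weak_derivative_def
proof (intro conjI allI impI locally_integrable_rep_L2 \<Omega>)
  show "locally_integrable \<Omega> G" using wd by (simp add: weak_derivative_def)
  fix \<phi> assume t: "test_function \<Omega> \<phi>"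
  then obtain D K where D: "\<And>x. (\<phi> has_real_derivative D x) (at x)" "continuous_on UNIV D" "deriv \<phi> = D"
    "compact K" "K \<subseteq> \<Omega>" "\<And>x. x \<notin> K \<Longrightarrow> \<phi> x = 0" by (rule test_functionE) blast
  have [measurable]: "D \<in> borel_measurable borel" by (rule borel_measurable_continuous_onI[OF D(2)])
  have [measurable]: "\<Omega> \<in> sets borel" using o by simp
  have m: "(\<lambda>x. indicator \<Omega> x *\<^sub>R (f x * D x)) \<in> borel_measurable lborel" if "square_integrable I11 f" for f
  proof -
    have [measurable]: "(\<lambda>x. indicator {-1<..<1} x * f x) \<in> borel_measurable borel"
      using that by (simp add: square_integrable_def measurable_I11)
    have eq: "indicator \<Omega> x *\<^sub>R (f x * D x) = indicator \<Omega> x * ((indicator {-1<..<1} x * f x) * D x)" for x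
      using \<Omega> by (auto simp: indicator_def)
    show ?thesis unfolding eq by measurable
  qed
  have "(LINT x:\<Omega>|lborel. rep_L2 (L2_of F) x * D x) = (LINT x:\<Omega>|lborel. F x * D x)"
    unfolding set_lebesgue_integral_def
  proof (rule integral_cong_AE[OF m[OF square_integrable_rep_L2] m[OF sq]])
    show "AE x in lborel. indicator \<Omega> x *\<^sub>R (rep_L2 (L2_of F) x * D x) = indicator \<Omega> x *\<^sub>R (F x * D x)"
      using rep_L2_of[OF sq] unfolding AE_I11 by eventually_elim (use \<Omega> in \<open>auto simp: indicator_def\<close>)
  qed
  moreover have "(LINT x:\<Omega>|lborel. F x * deriv \<phi> x) = - (LINT x:\<Omega>|lborel. G x * \<phi> x)"
    using wd t unfolding weak_derivative_def by blast
  ultimately show "(LINT x:\<Omega>|lborel. rep_L2 (L2_of F) x * deriv \<phi> x) = - (LINT x:\<Omega>|lborel. G x * \<phi> x)"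
    by (simp only: D(3))
qed

lemma weak_derivative_rep_right:
  assumes \<Omega>: "\<Omega> \<subseteq> {-1<..<1}" and sq: "square_integrable I11 G" and wd: "weak_derivative \<Omega> F G" and o: "open \<Omega>"
  shows "weak_derivative \<Omega> F (rep_L2 (L2_of G))"
  unfolding weak_derivative_def
proof (intro conjI allI impI locally_integrable_rep_L2 \<Omega>)
  show "locally_integrable \<Omega> F" using wd by (simp add: weak_derivative_def)
  fix \<phi> assume t: "test_function \<Omega> \<phi>"
  then obtain D K where D: "\<And>x. (\<phi> has_real_derivative D x) (at x)" by (rule test_functionE) blast
  then have "continuous_on UNIV \<phi>" by (intro continuous_at_imp_continuous_on ballI) (rule DERIV_isCont)
  then have [measurable]: "\<phi> \<in> borel_measurable borel" by (rule borel_measurable_continuous_onI)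
  have [measurable]: "\<Omega> \<in> sets borel" using o by simp
  have m: "(\<lambda>x. indicator \<Omega> x *\<^sub>R (f x * \<phi> x)) \<in> borel_measurable lborel" if "square_integrable I11 f" for f
  proof -
    have [measurable]: "(\<lambda>x. indicator {-1<..<1} x * f x) \<in> borel_measurable borel"
      using that by (simp add: square_integrable_def measurable_I11)
    have eq: "indicator \<Omega> x *\<^sub>R (f x * \<phi> x) = indicator \<Omega> x * ((indicator {-1<..<1} x * f x) * \<phi> x)" for x
      using \<Omega> by (auto simp: indicator_def)
    show ?thesis unfolding eq by measurable
  qed
  have "(LINT x:\<Omega>|lborel. rep_L2 (L2_of G) x * \<phi> x) = (LINT x:\<Omega>|lborel. G x * \<phi> x)"
    unfolding set_lebesgue_integral_def
  proof (rule integral_cong_AE[OF m[OF square_integrable_rep_L2] m[OF sq]])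
    show "AE x in lborel. indicator \<Omega> x *\<^sub>R (rep_L2 (L2_of G) x * \<phi> x) = indicator \<Omega> x *\<^sub>R (G x * \<phi> x)"
      using rep_L2_of[OF sq] unfolding AE_I11 by eventually_elim (use \<Omega> in \<open>auto simp: indicator_def\<close>)
  qed
  moreover have "(LINT x:\<Omega>|lborel. F x * deriv \<phi> x) = - (LINT x:\<Omega>|lborel. G x * \<phi> x)"
    using wd t unfolding weak_derivative_def by blast
  ultimately show "(LINT x:\<Omega>|lborel. F x * deriv \<phi> x) = - (LINT x:\<Omega>|lborel. rep_L2 (L2_of G) x * \<phi> x)"
    by simp
qed

lemma AE_eq_imp_limits_eq:
  fixes F G :: "real \<Rightarrow> real"
  assumes ae: "AE x in lborel. x \<in> {-1<..<1} \<longrightarrow> F x = G x" and a: "a \<in> {-1..1}"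
    and F: "(F \<longlongrightarrow> y) (at a within {-1<..<1})" and G: "(G \<longlongrightarrow> z) (at a within {-1<..<1})"
  shows "y = z"
proof (rule ccontr)
  assume "y \<noteq> z"
  have "((\<lambda>x. F x - G x) \<longlongrightarrow> y - z) (at a within {-1<..<1})" by (intro tendsto_diff F G)
  then have "\<forall>\<^sub>F x in at a within {-1<..<1}. F x - G x \<noteq> 0"
    using \<open>y \<noteq> z\<close> by (intro tendsto_imp_eventually_ne) auto
  then obtain d where d: "d > 0" "\<And>x. x \<in> {-1<..<1} \<Longrightarrow> x \<noteq> a \<Longrightarrow> dist x a < d \<Longrightarrow> F x - G x \<noteq> 0"
    unfolding eventually_at by blast
  obtain p q where pq: "p < q" "{p<..<q} \<subseteq> {-1<..<1}" "\<And>x. x \<in> {p<..<q} \<Longrightarrow> x \<noteq> a \<and> dist x a < d"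
  proof (cases "a < 1")
    case True
    show thesis
      by (rule that[of a "min (a + d) 1"]) (use True a d(1) in \<open>auto simp: dist_real_def\<close>)
  next
    case False
    then have "a = 1" using a by simp
    then show thesis
      by (intro that[of "max (1 - d) (-1)" 1]) (use d(1) in \<open>auto simp: dist_real_def\<close>)
  qed
  have "AE x in lborel. x \<notin> {p<..<q}"
    using ae by eventually_elim (use pq d(2) in auto)
  then have "{p<..<q} \<in> null_sets lborel" by (subst (asm) AE_iff_null_sets[symmetric]) auto
  then show False using pq(1) by (auto simp: null_sets_def)
qed

lemma has_value_unique:
  assumes "has_value f a y" "AE x in I11. F x = rep_L2 f x" "(F \<longlongrightarrow> z) (at a within {-1<..<1})" "a \<in> {-1..1}"
  shows "y = z"
proof -
  obtain G where G: "AE x in I11. G x = rep_L2 f x" "(G \<longlongrightarrow> y) (at a within {-1<..<1})"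
    using assms(1) by (auto simp: has_value_def)
  have "AE x in lborel. x \<in> {-1<..<1} \<longrightarrow> G x = F x"
    using G(1) assms(2) unfolding AE_I11 by eventually_elim simp
  from AE_eq_imp_limits_eq[OF this assms(4) G(2) assms(3)] show ?thesis .
qed

lemma has_valueI:
  assumes "square_integrable I11 F" "(F \<longlongrightarrow> y) (at a within {-1<..<1})"
  shows "has_value (L2_of F) a y"
proof -
  have "AE x in I11. F x = rep_L2 (L2_of F) x" using rep_L2_of[OF assms(1)] by eventually_elim simp
  then show ?thesis using assms(2) by (auto simp: has_value_def)
qed

lemma square_integrable_halves:
  fixes F :: "real \<Rightarrow> real"
  assumes m: "(\<lambda>x. indicator {0<..<1} x * F x) \<in> borel_measurable borel"
      "(\<lambda>x. indicator {0<..<1} x * F (- x)) \<in> borel_measurable borel"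
    and i: "set_integrable lborel {0<..<1} (\<lambda>x. (F x)\<^sup>2)" "set_integrable lborel {0<..<1} (\<lambda>x. (F (- x))\<^sup>2)"
  shows "square_integrable I11 F"
proof -
  have r: "(\<lambda>x. indicator {-1<..<0} x * h x) = (\<lambda>x. indicator {0<..<1} (- x) * h (- (- x)))" for h :: "real \<Rightarrow> real"
    by (auto simp: fun_eq_iff indicator_def)
  have dec: "indicator {-1<..<1} x * h x = indicator {0<..<1} x * h x + indicator {-1<..<0} x * h x + indicator {0} x * h 0"
    for h :: "real \<Rightarrow> real" and x by (auto simp: indicator_def)
  have "(\<lambda>x. indicator {0<..<1} (- x) * F (- (- x))) \<in> borel_measurable borel"
    using measurable_compose[OF borel_measurable_uminus[OF measurable_ident] m(2)] by simp
  then have n: "(\<lambda>x. indicator {-1<..<0} x * F x) \<in> borel_measurable borel" unfolding r .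
  have z: "(\<lambda>x. indicator {0::real} x * F 0) \<in> borel_measurable borel" by measurable
  have "F \<in> borel_measurable I11"
    unfolding measurable_I11 dec by (intro borel_measurable_add m(1) n z)
  moreover have "integrable I11 (\<lambda>x. (F x)\<^sup>2)"
  proof -
    have "integrable lborel (\<lambda>x. indicator {0<..<1} (- x) * (F (- (- x)))\<^sup>2)"
      using integral_unit_scale(2)[of "-1" "\<lambda>x. indicator {0<..<1} x * (F (- x))\<^sup>2"] i(2) by (simp add: set_integrable_def)
    then have "integrable lborel (\<lambda>x. indicator {-1<..<0} x * (F x)\<^sup>2)" using r[of "\<lambda>x. (F x)\<^sup>2"] by simp
    moreover have "integrable lborel (\<lambda>x. indicator {0::real} x * (F 0)\<^sup>2)" by (rule integrable_mult_left) simp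
    ultimately show ?thesis
      using i(1) unfolding integrable_I11 set_integrable_def
      by (simp add: dec[where h = "\<lambda>x. (F x)\<^sup>2"])
  qed
  ultimately show ?thesis by (simp add: square_integrable_def)
qed

lemma set_integrable_square_bounded:
  fixes f :: "real \<Rightarrow> real"
  assumes "continuous_on {0<..<1} f" "\<And>x. x \<in> {0<..<1} \<Longrightarrow> \<bar>f x\<bar> \<le> B * x powr p" "p > -1/2"
  shows "set_integrable lborel {0<..<1} (\<lambda>x. (f x)\<^sup>2)"
  unfolding set_integrable_def
proof (rule Bochner_Integration.integrable_bound)
  have "set_integrable lborel {0..1::real} (\<lambda>x. x powr (2 * p))" using assms(3) by (intro powr_set_integrable) auto
  then show "integrable lborel (\<lambda>x. B\<^sup>2 * (indicator {0..1} x *\<^sub>R x powr (2 * p)))"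
    by (intro integrable_mult_right) (simp add: set_integrable_def)
  have "(\<lambda>x. indicator {0<..<1} x *\<^sub>R f x) \<in> borel_measurable borel"
    by (rule borel_measurable_continuous_on_indicator) (use assms in auto)
  then have "(\<lambda>x. (indicator {0<..<1} x *\<^sub>R f x)\<^sup>2) \<in> borel_measurable borel" by measurable
  moreover have "(\<lambda>x. (indicator {0<..<1} x *\<^sub>R f x)\<^sup>2) = (\<lambda>x. indicator {0<..<1} x *\<^sub>R (f x)\<^sup>2)"
    by (auto simp: fun_eq_iff indicator_def)
  ultimately show "(\<lambda>x. indicator {0<..<1} x *\<^sub>R (f x)\<^sup>2) \<in> borel_measurable lborel" by simp
  show "AE x in lborel. norm (indicator {0<..<1} x *\<^sub>R (f x)\<^sup>2) \<le> norm (B\<^sup>2 * (indicator {0..1} x *\<^sub>R x powr (2 * p)))"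
  proof (rule AE_I2)
    fix x :: real
    show "norm (indicator {0<..<1} x *\<^sub>R (f x)\<^sup>2) \<le> norm (B\<^sup>2 * (indicator {0..1} x *\<^sub>R x powr (2 * p)))"
    proof (cases "x \<in> {0<..<1}")
      case True
      have "(f x)\<^sup>2 \<le> (B * x powr p)\<^sup>2" using power_mono[OF assms(2)[OF True], of 2] by simp
      also have "\<dots> = B\<^sup>2 * x powr (2 * p)"
        by (simp add: power_mult_distrib power2_eq_square flip: powr_add)
      finally show ?thesis using True by simp
    qed simp
  qed
qed

lemma primitive_on_reflect:
  assumes "primitive_on {0<..<1} (\<lambda>x. F (- x)) (\<lambda>x. - G (- x))"
  shows "primitive_on {-1<..<0} F G"
  unfolding primitive_on_def
proof (intro allI impI)
  fix a b :: real assume "a \<le> b \<and> {a..b} \<subseteq> {-1<..<0}"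
  then have "- b \<le> - a" "a \<in> {-1<..<0}" "b \<in> {-1<..<0}" by auto
  then have ab: "- b \<le> - a" "{-b..-a} \<subseteq> {0<..<1}" by auto
  have i: "set_integrable lborel {-b..-a} (\<lambda>x. - G (- x))" by (rule primitive_onD(1)[OF assms ab])
  then have "integrable lborel (\<lambda>x. indicator {-b..-a} x * - G (- x))" by (simp add: set_integrable_def)
  then have "integrable lborel (\<lambda>x. indicator {-b..-a} (- x) * - G (- (- x)))"
    using integral_unit_scale(2)[of "-1" "\<lambda>x. indicator {-b..-a} x * - G (- x)"] by simp
  moreover have "indicator {-b..-a} (- x) = (indicator {a..b} x :: real)" for x
    by (auto simp: indicator_def)
  ultimately have "set_integrable lborel {a..b} G" by (simp add: set_integrable_def)
  moreover have "integral {a..b} G = F b - F a"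
    using primitive_onD(2)[OF assms ab] Henstock_Kurzweil_Integration.integral_reflect_real[of b a G] by simp
  ultimately show "set_integrable lborel {a..b} G \<and> integral {a..b} G = F b - F a" by blast
qed

text \<open>The weak derivatives are unique almost everywhere, so any pair of them computes the operator.\<close>
lemma A0_eqI:
  assumes f': "weak_derivative ({-1<..<1} - {0}) (rep_L2 f) f'"
    and f'': "weak_derivative ({-1<..<1} - {0}) f' f''"
    and g: "AE x in I11. rep_L2 g x = - f'' x + (\<nu>\<^sup>2 - 1/4) / x\<^sup>2 * rep_L2 f x"
  shows "A0 \<nu> f = g"
  unfolding A0_def
proof (rule the_equality)
  show "\<exists>f' f''. weak_derivative ({-1<..<1} - {0}) (rep_L2 f) f' \<and> weak_derivative ({-1<..<1} - {0}) f' f'' \<and>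
      (AE x in I11. rep_L2 g x = - f'' x + (\<nu>\<^sup>2 - 1/4) / x\<^sup>2 * rep_L2 f x)"
    using assms by blast
next
  fix h assume "\<exists>f' f''. weak_derivative ({-1<..<1} - {0}) (rep_L2 f) f' \<and> weak_derivative ({-1<..<1} - {0}) f' f'' \<and>
      (AE x in I11. rep_L2 h x = - f'' x + (\<nu>\<^sup>2 - 1/4) / x\<^sup>2 * rep_L2 f x)"
  then obtain p p' where p: "weak_derivative ({-1<..<1} - {0}) (rep_L2 f) p" "weak_derivative ({-1<..<1} - {0}) p p'"
    "AE x in I11. rep_L2 h x = - p' x + (\<nu>\<^sup>2 - 1/4) / x\<^sup>2 * rep_L2 f x" by blast
  have o: "open ({-1<..<1} - {0 :: real})" by (intro open_Diff) auto
  have "AE x in lborel. x \<in> {-1<..<1} - {0} \<longrightarrow> p x = f' x"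
    by (rule weak_derivative_unique[OF o p(1) f']) simp
  from weak_derivative_unique[OF o p(2) f'' this]
  have "AE x in lborel. x \<in> {-1<..<1} - {0} \<longrightarrow> p' x = f'' x" .
  then have "AE x in I11. rep_L2 h x = rep_L2 g x"
    using p(3) g AE_lborel_singleton[of 0] unfolding AE_I11 by eventually_elim auto
  then show "h = g"
    using L2_of_eqI[OF square_integrable_rep_L2 square_integrable_rep_L2, of h g] by (simp add: L2_of_rep_L2)
qed

context inverse_square
begin

lemma powr_abs: "\<bar>x\<bar> powr (\<nu> + 1/2) = \<bar>x\<bar> powr \<alpha>" "\<bar>x\<bar> powr (- \<nu> + 1/2) = \<bar>x\<bar> powr \<beta>" for x :: real
  by (simp_all add: \<alpha>_def \<beta>_def add.commute)

text \<open>By variation of parameters these are the solutions of \<open>- w'' + c / x\<^sup>2 w = g\<close> on one side.\<close>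
definition half_sol :: "real \<Rightarrow> real \<Rightarrow> real \<Rightarrow> L2 \<Rightarrow> real \<Rightarrow> real" where
  "half_sol c1 c2 \<sigma> g x = c1 * x powr \<alpha> + c2 * x powr \<beta> + V \<sigma> g x"

definition half_sol' :: "real \<Rightarrow> real \<Rightarrow> real \<Rightarrow> L2 \<Rightarrow> real \<Rightarrow> real" where
  "half_sol' c1 c2 \<sigma> g x = c1 * (\<alpha> * x powr (\<alpha> - 1)) + c2 * (\<beta> * x powr (\<beta> - 1)) + V' \<sigma> g x"

definition sol :: "real \<Rightarrow> real \<Rightarrow> real \<Rightarrow> real \<Rightarrow> L2 \<Rightarrow> real \<Rightarrow> real" where
  "sol c1m c2m c1p c2p g x = (if x > 0 then half_sol c1p c2p 1 g x else half_sol c1m c2m (- 1) g (- x))"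

lemma half_sol_primitive:
  assumes "\<sigma> \<in> {1, -1}"
  shows "primitive_on {0<..1} (half_sol c1 c2 \<sigma> g) (half_sol' c1 c2 \<sigma> g)"
    "primitive_on {0<..1} (half_sol' c1 c2 \<sigma> g) (\<lambda>x. pot / x\<^sup>2 * half_sol c1 c2 \<sigma> g x - rep0 g (\<sigma> * x))"
proof -
  have J: "{0<..1} \<subseteq> {0::real<..}" by auto
  note p = primitive_on_subset[OF primitive_on_powr J]
  show "primitive_on {0<..1} (half_sol c1 c2 \<sigma> g) (half_sol' c1 c2 \<sigma> g)"
    unfolding half_sol_def half_sol'_def
    by (intro primitive_on_add primitive_on_scale p V_primitive assms)
  have "primitive_on {0<..1} (half_sol' c1 c2 \<sigma> g)
      (\<lambda>x. c1 * (\<alpha> * ((\<alpha> - 1) * x powr (\<alpha> - 1 - 1))) + c2 * (\<beta> * ((\<beta> - 1) * x powr (\<beta> - 1 - 1)))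
        + (pot / x\<^sup>2 * V \<sigma> g x - rep0 g (\<sigma> * x)))"
    unfolding half_sol'_def by (intro primitive_on_add primitive_on_scale p V'_primitive assms)
  then show "primitive_on {0<..1} (half_sol' c1 c2 \<sigma> g) (\<lambda>x. pot / x\<^sup>2 * half_sol c1 c2 \<sigma> g x - rep0 g (\<sigma> * x))"
  proof (rule primitive_on_cong[THEN iffD1, rotated 2])
    fix x :: real assume "x \<in> {0<..1}"
    then have x: "x > 0" by simp
    have f: "x powr (\<beta> - 1 - 1) = x powr \<beta> / x\<^sup>2" "x powr (\<alpha> - 1 - 1) = x powr \<alpha> / x\<^sup>2"
      using x by (simp_all add: powr_diff power2_eq_square)
    have "c1 * (\<alpha> * ((\<alpha> - 1) * x powr (\<alpha> - 1 - 1))) + c2 * (\<beta> * ((\<beta> - 1) * x powr (\<beta> - 1 - 1)))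
        = (\<alpha> * (\<alpha> - 1)) * (c1 * x powr \<alpha> / x\<^sup>2) + (\<beta> * (\<beta> - 1)) * (c2 * x powr \<beta> / x\<^sup>2)"
      unfolding f by (simp add: algebra_simps)
    then show "c1 * (\<alpha> * ((\<alpha> - 1) * x powr (\<alpha> - 1 - 1))) + c2 * (\<beta> * ((\<beta> - 1) * x powr (\<beta> - 1 - 1)))
        + (pot / x\<^sup>2 * V \<sigma> g x - rep0 g (\<sigma> * x)) = pot / x\<^sup>2 * half_sol c1 c2 \<sigma> g x - rep0 g (\<sigma> * x)"
      unfolding exponents(5,6) by (simp add: half_sol_def algebra_simps)
  qed simp
qed

lemma half_sol_continuous:
  assumes "\<sigma> \<in> {1, -1}"
  shows "continuous_on {0<..1} (half_sol c1 c2 \<sigma> g)"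
proof -
  have "continuous_on {a..1} (half_sol c1 c2 \<sigma> g)" if "a > 0" for a
    by (rule primitive_on_continuous[OF half_sol_primitive(1)[OF assms]]) (use that in auto)
  then have c: "continuous (at x within {x/2..1}) (half_sol c1 c2 \<sigma> g)" if "x \<in> {0<..1}" for x
    using that by (auto simp: continuous_on_eq_continuous_within)
  show ?thesis
    unfolding continuous_on_eq_continuous_within
  proof
    fix x :: real assume x: "x \<in> {0<..1}"
    have "at x within {0<..1} = at x within {x/2..1}"
      by (rule at_within_nhd[of x "{x/2<..}"]) (use x in auto)
    then show "continuous (at x within {0<..1}) (half_sol c1 c2 \<sigma> g)" using c[OF x] by simp
  qed
qed

lemma half_sol_bound:
  assumes "\<sigma> \<in> {1, -1}"
  shows "\<exists>C\<ge>0. \<forall>x\<in>{0<..1}. \<bar>half_sol c1 c2 \<sigma> g x\<bar> \<le> C * x powr \<beta>"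
proof -
  obtain C where C: "C \<ge> 0" "\<And>x. x \<in> {0<..1} \<Longrightarrow> \<bar>V \<sigma> g x\<bar> \<le> C * x powr (3/2)" using V_bounds[OF assms] by blast
  have "\<bar>half_sol c1 c2 \<sigma> g x\<bar> \<le> (\<bar>c1\<bar> + \<bar>c2\<bar> + C) * x powr \<beta>" if x: "x \<in> {0<..1}" for x
  proof -
    have "x powr \<alpha> \<le> x powr \<beta>" "x powr (3/2) \<le> x powr \<beta>"
      using x \<nu> by (auto intro!: powr_mono' simp: \<alpha>_def \<beta>_def)
    then have "\<bar>c1 * x powr \<alpha>\<bar> \<le> \<bar>c1\<bar> * x powr \<beta>" "\<bar>V \<sigma> g x\<bar> \<le> C * x powr \<beta>"
      using C(2)[OF x] mult_left_mono[OF _ C(1)] by (auto simp: abs_mult mult_left_mono intro: order_trans)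
    moreover have "\<bar>c2 * x powr \<beta>\<bar> = \<bar>c2\<bar> * x powr \<beta>" by (simp add: abs_mult)
    ultimately show ?thesis unfolding half_sol_def by (simp add: distrib_right)
  qed
  then show ?thesis using C(1) by (intro exI[of _ "\<bar>c1\<bar> + \<bar>c2\<bar> + C"]) auto
qed

lemma continuous_imp_indicator_measurable:
  fixes f :: "real \<Rightarrow> real"
  assumes "continuous_on {0<..<1} f"
  shows "(\<lambda>x. indicator {0<..<1} x * f x) \<in> borel_measurable borel"
  using borel_measurable_continuous_on_indicator[OF _ assms] by simp

lemma half_continuous: "\<sigma> \<in> {1, -1} \<Longrightarrow> continuous_on {0<..<1} (half_sol c1 c2 \<sigma> g)"
  by (rule continuous_on_subset[OF half_sol_continuous]) auto

lemma square_integrable_sol: "square_integrable I11 (sol c1m c2m c1p c2p g)"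
proof -
  have s: "(\<lambda>x. indicator {0<..<1} x * sol c1m c2m c1p c2p g x) = (\<lambda>x. indicator {0<..<1} x * half_sol c1p c2p 1 g x)"
    "(\<lambda>x. indicator {0<..<1} x * sol c1m c2m c1p c2p g (- x)) = (\<lambda>x. indicator {0<..<1} x * half_sol c1m c2m (- 1) g x)"
    by (auto simp: fun_eq_iff sol_def indicator_def)
  have i: "set_integrable lborel {0<..<1} (\<lambda>x. (half_sol c1 c2 \<sigma> g x)\<^sup>2)" if \<sigma>: "\<sigma> \<in> {1, -1}" for c1 c2 \<sigma>
  proof -
    obtain C where "\<And>x. x \<in> {0<..1} \<Longrightarrow> \<bar>half_sol c1 c2 \<sigma> g x\<bar> \<le> C * x powr \<beta>"
      using half_sol_bound[OF \<sigma>] by blast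
    then show ?thesis by (intro set_integrable_square_bounded[where B = C, OF half_continuous[OF \<sigma>] _ exponents(2)]) auto
  qed
  show ?thesis
  proof (rule square_integrable_halves)
    show "set_integrable lborel {0<..<1} (\<lambda>x. (sol c1m c2m c1p c2p g x)\<^sup>2)"
      by (rule set_integrable_cong[THEN iffD1, OF refl refl _ i[of 1 c1p c2p]]) (auto simp: sol_def)
    show "set_integrable lborel {0<..<1} (\<lambda>x. (sol c1m c2m c1p c2p g (- x))\<^sup>2)"
      by (rule set_integrable_cong[THEN iffD1, OF refl refl _ i[of "-1" c1m c2m]]) (auto simp: sol_def)
  qed (unfold s, auto intro!: continuous_imp_indicator_measurable half_continuous)
qed

definition sol' :: "real \<Rightarrow> real \<Rightarrow> real \<Rightarrow> real \<Rightarrow> L2 \<Rightarrow> real \<Rightarrow> real" where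
  "sol' c1m c2m c1p c2p g x = (if x > 0 then half_sol' c1p c2p 1 g x else - half_sol' c1m c2m (- 1) g (- x))"

lemma sol_weak_derivatives:
  shows "weak_derivative ({-1<..<1} - {0}) (sol c1m c2m c1p c2p g) (sol' c1m c2m c1p c2p g)"
    "weak_derivative ({-1<..<1} - {0}) (sol' c1m c2m c1p c2p g) (\<lambda>x. pot / x\<^sup>2 * sol c1m c2m c1p c2p g x - rep0 g x)"
proof -
  have sub: "{0<..<1} \<subseteq> {0::real<..1}" by auto
  note p = primitive_on_subset[OF half_sol_primitive(1)[of 1 c1p c2p g] sub]
    primitive_on_subset[OF half_sol_primitive(2)[of 1 c1p c2p g] sub]
    primitive_on_subset[OF half_sol_primitive(1)[of "-1" c1m c2m g] sub]
    primitive_on_scale[OF primitive_on_subset[OF half_sol_primitive(2)[of "-1" c1m c2m g] sub], of "-1"]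
  have "primitive_on {0<..<1} (sol c1m c2m c1p c2p g) (sol' c1m c2m c1p c2p g)"
    by (rule primitive_on_cong[THEN iffD1, OF _ _ p(1)]) (auto simp: sol_def sol'_def)
  moreover have "primitive_on {-1<..<0} (sol c1m c2m c1p c2p g) (sol' c1m c2m c1p c2p g)"
    by (rule primitive_on_reflect, rule primitive_on_cong[THEN iffD1, OF _ _ p(3)]) (auto simp: sol_def sol'_def)
  ultimately show "weak_derivative ({-1<..<1} - {0}) (sol c1m c2m c1p c2p g) (sol' c1m c2m c1p c2p g)"
    by (intro weak_derivative_of_primitive_punctured) auto
  have "primitive_on {0<..<1} (sol' c1m c2m c1p c2p g) (\<lambda>x. pot / x\<^sup>2 * sol c1m c2m c1p c2p g x - rep0 g x)"
    by (rule primitive_on_cong[THEN iffD1, OF _ _ p(2)]) (auto simp: sol_def sol'_def)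
  moreover have "primitive_on {-1<..<0} (sol' c1m c2m c1p c2p g) (\<lambda>x. pot / x\<^sup>2 * sol c1m c2m c1p c2p g x - rep0 g x)"
    by (rule primitive_on_reflect, rule primitive_on_cong[THEN iffD1, OF _ _ p(4)]) (auto simp: sol_def sol'_def)
  ultimately show "weak_derivative ({-1<..<1} - {0}) (sol' c1m c2m c1p c2p g) (\<lambda>x. pot / x\<^sup>2 * sol c1m c2m c1p c2p g x - rep0 g x)"
    by (intro weak_derivative_of_primitive_punctured) auto
qed

lemma A0_sol: "A0 \<nu> (L2_of (sol c1m c2m c1p c2p g)) = g"
proof (rule A0_eqI)
  have o: "open ({-1<..<1} - {0 :: real})" by (intro open_Diff) auto
  show "weak_derivative ({-1<..<1} - {0}) (rep_L2 (L2_of (sol c1m c2m c1p c2p g))) (sol' c1m c2m c1p c2p g)"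
    by (rule weak_derivative_rep_left[OF _ square_integrable_sol sol_weak_derivatives(1) o]) auto
  show "AE x in I11. rep_L2 g x = - (pot / x\<^sup>2 * sol c1m c2m c1p c2p g x - rep0 g x)
      + (\<nu>\<^sup>2 - 1/4) / x\<^sup>2 * rep_L2 (L2_of (sol c1m c2m c1p c2p g)) x"
    using rep_L2_of[OF square_integrable_sol[of c1m c2m c1p c2p g]] AE_rep0[of g]
    by eventually_elim (simp add: pot_def)
qed (rule sol_weak_derivatives(2))

lemma hardy_difference:
  assumes p: "p > -1/2" "q > -1/2" and \<sigma>: "\<sigma> \<in> {1, -1}"
    and u: "\<And>x. x \<in> {0<..<1} \<Longrightarrow> u x = k * (x powr (- p - 1) * moment p \<sigma> g x - x powr (- q - 1) * moment q \<sigma> g x)"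
  shows "set_integrable lborel {0<..<1} (\<lambda>x. (u x)\<^sup>2)" "(\<lambda>x. indicator {0<..<1} x * u x) \<in> borel_measurable borel"
proof -
  define a where "a x = x powr (- p - 1) * moment p \<sigma> g x" for x
  define b where "b x = x powr (- q - 1) * moment q \<sigma> g x" for x
  have ab: "set_integrable lborel {0<..<1} (\<lambda>x. 2 * k\<^sup>2 * ((a x)\<^sup>2 + (b x)\<^sup>2))"
    unfolding a_def b_def by (intro set_integrable_mult_right set_integral_add hardy p \<sigma>)
  have sub: "{0<..<1} \<subseteq> {0..1::real}" by auto
  have "continuous_on {0<..<1} (\<lambda>x. k * (a x - b x))"
    unfolding a_def b_def
    by (intro continuous_intros continuous_on_subset[OF primitive_on_continuous[OF moment_primitive order_refl] sub] p \<sigma>) auto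
  then have "continuous_on {0<..<1} u" by (rule continuous_on_eq) (simp add: u a_def b_def)
  then show m: "(\<lambda>x. indicator {0<..<1} x * u x) \<in> borel_measurable borel" by (rule continuous_imp_indicator_measurable)
  show "set_integrable lborel {0<..<1} (\<lambda>x. (u x)\<^sup>2)"
    unfolding set_integrable_def
  proof (rule Bochner_Integration.integrable_bound)
    show "integrable lborel (\<lambda>x. indicator {0<..<1} x *\<^sub>R (2 * k\<^sup>2 * ((a x)\<^sup>2 + (b x)\<^sup>2)))"
      using ab by (simp add: set_integrable_def)
    have eq: "indicator {0<..<1} x *\<^sub>R (u x)\<^sup>2 = (indicator {0<..<1} x * u x)\<^sup>2" for x
      by (auto simp: indicator_def)
    show "(\<lambda>x. indicator {0<..<1} x *\<^sub>R (u x)\<^sup>2) \<in> borel_measurable lborel"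
      unfolding eq using m by measurable
    show "AE x in lborel. norm (indicator {0<..<1} x *\<^sub>R (u x)\<^sup>2)
        \<le> norm (indicator {0<..<1} x *\<^sub>R (2 * k\<^sup>2 * ((a x)\<^sup>2 + (b x)\<^sup>2)))"
    proof (rule AE_I2)
      fix x :: real
      have "(a x - b x)\<^sup>2 \<le> 2 * ((a x)\<^sup>2 + (b x)\<^sup>2)"
        using zero_le_power2[of "a x + b x"] by (simp add: power2_sum power2_diff)
      from mult_left_mono[OF this zero_le_power2[of k]]
      have "(k * (a x - b x))\<^sup>2 \<le> 2 * k\<^sup>2 * ((a x)\<^sup>2 + (b x)\<^sup>2)" by (simp only: power_mult_distrib mult_ac)
      then show "norm (indicator {0<..<1} x *\<^sub>R (u x)\<^sup>2)
        \<le> norm (indicator {0<..<1} x *\<^sub>R (2 * k\<^sup>2 * ((a x)\<^sup>2 + (b x)\<^sup>2)))"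
        by (cases "x \<in> {0<..<1}") (auto simp: u a_def b_def)
    qed
  qed
qed

text \<open>Since \<open>\<alpha> + \<beta> = 1\<close>, the quotient by \<open>x\<^sup>2\<close> is a difference of two terms of the form that occurs in
  Hardy's inequality.\<close>
lemma square_integrable_pot_V: "square_integrable I11 (\<lambda>x. pot / x\<^sup>2 * sol 0 0 0 0 g x)"
proof -
  define k where "k = pot / (2 * \<nu>)"
  have eq: "pot / x\<^sup>2 * V \<sigma> g x = k * (x powr (- \<alpha> - 1) * moment \<alpha> \<sigma> g x - x powr (- \<beta> - 1) * moment \<beta> \<sigma> g x)"
    if "x \<in> {0<..<1}" for x \<sigma>
  proof -
    have n: "- \<alpha> - 1 = \<beta> - 2" "- \<beta> - 1 = \<alpha> - 2" using exponents(3) by auto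
    have e: "x powr (- \<alpha> - 1) = x powr \<beta> / x\<^sup>2" "x powr (- \<beta> - 1) = x powr \<alpha> / x\<^sup>2"
      unfolding n using that by (simp_all add: powr_diff)
    show ?thesis unfolding e k_def V_def by (simp add: diff_divide_distrib right_diff_distrib mult_ac)
  qed
  have e1: "pot / x\<^sup>2 * sol 0 0 0 0 g x
      = k * (x powr (- \<alpha> - 1) * moment \<alpha> 1 g x - x powr (- \<beta> - 1) * moment \<beta> 1 g x)"
    and e2: "pot / (- x)\<^sup>2 * sol 0 0 0 0 g (- x)
      = k * (x powr (- \<alpha> - 1) * moment \<alpha> (- 1) g x - x powr (- \<beta> - 1) * moment \<beta> (- 1) g x)"
    if "x \<in> {0<..<1}" for x
    using eq[OF that, of 1] eq[OF that, of "-1"] that by (simp_all add: sol_def half_sol_def)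
  show ?thesis
    by (rule square_integrable_halves)
      (rule hardy_difference(2)[OF exponents(1,2) _ e1] hardy_difference(2)[OF exponents(1,2) _ e2]
        hardy_difference(1)[OF exponents(1,2) _ e1] hardy_difference(1)[OF exponents(1,2) _ e2]; simp)+
qed

lemma tendsto_of_power_bound:
  fixes F :: "real \<Rightarrow> real"
  assumes "\<And>x. x \<in> {-1<..<1} \<Longrightarrow> x \<noteq> 0 \<Longrightarrow> \<bar>F x\<bar> \<le> C * \<bar>x\<bar> powr p" "p > 0"
  shows "(F \<longlongrightarrow> 0) (at 0)"
proof (rule Lim_null_comparison)
  have "\<forall>\<^sub>F x in at (0::real). x \<in> {-1<..<1}" by (rule eventually_at_in_open') auto
  then show "\<forall>\<^sub>F x in at 0. norm (F x) \<le> C * \<bar>x\<bar> powr p"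
    using eventually_neq_at_within[of 0 0 UNIV] by eventually_elim (use assms(1) in simp)
  have "((\<lambda>x::real. \<bar>x\<bar> powr p) \<longlongrightarrow> 0) (at 0)"
    by (rule tendsto_zero_powrI) (use assms(2) in \<open>auto intro!: tendsto_eq_intros\<close>)
  then show "((\<lambda>x. C * \<bar>x\<bar> powr p) \<longlongrightarrow> 0) (at 0)" by (intro tendsto_mult_right_zero)
qed

text \<open>The regular part: the particular solution lies in \<open>H\<^sup>2\<close>, across the singularity, with
  vanishing data there.\<close>
lemma regular_part: "L2_of (sol 0 0 0 0 g) \<in> H2_0"
proof -
  define F where "F = sol 0 0 0 0 g"
  define F' where "F' = sol' 0 0 0 0 g"
  define F'' where "F'' x = pot / x\<^sup>2 * F x - rep0 g x" for x
  have F: "F x = (if x > 0 then V 1 g x else V (- 1) g (- x))" for x by (simp add: F_def sol_def half_sol_def)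
  have F': "F' x = (if x > 0 then V' 1 g x else - V' (- 1) g (- x))" for x by (simp add: F'_def sol'_def half_sol'_def)
  obtain C where C: "C \<ge> 0" "\<And>x. x \<in> {0<..1} \<Longrightarrow> \<bar>V 1 g x\<bar> \<le> C * x powr (3/2) \<and> \<bar>V' 1 g x\<bar> \<le> C * x powr (1/2)"
    using V_bounds[of 1 g] by auto
  obtain B where B: "B \<ge> 0" "\<And>x. x \<in> {0<..1} \<Longrightarrow> \<bar>V (-1) g x\<bar> \<le> B * x powr (3/2) \<and> \<bar>V' (-1) g x\<bar> \<le> B * x powr (1/2)"
    using V_bounds[of "-1" g] by auto
  have b: "\<bar>F x\<bar> \<le> (B + C) * \<bar>x\<bar> powr (3/2) \<and> \<bar>F' x\<bar> \<le> (B + C) * \<bar>x\<bar> powr (1/2)" if "x \<in> {-1..1}" "x \<noteq> 0" for x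
  proof (cases "x > 0")
    case True
    have "C * t \<le> (B + C) * t" if "t \<ge> 0" for t using B(1) that by (intro mult_right_mono) auto
    then show ?thesis using C(2)[of x] True that by (auto simp: F F' intro: order_trans)
  next
    case False
    have "B * t \<le> (B + C) * t" if "t \<ge> 0" for t using C(1) that by (intro mult_right_mono) auto
    then show ?thesis using B(2)[of "- x"] False that by (auto simp: F F' intro: order_trans)
  qed
  have t: "(F \<longlongrightarrow> 0) (at 0)" "(F' \<longlongrightarrow> 0) (at 0)"
    by (rule tendsto_of_power_bound[of _ "B + C" "3/2"], use b in auto)
      (rule tendsto_of_power_bound[of _ "B + C" "1/2"], use b in auto)
  have z: "F 0 = 0" "F' 0 = 0" by (simp_all add: F F' V_def V'_def)
  have c: "isCont F 0" "isCont F' 0" using t z by (auto simp: isCont_def)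
  have sqF: "square_integrable I11 F" unfolding F_def by (rule square_integrable_sol)
  have sqF'': "square_integrable I11 F''"
    unfolding F''_def F_def by (rule square_integrable_diff[OF square_integrable_pot_V square_integrable_rep0])
  have pp: "primitive_on {0<..1} F F'" "primitive_on {0<..1} F' F''"
    by (rule primitive_on_cong[THEN iffD1, OF _ _ V_primitive[of 1 g]], auto simp: F F')
      (rule primitive_on_cong[THEN iffD1, OF _ _ V'_primitive[of 1 g]], auto simp: F F' F''_def)
  have pn: "primitive_on {0<..1} (\<lambda>x. F (- x)) (\<lambda>x. - F' (- x))" "primitive_on {0<..1} (\<lambda>x. F' (- x)) (\<lambda>x. - F'' (- x))"
    by (rule primitive_on_cong[THEN iffD1, OF _ _ V_primitive[of "-1" g]], auto simp: F F')
      (rule primitive_on_cong[THEN iffD1, OF _ _ primitive_on_scale[OF V'_primitive[of "-1" g], of "-1"]], auto simp: F F' F''_def)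
  have iF'': "set_integrable lborel {-1..1} F''"
  proof -
    have "integrable lborel (\<lambda>x. indicator {-1<..<1} x *\<^sub>R F'' x)"
      using square_integrable_imp_integrable[OF sqF''] by (simp add: integrable_I11 set_integrable_def)
    then have "integrable lborel (\<lambda>x. indicator {-1<..<1} x *\<^sub>R F'' x + indicator {-1} x *\<^sub>R F'' (-1) + indicator {1} x *\<^sub>R F'' 1)"
      by (intro Bochner_Integration.integrable_add integrable_scaleR_left) auto
    moreover have "indicator {-1<..<1} x *\<^sub>R F'' x + indicator {-1} x *\<^sub>R F'' (-1) + indicator {1} x *\<^sub>R F'' 1 = indicator {-1..1} x *\<^sub>R F'' x" for x
      by (auto simp: indicator_def)
    ultimately show ?thesis by (simp add: set_integrable_def)
  qed
  have P': "primitive_on {-1..1} F' F''" by (rule primitive_on_glue[OF pp(2) pn(2) c(2) iF''])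
  have cF': "continuous_on {-1..1} F'" by (rule primitive_on_continuous[OF P' order_refl])
  have P: "primitive_on {-1..1} F F'"
    by (rule primitive_on_glue[OF pp(1) pn(1) c(1) set_integrable_lborel_continuous[OF cF']])
  have sqF': "square_integrable I11 F'"
    unfolding square_integrable_def
  proof
    have "(\<lambda>x. indicator {-1<..<1} x *\<^sub>R F' x) \<in> borel_measurable borel"
      by (rule borel_measurable_continuous_on_indicator) (auto intro: continuous_on_subset[OF cF'])
    then show "F' \<in> borel_measurable I11" by (simp add: measurable_I11)
    have "set_integrable lborel {-1..1} (\<lambda>x. (F' x)\<^sup>2)"
      by (intro set_integrable_lborel_continuous continuous_intros cF')
    then show "integrable I11 (\<lambda>x. (F' x)\<^sup>2)"
      unfolding integrable_I11 by (rule set_integrable_subset) auto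
  qed
  have sub: "{-1<..<1} \<subseteq> {-1..1::real}" by auto
  have w: "weak_derivative {-1<..<1} (rep_L2 (L2_of F)) (rep_L2 (L2_of F'))"
    by (intro weak_derivative_rep_left weak_derivative_rep_right sqF sqF'
        weak_derivative_of_primitive primitive_on_subset[OF P sub]) auto
  have w': "weak_derivative {-1<..<1} (rep_L2 (L2_of F')) (rep_L2 (L2_of F''))"
    by (intro weak_derivative_rep_left weak_derivative_rep_right sqF' sqF''
        weak_derivative_of_primitive primitive_on_subset[OF P' sub]) auto
  have "has_value (L2_of F) 0 0" "has_value (L2_of F') 0 0"
    by (rule has_valueI[OF sqF tendsto_within_subset[OF t(1) subset_UNIV]]
        has_valueI[OF sqF' tendsto_within_subset[OF t(2) subset_UNIV]])+
  then show ?thesis using w w' unfolding H2_0_def H2_def F_def[symmetric] by blast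
qed

end

lemma weak_derivative_cong_on:
  assumes "weak_derivative \<Omega> f g" "\<And>x. x \<in> \<Omega> \<Longrightarrow> f x = f' x" "\<And>x. x \<in> \<Omega> \<Longrightarrow> g x = g' x"
  shows "weak_derivative \<Omega> f' g'"
proof -
  have l: "locally_integrable \<Omega> h'" if h: "locally_integrable \<Omega> h" "\<And>x. x \<in> \<Omega> \<Longrightarrow> h x = h' x" for h h' :: "real \<Rightarrow> real"
    unfolding locally_integrable_def
  proof (intro allI impI)
    fix K assume "compact K \<and> K \<subseteq> \<Omega>"
    then have "set_integrable lborel K h" "\<And>x. x \<in> K \<Longrightarrow> h x = h' x" using h by (auto simp: locally_integrable_def)
    then show "set_integrable lborel K h'" by (subst set_integrable_cong[OF refl refl, of K h' h]) auto
  qed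
  have i: "(LINT x:\<Omega>|lborel. h x * p x) = (LINT x:\<Omega>|lborel. h' x * p x)" if "\<And>x. x \<in> \<Omega> \<Longrightarrow> h x = h' x" for h h' p :: "real \<Rightarrow> real"
    unfolding set_lebesgue_integral_def using that by (intro Bochner_Integration.integral_cong) (auto simp: indicator_def)
  show ?thesis
    using assms(1) l[of f f'] l[of g g'] i[of f f'] i[of g g'] assms(2,3) by (simp add: weak_derivative_def)
qed

lemma AE_lborel_reflect:
  assumes "AE x in lborel. P (x :: real)"
  shows "AE x in lborel. P (- x)"
proof -
  have "AE x in distr lborel borel uminus. P x" unfolding lborel_distr_uminus by (rule assms)
  then show ?thesis by (rule AE_distrD[rotated]) simp
qed

text \<open>A function with two weak derivatives and vanishing data at \<open>0\<close> is, on each side, the double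
  primitive \<open>x M\<^sub>0 - M\<^sub>1\<close> built from the moments of its second derivative.\<close>
lemma H2_0_double_primitive:
  assumes "f \<in> H2_0"
  shows "\<exists>q. AE x in lborel. x \<in> {-1<..<1} \<longrightarrow>
    rep0 f x = (if x > 0 then x * moment 0 1 q x - moment 1 1 q x
      else (- x) * moment 0 (- 1) q (- x) - moment 1 (- 1) q (- x))"
proof -
  obtain p q p2 where p: "weak_derivative {-1<..<1} (rep_L2 f) (rep_L2 p)" "weak_derivative {-1<..<1} (rep_L2 p) (rep_L2 q)"
    and f0: "has_value f 0 0" and p2: "weak_derivative {-1<..<1} (rep_L2 f) (rep_L2 p2)" "has_value p2 0 0"
    using assms by (auto simp: H2_0_def H2_def)
  have r: "rep_L2 g x = rep0 g x" if "x \<in> {-1<..<1}" for g x using that by (simp add: rep0_def)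
  have wp: "weak_derivative {-1<..<1} (rep0 f) (rep0 p)" "weak_derivative {-1<..<1} (rep0 p) (rep0 q)"
    using weak_derivative_cong_on[OF p(1) r r] weak_derivative_cong_on[OF p(2) r r] by auto
  have pp2: "AE x in lborel. x \<in> {-1<..<1} \<longrightarrow> rep_L2 p2 x = rep_L2 p x"
    by (rule weak_derivative_unique[OF _ p2(1) p(1)]) auto
  obtain c' where c': "AE x in lborel. x \<in> {-1<..<1} \<longrightarrow> rep0 p x = c' + integral {-1..x} (rep0 q)"
    using primitive_of_weak_derivative[OF wp(2) set_integrable_rep0] by blast
  define W' where "W' x = c' + integral {-1..x} (rep0 q)" for x
  have const: "primitive_on {-1..1} (\<lambda>x. c) (\<lambda>x. 0)" for c :: real by (rule primitive_on_C1) auto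
  have PW': "primitive_on {-1..1} W' (rep0 q)"
    using primitive_on_add[OF const[of c'] primitive_on_indefinite[OF set_integrable_rep0[of q]]] by (simp add: W'_def[abs_def])
  obtain c where c: "AE x in lborel. x \<in> {-1<..<1} \<longrightarrow> rep0 f x = c + integral {-1..x} (rep0 p)"
    using primitive_of_weak_derivative[OF wp(1) set_integrable_rep0] by blast
  define W where "W x = c + integral {-1..x} (rep0 p)" for x
  have PW0: "primitive_on {-1..1} W (rep0 p)"
    using primitive_on_add[OF const[of c] primitive_on_indefinite[OF set_integrable_rep0[of p]]] by (simp add: W_def[abs_def])
  have cW': "continuous_on {-1..1} W'" and cW: "continuous_on {-1..1} W"
    by (rule primitive_on_continuous[OF PW' order_refl] primitive_on_continuous[OF PW0 order_refl])+
  have PW: "primitive_on {-1..1} W W'"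
  proof (rule primitive_on_cong_AE[OF PW0])
    show "(\<lambda>x. indicator {-1..1} x * W' x) \<in> borel_measurable borel"
      using borel_measurable_continuous_on_indicator[OF _ cW'] by simp
    show "AE x in lborel. x \<in> {-1..1} \<longrightarrow> rep0 p x = W' x"
      using c' AE_lborel_singleton[of "-1"] AE_lborel_singleton[of 1]
      by eventually_elim (auto simp: W'_def)
  qed
  have lim: "(h \<longlongrightarrow> h 0) (at 0 within {-1<..<1})" if "continuous_on {-1..1} h" for h :: "real \<Rightarrow> real"
  proof -
    have "isCont h 0" by (rule continuous_on_interior[OF that]) auto
    then show ?thesis unfolding isCont_def by (rule tendsto_within_subset) simp
  qed
  have "AE x in I11. W x = rep_L2 f x" using c unfolding AE_I11 by eventually_elim (simp add: W_def rep0_def)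
  from has_value_unique[OF f0 this lim[OF cW]] have W0: "W 0 = 0" by simp
  have "AE x in I11. W' x = rep_L2 p2 x"
    using c' pp2 unfolding AE_I11 by eventually_elim (simp add: W'_def rep0_def)
  from has_value_unique[OF p2(2) this lim[OF cW']] have W'0: "W' 0 = 0" by simp
  have side: "\<sigma> * W' (\<sigma> * x) = moment 0 \<sigma> q x \<and> W (\<sigma> * x) = x * moment 0 \<sigma> q x - moment 1 \<sigma> q x"
    if \<sigma>: "\<sigma> \<in> {1, -1}" and x: "x \<in> {0..1}" for \<sigma> x
  proof -
    have refl: "F (\<sigma> * y) - F 0 = integral {0..y} (\<lambda>t. \<sigma> * G (\<sigma> * t))"
      if "primitive_on {-1..1} F G" "y \<in> {0..1}" for F G y
    proof (cases "\<sigma> = 1")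
      case True
      then show ?thesis using primitive_onD(2)[OF that(1), of 0 y] that(2) by auto
    next
      case False
      then have "\<sigma> = -1" using \<sigma> by simp
      then show ?thesis
        using primitive_onD(2)[OF that(1), of "-y" 0] that(2)
          Henstock_Kurzweil_Integration.integral_reflect_real[of 0 "-y" G] by auto
    qed
    have \<sigma>\<sigma>: "\<sigma> * (\<sigma> * t) = t" for t using \<sigma> by auto
    have m0: "\<sigma> * W' (\<sigma> * y) = moment 0 \<sigma> q y" if "y \<in> {0..1}" for y
    proof -
      have "\<sigma> * W' (\<sigma> * y) = \<sigma> * integral {0..y} (\<lambda>t. \<sigma> * rep0 q (\<sigma> * t))"
        using refl[OF PW' that] W'0 by simp
      also have "\<dots> = integral {0..y} (\<lambda>t. rep0 q (\<sigma> * t))"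
        unfolding integral_mult_right[symmetric] \<sigma>\<sigma> ..
      also have "\<dots> = moment 0 \<sigma> q y"
        unfolding moment_def by (rule integral_spike[of "{0}"]) auto
      finally show ?thesis .
    qed
    have "integral {0..x} (\<lambda>t. \<sigma> * W' (\<sigma> * t)) = integral {0..x} (moment 0 \<sigma> q)"
      by (rule integral_cong) (use m0 x in auto)
    then have "W (\<sigma> * x) = integral {0..x} (moment 0 \<sigma> q)"
      using refl[OF PW x] W0 by simp
    moreover have "primitive_on {0..1} (\<lambda>x. x * moment 0 \<sigma> q x - moment 1 \<sigma> q x) (moment 0 \<sigma> q)"
    proof -
      have id: "primitive_on {0..1} (\<lambda>x. x) (\<lambda>x. 1 :: real)" by (rule primitive_on_C1) auto
      have "primitive_on {0..1} (\<lambda>x. x * moment 0 \<sigma> q x - moment 1 \<sigma> q x)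
        (\<lambda>x. (1 * moment 0 \<sigma> q x + x * (x powr 0 * rep0 q (\<sigma> * x))) - x powr 1 * rep0 q (\<sigma> * x))"
        by (intro primitive_on_diff primitive_on_mult id moment_primitive \<sigma>) auto
      then show ?thesis by (rule primitive_on_cong[THEN iffD1, rotated 2]) auto
    qed
    from primitive_onD(2)[OF this, of 0 x]
    have "integral {0..x} (moment 0 \<sigma> q) = x * moment 0 \<sigma> q x - moment 1 \<sigma> q x"
      using x by (simp add: moment_def)
    ultimately show ?thesis using m0[OF x] by simp
  qed
  show ?thesis
  proof (intro exI)
    show "AE x in lborel. x \<in> {-1<..<1} \<longrightarrow>
      rep0 f x = (if x > 0 then x * moment 0 1 q x - moment 1 1 q x
        else (- x) * moment 0 (- 1) q (- x) - moment 1 (- 1) q (- x))"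
      using c
    proof eventually_elim
      case (elim x)
      then show ?case using side[of 1 x] side[of "-1" "- x"] by (auto simp: W_def)
    qed
  qed
qed

context inverse_square
begin

text \<open>Writing \<open>f\<close> as a double primitive shows that \<open>g = c / x\<^sup>2 f - f''\<close> is square integrable, again by
  Hardy's inequality, and bounds \<open>f\<close> and \<open>f'\<close> so that uniqueness for the problem with vanishing data
  applies.\<close>
lemma H2_0_imp_sol:
  assumes "f \<in> H2_0"
  shows "\<exists>g. f = L2_of (sol 0 0 0 0 g)"
proof -
  obtain q where q: "AE x in lborel. x \<in> {-1<..<1} \<longrightarrow>
    rep0 f x = (if x > 0 then x * moment 0 1 q x - moment 1 1 q x
      else (- x) * moment 0 (- 1) q (- x) - moment 1 (- 1) q (- x))"
    using H2_0_double_primitive[OF assms] by blast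
  define w where "w \<sigma> x = x * moment 0 \<sigma> q x - moment 1 \<sigma> q x" for \<sigma> x
  define S where "S x = (if x > 0 then w 1 x else w (- 1) (- x))" for x
  have eq: "pot / x\<^sup>2 * w \<sigma> x = pot * (x powr (- 0 - 1) * moment 0 \<sigma> q x - x powr (- 1 - 1) * moment 1 \<sigma> q x)"
    if "x \<in> {0<..<1}" for x \<sigma>
  proof -
    have "x powr (- 0 - 1) = x / x\<^sup>2" "x powr (- 1 - 1) = 1 / x\<^sup>2"
      using that by (auto simp: powr_minus power2_eq_square field_simps powr_numeral)
    then show ?thesis by (simp only: w_def) (simp add: diff_divide_distrib right_diff_distrib)
  qed
  have e1: "pot / x\<^sup>2 * S x = pot * (x powr (- 0 - 1) * moment 0 1 q x - x powr (- 1 - 1) * moment 1 1 q x)"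
    and e2: "pot / (- x)\<^sup>2 * S (- x) = pot * (x powr (- 0 - 1) * moment 0 (- 1) q x - x powr (- 1 - 1) * moment 1 (- 1) q x)"
    if "x \<in> {0<..<1}" for x
    using eq[OF that, of 1] eq[OF that, of "-1"] that by (simp_all add: S_def)
  have sqS: "square_integrable I11 (\<lambda>x. pot / x\<^sup>2 * S x)"
    by (rule square_integrable_halves)
      (rule hardy_difference(2)[OF _ _ _ e1] hardy_difference(2)[OF _ _ _ e2]
        hardy_difference(1)[OF _ _ _ e1] hardy_difference(1)[OF _ _ _ e2]; simp)+
  define G where "G x = pot / x\<^sup>2 * S x - rep0 q x" for x
  have sqG: "square_integrable I11 G"
    unfolding G_def by (rule square_integrable_diff[OF sqS square_integrable_rep0])
  define g where "g = L2_of G"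
  have ge: "AE x in lborel. x \<in> {-1<..<1} \<longrightarrow> rep0 g x = G x" unfolding g_def by (rule rep0_L2_of[OF sqG])
  have wV: "w \<sigma> x = V \<sigma> g x" if \<sigma>: "\<sigma> \<in> {1, -1}" and x: "x \<in> {0<..1}" for \<sigma> x
  proof -
    have J: "{0<..1} \<subseteq> {0..1::real}" by auto
    have id: "primitive_on {0<..1} (\<lambda>x. x) (\<lambda>x. 1 :: real)" by (rule primitive_on_C1) auto
    have m0: "primitive_on {0<..1} (moment 0 \<sigma> q) (\<lambda>x. x powr 0 * rep0 q (\<sigma> * x))"
      by (rule primitive_on_subset[OF moment_primitive J]) (use \<sigma> in auto)
    have m1: "primitive_on {0<..1} (moment 1 \<sigma> q) (\<lambda>x. x powr 1 * rep0 q (\<sigma> * x))"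
      by (rule primitive_on_subset[OF moment_primitive J]) (use \<sigma> in auto)
    have Pw: "primitive_on {0<..1} (w \<sigma>) (moment 0 \<sigma> q)"
      by (rule primitive_on_cong[THEN iffD1, OF _ _ primitive_on_diff[OF primitive_on_mult[OF id m0] m1]]) (auto simp: w_def)
    have cw: "continuous_on {0..1} (w \<sigma>)"
      unfolding w_def using \<sigma>
      by (intro continuous_intros primitive_on_continuous[OF moment_primitive order_refl]) auto
    have aes: "AE x in lborel. \<sigma> * x \<in> {-1<..<1} \<longrightarrow> rep0 g (\<sigma> * x) = G (\<sigma> * x)"
      using ge AE_lborel_reflect[OF ge] \<sigma> by auto
    have Pw': "primitive_on {0<..1} (moment 0 \<sigma> q) (\<lambda>x. pot / x\<^sup>2 * w \<sigma> x - rep0 g (\<sigma> * x))"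
    proof (rule primitive_on_cong_AE[OF m0])
      have "(\<lambda>x. indicator {0..1} x * w \<sigma> x) \<in> borel_measurable borel"
        using borel_measurable_continuous_on_indicator[OF _ cw] by simp
      then have m: "(\<lambda>x. indicator {0<..1} x * (pot / x\<^sup>2 * (indicator {0..1} x * w \<sigma> x) - rep0 g (\<sigma> * x))) \<in> borel_measurable borel"
        by measurable
      have eq: "indicator {0<..1} x * (pot / x\<^sup>2 * (indicator {0..1} x * w \<sigma> x) - rep0 g (\<sigma> * x))
          = indicator {0<..1} x * (pot / x\<^sup>2 * w \<sigma> x - rep0 g (\<sigma> * x))" for x
        by (auto simp: indicator_def)
      show "(\<lambda>x. indicator {0<..1} x * (pot / x\<^sup>2 * w \<sigma> x - rep0 g (\<sigma> * x))) \<in> borel_measurable borel"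
        using m unfolding eq .
      show "AE x in lborel. x \<in> {0<..1} \<longrightarrow> x powr 0 * rep0 q (\<sigma> * x) = pot / x\<^sup>2 * w \<sigma> x - rep0 g (\<sigma> * x)"
        using aes AE_lborel_singleton[of 1]
      proof eventually_elim
        case (elim x)
        show ?case
        proof
          assume "x \<in> {0<..1}"
          then have x: "0 < x" "x < 1" using elim(2) by auto
          have "S (\<sigma> * x) = w \<sigma> x" "(\<sigma> * x)\<^sup>2 = x\<^sup>2" using \<sigma> x by (auto simp: S_def)
          then show "x powr 0 * rep0 q (\<sigma> * x) = pot / x\<^sup>2 * w \<sigma> x - rep0 g (\<sigma> * x)"
            using elim(1) x \<sigma> by (auto simp: G_def)
        qed
      qed
    qed
    have b0: "\<bar>moment 0 \<sigma> q x\<bar> \<le> norm q * x powr (1/2)" and b1: "\<bar>moment 1 \<sigma> q x\<bar> \<le> norm q * x powr (3/2)"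
      if "x \<in> {0<..1}" for x
    proof -
      show "\<bar>moment 0 \<sigma> q x\<bar> \<le> norm q * x powr (1/2)"
        using moment_bound[of 0 x \<sigma> q] \<sigma> that by simp
      have "\<bar>moment 1 \<sigma> q x\<bar> \<le> norm q * (x powr (3/2) / sqrt 3)"
        using moment_bound[of 1 x \<sigma> q] \<sigma> that by simp
      also have "\<dots> \<le> norm q * x powr (3/2)"
        by (intro mult_left_mono) (auto simp: divide_le_eq mult_le_cancel_left1)
      finally show "\<bar>moment 1 \<sigma> q x\<bar> \<le> norm q * x powr (3/2)" .
    qed
    show ?thesis
    proof (rule V_unique[OF \<sigma> Pw Pw' _ _ x, where C = "2 * norm q"])
      fix x :: real assume x: "x \<in> {0<..1}"
      have "\<bar>x * moment 0 \<sigma> q x\<bar> \<le> x * (norm q * x powr (1/2))"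
        unfolding abs_mult using b0[OF x] x by (intro mult_mono) auto
      moreover have "x * x powr (1/2) = x powr (3/2)" using x powr_mult_base[of x "1/2"] by simp
      moreover have "x * (norm q * x powr (1/2)) = norm q * (x * x powr (1/2))" by (rule mult.left_commute)
      ultimately have "\<bar>x * moment 0 \<sigma> q x\<bar> \<le> norm q * x powr (3/2)" by (simp only:)
      then show "\<bar>w \<sigma> x\<bar> \<le> 2 * norm q * x powr (3/2)" using b1[OF x] unfolding w_def by linarith
      have "0 \<le> norm q * x powr (1/2)" by simp
      then show "\<bar>moment 0 \<sigma> q x\<bar> \<le> 2 * norm q * x powr (1/2)" using b0[OF x] by linarith
    qed
  qed
  have "f = L2_of (sol 0 0 0 0 g)"
  proof (rule L2_eqI)
    show "AE x in lborel. x \<in> {-1<..<1} \<longrightarrow> rep0 f x = rep0 (L2_of (sol 0 0 0 0 g)) x"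
      using q rep0_L2_of[OF square_integrable_sol[of 0 0 0 0 g]] AE_lborel_singleton[of 0]
    proof eventually_elim
      case (elim x)
      then show ?case using wV[of 1 x] wV[of "-1" "- x"] by (auto simp: w_def sol_def half_sol_def)
    qed
  qed
  then show ?thesis by blast
qed

lemma sol_singular: "sol c1m c2m c1p c2p g x = singular_fun \<nu> c1m c2m c1p c2p x + sol 0 0 0 0 g x"
  unfolding sol_def half_sol_def singular_fun_def powr_abs by simp

lemma square_integrable_singular: "square_integrable I11 (singular_fun \<nu> c1m c2m c1p c2p)"
proof -
  have "singular_fun \<nu> c1m c2m c1p c2p = (\<lambda>x. sol c1m c2m c1p c2p 0 x - sol 0 0 0 0 0 x)"
    using sol_singular[of c1m c2m c1p c2p 0] by (simp add: fun_eq_iff)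
  then show ?thesis using square_integrable_diff[OF square_integrable_sol square_integrable_sol] by simp
qed

lemma L2_of_sol: "L2_of (sol c1m c2m c1p c2p g) = L2_of (sol 0 0 0 0 g) + L2_of (singular_fun \<nu> c1m c2m c1p c2p)"
proof -
  have "sol c1m c2m c1p c2p g = (\<lambda>x. sol 0 0 0 0 g x + singular_fun \<nu> c1m c2m c1p c2p x)"
    using sol_singular[of c1m c2m c1p c2p g] by (simp add: fun_eq_iff)
  then show ?thesis by (simp only: L2_of_add[OF square_integrable_sol square_integrable_singular])
qed

lemma sol_tendsto_ends:
  "(sol c1m c2m c1p c2p g \<longlongrightarrow> half_sol c1p c2p 1 g 1) (at 1 within {-1<..<1})"
  "(sol c1m c2m c1p c2p g \<longlongrightarrow> half_sol c1m c2m (- 1) g 1) (at (- 1) within {-1<..<1})"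
proof -
  have "(half_sol c1p c2p 1 g \<longlongrightarrow> half_sol c1p c2p 1 g 1) (at 1 within {0<..1})"
    using half_sol_continuous[of 1 c1p c2p g] by (auto simp: continuous_on_def)
  then have "(half_sol c1p c2p 1 g \<longlongrightarrow> half_sol c1p c2p 1 g 1) (at 1 within {0<..<1})"
    by (rule tendsto_within_subset) auto
  then have "(sol c1m c2m c1p c2p g \<longlongrightarrow> half_sol c1p c2p 1 g 1) (at 1 within {0<..<1})"
    by (rule Lim_transform_within[OF _ zero_less_one]) (auto simp: sol_def)
  moreover have "at 1 within {0<..<1} = at (1::real) within {-1<..<1}"
    by (rule at_within_nhd[of _ "{0<..}"]) auto
  ultimately show "(sol c1m c2m c1p c2p g \<longlongrightarrow> half_sol c1p c2p 1 g 1) (at 1 within {-1<..<1})" by simp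
  have "continuous_on {-1..<0} (\<lambda>x. half_sol c1m c2m (- 1) g (- x))"
    by (rule continuous_on_compose2[OF half_sol_continuous[of "-1"]]) (auto intro!: continuous_intros)
  then have "((\<lambda>x. half_sol c1m c2m (- 1) g (- x)) \<longlongrightarrow> half_sol c1m c2m (- 1) g (- (- 1))) (at (- 1) within {-1..<0})"
    unfolding continuous_on_def by (rule bspec) simp
  then have "((\<lambda>x. half_sol c1m c2m (- 1) g (- x)) \<longlongrightarrow> half_sol c1m c2m (- 1) g 1) (at (- 1) within {-1<..<0})"
    unfolding minus_minus by (rule tendsto_within_subset) auto
  then have "(sol c1m c2m c1p c2p g \<longlongrightarrow> half_sol c1m c2m (- 1) g 1) (at (- 1) within {-1<..<0})"
    by (rule Lim_transform_within[OF _ zero_less_one]) (auto simp: sol_def)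
  moreover have "at (- 1) within {-1<..<0} = at (- 1 :: real) within {-1<..<1}"
    by (rule at_within_nhd[of _ "{..<0}"]) auto
  ultimately show "(sol c1m c2m c1p c2p g \<longlongrightarrow> half_sol c1m c2m (- 1) g 1) (at (- 1) within {-1<..<1})" by simp
qed

definition admissible :: "real \<Rightarrow> real \<Rightarrow> real \<Rightarrow> real \<Rightarrow> L2 \<Rightarrow> bool" where
  "admissible c1m c2m c1p c2p g \<longleftrightarrow> c1m + c2m + c1p + c2p = 0 \<and> \<alpha> * c1m + \<beta> * c2m = \<alpha> * c1p + \<beta> * c2p \<and>
     half_sol c1p c2p 1 g 1 = 0 \<and> half_sol c1m c2m (- 1) g 1 = 0"

text \<open>The regular part of a domain element is \<open>V g\<close> for some \<open>g\<close> by uniqueness, and conversely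
  \<open>V g\<close> belongs to $\tilde H^2_0$; the singular part is annihilated.\<close>
theorem dom_A0_iff:
  "f \<in> dom_A0 \<nu> \<and> A0 \<nu> f = g \<longleftrightarrow>
    (\<exists>c1m c2m c1p c2p. f = L2_of (sol c1m c2m c1p c2p g) \<and> admissible c1m c2m c1p c2p g)"
proof
  assume fg: "f \<in> dom_A0 \<nu> \<and> A0 \<nu> f = g"
  then obtain fr c1m c2m c1p c2p where f: "fr \<in> H2_0" "f = fr + L2_of (singular_fun \<nu> c1m c2m c1p c2p)"
    "has_value f (-1) 0" "has_value f 1 0" and c: "c1m + c2m + c1p + c2p = 0"
    "(\<nu> + 1/2) * c1m + (- \<nu> + 1/2) * c2m = (\<nu> + 1/2) * c1p + (- \<nu> + 1/2) * c2p"
    unfolding dom_A0_def by blast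
  obtain h where h: "fr = L2_of (sol 0 0 0 0 h)" using H2_0_imp_sol[OF f(1)] by blast
  have fs: "f = L2_of (sol c1m c2m c1p c2p h)" unfolding f(2) h L2_of_sol[of c1m c2m c1p c2p h] ..
  then have "h = g" using fg A0_sol by simp
  have ae: "AE x in I11. sol c1m c2m c1p c2p h x = rep_L2 f x"
    unfolding fs using rep_L2_of[OF square_integrable_sol[of c1m c2m c1p c2p h]] by eventually_elim simp
  have "half_sol c1p c2p 1 h 1 = 0" "half_sol c1m c2m (- 1) h 1 = 0"
    using has_value_unique[OF f(4) ae sol_tendsto_ends(1)] has_value_unique[OF f(3) ae sol_tendsto_ends(2)] by auto
  then have "admissible c1m c2m c1p c2p g"
    using c \<open>h = g\<close> by (simp add: admissible_def \<alpha>_def \<beta>_def add.commute)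
  then show "\<exists>c1m c2m c1p c2p. f = L2_of (sol c1m c2m c1p c2p g) \<and> admissible c1m c2m c1p c2p g"
    using fs \<open>h = g\<close> by blast
next
  assume "\<exists>c1m c2m c1p c2p. f = L2_of (sol c1m c2m c1p c2p g) \<and> admissible c1m c2m c1p c2p g"
  then obtain c1m c2m c1p c2p where f: "f = L2_of (sol c1m c2m c1p c2p g)" and c: "admissible c1m c2m c1p c2p g" by blast
  have "has_value f 1 0" "has_value f (-1) 0"
    using has_valueI[OF square_integrable_sol sol_tendsto_ends(1)[of c1m c2m c1p c2p g]]
      has_valueI[OF square_integrable_sol sol_tendsto_ends(2)[of c1m c2m c1p c2p g]] c
    by (simp_all add: f admissible_def)
  moreover have "c1m + c2m + c1p + c2p = 0"
    "(\<nu> + 1/2) * c1m + (- \<nu> + 1/2) * c2m = (\<nu> + 1/2) * c1p + (- \<nu> + 1/2) * c2p"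
    using c by (simp_all add: admissible_def \<alpha>_def \<beta>_def add.commute)
  ultimately have "f \<in> dom_A0 \<nu>"
    unfolding dom_A0_def using regular_part[of g] L2_of_sol[of c1m c2m c1p c2p g] f by blast
  then show "f \<in> dom_A0 \<nu> \<and> A0 \<nu> f = g" using A0_sol f by simp
qed

end

section \<open>Compact resolvent\<close>

context inverse_square
begin

lemma moment_lincomb:
  assumes "p > -1/2" "\<sigma> \<in> {1, -1}" "x \<in> {0..1}"
  shows "moment p \<sigma> (g + r *\<^sub>R h) x = moment p \<sigma> g x + r * moment p \<sigma> h x"
  using assms by (simp add: moment_eq_inner inner_add_left)

lemma V_lincomb:
  assumes "\<sigma> \<in> {1, -1}" "x \<in> {0..1}"
  shows "V \<sigma> (g + r *\<^sub>R h) x = V \<sigma> g x + r * V \<sigma> h x"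
  unfolding V_def moment_lincomb[OF exponents(1) assms] moment_lincomb[OF exponents(2) assms]
  using \<nu> by (simp add: field_simps)

lemma V_zero:
  assumes "\<sigma> \<in> {1, -1}" "x \<in> {0..1}"
  shows "V \<sigma> 0 x = 0"
  using V_lincomb[OF assms, of 0 1 0] by simp

lemma half_sol_lincomb:
  assumes "\<sigma> \<in> {1, -1}" "x \<in> {0..1}"
  shows "half_sol (c1 + r * d1) (c2 + r * d2) \<sigma> (g + r *\<^sub>R h) x = half_sol c1 c2 \<sigma> g x + r * half_sol d1 d2 \<sigma> h x"
  unfolding half_sol_def V_lincomb[OF assms] by (simp add: algebra_simps)

lemma L2_of_sol_lincomb:
  "L2_of (sol (a + r * a') (b + r * b') (c + r * c') (d + r * d') (g + r *\<^sub>R h))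
    = L2_of (sol a b c d g) + r *\<^sub>R L2_of (sol a' b' c' d' h)"
proof -
  have "L2_of (sol (a + r * a') (b + r * b') (c + r * c') (d + r * d') (g + r *\<^sub>R h))
      = L2_of (\<lambda>x. sol a b c d g x + r * sol a' b' c' d' h x)"
  proof (rule L2_of_eqI)
    show "AE x in I11. sol (a + r * a') (b + r * b') (c + r * c') (d + r * d') (g + r *\<^sub>R h) x
        = sol a b c d g x + r * sol a' b' c' d' h x"
      unfolding AE_I11 by (intro AE_I2 impI) (auto simp: sol_def intro!: half_sol_lincomb)
  qed (intro square_integrable_sol square_integrable_add square_integrable_scale)+
  then show ?thesis
    by (simp add: L2_of_add L2_of_scaleR square_integrable_sol square_integrable_scale)
qed

text \<open>As a relation the operator is handled through the coefficients alone, without a separate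
  description of its domain.\<close>
definition Gr :: "L2 \<Rightarrow> L2 \<Rightarrow> bool" where "Gr f g \<longleftrightarrow> f \<in> dom_A0 \<nu> \<and> A0 \<nu> f = g"

lemma Gr_iff: "Gr f g \<longleftrightarrow> (\<exists>c1m c2m c1p c2p. f = L2_of (sol c1m c2m c1p c2p g) \<and> admissible c1m c2m c1p c2p g)"
  unfolding Gr_def by (rule dom_A0_iff)

lemma Gr_unique: "Gr f g \<Longrightarrow> Gr f h \<Longrightarrow> g = h"
  by (simp add: Gr_def)

lemma Gr_lincomb:
  assumes "Gr f g" "Gr f' g'"
  shows "Gr (f + r *\<^sub>R f') (g + r *\<^sub>R g')"
proof -
  obtain a b c d where f: "f = L2_of (sol a b c d g)" and ad: "admissible a b c d g" using assms(1) unfolding Gr_iff by blast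
  obtain a' b' c' d' where f': "f' = L2_of (sol a' b' c' d' g')" and ad': "admissible a' b' c' d' g'"
    using assms(2) unfolding Gr_iff by blast
  have "admissible (a + r * a') (b + r * b') (c + r * c') (d + r * d') (g + r *\<^sub>R g')"
  proof -
    have "a + r * a' + (b + r * b') + (c + r * c') + (d + r * d') = (a + b + c + d) + r * (a' + b' + c' + d')"
      "\<alpha> * (a + r * a') + \<beta> * (b + r * b') = (\<alpha> * a + \<beta> * b) + r * (\<alpha> * a' + \<beta> * b')"
      "\<alpha> * (c + r * c') + \<beta> * (d + r * d') = (\<alpha> * c + \<beta> * d) + r * (\<alpha> * c' + \<beta> * d')"
      by (simp_all add: algebra_simps)
    then show ?thesis using ad ad' by (simp add: admissible_def half_sol_lincomb)
  qed
  then show ?thesis unfolding Gr_iff f f' L2_of_sol_lincomb[symmetric] by blast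
qed

lemma half_sol_end: "half_sol c1 c2 \<sigma> g 1 = c1 + c2 + (moment \<alpha> \<sigma> g 1 - moment \<beta> \<sigma> g 1) / (2 * \<nu>)"
  by (simp add: half_sol_def V_def)

lemma admissible_zero: "admissible 0 0 0 0 0"
  by (simp add: admissible_def half_sol_def V_zero)

lemma Gr_zero: "Gr 0 0"
proof -
  have "L2_of (sol 0 0 0 0 0) = L2_of (\<lambda>x. 0)"
    by (rule L2_of_eqI[OF square_integrable_sol square_integrable_zero])
      (auto simp: AE_I11 sol_def half_sol_def V_zero intro!: AE_I2)
  then show ?thesis unfolding Gr_iff using admissible_zero by (metis L2_of_zero)
qed

lemma Gr_scale: "Gr f g \<Longrightarrow> Gr (r *\<^sub>R f) (r *\<^sub>R g)"
  using Gr_lincomb[OF Gr_zero, of f g r] by simp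

text \<open>The contribution of one side to the inner product of \<open>h\<close> with the particular solution.\<close>
definition pairing :: "real \<Rightarrow> L2 \<Rightarrow> L2 \<Rightarrow> real" where
  "pairing \<sigma> h g = integral {0..1} (\<lambda>y. rep0 h (\<sigma> * y) * V \<sigma> g y)"

lemma V_pairing_integrable:
  assumes \<sigma>: "\<sigma> \<in> {1, -1}"
  shows "set_integrable lborel {0..1} (\<lambda>y. rep0 h (\<sigma> * y) * V \<sigma> g y)"
proof -
  have c: "continuous_on {0..1} (moment p \<sigma> g)" if "p > -1/2" for p
    by (rule primitive_on_continuous[OF moment_primitive[OF that \<sigma>] order_refl])
  have "set_integrable lborel {0..1} (\<lambda>y. 1 / (2 * \<nu>) * ((y powr \<beta> * rep0 h (\<sigma> * y)) * moment \<alpha> \<sigma> g y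
      - (y powr \<alpha> * rep0 h (\<sigma> * y)) * moment \<beta> \<sigma> g y))"
    by (intro set_integrable_mult_right set_integral_diff set_integrable_mult_continuous
        side_product_integrable c exponents \<sigma>)
  moreover have "1 / (2 * \<nu>) * ((y powr \<beta> * rep0 h (\<sigma> * y)) * moment \<alpha> \<sigma> g y
      - (y powr \<alpha> * rep0 h (\<sigma> * y)) * moment \<beta> \<sigma> g y) = rep0 h (\<sigma> * y) * V \<sigma> g y" for y
    using \<nu> by (simp add: V_def field_simps)
  ultimately show ?thesis by simp
qed

lemma inner_sol:
  "inner h (L2_of (sol c1m c2m c1p c2p g)) =
    c1p * moment \<alpha> 1 h 1 + c2p * moment \<beta> 1 h 1 + pairing 1 h g
    + (c1m * moment \<alpha> (- 1) h 1 + c2m * moment \<beta> (- 1) h 1 + pairing (- 1) h g)"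
proof -
  define F where "F x = rep0 h x * sol c1m c2m c1p c2p g x" for x
  have i: "integrable I11 F"
    unfolding F_def by (rule square_integrable_mult[OF square_integrable_rep0 square_integrable_sol])
  have half: "(LINT y:{0<..<1}|lborel. rep0 h (\<sigma> * y) * half_sol c1 c2 \<sigma> g y)
      = c1 * moment \<alpha> \<sigma> h 1 + c2 * moment \<beta> \<sigma> h 1 + pairing \<sigma> h g" if \<sigma>: "\<sigma> \<in> {1, -1}" for \<sigma> c1 c2
  proof -
    define G where "G y = c1 * (y powr \<alpha> * rep0 h (\<sigma> * y)) + c2 * (y powr \<beta> * rep0 h (\<sigma> * y)) + rep0 h (\<sigma> * y) * V \<sigma> g y" for y
    have p: "set_integrable lborel {0..1} (\<lambda>y. c1 * (y powr \<alpha> * rep0 h (\<sigma> * y)))"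
      "set_integrable lborel {0..1} (\<lambda>y. c2 * (y powr \<beta> * rep0 h (\<sigma> * y)))"
      by (intro set_integrable_mult_right side_product_integrable exponents \<sigma>)+
    note pv = V_pairing_integrable[OF \<sigma>, of h g]
    have G: "set_integrable lborel {0..1} G" unfolding G_def by (intro set_integral_add(1) p pv)
    have "(LINT y:{0<..<1}|lborel. rep0 h (\<sigma> * y) * half_sol c1 c2 \<sigma> g y) = (LINT y|lborel. indicator {0<..<1} y * G y)"
      by (simp add: set_lebesgue_integral_def G_def half_sol_def algebra_simps)
    also have "\<dots> = (LINT y:{0..1}|lborel. G y)" by (rule LINT_open_closed(1)[OF G])
    also have "\<dots> = (LINT y:{0..1}|lborel. c1 * (y powr \<alpha> * rep0 h (\<sigma> * y)))
        + (LINT y:{0..1}|lborel. c2 * (y powr \<beta> * rep0 h (\<sigma> * y))) + (LINT y:{0..1}|lborel. rep0 h (\<sigma> * y) * V \<sigma> g y)"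
      unfolding G_def using set_integral_add[OF p] set_integral_add(2)[OF set_integral_add(1)[OF p] pv] by simp
    also have "\<dots> = c1 * moment \<alpha> \<sigma> h 1 + c2 * moment \<beta> \<sigma> h 1 + pairing \<sigma> h g"
      unfolding moment_def pairing_def
      using set_borel_integral_eq_integral(2)[OF side_product_integrable[OF exponents(1) \<sigma>, of h]]
        set_borel_integral_eq_integral(2)[OF side_product_integrable[OF exponents(2) \<sigma>, of h]]
        set_borel_integral_eq_integral(2)[OF pv] by simp
    finally show ?thesis .
  qed
  have "inner h (L2_of (sol c1m c2m c1p c2p g)) = (\<integral>x. F x \<partial>I11)"
    unfolding F_def by (rule inner_rep0[OF square_integrable_sol])
  also have "\<dots> = (LINT x:{0<..<1}|lborel. F x) + (LINT x:{0<..<1}|lborel. F (- x))"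
    by (rule integral_I11_split(3)[OF i])
  also have "(LINT x:{0<..<1}|lborel. F x) = (LINT y:{0<..<1}|lborel. rep0 h (1 * y) * half_sol c1p c2p 1 g y)"
    unfolding set_lebesgue_integral_def F_def
    by (intro Bochner_Integration.integral_cong) (auto simp: sol_def indicator_def)
  also have "(LINT x:{0<..<1}|lborel. F (- x)) = (LINT y:{0<..<1}|lborel. rep0 h (- 1 * y) * half_sol c1m c2m (- 1) g y)"
    unfolding set_lebesgue_integral_def F_def
    by (intro Bochner_Integration.integral_cong) (auto simp: sol_def indicator_def)
  finally show ?thesis using half[of 1 c1p c2p] half[of "-1" c1m c2m] by simp
qed

text \<open>The kernel of \<open>V\<close> is antisymmetric as a function on the square, so the failure of symmetry
  is a difference of products of moments.\<close>
lemma pairing_swap: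
  assumes \<sigma>: "\<sigma> \<in> {1, -1}"
  shows "pairing \<sigma> h g - pairing \<sigma> g h =
    (moment \<alpha> \<sigma> g 1 * moment \<beta> \<sigma> h 1 - moment \<beta> \<sigma> g 1 * moment \<alpha> \<sigma> h 1) / (2 * \<nu>)"
proof -
  note p = moment_primitive[OF exponents(1) \<sigma>] moment_primitive[OF exponents(2) \<sigma>]
  have "primitive_on {0..1} (\<lambda>x. moment \<alpha> \<sigma> g x * moment \<beta> \<sigma> h x - moment \<beta> \<sigma> g x * moment \<alpha> \<sigma> h x)
    (\<lambda>x. x powr \<alpha> * rep0 g (\<sigma> * x) * moment \<beta> \<sigma> h x + moment \<alpha> \<sigma> g x * (x powr \<beta> * rep0 h (\<sigma> * x))
      - (x powr \<beta> * rep0 g (\<sigma> * x) * moment \<alpha> \<sigma> h x + moment \<beta> \<sigma> g x * (x powr \<alpha> * rep0 h (\<sigma> * x))))"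
    by (intro primitive_on_diff primitive_on_mult p)
  then have "primitive_on {0..1} (\<lambda>x. moment \<alpha> \<sigma> g x * moment \<beta> \<sigma> h x - moment \<beta> \<sigma> g x * moment \<alpha> \<sigma> h x)
    (\<lambda>x. 2 * \<nu> * (rep0 h (\<sigma> * x) * V \<sigma> g x - rep0 g (\<sigma> * x) * V \<sigma> h x))"
    by (rule primitive_on_cong[THEN iffD1, rotated 2]) (use \<nu> in \<open>auto simp: V_def field_simps\<close>)
  from primitive_onD(2)[OF this, of 0 1]
  have "2 * \<nu> * integral {0..1} (\<lambda>x. rep0 h (\<sigma> * x) * V \<sigma> g x - rep0 g (\<sigma> * x) * V \<sigma> h x)
      = moment \<alpha> \<sigma> g 1 * moment \<beta> \<sigma> h 1 - moment \<beta> \<sigma> g 1 * moment \<alpha> \<sigma> h 1"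
    by (simp add: moment_def)
  moreover have "integral {0..1} (\<lambda>x. rep0 h (\<sigma> * x) * V \<sigma> g x - rep0 g (\<sigma> * x) * V \<sigma> h x) = pairing \<sigma> h g - pairing \<sigma> g h"
    unfolding pairing_def
    by (rule integral_diff; rule set_borel_integral_eq_integral(1)[OF V_pairing_integrable[OF \<sigma>]])
  ultimately have "2 * \<nu> * (pairing \<sigma> h g - pairing \<sigma> g h)
      = moment \<alpha> \<sigma> g 1 * moment \<beta> \<sigma> h 1 - moment \<beta> \<sigma> g 1 * moment \<alpha> \<sigma> h 1" by (simp only:)
  then show ?thesis using \<nu> by (simp add: eq_divide_eq mult.commute)
qed

text \<open>With \<open>s = c\<^sub>1 + c\<^sub>2\<close> and \<open>d = \<alpha> c\<^sub>1 + \<beta> c\<^sub>2\<close> on either side, the boundary form is a multiple of the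
  sum of the two determinants \<open>s d' - s' d\<close>; passing to the other side flips \<open>s\<close> and keeps \<open>d\<close>.\<close>
lemma Gr_symmetric:
  assumes "Gr f g" "Gr f' g'"
  shows "inner g f' = inner f g'"
proof -
  obtain a b c d where f: "f = L2_of (sol a b c d g)" and ad: "admissible a b c d g" using assms(1) unfolding Gr_iff by blast
  obtain a' b' c' d' where f': "f' = L2_of (sol a' b' c' d' g')" and ad': "admissible a' b' c' d' g'"
    using assms(2) unfolding Gr_iff by blast
  define k where "k = 2 * \<nu>"
  have k: "k > 0" "\<alpha> - \<beta> = k" using \<nu> by (auto simp: k_def \<alpha>_def \<beta>_def)
  have side: "c1' * ma + c2' * mb - (c1 * ma' + c2 * mb') + (ma' * mb - mb' * ma) / k = k * (c1 * c2' - c2 * c1')"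
    if "c1 + c2 + (ma - mb) / k = 0" "c1' + c2' + (ma' - mb') / k = 0" for c1 c2 c1' c2' ma mb ma' mb'
  proof -
    have m: "ma = mb - k * (c1 + c2)" "ma' = mb' - k * (c1' + c2')" using that k by (auto simp: field_simps)
    have Q: "(ma' * mb - mb' * ma) / k = mb' * (c1 + c2) - mb * (c1' + c2')"
      unfolding m using k(1) by (simp add: field_simps)
    show ?thesis unfolding Q unfolding m by (simp add: algebra_simps)
  qed
  have e: "c + d + (moment \<alpha> 1 g 1 - moment \<beta> 1 g 1) / k = 0" "c' + d' + (moment \<alpha> 1 g' 1 - moment \<beta> 1 g' 1) / k = 0"
    "a + b + (moment \<alpha> (- 1) g 1 - moment \<beta> (- 1) g 1) / k = 0" "a' + b' + (moment \<alpha> (- 1) g' 1 - moment \<beta> (- 1) g' 1) / k = 0"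
    using ad ad' by (auto simp: admissible_def half_sol_end k_def)
  have "inner g f' - inner g' f = k * (c * d' - d * c') + k * (a * b' - b * a')"
    unfolding f f' inner_sol using side[OF e(1,2)] side[OF e(3,4)] pairing_swap[of 1 g g'] pairing_swap[of "-1" g g']
    by (simp add: k_def)
  also have "\<dots> = 0"
  proof -
    have D: "(\<alpha> * u + \<beta> * v) * (u' + v') - (u + v) * (\<alpha> * u' + \<beta> * v') = k * (u * v' - v * u')" for u v u' v'
      unfolding k(2)[symmetric] by (simp add: algebra_simps)
    have s: "a + b = - (c + d)" "a' + b' = - (c' + d')" "\<alpha> * a + \<beta> * b = \<alpha> * c + \<beta> * d" "\<alpha> * a' + \<beta> * b' = \<alpha> * c' + \<beta> * d'"
      using ad ad' by (auto simp: admissible_def)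
    show ?thesis unfolding D[symmetric] s by (simp add: algebra_simps)
  qed
  finally show ?thesis by (simp add: inner_commute)
qed

lemma sol_scale_zero: "L2_of (sol (k * a) (k * b) (k * c) (k * d) 0) = k *\<^sub>R L2_of (sol a b c d 0)"
proof -
  have "L2_of (sol 0 0 0 0 0) = 0"
  proof -
    have "L2_of (sol 0 0 0 0 0) = L2_of (\<lambda>x. 0)"
      by (rule L2_of_eqI[OF square_integrable_sol square_integrable_zero])
        (auto simp: AE_I11 sol_def half_sol_def V_zero intro!: AE_I2)
    then show ?thesis by (simp add: L2_of_zero)
  qed
  then show ?thesis using L2_of_sol_lincomb[of 0 k a 0 b 0 c 0 d 0 0] by simp
qed

text \<open>The ground state \<open>x\<^sup>\<alpha> - x\<^sup>\<beta>\<close>, even, spans the kernel.\<close>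
definition ground :: L2 where "ground = L2_of (sol 1 (-1) 1 (-1) 0)"

lemma Gr_ground: "Gr ground 0"
  unfolding Gr_iff ground_def by (rule exI[of _ 1], rule exI[of _ "-1"], rule exI[of _ 1], rule exI[of _ "-1"])
    (simp add: admissible_def half_sol_def V_zero)

lemma Gr_kernel:
  assumes "Gr f 0"
  shows "\<exists>k. f = k *\<^sub>R ground"
proof -
  obtain a b c d where f: "f = L2_of (sol a b c d 0)" and ad: "admissible a b c d 0" using assms unfolding Gr_iff by blast
  have "b = - a" "d = - c" using ad by (auto simp: admissible_def half_sol_def V_zero)
  moreover have "(\<alpha> - \<beta>) * a = (\<alpha> - \<beta>) * c" using ad calculation by (simp add: admissible_def algebra_simps)
  then have "a = c" using exponents(4) \<nu> by simp
  ultimately have "f = a *\<^sub>R ground" unfolding f ground_def sol_scale_zero[symmetric] by simp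
  then show ?thesis by blast
qed

lemma inner_ground: "inner g ground =
    (moment \<alpha> 1 g 1 - moment \<beta> 1 g 1) + (moment \<alpha> (- 1) g 1 - moment \<beta> (- 1) g 1)"
proof -
  have "pairing \<sigma> g 0 = 0" if "\<sigma> \<in> {1, -1}" for \<sigma>
  proof -
    have "pairing \<sigma> g 0 = integral {0..1::real} (\<lambda>y. 0)"
      unfolding pairing_def by (rule integral_cong) (use that in \<open>auto simp: V_zero\<close>)
    then show ?thesis by simp
  qed
  then show ?thesis unfolding ground_def inner_sol by simp
qed

lemma ground_nonzero: "ground \<noteq> 0"
proof
  assume "ground = 0"
  then have "AE x in lborel. x \<in> {-1<..<1} \<longrightarrow> sol 1 (-1) 1 (-1) 0 x = 0"
    using rep0_L2_of[OF square_integrable_sol[of 1 "-1" 1 "-1" 0]] rep0_L2_of[OF square_integrable_zero]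
    unfolding ground_def[symmetric] L2_of_zero by (auto elim!: AE_mp)
  then have "AE x in lborel. x \<notin> {0<..<1::real}"
  proof eventually_elim
    case (elim x)
    show ?case
    proof
      assume x: "x \<in> {0<..<1}"
      then have "x powr \<alpha> - x powr \<beta> = 0" using elim by (auto simp: sol_def half_sol_def V_zero)
      then show False using x \<nu> powr_less_mono'[of x \<beta> \<alpha>] by (auto simp: \<alpha>_def \<beta>_def)
    qed
  qed
  then have "{0<..<1::real} \<in> null_sets lborel" by (subst (asm) AE_iff_null_sets[symmetric]) auto
  then show False by (auto simp: null_sets_def)
qed

definition \<phi> :: L2 where "\<phi> = ground /\<^sub>R norm ground"

lemma norm_phi: "norm \<phi> = 1" "inner \<phi> \<phi> = 1"
proof -
  show "norm \<phi> = 1" using ground_nonzero by (simp add: \<phi>_def)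
  then show "inner \<phi> \<phi> = 1" by (simp only: norm_eq_1)
qed

lemma Gr_phi: "Gr \<phi> 0"
  using Gr_scale[OF Gr_ground, of "inverse (norm ground)"] by (simp add: \<phi>_def)

lemma Gr_zero_orthogonal_phi:
  assumes "Gr f 0" "inner f \<phi> = 0"
  shows "f = 0"
proof -
  obtain k where "f = k *\<^sub>R ground" using Gr_kernel[OF assms(1)] by blast
  then have "f = (k * norm ground) *\<^sub>R \<phi>" using ground_nonzero by (simp add: \<phi>_def)
  then show ?thesis using assms(2) norm_phi by simp
qed

text \<open>For \<open>g\<close> orthogonal to the kernel, \<open>A f = g\<close> is solved explicitly. The Dirichlet condition forces
  \<open>c\<^sub>1 + c\<^sub>2 = slope\<close> on either side, a multiple of the ground state removes \<open>c\<^sub>1\<close> on the right, and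
  the second transmission condition then gives \<open>c\<^sub>1 = coeff\<close> on the left. The first one holds by
  orthogonality.\<close>
definition slope :: "real \<Rightarrow> L2 \<Rightarrow> real" where
  "slope \<sigma> g = (moment \<beta> \<sigma> g 1 - moment \<alpha> \<sigma> g 1) / (2 * \<nu>)"

definition coeff :: "L2 \<Rightarrow> real" where "coeff g = \<beta> * (slope 1 g - slope (- 1) g) / (2 * \<nu>)"

definition particular :: "L2 \<Rightarrow> L2" where
  "particular g = L2_of (sol (coeff g) (slope (- 1) g - coeff g) 0 (slope 1 g) g)"

lemma Gr_particular:
  assumes "inner g \<phi> = 0"
  shows "Gr (particular g) g"
proof -
  have "inner g ground = norm ground * inner g \<phi>" using ground_nonzero by (simp add: \<phi>_def)
  moreover have "slope 1 g + slope (- 1) g = - inner g ground / (2 * \<nu>)"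
    by (simp add: slope_def inner_ground add_divide_distrib diff_divide_distrib)
  ultimately have "slope 1 g + slope (- 1) g = 0" using assms by simp
  moreover have "\<alpha> * coeff g + \<beta> * (slope (- 1) g - coeff g) = \<beta> * slope 1 g"
  proof -
    have "\<alpha> * coeff g + \<beta> * (slope (- 1) g - coeff g) = (\<alpha> - \<beta>) * coeff g + \<beta> * slope (- 1) g" by (simp add: algebra_simps)
    also have "\<dots> = \<beta> * (slope 1 g - slope (- 1) g) + \<beta> * slope (- 1) g"
    proof -
      have "\<alpha> - \<beta> = 2 * \<nu>" using exponents(4) by simp
      then show ?thesis using \<nu> by (simp add: coeff_def)
    qed
    finally show ?thesis by (simp add: algebra_simps)
  qed
  moreover have "half_sol 0 (slope 1 g) 1 g 1 = 0" "half_sol (coeff g) (slope (- 1) g - coeff g) (- 1) g 1 = 0"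
    using \<nu> by (simp_all add: half_sol_end slope_def field_simps)
  ultimately have "admissible (coeff g) (slope (- 1) g - coeff g) 0 (slope 1 g) g"
    by (simp add: admissible_def)
  then show ?thesis unfolding Gr_iff particular_def by blast
qed

text \<open>The inverse of the operator, extended by the identity on the kernel.\<close>
definition Res :: "L2 \<Rightarrow> L2" where
  "Res g = (let g' = g - inner g \<phi> *\<^sub>R \<phi>; f = particular g' in f + (inner g \<phi> - inner f \<phi>) *\<^sub>R \<phi>)"

lemma Gr_Res: "Gr (Res g) (g - inner g \<phi> *\<^sub>R \<phi>)" and inner_Res: "inner (Res g) \<phi> = inner g \<phi>"
proof -
  define g' where "g' = g - inner g \<phi> *\<^sub>R \<phi>"
  have "inner g' \<phi> = 0" by (simp add: g'_def inner_diff_left norm_phi)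
  from Gr_lincomb[OF Gr_particular[OF this] Gr_phi]
  show "Gr (Res g) (g - inner g \<phi> *\<^sub>R \<phi>)" by (simp add: Res_def Let_def flip: g'_def)
  show "inner (Res g) \<phi> = inner g \<phi>"
    by (simp add: Res_def Let_def inner_add_left norm_phi)
qed

lemma Res_unique:
  assumes "Gr f (g - inner g \<phi> *\<^sub>R \<phi>)" "inner f \<phi> = inner g \<phi>"
  shows "f = Res g"
proof -
  have "Gr (f + (-1) *\<^sub>R Res g) 0" using Gr_lincomb[OF assms(1) Gr_Res[of g], of "-1"] by simp
  moreover have "inner (f + (-1) *\<^sub>R Res g) \<phi> = 0" using assms(2) inner_Res[of g] by (simp add: inner_diff_left)
  ultimately have "f + (-1) *\<^sub>R Res g = 0" by (rule Gr_zero_orthogonal_phi)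
  then show ?thesis by simp
qed

lemma linear_Res: "linear Res"
proof (rule linearI)
  show "Res (g + h) = Res g + Res h" for g h
    using Gr_lincomb[OF Gr_Res[of g] Gr_Res[of h], of 1] inner_Res
    by (intro Res_unique[symmetric]) (simp_all add: inner_add_left algebra_simps)
  show "Res (r *\<^sub>R g) = r *\<^sub>R Res g" for r g
    using Gr_scale[OF Gr_Res[of g], of r] inner_Res
    by (intro Res_unique[symmetric]) (simp_all add: algebra_simps)
qed

lemma Res_symmetric: "inner (Res g) h = inner g (Res h)"
proof -
  have "inner (g - inner g \<phi> *\<^sub>R \<phi>) (Res h) = inner (Res g) (h - inner h \<phi> *\<^sub>R \<phi>)"
    by (rule Gr_symmetric[OF Gr_Res Gr_Res])
  then show ?thesis using inner_Res by (simp add: inner_diff_left inner_diff_right inner_commute)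
qed

lemma Res_injective:
  assumes "Res g = 0"
  shows "g = 0"
proof -
  have "inner g \<phi> = 0" using inner_Res[of g] assms by simp
  then have "Gr 0 g" using Gr_Res[of g] assms by simp
  then show ?thesis using Gr_unique[OF _ Gr_zero] by blast
qed

lemma weakly_Cauchy_lincomb:
  assumes g: "weakly_Cauchy g"
  shows "weakly_Cauchy (\<lambda>n. g n - inner (g n) \<phi> *\<^sub>R \<phi>)"
proof -
  obtain B where B: "\<And>n. norm (g n) \<le> B" using g by (auto simp: weakly_Cauchy_def bounded_iff)
  have "norm (g n - inner (g n) \<phi> *\<^sub>R \<phi>) \<le> 2 * B" for n
  proof -
    have "\<bar>inner (g n) \<phi>\<bar> \<le> norm (g n)" using Cauchy_Schwarz_ineq2[of "g n" \<phi>] norm_phi by simp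
    then show ?thesis using norm_triangle_ineq4[of "g n" "inner (g n) \<phi> *\<^sub>R \<phi>"] B[of n] norm_phi by simp
  qed
  moreover have "convergent (\<lambda>n. inner (g n - inner (g n) \<phi> *\<^sub>R \<phi>) y)" for y
    using g unfolding weakly_Cauchy_def inner_diff_left inner_scaleR_left
    by (intro convergent_diff convergent_mult convergent_const) auto
  ultimately show ?thesis by (auto simp: weakly_Cauchy_def bounded_iff)
qed

lemma V_uniform_bound:
  shows "\<exists>K\<ge>0. \<forall>g. \<forall>\<sigma>\<in>{1, -1}. \<forall>x\<in>{0..1}. \<bar>V \<sigma> g x\<bar> \<le> K * norm g"
proof -
  define K where "K = (1 / sqrt (2 * \<alpha> + 1) + 1 / sqrt (2 * \<beta> + 1)) / (2 * \<nu>)"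
  have pos: "1 / sqrt (2 * \<alpha> + 1) \<ge> 0" "1 / sqrt (2 * \<beta> + 1) \<ge> 0" using exponents(1,2) by auto
  have "\<bar>V \<sigma> g x\<bar> \<le> K * norm g" if \<sigma>: "\<sigma> \<in> {1, -1}" and x: "x \<in> {0..1}" for g \<sigma> x
  proof -
    have t: "\<bar>x powr b * moment a \<sigma> g x\<bar> \<le> norm g * (1 / sqrt (2 * a + 1))" if "a > -1/2" "a + b = 1" for a b
    proof -
      have "\<bar>x powr b * moment a \<sigma> g x\<bar> \<le> x powr b * (norm g * (x powr (a + 1/2) / sqrt (2 * a + 1)))"
        unfolding abs_mult using moment_bound[OF that(1) _ _ \<sigma>, of x g] x by (intro mult_mono) auto
      also have "\<dots> = norm g * (1 / sqrt (2 * a + 1)) * (x powr b * x powr (a + 1/2))" by simp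
      also have "x powr b * x powr (a + 1/2) = x powr (3/2)"
      proof -
        have "b + (a + 1/2) = 3/2" using that(2) by simp
        then show ?thesis by (simp only: powr_add[symmetric])
      qed
      also have "norm g * (1 / sqrt (2 * a + 1)) * x powr (3/2) \<le> norm g * (1 / sqrt (2 * a + 1)) * 1"
        using x that(1) by (intro mult_left_mono powr_le1) auto
      finally show ?thesis by simp
    qed
    have "\<bar>x powr \<beta> * moment \<alpha> \<sigma> g x - x powr \<alpha> * moment \<beta> \<sigma> g x\<bar>
        \<le> norm g * (1 / sqrt (2 * \<alpha> + 1)) + norm g * (1 / sqrt (2 * \<beta> + 1))"
      using t[of \<alpha> \<beta>] t[of \<beta> \<alpha>] exponents
        abs_triangle_ineq4[of "x powr \<beta> * moment \<alpha> \<sigma> g x" "x powr \<alpha> * moment \<beta> \<sigma> g x"] by (simp add: add.commute)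
    also have "\<dots> = norm g * (1 / sqrt (2 * \<alpha> + 1) + 1 / sqrt (2 * \<beta> + 1))" by (simp add: distrib_left)
    finally have "\<bar>x powr \<beta> * moment \<alpha> \<sigma> g x - x powr \<alpha> * moment \<beta> \<sigma> g x\<bar> / (2 * \<nu>)
        \<le> norm g * (1 / sqrt (2 * \<alpha> + 1) + 1 / sqrt (2 * \<beta> + 1)) / (2 * \<nu>)"
      using \<nu> by (intro divide_right_mono) auto
    then show ?thesis using \<nu> by (simp add: V_def K_def mult.commute)
  qed
  moreover have "K \<ge> 0" using pos \<nu> by (simp add: K_def)
  ultimately show ?thesis by blast
qed

text \<open>The values of an integral operator along a weakly Cauchy sequence converge pointwise, and
  they are uniformly bounded.\<close>
lemma completely_continuous_V: "completely_continuous (\<lambda>g. L2_of (sol 0 0 0 0 g))"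
  unfolding completely_continuous_def
proof (intro allI impI)
  fix g :: "nat \<Rightarrow> L2" assume g: "weakly_Cauchy g"
  obtain B where B: "\<And>n. norm (g n) \<le> B" using g by (auto simp: weakly_Cauchy_def bounded_iff)
  obtain K where K: "K \<ge> 0" "\<And>g \<sigma> x. \<sigma> \<in> {1, -1} \<Longrightarrow> x \<in> {0..1} \<Longrightarrow> \<bar>V \<sigma> g x\<bar> \<le> K * norm g"
    using V_uniform_bound by blast
  define F where "F n = sol 0 0 0 0 (g n)" for n
  have F: "F n x = (if x > 0 then V 1 (g n) x else V (- 1) (g n) (- x))" for n x
    by (simp add: F_def sol_def half_sol_def)
  have [measurable]: "F n \<in> borel_measurable I11" for n
    using square_integrable_sol unfolding F_def square_integrable_def by blast
  have sqF: "square_integrable I11 (F n)" for n unfolding F_def by (rule square_integrable_sol)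
  have Fb: "\<bar>F n x\<bar> \<le> K * B" if "x \<in> {-1<..<1}" for n x
  proof -
    have "\<bar>F n x\<bar> \<le> K * norm (g n)" using K(2)[of 1 x "g n"] K(2)[of "-1" "- x" "g n"] that by (auto simp: F)
    also have "\<dots> \<le> K * B" using B K(1) by (intro mult_left_mono)
    finally show ?thesis .
  qed
  have cm: "convergent (\<lambda>n. moment p \<sigma> (g n) x)" if "p > -1/2" "\<sigma> \<in> {1, -1}" "x \<in> {0..1}" for p \<sigma> x
    using that g by (simp add: moment_eq_inner weakly_Cauchy_def)
  have cV: "convergent (\<lambda>n. V \<sigma> (g n) x)" if \<sigma>: "\<sigma> \<in> {1, -1}" and x: "x \<in> {0..1}" for \<sigma> x
  proof -
    have "convergent (\<lambda>n. 1 / (2 * \<nu>) * (x powr \<beta> * moment \<alpha> \<sigma> (g n) x - x powr \<alpha> * moment \<beta> \<sigma> (g n) x))"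
      by (intro convergent_mult convergent_diff convergent_const cm exponents \<sigma> x)
    then show ?thesis by (simp add: V_def)
  qed
  define H where "H x = lim (\<lambda>n. F n x)" for x
  have [measurable]: "H \<in> borel_measurable I11" unfolding H_def by measurable
  have lim: "(\<lambda>n. F n x) \<longlonglongrightarrow> H x" if "x \<in> {-1<..<1}" for x
  proof -
    have "convergent (\<lambda>n. F n x)"
      using cV[of 1 x] cV[of "-1" "- x"] that by (cases "x > 0") (auto simp: F)
    then show ?thesis by (simp add: H_def convergent_LIMSEQ_iff)
  qed
  have Hb: "\<bar>H x\<bar> \<le> K * B" if "x \<in> {-1<..<1}" for x
    by (rule LIMSEQ_le_const2[OF tendsto_rabs[OF lim[OF that]]]) (use Fb[OF that] in blast)
  have sp: "space I11 = {-1<..<1}" by (simp add: I11_def space_restrict_space)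
  have sqH: "square_integrable I11 H"
    unfolding square_integrable_def
  proof
    show "integrable I11 (\<lambda>x. (H x)\<^sup>2)"
    proof (rule finite_measure.integrable_const_bound[OF finite_measure_I11, of _ "(K * B)\<^sup>2"])
      show "AE x in I11. norm ((H x)\<^sup>2) \<le> (K * B)\<^sup>2"
        using power_mono[OF Hb, of _ 2] by (intro AE_I2) (auto simp: sp)
    qed simp
  qed simp
  have "(\<lambda>n. \<integral>x. (F n x - H x)\<^sup>2 \<partial>I11) \<longlonglongrightarrow> (\<integral>x. 0 \<partial>I11)"
  proof (rule integral_dominated_convergence[where w = "\<lambda>x. (2 * (K * B))\<^sup>2"])
    show "integrable I11 (\<lambda>x. (2 * (K * B))\<^sup>2)" using finite_measure.integrable_const[OF finite_measure_I11] by blast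
    show "AE x in I11. (\<lambda>n. (F n x - H x)\<^sup>2) \<longlonglongrightarrow> 0"
    proof (rule AE_I2)
      fix x assume "x \<in> space I11"
      then have "x \<in> {-1<..<1}" by (simp add: sp)
      from tendsto_power[OF tendsto_diff[OF lim[OF this] tendsto_const[of "H x"]], of 2]
      show "(\<lambda>n. (F n x - H x)\<^sup>2) \<longlonglongrightarrow> 0" by simp
    qed
    show "AE x in I11. norm ((F n x - H x)\<^sup>2) \<le> (2 * (K * B))\<^sup>2" for n
    proof (rule AE_I2)
      fix x assume "x \<in> space I11"
      then have "\<bar>F n x - H x\<bar> \<le> 2 * (K * B)" using Fb[of x n] Hb[of x] by (auto simp: sp)
      from power_mono[OF this, of 2] show "norm ((F n x - H x)\<^sup>2) \<le> (2 * (K * B))\<^sup>2" by simp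
    qed
  qed simp_all
  then have "(\<lambda>n. (dist (L2_of (F n)) (L2_of H))\<^sup>2) \<longlonglongrightarrow> 0"
    by (simp add: dist_norm L2_of_diff[OF sqF sqH] norm_L2_of[OF square_integrable_diff[OF sqF sqH]])
  then have "(\<lambda>n. sqrt ((dist (L2_of (F n)) (L2_of H))\<^sup>2)) \<longlonglongrightarrow> sqrt 0" by (rule tendsto_real_sqrt)
  then have "(\<lambda>n. L2_of (F n)) \<longlonglongrightarrow> L2_of H" by (simp add: tendsto_dist_iff[of _ "L2_of H"])
  then show "convergent (\<lambda>n. L2_of (sol 0 0 0 0 (g n)))" by (auto simp: F_def convergent_def)
qed

lemma L2_of_sol_expand:
  "L2_of (sol a b c d g) = L2_of (sol 0 0 0 0 g) + (a *\<^sub>R L2_of (sol 1 0 0 0 0) + b *\<^sub>R L2_of (sol 0 1 0 0 0)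
    + c *\<^sub>R L2_of (sol 0 0 1 0 0) + d *\<^sub>R L2_of (sol 0 0 0 1 0))"
  using L2_of_sol_lincomb[of 0 a 1 0 0 0 0 0 0 g 0] L2_of_sol_lincomb[of a b 0 0 1 0 0 0 0 g 0]
    L2_of_sol_lincomb[of a c 0 b 0 0 1 0 0 g 0] L2_of_sol_lincomb[of a d 0 b 0 c 0 0 1 g 0]
  by (simp add: add.assoc)

text \<open>Besides \<open>V\<close> the resolvent involves only inner products with fixed vectors, such as the moments
  on the whole interval, and these converge along weakly Cauchy sequences.\<close>
lemma completely_continuous_Res: "completely_continuous Res"
  unfolding completely_continuous_def
proof (intro allI impI)
  fix g :: "nat \<Rightarrow> L2" assume g: "weakly_Cauchy g"
  define g' where "g' n = g n - inner (g n) \<phi> *\<^sub>R \<phi>" for n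
  have g': "weakly_Cauchy g'" unfolding g'_def by (rule weakly_Cauchy_lincomb[OF g])
  have slope: "convergent (\<lambda>n. slope \<sigma> (g' n))" if "\<sigma> \<in> {1, -1}" for \<sigma>
  proof -
    have m: "convergent (\<lambda>n. moment p \<sigma> (g' n) 1)" if "p > -1/2" for p
      using \<open>\<sigma> \<in> {1, -1}\<close> that g' by (simp add: moment_eq_inner weakly_Cauchy_def)
    have "convergent (\<lambda>n. 1 / (2 * \<nu>) * (moment \<beta> \<sigma> (g' n) 1 - moment \<alpha> \<sigma> (g' n) 1))"
      by (intro convergent_mult convergent_diff convergent_const m exponents)
    then show ?thesis by (simp add: slope_def)
  qed
  have coeff: "convergent (\<lambda>n. coeff (g' n))"
  proof -
    have "convergent (\<lambda>n. \<beta> / (2 * \<nu>) * (slope 1 (g' n) - slope (- 1) (g' n)))"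
      by (intro convergent_mult convergent_diff convergent_const slope) auto
    then show ?thesis by (simp add: coeff_def)
  qed
  have sc: "convergent (\<lambda>n. r n *\<^sub>R x)" if "convergent r" for r :: "nat \<Rightarrow> real" and x :: L2
    using that tendsto_scaleR[OF _ tendsto_const] unfolding convergent_def by blast
  have "convergent (\<lambda>n. L2_of (sol 0 0 0 0 (g' n)))"
    using completely_continuous_V g' by (auto simp: completely_continuous_def)
  then have part: "convergent (\<lambda>n. particular (g' n))"
    unfolding particular_def L2_of_sol_expand[of "coeff _"]
    by (intro convergent_add sc convergent_diff convergent_const coeff slope) auto
  then have "convergent (\<lambda>n. inner (particular (g' n)) \<phi>)"
    using tendsto_inner[OF _ tendsto_const] unfolding convergent_def by blast
  then have "convergent (\<lambda>n. inner (g n) \<phi> - inner (particular (g' n)) \<phi>)"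
    using g by (intro convergent_diff) (auto simp: weakly_Cauchy_def)
  then show "convergent (\<lambda>n. Res (g n))"
    unfolding Res_def Let_def g'_def[symmetric] by (intro convergent_add part sc)
qed

text \<open>An orthonormal basis of eigenvectors of \<open>Res\<close> that contains \<open>\<phi>\<close> diagonalises the operator,
  since the other basis vectors are orthogonal to the kernel.\<close>
theorem diagonalisation:
  "\<exists>E ev. total_orthonormal E \<and> (\<forall>e\<in>E. Gr e (ev e *\<^sub>R e)) \<and>
    (\<forall>f g. f \<in> dom_A0 \<nu> \<and> A0 \<nu> f = g \<longleftrightarrow> (\<forall>e\<in>E. inner g e = ev e * inner f e))"
proof -
  have Res_phi: "Res \<phi> = \<phi>"
    by (rule Res_unique[symmetric]) (simp_all add: norm_phi Gr_phi)
  have on: "orthonormal {\<phi>}" by (simp add: orthonormal_def norm_phi)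
  have eig: "\<exists>\<rho>. Res e = \<rho> *\<^sub>R e" if "e \<in> {\<phi>}" for e using that Res_phi by (intro exI[of _ 1]) simp
  have "\<exists>E. {\<phi>} \<subseteq> E \<and> orthonormal E \<and> (\<forall>e\<in>E. \<exists>\<rho>. Res e = \<rho> *\<^sub>R e) \<and> (\<forall>z. (\<forall>e\<in>E. inner z e = 0) \<longrightarrow> z = 0)"
    by (rule total_orthonormal_eigenvectors[OF linear_Res completely_continuous_Res Res_symmetric _ on])
      (fact Res_injective, fact eig)
  then obtain E where "{\<phi>} \<subseteq> E \<and> orthonormal E \<and> (\<forall>e\<in>E. \<exists>\<rho>. Res e = \<rho> *\<^sub>R e) \<and> (\<forall>z. (\<forall>e\<in>E. inner z e = 0) \<longrightarrow> z = 0)"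
    by (rule exE)
  then have E: "{\<phi>} \<subseteq> E" "orthonormal E" "\<forall>e\<in>E. \<exists>\<rho>. Res e = \<rho> *\<^sub>R e"
    "\<forall>z. (\<forall>e\<in>E. inner z e = 0) \<longrightarrow> z = 0" by simp_all
  interpret total_orthonormal E
  proof
    show "orthonormal E" by (rule E(2))
    show "z = 0" if "\<And>e. e \<in> E \<Longrightarrow> inner z e = 0" for z using E(4) that by simp
  qed
  have "\<exists>\<mu>. Gr e (\<mu> *\<^sub>R e)" if e: "e \<in> E" for e
  proof (cases "e = \<phi>")
    case True
    then show ?thesis using Gr_phi by (intro exI[of _ 0]) simp
  next
    case False
    obtain \<rho> where \<rho>: "Res e = \<rho> *\<^sub>R e" using E(3) e by blast
    have e1: "norm e = 1" using E(2) e by (simp add: orthonormal_def)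
    have "\<rho> \<noteq> 0" using Res_injective[of e] \<rho> e1 by auto
    have "inner e \<phi> = 0" using inner_basis[OF e, of \<phi>] E(1) False by simp
    then have "Gr (\<rho> *\<^sub>R e) e" using Gr_Res[of e] \<rho> by simp
    from Gr_scale[OF this, of "inverse \<rho>"] show ?thesis using \<open>\<rho> \<noteq> 0\<close> by auto
  qed
  then obtain ev where ev: "\<And>e. e \<in> E \<Longrightarrow> Gr e (ev e *\<^sub>R e)" by metis
  have fw: "inner g e = ev e * inner f e" if "Gr f g" "e \<in> E" for f g e
    using Gr_symmetric[OF that(1) ev[OF that(2)]] by simp
  have bw: "Gr f g" if fg: "\<forall>e\<in>E. inner g e = ev e * inner f e" for f g
  proof -
    have "ev \<phi> *\<^sub>R \<phi> = 0" using Gr_unique[OF ev Gr_phi] E(1) by simp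
    then have "ev \<phi> = 0" using norm_phi by auto
    then have g\<phi>: "inner g \<phi> = 0" using fg E(1) by simp
    define h where "h = g + inner f \<phi> *\<^sub>R \<phi>"
    have h\<phi>: "inner h \<phi> = inner f \<phi>" by (simp add: h_def inner_add_left g\<phi> norm_phi)
    have Gh: "Gr (Res h) g" using Gr_Res[of h] unfolding h\<phi> by (simp add: h_def)
    have "Res h = f"
    proof (rule coord_eqI)
      fix e assume e: "e \<in> E"
      show "inner (Res h) e = inner f e"
      proof (cases "e = \<phi>")
        case True
        then show ?thesis using inner_Res[of h] h\<phi> by simp
      next
        case False
        have "inner e \<phi> = 0" using inner_basis[OF e, of \<phi>] E(1) False by simp
        moreover have "norm e = 1" using E(2) e by (simp add: orthonormal_def)
        ultimately have "ev e \<noteq> 0" using Gr_zero_orthogonal_phi[of e] ev[OF e] by auto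
        moreover have "ev e * inner (Res h) e = ev e * inner f e" using fw[OF Gh e] bspec[OF fg e] by (rule trans[OF sym])
        ultimately show ?thesis by simp
      qed
    qed
    then show ?thesis using Gh by simp
  qed
  show ?thesis
    using ev fw bw total_orthonormal_axioms unfolding Gr_def[symmetric] by blast
qed

end

section \<open>Volterra equations at the singularity\<close>

context inverse_square
begin

text \<open>As a function of \<open>x\<close> this is the homogeneous solution with value \<open>0\<close> and derivative \<open>1\<close> at
  \<open>y\<close>.\<close>
definition kernel :: "real \<Rightarrow> real \<Rightarrow> real" where
  "kernel x y = (x powr \<alpha> * y powr \<beta> - x powr \<beta> * y powr \<alpha>) / (2 * \<nu>)"

lemma kernel_nonneg: "0 \<le> y \<Longrightarrow> y \<le> x \<Longrightarrow> 0 \<le> kernel x y"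
  and kernel_le: "0 \<le> y \<Longrightarrow> y \<le> x \<Longrightarrow> x \<le> 1 \<Longrightarrow> kernel x y \<le> x powr \<beta> * y powr \<beta> / (2 * \<nu>)"
proof -
  assume y: "0 \<le> y" "y \<le> x"
  have e: "t powr \<alpha> = t powr \<beta> * t powr (2 * \<nu>)" for t :: real
    by (simp add: \<alpha>_def \<beta>_def add.commute flip: powr_add)
  have k: "kernel x y = x powr \<beta> * y powr \<beta> * (x powr (2 * \<nu>) - y powr (2 * \<nu>)) / (2 * \<nu>)"
    unfolding kernel_def e by (simp add: algebra_simps)
  have "y powr (2 * \<nu>) \<le> x powr (2 * \<nu>)" using y \<nu> by (intro powr_mono2) auto
  then show "0 \<le> kernel x y" unfolding k using \<nu> by simp
  assume "x \<le> 1"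
  then have "x powr (2 * \<nu>) \<le> 1" using y \<nu> by (intro powr_le1) auto
  then have "x powr (2 * \<nu>) - y powr (2 * \<nu>) \<le> 1" using powr_ge_zero[of y "2 * \<nu>"] by linarith
  then have "x powr \<beta> * y powr \<beta> * (x powr (2 * \<nu>) - y powr (2 * \<nu>)) \<le> x powr \<beta> * y powr \<beta> * 1"
    by (intro mult_left_mono) auto
  then show "kernel x y \<le> x powr \<beta> * y powr \<beta> / (2 * \<nu>)" unfolding k using \<nu> by (simp add: divide_right_mono)
qed

definition volt :: "(real \<Rightarrow> real) \<Rightarrow> real \<Rightarrow> real" where
  "volt F x = integral {0..x} (\<lambda>y. kernel x y * F y)"

text \<open>The functions on which the Volterra operator acts: continuous away from the singularity and
  bounded by the larger of the two powers.\<close>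
definition tame :: "(real \<Rightarrow> real) \<Rightarrow> bool" where
  "tame F \<longleftrightarrow> continuous_on {0<..1} F \<and> (\<exists>C. \<forall>x\<in>{0<..1}. \<bar>F x\<bar> \<le> C * x powr \<beta>)"

lemma tame_lincomb:
  assumes "tame F" "tame G"
  shows "tame (\<lambda>x. F x + r * G x)"
proof -
  obtain B C where B: "\<And>x. x \<in> {0<..1} \<Longrightarrow> \<bar>F x\<bar> \<le> B * x powr \<beta>" and C: "\<And>x. x \<in> {0<..1} \<Longrightarrow> \<bar>G x\<bar> \<le> C * x powr \<beta>"
    using assms unfolding tame_def by blast
  have "\<bar>F x + r * G x\<bar> \<le> (B + \<bar>r\<bar> * C) * x powr \<beta>" if x: "x \<in> {0<..1}" for x
  proof -
    have "\<bar>r * G x\<bar> \<le> \<bar>r\<bar> * (C * x powr \<beta>)" unfolding abs_mult using C[OF x] by (intro mult_left_mono) auto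
    then show ?thesis using B[OF x] abs_triangle_ineq[of "F x" "r * G x"] by (simp add: algebra_simps)
  qed
  moreover have "continuous_on {0<..1} (\<lambda>x. F x + r * G x)"
    using assms unfolding tame_def by (intro continuous_intros) auto
  ultimately show ?thesis unfolding tame_def by blast
qed

lemma tame_half_sol: "\<sigma> \<in> {1, -1} \<Longrightarrow> tame (half_sol c1 c2 \<sigma> g)"
  unfolding tame_def using half_sol_continuous half_sol_bound by blast

lemma tame_abs: "tame F \<Longrightarrow> tame (\<lambda>x. \<bar>F x\<bar>)"
  unfolding tame_def by (auto intro: continuous_on_rabs)

lemma tame_max:
  assumes "tame F"
  shows "tame (\<lambda>x. max 0 (F x))"
proof -
  obtain C where C: "\<And>x. x \<in> {0<..1} \<Longrightarrow> \<bar>F x\<bar> \<le> C * x powr \<beta>" and c: "continuous_on {0<..1} F"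
    using assms unfolding tame_def by blast
  have "\<bar>max 0 (F x)\<bar> \<le> C * x powr \<beta>" if "x \<in> {0<..1}" for x
  proof -
    have "\<bar>max 0 (F x)\<bar> \<le> \<bar>F x\<bar>" by linarith
    then show ?thesis using C[OF that] by linarith
  qed
  moreover have "continuous_on {0<..1} (\<lambda>x. max 0 (F x))" by (intro continuous_on_max continuous_on_const c)
  ultimately show ?thesis unfolding tame_def by blast
qed

lemma tame_integrable:
  assumes F: "tame F" and p: "p \<ge> \<beta>"
  shows "set_integrable lborel {0..1} (\<lambda>y. y powr p * F y)"
proof -
  obtain C where C: "\<And>x. x \<in> {0<..1} \<Longrightarrow> \<bar>F x\<bar> \<le> C * x powr \<beta>" and c: "continuous_on {0<..1} F"
    using F unfolding tame_def by blast
  have "2 * \<beta> > -1" using exponents(2) by simp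
  then have i: "set_integrable lborel {0..1::real} (\<lambda>y. C * y powr (2 * \<beta>))"
    by (intro set_integrable_mult_right powr_set_integrable) auto
  have m: "(\<lambda>y. indicator {0<..1} y *\<^sub>R F y) \<in> borel_measurable borel"
    using c by (intro borel_measurable_continuous_on_indicator) auto
  have eq: "indicator {0..1} y *\<^sub>R (y powr p * F y) = y powr p * (indicator {0<..1} y *\<^sub>R F y)" for y
    by (auto simp: indicator_def)
  show ?thesis
    unfolding set_integrable_def
  proof (rule Bochner_Integration.integrable_bound)
    show "integrable lborel (\<lambda>y. indicator {0..1} y *\<^sub>R (C * y powr (2 * \<beta>)))" using i by (simp add: set_integrable_def)
    show "(\<lambda>y. indicator {0..1} y *\<^sub>R (y powr p * F y)) \<in> borel_measurable lborel"
      unfolding eq using m by measurable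
    show "AE y in lborel. norm (indicator {0..1} y *\<^sub>R (y powr p * F y)) \<le> norm (indicator {0..1} y *\<^sub>R (C * y powr (2 * \<beta>)))"
    proof (rule AE_I2)
      fix y :: real
      show "norm (indicator {0..1} y *\<^sub>R (y powr p * F y)) \<le> norm (indicator {0..1} y *\<^sub>R (C * y powr (2 * \<beta>)))"
      proof (cases "y \<in> {0<..1}")
        case True
        have "y powr p \<le> y powr \<beta>" using True p by (intro powr_mono') auto
        then have "\<bar>y powr p * F y\<bar> \<le> y powr \<beta> * (C * y powr \<beta>)"
          unfolding abs_mult using C[OF True] by (intro mult_mono) auto
        also have "\<dots> = C * y powr (2 * \<beta>)" by (simp flip: powr_add)
        finally have "\<bar>y powr p * F y\<bar> \<le> \<bar>C * y powr (2 * \<beta>)\<bar>" by linarith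
        then show ?thesis using True by simp
      next
        case False
        then show ?thesis by (auto simp: indicator_def)
      qed
    qed
  qed
qed

lemma \<alpha>_ge_\<beta>: "\<alpha> \<ge> \<beta>" using \<nu> by (simp add: \<alpha>_def \<beta>_def)

lemma kernel_integrable:
  assumes "tame F" "x \<in> {0..1}"
  shows "(\<lambda>y. kernel x y * F y) integrable_on {0..x}"
proof -
  have i: "(\<lambda>y. y powr p * F y) integrable_on {0..x}" if "p \<ge> \<beta>" for p
    by (rule integrable_on_subinterval[OF set_borel_integral_eq_integral(1)[OF tame_integrable[OF assms(1) that]]])
      (use assms(2) in auto)
  have "(\<lambda>y. 1 / (2 * \<nu>) * (x powr \<alpha> * (y powr \<beta> * F y) - x powr \<beta> * (y powr \<alpha> * F y))) integrable_on {0..x}"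
    using i[OF order_refl] i[OF \<alpha>_ge_\<beta>] by (intro integrable_on_mult_right integrable_diff)
  then show ?thesis by (simp add: kernel_def field_simps)
qed

lemma volt_lincomb:
  assumes "tame F" "tame G" "x \<in> {0..1}"
  shows "volt (\<lambda>y. F y + r * G y) x = volt F x + r * volt G x"
proof -
  have "volt (\<lambda>y. F y + r * G y) x = integral {0..x} (\<lambda>y. kernel x y * F y + r * (kernel x y * G y))"
    by (simp add: volt_def algebra_simps)
  also have "\<dots> = volt F x + r * volt G x"
    unfolding volt_def using kernel_integrable assms
    by (subst integral_add) (auto intro: integrable_on_mult_right)
  finally show ?thesis .
qed

text \<open>This closes the equation of an eigenfunction \<open>f\<close>: the right-hand side of the differential
  equation is a multiple of \<open>f\<close>, which enters \<open>V\<close> only through its values almost everywhere.\<close>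
lemma V_eq_volt:
  assumes \<sigma>: "\<sigma> \<in> {1, -1}" and F: "tame F" and x: "x \<in> {0..1}"
    and ae: "AE y in lborel. y \<in> {0<..<1} \<longrightarrow> rep0 f (\<sigma> * y) = F y"
  shows "V \<sigma> f x = - volt F x"
proof -
  have m: "moment p \<sigma> f x = integral {0..x} (\<lambda>y. y powr p * F y)" if "p > -1/2" "p \<ge> \<beta>" for p
  proof -
    have i: "set_integrable lborel {0..x} (\<lambda>y. y powr p * rep0 f (\<sigma> * y))"
      by (rule set_integrable_subset[OF side_product_integrable[OF that(1) \<sigma>]]) (use x in auto)
    have i': "set_integrable lborel {0..x} (\<lambda>y. y powr p * F y)"
      by (rule set_integrable_subset[OF tame_integrable[OF F that(2)]]) (use x in auto)
    have "(LINT y:{0..x}|lborel. y powr p * rep0 f (\<sigma> * y)) = (LINT y:{0..x}|lborel. y powr p * F y)"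
      unfolding set_lebesgue_integral_def
    proof (rule integral_cong_AE)
      show "AE y in lborel. indicator {0..x} y *\<^sub>R (y powr p * rep0 f (\<sigma> * y)) = indicator {0..x} y *\<^sub>R (y powr p * F y)"
        using ae AE_lborel_singleton[of 1]
        by eventually_elim (use x in \<open>auto simp: indicator_def\<close>)
    qed (use i i' in \<open>auto simp: set_integrable_def\<close>)
    then show ?thesis
      unfolding moment_def using set_borel_integral_eq_integral(2)[OF i] set_borel_integral_eq_integral(2)[OF i'] by simp
  qed
  have i: "(\<lambda>y. y powr p * F y) integrable_on {0..x}" if "p \<ge> \<beta>" for p
    by (rule integrable_on_subinterval[OF set_borel_integral_eq_integral(1)[OF tame_integrable[OF F that]]])
      (use x in auto)
  have "volt F x = integral {0..x} (\<lambda>y. (1 / (2 * \<nu>)) * (x powr \<alpha> * (y powr \<beta> * F y) - x powr \<beta> * (y powr \<alpha> * F y)))"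
    unfolding volt_def using \<nu> by (intro integral_cong) (simp add: kernel_def field_simps)
  also have "\<dots> = (1 / (2 * \<nu>)) * (x powr \<alpha> * integral {0..x} (\<lambda>y. y powr \<beta> * F y) - x powr \<beta> * integral {0..x} (\<lambda>y. y powr \<alpha> * F y))"
    using i[OF order_refl] i[OF \<alpha>_ge_\<beta>]
    by (subst integral_mult_right, subst integral_diff) (auto intro: integrable_on_mult_right)
  finally show ?thesis
    using m[OF exponents(2) order_refl] m[OF exponents(1) \<alpha>_ge_\<beta>] by (simp add: V_def diff_divide_distrib)
qed

text \<open>A primitive of \<open>y\<^bsup>2\<beta>\<^esup>\<close>, which up to the factor \<open>x\<^sup>\<beta> / (2 \<nu>)\<close> bounds \<open>kernel x y * y\<^sup>\<beta>\<close>.\<close>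
definition weight :: "real \<Rightarrow> real" where "weight x = x powr (2 * \<beta> + 1) / (2 * \<beta> + 1)"

lemma weight_has_integral:
  assumes "s > 0" "x \<in> {0<..1}"
  shows "((\<lambda>y. y powr (2 * \<beta>) * exp (s * weight y)) has_integral (exp (s * weight x) - 1) / s) {0..x}"
proof -
  have b: "2 * \<beta> + 1 > 0" using exponents(2) by simp
  have "((\<lambda>y. y powr (2 * \<beta>) * exp (s * weight y)) has_integral exp (s * weight x) / s - exp (s * weight 0) / s) {0..x}"
  proof (rule fundamental_theorem_of_calculus_interior)
    show "continuous_on {0..x} (\<lambda>y. exp (s * weight y) / s)"
      unfolding weight_def using b assms by (intro continuous_intros continuous_on_powr') auto
    fix y assume y: "y \<in> {0<..<x}"
    have "(weight has_real_derivative (2 * \<beta> + 1) * y powr (2 * \<beta> + 1 - 1) / (2 * \<beta> + 1)) (at y)"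
      unfolding weight_def using y by (intro DERIV_cdivide has_real_derivative_powr) auto
    then have w: "(weight has_real_derivative y powr (2 * \<beta>)) (at y)" using b by simp
    have "((\<lambda>y. exp (s * weight y) / s) has_real_derivative (exp (s * weight y) * (s * y powr (2 * \<beta>))) / s) (at y)"
      by (intro DERIV_cdivide DERIV_chain2[OF DERIV_exp] DERIV_cmult w)
    then show "((\<lambda>y. exp (s * weight y) / s) has_vector_derivative y powr (2 * \<beta>) * exp (s * weight y)) (at y)"
      using assms(1) by (simp add: has_real_derivative_iff_has_vector_derivative mult.commute)
  qed (use assms in auto)
  then show ?thesis using b by (simp add: weight_def diff_divide_distrib)
qed

lemma volt_upper_bound:
  assumes F: "tame F" and x: "x \<in> {0<..1}" and s: "s > 0" and N: "N \<ge> 0"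
    and le: "\<And>y. y \<in> {0<..x} \<Longrightarrow> F y \<le> N * (y powr \<beta> * exp (s * weight y))"
  shows "volt F x \<le> x powr \<beta> * (N * (exp (s * weight x) - 1) / (2 * \<nu> * s))"
proof -
  have h: "((\<lambda>y. (x powr \<beta> * N / (2 * \<nu>)) * (y powr (2 * \<beta>) * exp (s * weight y))) has_integral
      (x powr \<beta> * N / (2 * \<nu>)) * ((exp (s * weight x) - 1) / s)) {0..x}"
    by (intro has_integral_mult_right weight_has_integral s x)
  have "volt F x \<le> (x powr \<beta> * N / (2 * \<nu>)) * ((exp (s * weight x) - 1) / s)"
    unfolding volt_def
  proof (rule has_integral_le[OF integrable_integral[OF kernel_integrable[OF F]] h])
    show "x \<in> {0..1}" using x by auto
    fix y assume y: "y \<in> {0..x}"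
    show "kernel x y * F y \<le> (x powr \<beta> * N / (2 * \<nu>)) * (y powr (2 * \<beta>) * exp (s * weight y))"
    proof (cases "y = 0")
      case True
      then show ?thesis by (simp add: kernel_def)
    next
      case False
      have "kernel x y * F y \<le> kernel x y * (N * (y powr \<beta> * exp (s * weight y)))"
        using le[of y] kernel_nonneg[of y x] y False by (intro mult_left_mono) auto
      also have "\<dots> \<le> (x powr \<beta> * y powr \<beta> / (2 * \<nu>)) * (N * (y powr \<beta> * exp (s * weight y)))"
        using kernel_le[of y x] y x N by (intro mult_right_mono) auto
      also have "\<dots> = (x powr \<beta> * N / (2 * \<nu>)) * ((y powr \<beta> * y powr \<beta>) * exp (s * weight y))" by simp
      also have "y powr \<beta> * y powr \<beta> = y powr (2 * \<beta>)" by (simp flip: powr_add)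
      finally show ?thesis .
    qed
  qed
  then show ?thesis by (simp add: mult_ac)
qed

text \<open>Gronwall: take the least \<open>N\<close> with \<open>F \<le> N x\<^sup>\<beta> exp (s weight)\<close>; for large \<open>s\<close> the inequality
  halves it. The positive parts in the hypothesis let the lemma apply to \<open>- F\<close>, where it gives
  positivity, and to \<open>\<bar>F\<bar>\<close>, where it gives uniqueness.\<close>
lemma volt_gronwall:
  assumes F: "tame F" and \<mu>: "\<mu> \<ge> 0" and le: "\<And>x. x \<in> {0<..1} \<Longrightarrow> F x \<le> \<mu> * max 0 (volt (\<lambda>y. max 0 (F y)) x)"
    and x: "x \<in> {0<..1}"
  shows "F x \<le> 0"
proof -
  define s where "s = (\<mu> + 1) / \<nu>"
  have s: "s > 0" using \<mu> \<nu> by (simp add: s_def add_nonneg_pos)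
  define q where "q x = F x / (x powr \<beta> * exp (s * weight x))" for x
  define N where "N = max 0 (Sup (q ` {0<..1}))"
  obtain C where C: "\<And>x. x \<in> {0<..1} \<Longrightarrow> \<bar>F x\<bar> \<le> C * x powr \<beta>" and cF: "continuous_on {0<..1} F"
    using F unfolding tame_def by blast
  have w0: "weight x \<ge> 0" for x using exponents(2) by (simp add: weight_def)
  have C0: "C \<ge> 0" using C[of 1] by simp
  have pos: "x powr \<beta> * exp (s * weight x) > 0" if "x \<in> {0<..1}" for x using that by simp
  have bdd: "bdd_above (q ` {0<..1})"
  proof (rule bdd_aboveI2)
    fix x :: real assume x: "x \<in> {0<..1}"
    have "F x \<le> C * x powr \<beta>" using C[OF x] by simp
    also have "\<dots> \<le> C * (x powr \<beta> * exp (s * weight x))"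
      using s w0[of x] C0 by (intro mult_left_mono) (auto simp: mult_le_cancel_left1)
    finally show "q x \<le> C" using pos[OF x] by (simp add: q_def divide_le_eq)
  qed
  have qN: "q x \<le> N" if "x \<in> {0<..1}" for x
    unfolding N_def using cSup_upper[OF imageI[OF that] bdd] by linarith
  have N0: "N \<ge> 0" by (simp add: N_def)
  have FN: "F x \<le> N * (x powr \<beta> * exp (s * weight x))" if "x \<in> {0<..1}" for x
    using qN[OF that] pos[OF that] by (simp add: q_def divide_le_eq)
  have tm: "tame (\<lambda>y. max 0 (F y))" by (rule tame_max[OF F])
  have qhalf: "q x \<le> N / 2" if x: "x \<in> {0<..1}" for x
  proof -
    have x': "{0<..x} \<subseteq> {0<..1}" using x by auto
    have "max 0 (F y) \<le> N * (y powr \<beta> * exp (s * weight y))" if "y \<in> {0<..x}" for y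
      using FN[of y] that x' N0 by auto
    from volt_upper_bound[OF tm x s N0 this]
    have v: "volt (\<lambda>y. max 0 (F y)) x \<le> x powr \<beta> * (N * (exp (s * weight x) - 1) / (2 * \<nu> * s))" .
    have "N * (exp (s * weight x) - 1) / (2 * \<nu> * s) \<le> N * exp (s * weight x) / (2 * \<nu> * s)"
      using s \<nu> N0 by (intro divide_right_mono mult_left_mono) auto
    then have "x powr \<beta> * (N * (exp (s * weight x) - 1) / (2 * \<nu> * s)) \<le> x powr \<beta> * (N * exp (s * weight x) / (2 * \<nu> * s))"
      by (intro mult_left_mono) auto
    then have v': "max 0 (volt (\<lambda>y. max 0 (F y)) x) \<le> x powr \<beta> * (N * exp (s * weight x) / (2 * \<nu> * s))"
      using v N0 \<nu> s by (simp add: max_def)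
    have "F x \<le> \<mu> * (x powr \<beta> * (N * exp (s * weight x) / (2 * \<nu> * s)))"
      using le[OF x] mult_left_mono[OF v' \<mu>] by linarith
    also have "\<dots> = (\<mu> / (\<mu> + 1)) * (N / 2 * (x powr \<beta> * exp (s * weight x)))"
    proof -
      have n: "2 * \<nu> * s = 2 * (\<mu> + 1)" using \<nu> by (simp add: s_def)
      have "m * (a * (N * E / (2 * k))) = m / k * (N / 2 * (a * E))" for m a E k :: real by (simp add: mult_ac)
      then show ?thesis unfolding n .
    qed
    also have "\<dots> \<le> 1 * (N / 2 * (x powr \<beta> * exp (s * weight x)))"
      using \<mu> N0 by (intro mult_right_mono) auto
    finally show ?thesis using pos[OF x] by (simp add: q_def divide_le_eq)
  qed
  have "Sup (q ` {0<..1}) \<le> N / 2" using qhalf by (intro cSup_least) auto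
  then have "N = 0" using N0 unfolding N_def by linarith
  then show ?thesis using FN[OF x] by simp
qed

lemma volt_mono:
  assumes "tame F" "tame G" "x \<in> {0..1}" "\<And>y. y \<in> {0<..x} \<Longrightarrow> F y \<le> G y"
  shows "volt F x \<le> volt G x"
  unfolding volt_def
proof (rule integral_le)
  fix y assume y: "y \<in> {0..x}"
  show "kernel x y * F y \<le> kernel x y * G y"
  proof (cases "y = 0")
    case True
    then show ?thesis by (simp add: kernel_def)
  next
    case False
    then show ?thesis using y assms(4)[of y] kernel_nonneg[of y x] by (intro mult_left_mono) auto
  qed
qed (intro kernel_integrable assms)+

lemma volt_positivity:
  assumes F: "tame F" and \<mu>: "\<mu> \<ge> 0" and le: "\<And>x. x \<in> {0<..1} \<Longrightarrow> F x \<ge> \<mu> * volt F x" and x: "x \<in> {0<..1}"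
  shows "F x \<ge> 0"
proof -
  have neg: "tame (\<lambda>x. - F x)" using tame_lincomb[OF F F, of "-2"] by simp
  have tm: "tame (\<lambda>y. max 0 (- F y))" by (rule tame_max[OF neg])
  have "- F x \<le> \<mu> * max 0 (volt (\<lambda>y. max 0 (- F y)) x)" if x: "x \<in> {0<..1}" for x
  proof -
    have x': "x \<in> {0..1}" using x by auto
    have "volt (\<lambda>x. - F x) x = - volt F x" by (simp add: volt_def)
    moreover have "volt (\<lambda>x. - F x) x \<le> volt (\<lambda>y. max 0 (- F y)) x"
      by (rule volt_mono[OF neg tm x']) simp
    ultimately have "- volt F x \<le> max 0 (volt (\<lambda>y. max 0 (- F y)) x)" by linarith
    from mult_left_mono[OF this \<mu>] show ?thesis using le[OF x] by simp
  qed
  from volt_gronwall[OF neg \<mu> this x] show ?thesis by simp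
qed

lemma volt_uniqueness:
  assumes F: "tame F" and eq: "\<And>x. x \<in> {0<..1} \<Longrightarrow> F x = \<mu> * volt F x" and x: "x \<in> {0<..1}"
  shows "F x = 0"
proof -
  have a: "tame (\<lambda>x. \<bar>F x\<bar>)" by (rule tame_abs[OF F])
  have neg: "tame (\<lambda>x. - F x)" using tame_lincomb[OF F F, of "-2"] by simp
  have "\<bar>F x\<bar> \<le> \<bar>\<mu>\<bar> * max 0 (volt (\<lambda>y. max 0 \<bar>F y\<bar>) x)" if x: "x \<in> {0<..1}" for x
  proof -
    have x': "x \<in> {0..1}" using x by auto
    have "volt F x \<le> volt (\<lambda>y. \<bar>F y\<bar>) x" by (rule volt_mono[OF F a x']) simp
    moreover have "- volt F x \<le> volt (\<lambda>y. \<bar>F y\<bar>) x"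
      using volt_mono[OF neg a x'] by (simp add: volt_def)
    ultimately have "\<bar>volt F x\<bar> \<le> max 0 (volt (\<lambda>y. max 0 \<bar>F y\<bar>) x)" by simp
    then show ?thesis unfolding eq[OF x] abs_mult by (rule mult_left_mono) simp
  qed
  from volt_gronwall[OF a _ this x] show ?thesis by simp
qed

end

section \<open>Eigenfunctions\<close>

text \<open>\<open>U exp (- M x)\<close> decreases and \<open>U exp (M x)\<close> increases, so a zero of \<open>U\<close> spreads to both
  sides.\<close>
lemma primitive_on_gronwall:
  assumes P: "primitive_on {a..b} U U'" and U: "\<And>x. x \<in> {a..b} \<Longrightarrow> U x \<ge> 0"
    and b: "\<And>x. x \<in> {a..b} \<Longrightarrow> \<bar>U' x\<bar> \<le> M * U x" and s: "s \<in> {a..b}" "U s = 0" and x: "x \<in> {a..b}"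
  shows "U x = 0"
proof -
  have P': "primitive_on {a..b} (\<lambda>x. U x * exp (k * x)) (\<lambda>x. U' x * exp (k * x) + U x * (exp (k * x) * k))" for k
  proof (rule primitive_on_mult[OF P primitive_on_C1])
    show "((\<lambda>x. exp (k * x)) has_real_derivative exp (k * x) * k) (at x within {a..b})" for x
      by (auto intro!: derivative_eq_intros)
    show "continuous_on {a..b} (\<lambda>x. exp (k * x) * k)" by (intro continuous_intros)
  qed
  have "U x \<le> 0"
  proof (cases "s \<le> x")
    case True
    have "((\<lambda>x. U' x * exp (- M * x) + U x * (exp (- M * x) * (- M))) has_integral
        U x * exp (- M * x) - U s * exp (- M * s)) {s..x}"
      by (rule primitive_on_has_integral[OF P' True]) (use s x in auto)
    moreover have "U' y * exp (- M * y) + U y * (exp (- M * y) * (- M)) \<le> 0" if "y \<in> {s..x}" for y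
    proof -
      have "U' y * exp (- M * y) \<le> (M * U y) * exp (- M * y)"
        using b[of y] that s x by (intro mult_right_mono) auto
      then show ?thesis by (simp add: mult_ac)
    qed
    ultimately have "U x * exp (- M * x) - U s * exp (- M * s) \<le> 0"
      by (rule has_integral_le[OF _ has_integral_0])
    then show ?thesis using s(2) by (simp add: mult_le_0_iff)
  next
    case False
    have "((\<lambda>x. U' x * exp (M * x) + U x * (exp (M * x) * M)) has_integral
        U s * exp (M * s) - U x * exp (M * x)) {x..s}"
      by (rule primitive_on_has_integral[OF P']) (use s x False in auto)
    moreover have "0 \<le> U' y * exp (M * y) + U y * (exp (M * y) * M)" if "y \<in> {x..s}" for y
    proof -
      have "(- (M * U y)) * exp (M * y) \<le> U' y * exp (M * y)"
        using b[of y] that s x by (intro mult_right_mono) auto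
      then show ?thesis by (simp add: mult_ac)
    qed
    ultimately have "0 \<le> U s * exp (M * s) - U x * exp (M * x)"
      by (rule has_integral_nonneg)
    then show ?thesis using s(2) by (simp add: mult_le_0_iff)
  qed
  then show ?thesis using U[OF x] by simp
qed

lemma continuous_zero_of_AE:
  fixes F :: "real \<Rightarrow> real"
  assumes c: "continuous_on S F" and S: "open S" and ae: "AE x in lborel. x \<in> S \<longrightarrow> F x = 0" and x: "x \<in> S"
  shows "F x = 0"
proof (rule ccontr)
  assume ne: "F x \<noteq> 0"
  define N where "N = S \<inter> F -` (- {0})"
  have N: "open N" unfolding N_def by (rule continuous_open_preimage[OF c S]) auto
  have "AE x in lborel. x \<notin> N" using ae by eventually_elim (auto simp: N_def)
  then have "N \<in> null_sets lborel" using N by (subst (asm) AE_iff_null_sets[symmetric]) auto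
  then have "negligible N" by (simp add: negligible_iff_null_sets null_sets_completionI)
  moreover have "x \<in> N" using x ne by (simp add: N_def)
  ultimately show False using open_not_negligible[OF N] by blast
qed

context inverse_square
begin

text \<open>An eigenfunction solves a Volterra equation on either side of the singularity.\<close>
lemma eigenfunction_halves:
  assumes "Gr f (\<kappa> *\<^sub>R f)"
  obtains C1 C2 :: "real \<Rightarrow> real" and F :: "real \<Rightarrow> real \<Rightarrow> real" where
    "\<And>\<sigma>. F \<sigma> = half_sol (C1 \<sigma>) (C2 \<sigma>) \<sigma> (\<kappa> *\<^sub>R f)"
    "\<And>\<sigma>. \<sigma> \<in> {1, -1} \<Longrightarrow> AE y in lborel. y \<in> {0<..<1} \<longrightarrow> rep0 f (\<sigma> * y) = F \<sigma> y"
    "\<And>\<sigma> x. \<sigma> \<in> {1, -1} \<Longrightarrow> x \<in> {0..1} \<Longrightarrow> F \<sigma> x = C1 \<sigma> * x powr \<alpha> + C2 \<sigma> * x powr \<beta> - \<kappa> * volt (F \<sigma>) x"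
    "C1 (- 1) + C2 (- 1) + C1 1 + C2 1 = 0" "\<alpha> * C1 (- 1) + \<beta> * C2 (- 1) = \<alpha> * C1 1 + \<beta> * C2 1"
    "\<And>\<sigma>. \<sigma> \<in> {1, -1} \<Longrightarrow> F \<sigma> 1 = 0"
    "(\<And>\<sigma> x. \<sigma> \<in> {1, -1} \<Longrightarrow> x \<in> {0<..1} \<Longrightarrow> F \<sigma> x = 0) \<Longrightarrow> f = 0"
proof -
  obtain a b c d where f: "f = L2_of (sol a b c d (\<kappa> *\<^sub>R f))" and ad: "admissible a b c d (\<kappa> *\<^sub>R f)"
    using assms unfolding Gr_iff by blast
  define C1 where "C1 \<sigma> = (if \<sigma> = 1 then c else a)" for \<sigma> :: real
  define C2 where "C2 \<sigma> = (if \<sigma> = 1 then d else b)" for \<sigma> :: real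
  define F where "F \<sigma> = half_sol (C1 \<sigma>) (C2 \<sigma>) \<sigma> (\<kappa> *\<^sub>R f)" for \<sigma>
  have rf: "AE x in lborel. x \<in> {-1<..<1} \<longrightarrow> rep0 f x = sol a b c d (\<kappa> *\<^sub>R f) x"
    using rep0_L2_of[OF square_integrable_sol, of a b c d "\<kappa> *\<^sub>R f"] f by simp
  have ae: "AE y in lborel. y \<in> {0<..<1} \<longrightarrow> rep0 f (\<sigma> * y) = F \<sigma> y" if "\<sigma> \<in> {1, -1}" for \<sigma>
  proof (cases "\<sigma> = 1")
    case True
    show ?thesis using rf by eventually_elim (auto simp: True sol_def F_def C1_def C2_def)
  next
    case False
    then have \<sigma>: "\<sigma> = -1" using that by simp
    show ?thesis
      using AE_lborel_reflect[OF rf] by eventually_elim (auto simp: \<sigma> sol_def F_def C1_def C2_def)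
  qed
  show thesis
  proof (rule that[of F C1 C2])
    show "F \<sigma> = half_sol (C1 \<sigma>) (C2 \<sigma>) \<sigma> (\<kappa> *\<^sub>R f)" for \<sigma> by (rule F_def)
    show "AE y in lborel. y \<in> {0<..<1} \<longrightarrow> rep0 f (\<sigma> * y) = F \<sigma> y" if "\<sigma> \<in> {1, -1}" for \<sigma>
      by (rule ae[OF that])
    show "F \<sigma> x = C1 \<sigma> * x powr \<alpha> + C2 \<sigma> * x powr \<beta> - \<kappa> * volt (F \<sigma>) x" if \<sigma>: "\<sigma> \<in> {1, -1}" and x: "x \<in> {0..1}" for \<sigma> x
    proof -
      have "V \<sigma> (\<kappa> *\<^sub>R f) x = \<kappa> * V \<sigma> f x"
        using V_lincomb[OF \<sigma> x, of 0 \<kappa> f] V_zero[OF \<sigma> x] by simp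
      also have "V \<sigma> f x = - volt (F \<sigma>) x"
        by (rule V_eq_volt[OF \<sigma> _ x ae[OF \<sigma>]]) (simp add: F_def tame_half_sol[OF \<sigma>])
      finally show ?thesis by (simp add: F_def half_sol_def[of _ _ _ _ x])
    qed
    show "C1 (- 1) + C2 (- 1) + C1 1 + C2 1 = 0" "\<alpha> * C1 (- 1) + \<beta> * C2 (- 1) = \<alpha> * C1 1 + \<beta> * C2 1"
      using ad by (auto simp: C1_def C2_def admissible_def)
    show "F \<sigma> 1 = 0" if "\<sigma> \<in> {1, -1}" for \<sigma>
      using ad that by (auto simp: C1_def C2_def F_def admissible_def)
    show "f = 0" if z: "\<And>\<sigma> x. \<sigma> \<in> {1, -1} \<Longrightarrow> x \<in> {0<..1} \<Longrightarrow> F \<sigma> x = 0"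
    proof (rule L2_eqI)
      have r0: "AE x in lborel. x \<in> {-1<..<1} \<longrightarrow> rep0 0 x = 0"
        using rep0_L2_of[OF square_integrable_zero] by (simp add: L2_of_zero)
      have p: "AE y in lborel. y \<in> {0<..<1} \<longrightarrow> rep0 f y = 0"
        using ae[of 1, simplified] by eventually_elim (use z[of 1] in auto)
      have "AE y in lborel. y \<in> {0<..<1} \<longrightarrow> rep0 f (- y) = 0"
        using ae[of "-1", simplified] by eventually_elim (use z[of "-1"] in auto)
      from AE_lborel_reflect[OF this]
      have m: "AE y in lborel. - y \<in> {0<..<1} \<longrightarrow> rep0 f y = 0" by simp
      show "AE x in lborel. x \<in> {-1<..<1} \<longrightarrow> rep0 f x = rep0 0 x"
        using r0 p m AE_lborel_singleton[of 0]
      proof eventually_elim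
        case (elim x)
        then show ?case by (cases "x > 0") auto
      qed
    qed
  qed
qed

text \<open>The kernel is positive for \<open>0 < y < 1\<close> at \<open>x = 1\<close>, so the integrand vanishes.\<close>
lemma volt_nonneg_zero:
  assumes F: "tame F" and nn: "\<And>x. x \<in> {0<..1} \<Longrightarrow> F x \<ge> 0" and v: "volt F 1 \<le> 0" and x: "0 < x" "x < 1"
  shows "F x = 0"
proof -
  have i: "(\<lambda>y. kernel 1 y * F y) integrable_on {0..1}" by (rule kernel_integrable[OF F]) simp
  have nn': "0 \<le> kernel 1 y * F y" if "y \<in> {0..1}" for y
  proof (cases "y = 0")
    case True
    then show ?thesis by (simp add: kernel_def)
  next
    case False
    then show ?thesis using that nn[of y] kernel_nonneg[of y 1] by simp
  qed
  have c: "continuous_on {x..1} (\<lambda>y. kernel 1 y * F y)"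
  proof -
    have "continuous_on {x..1} F" using F x unfolding tame_def by (auto elim: continuous_on_subset)
    then show ?thesis unfolding kernel_def using x \<nu> by (intro continuous_intros) auto
  qed
  have i': "(\<lambda>y. kernel 1 y * F y) integrable_on {x..1}"
    by (rule integrable_on_subinterval[OF i]) (use x in auto)
  have "integral {x..1} (\<lambda>y. kernel 1 y * F y) \<le> integral {0..1} (\<lambda>y. kernel 1 y * F y)"
    by (rule integral_subset_le[OF _ i' i]) (use x nn' in auto)
  moreover have "0 \<le> integral {x..1} (\<lambda>y. kernel 1 y * F y)"
    by (rule integral_nonneg[OF i']) (use x nn' in auto)
  ultimately have "integral {x..1} (\<lambda>y. kernel 1 y * F y) = 0" using v unfolding volt_def by linarith
  then have "((\<lambda>y. kernel 1 y * F y) has_integral 0) (cbox x 1)" using i' by (metis cbox_interval integrable_integral)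
  then have "kernel 1 x * F x = 0"
    by (rule has_integral_0_cbox_imp_0[rotated 2]) (use c x nn' in \<open>auto simp: box_eq_empty\<close>)
  moreover have "x powr \<alpha> < x powr \<beta>" using x \<nu> by (intro powr_less_mono') (auto simp: \<alpha>_def \<beta>_def)
  then have "kernel 1 x \<noteq> 0" using \<nu> by (simp add: kernel_def)
  ultimately show ?thesis by simp
qed

text \<open>With \<open>\<mu> > 0\<close> all terms on the right have the sign of \<open>D\<close>, so a solution that vanishes
  at the end point vanishes.\<close>
lemma volt_end_zero:
  assumes F: "tame F" and \<mu>: "\<mu> > 0" and eq: "\<And>x. x \<in> {0<..1} \<Longrightarrow> F x = D * k x + \<mu> * volt F x"
    and k: "\<And>x. x \<in> {0<..1} \<Longrightarrow> k x \<ge> 0" and e: "F 1 = 0" and x: "x \<in> {0<..1}"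
  shows "F x = 0"
proof -
  have pos: "G x = 0" if G: "tame G" and eqG: "\<And>x. x \<in> {0<..1} \<Longrightarrow> G x = d * k x + \<mu> * volt G x"
    and e: "G 1 = 0" and d: "d \<ge> 0" for G d
  proof -
    have nn: "G y \<ge> 0" if "y \<in> {0<..1}" for y
      by (rule volt_positivity[OF G _ _ that, of \<mu>]) (use eqG k d \<mu> in auto)
    have "\<mu> * volt G 1 \<le> 0" using eqG[of 1] e mult_nonneg_nonneg[OF d k[of 1]] by simp
    then have "volt G 1 \<le> 0" using \<mu> by (simp add: mult_le_0_iff)
    from volt_nonneg_zero[OF G nn this] show ?thesis using e x by (cases "x = 1") auto
  qed
  show ?thesis
  proof (cases "D \<ge> 0")
    case True
    then show ?thesis using pos[OF F eq e] by blast
  next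
    case False
    have neg: "tame (\<lambda>x. - F x)" using tame_lincomb[OF F F, of "-2"] by simp
    have "- F x = 0"
      by (rule pos[OF neg, of "- D"]) (use eq e False in \<open>auto simp: volt_def\<close>)
    then show ?thesis by simp
  qed
qed

text \<open>The transmission conditions decouple in the even and the odd part of an eigenfunction: the
  even part starts like \<open>x\<^sup>\<beta> - x\<^sup>\<alpha>\<close>, the odd part like \<open>x\<^sup>\<beta> - (\<beta>/\<alpha>) x\<^sup>\<alpha>\<close>.\<close>
lemma eigenvalue_nonneg:
  assumes Gr: "Gr f (\<kappa> *\<^sub>R f)" and neg: "\<kappa> < 0"
  shows "f = 0"
proof -
  obtain C1 C2 F where Fd: "\<And>\<sigma>. F \<sigma> = half_sol (C1 \<sigma>) (C2 \<sigma>) \<sigma> (\<kappa> *\<^sub>R f)"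
    and eq: "\<And>\<sigma> x. \<sigma> \<in> {1, -1} \<Longrightarrow> x \<in> {0..1} \<Longrightarrow> F \<sigma> x = C1 \<sigma> * x powr \<alpha> + C2 \<sigma> * x powr \<beta> - \<kappa> * volt (F \<sigma>) x"
    and T: "C1 (- 1) + C2 (- 1) + C1 1 + C2 1 = 0" "\<alpha> * C1 (- 1) + \<beta> * C2 (- 1) = \<alpha> * C1 1 + \<beta> * C2 1"
    and e: "\<And>\<sigma>. \<sigma> \<in> {1, -1} \<Longrightarrow> F \<sigma> 1 = 0"
    and z: "(\<And>\<sigma> x. \<sigma> \<in> {1, -1} \<Longrightarrow> x \<in> {0<..1} \<Longrightarrow> F \<sigma> x = 0) \<Longrightarrow> f = 0"
    by (rule eigenfunction_halves[OF Gr]) blast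
  have tm: "tame (F \<sigma>)" if "\<sigma> \<in> {1, -1}" for \<sigma> unfolding Fd by (rule tame_half_sol[OF that])
  have comb: "F 1 x + r * F (- 1) x = (C1 1 + r * C1 (- 1)) * x powr \<alpha> + (C2 1 + r * C2 (- 1)) * x powr \<beta>
      + (- \<kappa>) * volt (\<lambda>x. F 1 x + r * F (- 1) x) x" if x: "x \<in> {0<..1}" for x r
  proof -
    have x': "x \<in> {0..1}" using x by auto
    have "F 1 x + r * F (- 1) x = C1 1 * x powr \<alpha> + C2 1 * x powr \<beta> - \<kappa> * volt (F 1) x
        + r * (C1 (- 1) * x powr \<alpha> + C2 (- 1) * x powr \<beta> - \<kappa> * volt (F (- 1)) x)"
      using eq[of 1, OF _ x'] eq[of "-1", OF _ x'] by simp
    moreover have "volt (\<lambda>x. F 1 x + r * F (- 1) x) x = volt (F 1) x + r * volt (F (- 1)) x"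
      using volt_lincomb[OF tm tm x'] by simp
    ultimately show ?thesis by (simp add: algebra_simps)
  qed
  have le: "x powr \<alpha> \<le> x powr \<beta>" if "x \<in> {0<..1}" for x
    using that \<alpha>_ge_\<beta> by (intro powr_mono') auto
  have \<alpha>: "\<alpha> > 0" using \<nu> by (simp add: \<alpha>_def)
  have even: "F 1 x + 1 * F (- 1) x = 0" if x: "x \<in> {0<..1}" for x
  proof (rule volt_end_zero[where F = "\<lambda>x. F 1 x + 1 * F (- 1) x" and \<mu> = "- \<kappa>" and D = "C2 1 + C2 (- 1)" and k = "\<lambda>x. x powr \<beta> - x powr \<alpha>"])
    fix x :: real assume x: "x \<in> {0<..1}"
    have C: "C1 1 + 1 * C1 (- 1) = - (C2 1 + C2 (- 1))" using T(1) by simp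
    show "F 1 x + 1 * F (- 1) x = (C2 1 + C2 (- 1)) * (x powr \<beta> - x powr \<alpha>) + (- \<kappa>) * volt (\<lambda>x. F 1 x + 1 * F (- 1) x) x"
      unfolding comb[OF x, of 1] C by (simp add: algebra_simps)
    show "0 \<le> x powr \<beta> - x powr \<alpha>" using le[OF x] by simp
  qed (use e x neg in \<open>auto intro: tame_lincomb[OF tm[of 1] tm[of "-1"], of 1, simplified] tame_lincomb[OF tm[of 1] tm[of "-1"], of "-1", simplified]\<close>)
  have odd: "F 1 x + (-1) * F (- 1) x = 0" if x: "x \<in> {0<..1}" for x
  proof (rule volt_end_zero[where F = "\<lambda>x. F 1 x + (-1) * F (- 1) x" and \<mu> = "- \<kappa>" and D = "C2 1 - C2 (- 1)" and k = "\<lambda>x. x powr \<beta> - \<beta> / \<alpha> * x powr \<alpha>"])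
    fix x :: real assume x: "x \<in> {0<..1}"
    have "\<alpha> * (C1 1 + (-1) * C1 (- 1)) = - \<beta> * (C2 1 - C2 (- 1))" using T(2) by (simp add: algebra_simps)
    then have C: "C1 1 + (-1) * C1 (- 1) = - (\<beta> / \<alpha>) * (C2 1 - C2 (- 1))" using \<alpha> by (simp add: field_simps)
    show "F 1 x + (-1) * F (- 1) x = (C2 1 - C2 (- 1)) * (x powr \<beta> - \<beta> / \<alpha> * x powr \<alpha>) + (- \<kappa>) * volt (\<lambda>x. F 1 x + (-1) * F (- 1) x) x"
      unfolding comb[OF x, of "-1"] C by (simp add: algebra_simps diff_divide_distrib)
    have "\<beta> / \<alpha> * x powr \<alpha> \<le> 1 * x powr \<alpha>" using \<alpha> \<alpha>_ge_\<beta> by (intro mult_right_mono) auto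
    then show "0 \<le> x powr \<beta> - \<beta> / \<alpha> * x powr \<alpha>" using le[OF x] by simp
  qed (use e x neg in \<open>auto intro: tame_lincomb[OF tm[of 1] tm[of "-1"], of 1, simplified] tame_lincomb[OF tm[of 1] tm[of "-1"], of "-1", simplified]\<close>)
  show ?thesis
  proof (rule z)
    fix \<sigma> x :: real assume "\<sigma> \<in> {1, -1}" "x \<in> {0<..1}"
    then show "F \<sigma> x = 0" using even[of x] odd[of x] by auto
  qed
qed

text \<open>An eigenfunction that vanishes near a point of one side vanishes on that side by uniqueness
  for the regular differential equation; then its leading coefficients vanish there, hence on the
  other side by the transmission conditions, and the Volterra equation there has only the zero
  solution.\<close>
lemma eigenfunction_unique_continuation:
  assumes Gr: "Gr f (\<kappa> *\<^sub>R f)" and \<omega>: "open \<omega>" "\<omega> \<noteq> {}" "\<omega> \<subseteq> {-1<..<1}"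
    and ae0: "AE x in lborel. x \<in> \<omega> \<longrightarrow> rep0 f x = 0"
  shows "f = 0"
proof -
  obtain C1 C2 F where Fd: "\<And>\<sigma>. F \<sigma> = half_sol (C1 \<sigma>) (C2 \<sigma>) \<sigma> (\<kappa> *\<^sub>R f)"
    and ae: "\<And>\<sigma>. \<sigma> \<in> {1, -1} \<Longrightarrow> AE y in lborel. y \<in> {0<..<1} \<longrightarrow> rep0 f (\<sigma> * y) = F \<sigma> y"
    and eq: "\<And>\<sigma> x. \<sigma> \<in> {1, -1} \<Longrightarrow> x \<in> {0..1} \<Longrightarrow> F \<sigma> x = C1 \<sigma> * x powr \<alpha> + C2 \<sigma> * x powr \<beta> - \<kappa> * volt (F \<sigma>) x"
    and T: "C1 (- 1) + C2 (- 1) + C1 1 + C2 1 = 0" "\<alpha> * C1 (- 1) + \<beta> * C2 (- 1) = \<alpha> * C1 1 + \<beta> * C2 1"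
    and z: "(\<And>\<sigma> x. \<sigma> \<in> {1, -1} \<Longrightarrow> x \<in> {0<..1} \<Longrightarrow> F \<sigma> x = 0) \<Longrightarrow> f = 0"
    by (rule eigenfunction_halves[OF Gr]) blast
  have tm: "tame (F \<sigma>)" if "\<sigma> \<in> {1, -1}" for \<sigma> unfolding Fd by (rule tame_half_sol[OF that])
  have "\<not> \<omega> \<subseteq> {0}" using open_not_negligible[OF \<omega>(1,2)] by (meson negligible_sing negligible_subset)
  then obtain p where p: "p \<in> \<omega>" "p \<noteq> 0" by auto
  define \<sigma> where "\<sigma> = sgn p"
  have \<sigma>: "\<sigma> \<in> {1, -1}" and p\<sigma>: "p = \<sigma> * \<bar>p\<bar>" using p by (auto simp: \<sigma>_def sgn_if)
  define S where "S = {0<..<1} \<inter> (\<lambda>y. \<sigma> * y) -` \<omega>"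
  have S: "open S" unfolding S_def by (rule continuous_open_preimage[OF _ _ \<omega>(1)]) (auto intro!: continuous_intros)
  have "- 1 < p" "p < 1" using p(1) \<omega>(3) by auto
  then have pS: "\<bar>p\<bar> \<in> S" using p p\<sigma> by (auto simp: S_def)
  have ae0': "AE y in lborel. \<sigma> * y \<in> \<omega> \<longrightarrow> rep0 f (\<sigma> * y) = 0"
    using ae0 AE_lborel_reflect[OF ae0] \<sigma> by auto
  have FS: "F \<sigma> y = 0" if "y \<in> S" for y
  proof (rule continuous_zero_of_AE[OF _ S _ that])
    show "continuous_on S (F \<sigma>)"
      unfolding Fd by (rule continuous_on_subset[OF half_sol_continuous[OF \<sigma>]]) (auto simp: S_def)
    show "AE x in lborel. x \<in> S \<longrightarrow> F \<sigma> x = 0"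
      using ae[OF \<sigma>] ae0' by eventually_elim (auto simp: S_def)
  qed
  obtain r where r: "r > 0" "{\<bar>p\<bar>..\<bar>p\<bar> + r} \<subseteq> S"
  proof -
    obtain e where e: "e > 0" "ball \<bar>p\<bar> e \<subseteq> S" using S pS openE by blast
    have "{\<bar>p\<bar>..\<bar>p\<bar> + e / 2} \<subseteq> ball \<bar>p\<bar> e" using e(1) by (auto simp: dist_real_def)
    then show thesis using e by (intro that[of "e / 2"]) auto
  qed
  define G where "G = half_sol' (C1 \<sigma>) (C2 \<sigma>) \<sigma> (\<kappa> *\<^sub>R f)"
  define q where "q x = pot / x\<^sup>2 - \<kappa>" for x :: real
  have P1: "primitive_on {0<..1} (F \<sigma>) G" unfolding Fd G_def by (rule half_sol_primitive(1)[OF \<sigma>])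
  have cF: "continuous_on {0<..1} (F \<sigma>)" unfolding Fd by (rule half_sol_continuous[OF \<sigma>])
  have P2: "primitive_on {0<..1} G (\<lambda>x. q x * F \<sigma> x)"
  proof (rule primitive_on_cong_AE)
    show "primitive_on {0<..1} G (\<lambda>x. pot / x\<^sup>2 * F \<sigma> x - rep0 (\<kappa> *\<^sub>R f) (\<sigma> * x))"
      unfolding Fd G_def by (rule half_sol_primitive(2)[OF \<sigma>])
    have "continuous_on {0<..1} (\<lambda>x. q x * F \<sigma> x)"
      unfolding q_def by (intro continuous_intros cF) auto
    from borel_measurable_continuous_on_indicator[OF _ this]
    show "(\<lambda>x. indicator {0<..1} x * (q x * F \<sigma> x)) \<in> borel_measurable borel" by simp
    have sc: "AE x in lborel. x \<in> {-1<..<1} \<longrightarrow> rep0 (\<kappa> *\<^sub>R f) x = \<kappa> * rep0 f x"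
      using rep0_L2_of[OF square_integrable_scale[OF square_integrable_rep0], of \<kappa> f]
      unfolding L2_of_scaleR[OF square_integrable_rep0, symmetric] L2_of_rep0 .
    have sc': "AE x in lborel. x \<in> {0<..<1} \<longrightarrow> rep0 (\<kappa> *\<^sub>R f) (\<sigma> * x) = \<kappa> * rep0 f (\<sigma> * x)"
    proof (cases "\<sigma> = 1")
      case True
      show ?thesis using sc by eventually_elim (auto simp: True)
    next
      case False
      then have s: "\<sigma> = -1" using \<sigma> by simp
      show ?thesis using AE_lborel_reflect[OF sc] by eventually_elim (auto simp: s)
    qed
    show "AE x in lborel. x \<in> {0<..1} \<longrightarrow> pot / x\<^sup>2 * F \<sigma> x - rep0 (\<kappa> *\<^sub>R f) (\<sigma> * x) = q x * F \<sigma> x"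
      using sc' ae[OF \<sigma>] AE_lborel_singleton[of 1]
    proof eventually_elim
      case (elim x)
      show ?case
      proof
        assume "x \<in> {0<..1}"
        then have "x \<in> {0<..<1}" using elim(3) by auto
        then show "pot / x\<^sup>2 * F \<sigma> x - rep0 (\<kappa> *\<^sub>R f) (\<sigma> * x) = q x * F \<sigma> x"
          using elim(1,2) by (simp add: q_def left_diff_distrib)
      qed
    qed
  qed
  have S01: "S \<subseteq> {0<..1}" by (auto simp: S_def)
  have F0: "F \<sigma> y = 0" if "y \<in> {\<bar>p\<bar>..\<bar>p\<bar> + r}" for y using FS subsetD[OF r(2) that] by blast
  have le: "\<bar>p\<bar> \<le> \<bar>p\<bar> + r" using r(1) by simp
  have Gp: "G \<bar>p\<bar> = 0"
  proof -
    have const: "G t = G \<bar>p\<bar>" if t: "t \<in> {\<bar>p\<bar>..\<bar>p\<bar> + r}" for t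
    proof -
      have sub: "{\<bar>p\<bar>..t} \<subseteq> {\<bar>p\<bar>..\<bar>p\<bar> + r}" and le: "\<bar>p\<bar> \<le> t" using t by auto
      have "integral {\<bar>p\<bar>..t} (\<lambda>x. q x * F \<sigma> x) = G t - G \<bar>p\<bar>"
        by (rule primitive_onD(2)[OF P2 le subset_trans[OF sub subset_trans[OF r(2) S01]]])
      moreover have "integral {\<bar>p\<bar>..t} (\<lambda>x. q x * F \<sigma> x) = integral {\<bar>p\<bar>..t} (\<lambda>x. 0)"
        by (rule Henstock_Kurzweil_Integration.integral_cong) (simp only: F0[OF subsetD[OF sub]] mult_zero_right)
      ultimately show ?thesis by simp
    qed
    have "integral {\<bar>p\<bar>..\<bar>p\<bar> + r} G = F \<sigma> (\<bar>p\<bar> + r) - F \<sigma> \<bar>p\<bar>"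
      by (rule primitive_onD(2)[OF P1 le subset_trans[OF r(2) S01]])
    also have "integral {\<bar>p\<bar>..\<bar>p\<bar> + r} G = integral {\<bar>p\<bar>..\<bar>p\<bar> + r} (\<lambda>_. G \<bar>p\<bar>)"
      by (rule Henstock_Kurzweil_Integration.integral_cong) (rule const)
    also have "\<dots> = r * G \<bar>p\<bar>" using r(1) by simp
    also have "F \<sigma> (\<bar>p\<bar> + r) - F \<sigma> \<bar>p\<bar> = 0" using F0[of "\<bar>p\<bar>"] F0[of "\<bar>p\<bar> + r"] r(1) by simp
    finally have "r * G \<bar>p\<bar> = 0" .
    then show ?thesis using r by simp
  qed
  have F\<sigma>: "F \<sigma> x = 0" if x: "x \<in> {0<..1}" for x
  proof -
    define \<delta> where "\<delta> = min x \<bar>p\<bar>"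
    have p1: "\<bar>p\<bar> < 1" using pS by (auto simp: S_def)
    have \<delta>: "\<delta> > 0" "x \<in> {\<delta>..1}" "\<bar>p\<bar> \<in> {\<delta>..1}" using x p p1 by (auto simp: \<delta>_def)
    have sub: "{\<delta>..1} \<subseteq> {0<..1}" using \<delta>(1) by auto
    define M where "M = 1 + \<bar>pot\<bar> / \<delta>\<^sup>2 + \<bar>\<kappa>\<bar>"
    note P1' = primitive_on_subset[OF P1 sub] and P2' = primitive_on_subset[OF P2 sub]
    have "(F \<sigma> x * F \<sigma> x + G x * G x) = 0"
    proof (rule primitive_on_gronwall[OF primitive_on_add[OF primitive_on_mult[OF P1' P1'] primitive_on_mult[OF P2' P2']] _ _ \<delta>(3) _ \<delta>(2), where M = M])
      fix y assume y: "y \<in> {\<delta>..1}"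
      have "\<delta>\<^sup>2 \<le> y\<^sup>2" using y \<delta>(1) by (intro power_mono) auto
      then have "\<bar>pot\<bar> / y\<^sup>2 \<le> \<bar>pot\<bar> / \<delta>\<^sup>2" using \<delta>(1) y by (intro divide_left_mono) (auto intro!: mult_pos_pos)
      moreover have "\<bar>pot / y\<^sup>2\<bar> = \<bar>pot\<bar> / y\<^sup>2" by simp
      ultimately have qM: "\<bar>1 + q y\<bar> \<le> M" unfolding q_def M_def by linarith
      have "\<bar>2 * (F \<sigma> y * G y)\<bar> \<le> F \<sigma> y * F \<sigma> y + G y * G y"
      proof -
        have "0 \<le> (F \<sigma> y - G y) * (F \<sigma> y - G y)" "0 \<le> (F \<sigma> y + G y) * (F \<sigma> y + G y)" by simp_all
        then show ?thesis by (auto simp: algebra_simps abs_le_iff)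
      qed
      then have "\<bar>1 + q y\<bar> * \<bar>2 * (F \<sigma> y * G y)\<bar> \<le> M * (F \<sigma> y * F \<sigma> y + G y * G y)"
        using qM by (intro mult_mono) auto
      moreover have "G y * F \<sigma> y + F \<sigma> y * G y + (q y * F \<sigma> y * G y + G y * (q y * F \<sigma> y)) = (1 + q y) * (2 * (F \<sigma> y * G y))"
        by (simp add: algebra_simps)
      ultimately show "\<bar>G y * F \<sigma> y + F \<sigma> y * G y + (q y * F \<sigma> y * G y + G y * (q y * F \<sigma> y))\<bar> \<le> M * (F \<sigma> y * F \<sigma> y + G y * G y)"
        by (simp only: abs_mult)
    qed (use FS[OF pS] Gp in auto)
    then show ?thesis by (simp add: add_nonneg_eq_0_iff)
  qed
  have CC: "C1 \<sigma> * x powr \<alpha> + C2 \<sigma> * x powr \<beta> = 0" if x: "x \<in> {0<..1}" for x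
  proof -
    have "volt (F \<sigma>) x = integral {0..x} (\<lambda>y. 0)"
      unfolding volt_def
    proof (rule Henstock_Kurzweil_Integration.integral_cong)
      fix y assume "y \<in> {0..x}"
      then show "kernel x y * F \<sigma> y = 0" using F\<sigma>[of y] x by (cases "y = 0") (auto simp: kernel_def)
    qed
    then show ?thesis using eq[OF \<sigma>, of x] F\<sigma>[OF x] x by simp
  qed
  have "(1/2) powr \<alpha> < (1/2 :: real) powr \<beta>" using \<nu> by (intro powr_less_mono') (auto simp: \<alpha>_def \<beta>_def)
  moreover have c2: "C2 \<sigma> = - C1 \<sigma>" using CC[of 1] by simp
  then have "C1 \<sigma> * ((1/2) powr \<alpha> - (1/2) powr \<beta>) = 0" using CC[of "1/2"] by (simp add: algebra_simps)
  ultimately have C\<sigma>: "C1 \<sigma> = 0" "C2 \<sigma> = 0" using c2 by auto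
  have \<sigma>': "- \<sigma> \<in> {1, -1}" using \<sigma> by auto
  have "C1 (- \<sigma>) + C2 (- \<sigma>) = 0" "\<alpha> * C1 (- \<sigma>) + \<beta> * C2 (- \<sigma>) = 0"
    using T C\<sigma> \<sigma> by auto
  then have c2': "C2 (- \<sigma>) = - C1 (- \<sigma>)" and D: "\<alpha> * C1 (- \<sigma>) + \<beta> * C2 (- \<sigma>) = 0" by linarith+
  have "(\<alpha> - \<beta>) * C1 (- \<sigma>) = 0" using D unfolding c2' by (simp add: left_diff_distrib)
  with c2' have C\<sigma>': "C1 (- \<sigma>) = 0" "C2 (- \<sigma>) = 0" using exponents(4) \<nu> by auto
  have F\<sigma>': "F (- \<sigma>) x = 0" if x: "x \<in> {0<..1}" for x
    by (rule volt_uniqueness[OF tm[OF \<sigma>'] _ x, of "- \<kappa>"]) (use eq[OF \<sigma>'] C\<sigma>' in auto)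
  show ?thesis
  proof (rule z)
    fix \<tau> x :: real assume \<tau>: "\<tau> \<in> {1, -1}" and x: "x \<in> {0<..1}"
    have "\<tau> = \<sigma> \<or> \<tau> = - \<sigma>" using \<tau> \<sigma> by auto
    then show "F \<tau> x = 0" using F\<sigma>[OF x] F\<sigma>'[OF x] by auto
  qed
qed

theorem diagonal_operator_A0: "\<exists>E ev. diagonal_operator E ev (dom_A0 \<nu>) (A0 \<nu>)"
proof -
  obtain E ev where E: "total_orthonormal E" and ev: "\<And>e. e \<in> E \<Longrightarrow> Gr e (ev e *\<^sub>R e)"
    and d: "\<And>f g. f \<in> dom_A0 \<nu> \<and> A0 \<nu> f = g \<longleftrightarrow> (\<forall>e\<in>E. inner g e = ev e * inner f e)"
    using diagonalisation by blast
  interpret total_orthonormal E by (rule E)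
  have "ev e \<ge> 0" if e: "e \<in> E" for e
  proof (rule ccontr)
    assume "\<not> ev e \<ge> 0"
    then have "e = 0" using eigenvalue_nonneg[OF ev[OF e]] by simp
    moreover have "inner e e = 1" using inner_basis[OF e e] by simp
    ultimately show False by simp
  qed
  then have "diagonal_operator E ev (dom_A0 \<nu>) (A0 \<nu>)" using d by unfold_locales auto
  then show ?thesis by blast
qed

end

section \<open>Controls\<close>

text \<open>For open \<open>\<omega>\<close>, the orthogonal projection to the elements of \<open>L\<^sup>2\<close> supported in \<open>\<omega>\<close>.\<close>
definition localise :: "real set \<Rightarrow> L2 \<Rightarrow> L2" where
  "localise \<omega> g = L2_of (\<lambda>x. rep0 g x * indicat_real \<omega> x)"

lemma square_integrable_localised:
  assumes "open \<omega>"
  shows "square_integrable I11 (\<lambda>x. rep0 g x * indicat_real \<omega> x)"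
  unfolding square_integrable_def
proof
  have i: "integrable I11 (\<lambda>x. (rep0 g x)\<^sup>2)" and m: "rep0 g \<in> borel_measurable I11"
    using square_integrable_rep0[of g] by (auto simp: square_integrable_def)
  have "indicat_real \<omega> \<in> borel_measurable I11"
    unfolding I11_def using assms by (intro measurable_restrict_space1 borel_measurable_indicator) auto
  then show m': "(\<lambda>x. rep0 g x * indicat_real \<omega> x) \<in> borel_measurable I11" using m by simp
  show "integrable I11 (\<lambda>x. (rep0 g x * indicat_real \<omega> x)\<^sup>2)"
    by (rule Bochner_Integration.integrable_bound[OF i]) (use m' in \<open>auto simp: indicator_def\<close>)
qed

lemma square_integrable_elementary:
  fixes a b T :: real
  assumes "open \<omega>"
  shows "square_integrable (restrict_space lborel ({0<..<T} \<times> \<omega>))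
    (\<lambda>p. indicat_real {a..b} (fst p) * rep0 g (snd p))"
proof -
  define h where "h p = indicat_real {a..b} (fst p) * rep0 g (snd p)" for p :: "real \<times> real"
  have m: "h \<in> borel_measurable (lborel \<Otimes>\<^sub>M lborel)" unfolding h_def[abs_def] by measurable
  have i: "integrable (lborel \<Otimes>\<^sub>M lborel) (\<lambda>p. (h p)\<^sup>2)"
  proof (rule lborel_pair.Fubini_integrable)
    show "(\<lambda>p. (h p)\<^sup>2) \<in> borel_measurable (lborel \<Otimes>\<^sub>M lborel)" using m by measurable
    have r: "integrable lborel (\<lambda>y. (rep0 g y)\<^sup>2)"
      using rep0_mult_integrable[of g g] by (simp only: power2_eq_square)
    have e: "(h (x, y))\<^sup>2 = indicator {a..b} x * (rep0 g y)\<^sup>2" for x y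
      by (simp add: h_def power_mult_distrib) (simp add: indicator_def)
    have "(\<lambda>x. \<integral>y. norm ((h (x, y))\<^sup>2) \<partial>lborel) = (\<lambda>x. indicator {a..b} x * (\<integral>y. (rep0 g y)\<^sup>2 \<partial>lborel))"
      unfolding e by (intro ext) (simp add: abs_mult)
    moreover have "integrable lborel (\<lambda>x. indicat_real {a..b} x * (\<integral>y. (rep0 g y)\<^sup>2 \<partial>lborel))"
      by (intro integrable_mult_left integrable_real_indicator) (auto simp: emeasure_lborel_Icc_eq)
    ultimately show "integrable lborel (\<lambda>x. \<integral>y. norm ((h (x, y))\<^sup>2) \<partial>lborel)" by (simp only:)
    show "AE x in lborel. integrable lborel (\<lambda>y. (h (x, y))\<^sup>2)"
      unfolding e by (intro AE_I2 integrable_mult_right r)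
  qed
  have \<Omega>: "{0<..<T} \<times> \<omega> \<in> sets (lborel :: (real \<times> real) measure)"
    using assms by (simp add: open_Times borel_open)
  have m2: "h \<in> borel_measurable lborel" and i2: "integrable lborel (\<lambda>p. (h p)\<^sup>2)"
    using m i unfolding lborel_prod by simp_all
  have "h \<in> borel_measurable (restrict_space lborel ({0<..<T} \<times> \<omega>))"
    by (rule measurable_restrict_space1[OF m2])
  moreover have "integrable (restrict_space lborel ({0<..<T} \<times> \<omega>)) (\<lambda>p. (h p)\<^sup>2)"
    using integrable_mult_indicator[OF \<Omega> i2] \<Omega> by (simp add: integrable_restrict_space)
  ultimately show ?thesis by (simp add: square_integrable_def h_def[abs_def])
qed

lemma zero_of_integrals:
  fixes h :: "real \<Rightarrow> real"
  assumes c: "continuous_on {0<..<T} h" and z: "\<And>a b. 0 < a \<Longrightarrow> a \<le> b \<Longrightarrow> b < T \<Longrightarrow> integral {a..b} h = 0"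
    and t: "0 < t" "t < T"
  shows "h t = 0"
proof -
  define b where "b = (t + T) / 2"
  have b: "t < b" "b < T" using t by (auto simp: b_def)
  have "((\<lambda>u. integral {t..u} h) has_vector_derivative h t) (at t within {t..b})"
    by (rule integral_has_vector_derivative[OF continuous_on_subset[OF c]]) (use t b in auto)
  moreover have "((\<lambda>u. integral {t..u} h) has_vector_derivative 0) (at t within {t..b})"
    by (rule has_vector_derivative_transform[OF _ _ has_vector_derivative_const]) (use t b z in auto)
  ultimately show ?thesis
    using vector_derivative_unique_within_closed_interval[of t b t] b by simp
qed

text \<open>Duality. The controls that are piecewise constant in time already reach a dense set: an
  element orthogonal to all the states reached is orthogonal to \<open>S t w\<close> for all \<open>w\<close> supported in
  the control region.\<close>
theorem approximate_controllability:
  fixes S :: "real \<Rightarrow> L2 \<Rightarrow> L2"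
  assumes T: "T > 0" and \<omega>: "open \<omega>"
    and S: "\<And>t. t \<ge> 0 \<Longrightarrow> bounded_linear (S t)"
    and cS: "\<And>t f. t \<ge> 0 \<Longrightarrow> ((\<lambda>s. S s f) \<longlongrightarrow> S t f) (at t within {0..})"
    and uc: "\<And>z. (\<And>t g. 0 < t \<Longrightarrow> t < T \<Longrightarrow> inner (S t (localise \<omega> g)) z = 0) \<Longrightarrow> z = 0"
    and \<epsilon>: "\<epsilon> > 0"
  shows "\<exists>u. square_integrable (restrict_space lborel ({0<..<T} \<times> \<omega>)) u \<and>
    norm (S T f0 + (LINT \<tau>:{0..T}|lborel. S (T - \<tau>) (L2_of (\<lambda>x. u (\<tau>, x) * indicat_real \<omega> x))) - fT) \<le> \<epsilon>"
proof -
  define v where "v u \<tau> = L2_of (\<lambda>x. u (\<tau>, x) * indicat_real \<omega> x)" for u :: "real \<times> real \<Rightarrow> real" and \<tau>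
  define out where "out u = (LINT \<tau>:{0..T}|lborel. S (T - \<tau>) (v u \<tau>))" for u
  define good where "good u \<longleftrightarrow> square_integrable (restrict_space lborel ({0<..<T} \<times> \<omega>)) u \<and>
    (\<forall>t. square_integrable I11 (\<lambda>x. u (t, x) * indicat_real \<omega> x)) \<and>
    set_integrable lborel {0..T} (\<lambda>\<tau>. S (T - \<tau>) (v u \<tau>))" for u
  have lincomb: "good (\<lambda>p. r * u p + u' p) \<and> out (\<lambda>p. r * u p + u' p) = r *\<^sub>R out u + out u'"
    if u: "good u" and u': "good u'" for u u' r
  proof -
    have sq: "square_integrable I11 (\<lambda>x. u (t, x) * indicat_real \<omega> x)" "square_integrable I11 (\<lambda>x. u' (t, x) * indicat_real \<omega> x)" for t
      using u u' by (auto simp: good_def)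
    have i: "set_integrable lborel {0..T} (\<lambda>\<tau>. S (T - \<tau>) (v u \<tau>))" "set_integrable lborel {0..T} (\<lambda>\<tau>. S (T - \<tau>) (v u' \<tau>))"
      using u u' by (auto simp: good_def)
    have e: "(r * u (t, x) + u' (t, x)) * indicat_real \<omega> x = r * (u (t, x) * indicat_real \<omega> x) + u' (t, x) * indicat_real \<omega> x" for t x
      by (simp add: algebra_simps)
    have vv: "v (\<lambda>p. r * u p + u' p) t = r *\<^sub>R v u t + v u' t" for t
      unfolding v_def e L2_of_scaleR[OF sq(1)]
      by (rule L2_of_add[OF square_integrable_scale[OF sq(1)] sq(2), symmetric])
    have Sv: "S (T - \<tau>) (v (\<lambda>p. r * u p + u' p) \<tau>) = r *\<^sub>R S (T - \<tau>) (v u \<tau>) + S (T - \<tau>) (v u' \<tau>)" if "\<tau> \<in> {0..T}" for \<tau>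
    proof -
      interpret bounded_linear "S (T - \<tau>)" by (rule S) (use that in simp)
      show ?thesis by (simp add: vv add scaleR)
    qed
    have i': "set_integrable lborel {0..T} (\<lambda>\<tau>. r *\<^sub>R S (T - \<tau>) (v u \<tau>))"
      using i(1) by (rule set_integrable_scaleR_right)
    have "set_integrable lborel {0..T} (\<lambda>\<tau>. r *\<^sub>R S (T - \<tau>) (v u \<tau>) + S (T - \<tau>) (v u' \<tau>))"
      by (rule set_integral_add(1)[OF i' i(2)])
    then have "set_integrable lborel {0..T} (\<lambda>\<tau>. S (T - \<tau>) (v (\<lambda>p. r * u p + u' p) \<tau>))"
      by (subst set_integrable_cong[OF refl refl Sv]) auto
    moreover have "out (\<lambda>p. r * u p + u' p) = (LINT \<tau>:{0..T}|lborel. r *\<^sub>R S (T - \<tau>) (v u \<tau>) + S (T - \<tau>) (v u' \<tau>))"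
      unfolding out_def using Sv by (intro set_lebesgue_integral_cong) auto
    then have "out (\<lambda>p. r * u p + u' p) = r *\<^sub>R out u + out u'"
      unfolding set_integral_add(2)[OF i' i(2)] by (simp add: out_def)
    moreover have "square_integrable I11 (\<lambda>x. (r * u (t, x) + u' (t, x)) * indicat_real \<omega> x)" for t
      unfolding e by (intro square_integrable_add square_integrable_scale sq)
    moreover have "square_integrable (restrict_space lborel ({0<..<T} \<times> \<omega>)) (\<lambda>p. r * u p + u' p)"
      using u u' by (intro square_integrable_add square_integrable_scale) (auto simp: good_def)
    ultimately show ?thesis by (simp add: good_def)
  qed
  have S0: "S (T - \<tau>) 0 = 0" if "\<tau> \<in> {0..T}" for \<tau>
  proof -
    interpret bounded_linear "S (T - \<tau>)" by (rule S) (use that in simp)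
    show ?thesis by (rule zero)
  qed
  have cont: "continuous_on {0..T} (\<lambda>\<tau>. S (T - \<tau>) f)" for f
  proof -
    have "continuous_on {0..} (\<lambda>s. S s f)" using cS by (auto simp: continuous_on_def)
    then show ?thesis
      by (rule continuous_on_compose2) (auto intro!: continuous_intros)
  qed
  define el where "el a b g p = indicat_real {a..b} (fst p) * rep0 g (snd p)" for a b :: real and g and p :: "real \<times> real"
  have el: "good (el a b g) \<and> out (el a b g) = (LINT \<tau>:{a..b}|lborel. S (T - \<tau>) (localise \<omega> g))"
    if ab: "0 < a" "a \<le> b" "b < T" for a b g
  proof -
    have sub: "{a..b} \<subseteq> {0..T}" using ab by auto
    have vel: "v (el a b g) \<tau> = indicat_real {a..b} \<tau> *\<^sub>R localise \<omega> g" for \<tau>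
      unfolding v_def el_def localise_def L2_of_scaleR[OF square_integrable_localised[OF \<omega>]]
      by (simp add: mult.assoc)
    have Sel: "indicator {0..T} \<tau> *\<^sub>R S (T - \<tau>) (v (el a b g) \<tau>) = indicator {a..b} \<tau> *\<^sub>R S (T - \<tau>) (localise \<omega> g)" for \<tau>
      using S0[of \<tau>] sub unfolding vel by (auto simp: indicator_def)
    have "set_integrable lborel {a..b} (\<lambda>\<tau>. S (T - \<tau>) (localise \<omega> g))"
      by (rule borel_integrable_atLeastAtMost'[OF continuous_on_subset[OF cont sub]])
    then have "set_integrable lborel {0..T} (\<lambda>\<tau>. S (T - \<tau>) (v (el a b g) \<tau>))"
      unfolding set_integrable_def Sel .
    moreover have "out (el a b g) = (LINT \<tau>:{a..b}|lborel. S (T - \<tau>) (localise \<omega> g))"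
      unfolding out_def set_lebesgue_integral_def Sel ..
    moreover have "square_integrable I11 (\<lambda>x. el a b g (t, x) * indicat_real \<omega> x)" for t
      using square_integrable_scale[OF square_integrable_localised[OF \<omega>], of "indicat_real {a..b} t" g]
      by (simp add: el_def mult.assoc)
    moreover have "square_integrable (restrict_space lborel ({0<..<T} \<times> \<omega>)) (el a b g)"
      unfolding el_def[abs_def] by (rule square_integrable_elementary[OF \<omega>])
    ultimately show ?thesis by (simp add: good_def)
  qed
  define Y where "Y = {out (el a b g) | a b g. 0 < a \<and> a \<le> b \<and> b < T}"
  have reach: "\<exists>u. good u \<and> out u = y" if "y \<in> span Y" for y
    using that
  proof (induction rule: span_induct_alt)
    case base
    have v0: "v (\<lambda>p. 0) \<tau> = 0" for \<tau> by (simp add: v_def L2_of_zero)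
    have z: "indicator {0..T} \<tau> *\<^sub>R S (T - \<tau>) (v (\<lambda>p. 0) \<tau>) = 0" for \<tau>
      unfolding v0 using S0[of \<tau>] by (simp add: indicator_def)
    have "good (\<lambda>p. 0)" unfolding good_def set_integrable_def z by (simp add: square_integrable_zero)
    moreover have "out (\<lambda>p. 0) = 0" unfolding out_def set_lebesgue_integral_def z by simp
    ultimately show ?case by blast
  next
    case (step c x y)
    obtain a b g where "0 < a" "a \<le> b" "b < T" "x = out (el a b g)" using step(1) by (auto simp: Y_def)
    moreover obtain u where "good u" "out u = y" using step(2) by blast
    ultimately show ?case using lincomb[of "el a b g" u c] el[of a b g] by blast
  qed
  have "closure (span Y) = UNIV"
  proof (rule closure_span_eq_UNIV)
    fix z assume z: "\<And>y. y \<in> Y \<Longrightarrow> inner z y = 0"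
    show "z = 0"
    proof (rule uc)
      fix t g assume t: "0 < t" "t < T"
      define h where "h \<tau> = inner (S (T - \<tau>) (localise \<omega> g)) z" for \<tau>
      have ch: "continuous_on {0..T} h" unfolding h_def[abs_def] by (intro continuous_intros cont)
      have "h (T - t) = 0"
      proof (rule zero_of_integrals[where T = T and h = h])
        show "continuous_on {0<..<T} h" by (rule continuous_on_subset[OF ch]) auto
        fix a b assume ab: "0 < a" "a \<le> b" "b < T"
        have sub: "{a..b} \<subseteq> {0..T}" using ab by auto
        have i: "set_integrable lborel {a..b} (\<lambda>\<tau>. S (T - \<tau>) (localise \<omega> g))"
          by (rule borel_integrable_atLeastAtMost'[OF continuous_on_subset[OF cont sub]])
        have ih: "set_integrable lborel {a..b} h"
          by (rule borel_integrable_atLeastAtMost'[OF continuous_on_subset[OF ch sub]])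
        have "integral {a..b} h = (LINT \<tau>:{a..b}|lborel. h \<tau>)"
          by (rule set_borel_integral_eq_integral(2)[OF ih, symmetric])
        also have "\<dots> = (\<integral>\<tau>. inner (indicator {a..b} \<tau> *\<^sub>R S (T - \<tau>) (localise \<omega> g)) z \<partial>lborel)"
          by (simp add: set_lebesgue_integral_def h_def)
        also have "\<dots> = inner (LINT \<tau>:{a..b}|lborel. S (T - \<tau>) (localise \<omega> g)) z"
          unfolding set_lebesgue_integral_def
          by (rule integral_inner_left) (use i in \<open>simp add: set_integrable_def\<close>)
        also have "\<dots> = inner z (out (el a b g))" using el[OF ab, of g] by (simp add: inner_commute)
        also have "\<dots> = 0" by (rule z) (use ab in \<open>auto simp: Y_def\<close>)
        finally show "integral {a..b} h = 0" .
      qed (use t in auto)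
      then show "inner (S t (localise \<omega> g)) z = 0" by (simp add: h_def)
    qed
  qed
  then have "fT - S T f0 \<in> closure (span Y)" by simp
  then obtain y where y: "y \<in> span Y" "dist y (fT - S T f0) < \<epsilon>"
    using \<epsilon> unfolding closure_approachable by blast
  obtain u where u: "good u" "out u = y" using reach[OF y(1)] by blast
  have "norm (S T f0 + out u - fT) \<le> \<epsilon>" using y(2) u(2) by (simp add: dist_norm algebra_simps)
  then show ?thesis using u(1) unfolding good_def out_def v_def by blast
qed

context inverse_square
begin

lemma approximate_controllability_A0:
  assumes T: "T > 0" and \<omega>: "open \<omega>" "\<omega> \<noteq> {}" "\<omega> \<subseteq> {-1<..<1}" and \<epsilon>: "\<epsilon> > 0"
  shows "\<exists>u. square_integrable (restrict_space lborel ({0<..<T} \<times> \<omega>)) u \<and>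
    norm (mild_solution \<nu> f0 (\<lambda>t. L2_of (\<lambda>x. u (t, x) * indicat_real \<omega> x)) T - fT) \<le> \<epsilon>"
proof -
  obtain E ev where "diagonal_operator E ev (dom_A0 \<nu>) (A0 \<nu>)" using diagonal_operator_A0 by blast
  then interpret diagonal_operator E ev "dom_A0 \<nu>" "A0 \<nu>" .
  have S: "exp_A0 \<nu> t f = heat t f" if "t \<ge> 0" for t f
    unfolding exp_A0_def by (rule generated_semigroup_eq_heat[OF that])
  show ?thesis
    unfolding mild_solution_def
  proof (rule approximate_controllability[OF T \<omega>(1) _ _ _ \<epsilon>])
    show "bounded_linear (exp_A0 \<nu> t)" if t: "t \<ge> 0" for t
    proof -
      have "exp_A0 \<nu> t = heat t" using S[OF t] by blast
      then show ?thesis using C0_semigroup_heat t by (simp add: C0_semigroup_def)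
    qed
    show "((\<lambda>s. exp_A0 \<nu> s f) \<longlongrightarrow> exp_A0 \<nu> t f) (at t within {0..})" if t: "t \<ge> 0" for t f
      unfolding S[OF t]
      by (rule Lim_transform_eventually[OF heat_tendsto[OF t]]) (auto simp: eventually_at_filter S)
    show "z = 0" if z: "\<And>t g. 0 < t \<Longrightarrow> t < T \<Longrightarrow> inner (exp_A0 \<nu> t (localise \<omega> g)) z = 0" for z
    proof (rule heat_unique_continuation[OF T, where W = "range (localise \<omega>)"])
      show "inner (heat t w) z = 0" if "0 < t" "t < T" "w \<in> range (localise \<omega>)" for t w
        using that z[of t] S[of t] by auto
      fix p \<mu> assume p: "p \<in> dom_A0 \<nu>" "A0 \<nu> p = \<mu> *\<^sub>R p" and w: "\<And>w. w \<in> range (localise \<omega>) \<Longrightarrow> inner w p = 0"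
      show "p = 0"
      proof (rule eigenfunction_unique_continuation[OF _ \<omega>])
        show "Gr p (\<mu> *\<^sub>R p)" using p by (simp add: Gr_def)
        have sq: "square_integrable I11 (\<lambda>x. rep0 p x * indicat_real \<omega> x)" by (rule square_integrable_localised[OF \<omega>(1)])
        have "(\<integral>x. rep0 p x * (rep0 p x * indicat_real \<omega> x) \<partial>I11) = inner p (localise \<omega> p)"
          unfolding localise_def by (rule inner_rep0[OF sq, symmetric])
        also have "\<dots> = 0" using w[of "localise \<omega> p"] by (simp add: inner_commute)
        finally have "AE x in I11. rep0 p x * (rep0 p x * indicat_real \<omega> x) = 0"
          by (subst (asm) integral_nonneg_eq_0_iff_AE[OF square_integrable_mult[OF square_integrable_rep0 sq]])
            (auto simp: indicator_def)
        then show "AE x in lborel. x \<in> \<omega> \<longrightarrow> rep0 p x = 0"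
          unfolding AE_I11 by eventually_elim (use \<omega>(3) in \<open>auto simp: indicator_def\<close>)
      qed
    qed
  qed
qed

end

theorem theorem1p2:
  fixes T c \<nu> :: real and \<omega> :: "real set"
  assumes "T > 0"
    and "-1/4 < c" and "c < 3/4"
    and "0 < \<nu>" and "\<nu> < 1" and "c = \<nu>\<^sup>2 - 1/4"
    and "open \<omega>" and "\<omega> \<noteq> {}" and "\<omega> \<subseteq> {-1<..<1}"
  shows "\<forall>f0 fT :: L2. \<forall>\<epsilon>>0. \<exists>u :: real \<times> real \<Rightarrow> real.
    square_integrable (restrict_space lborel ({0<..<T} \<times> \<omega>)) u \<and>
    norm (mild_solution \<nu> f0 (\<lambda>t. L2_of (\<lambda>x. u (t, x) * indicat_real \<omega> x)) T - fT) \<le> \<epsilon>"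
proof (intro allI impI)
  interpret inverse_square \<nu> by unfold_locales (use assms in auto)
  fix f0 fT :: L2 and \<epsilon> :: real
  assume "\<epsilon> > 0"
  with assms(1,7-9) show "\<exists>u :: real \<times> real \<Rightarrow> real.
    square_integrable (restrict_space lborel ({0<..<T} \<times> \<omega>)) u \<and>
    norm (mild_solution \<nu> f0 (\<lambda>t. L2_of (\<lambda>x. u (t, x) * indicat_real \<omega> x)) T - fT) \<le> \<epsilon>"
    by (rule approximate_controllability_A0)
qed

end
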